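(* Work in the setting and under the standing assumptions stated in the context. Let $g\in L^+_\infty(D\times V)$ with $\langle g,\tilde\varphi\rangle>0$ and let $(r,\upsilon)\in D\times V$. There exist constants $\kappa_{[i]}=\kappa_{[i]}(g,r,\upsilon)$, $i=0,1,2,3$, such that for all $t>0$ and all integers $k\ge 1$: (i) if $\lambda_*=0$, then $\displaystyle \mathbb{E}_{\delta_{(r,\upsilon)}}\Big[\big(\Psi^{\mathrm{br}}_k[g](t,r,\upsilon)^{1/t}-e^{\lambda_*}\big)^2\Big]\le \frac{\kappa_{[1]}t}{k}+\frac{\kappa_{[0]}}{t^2}$; (ii) if $\lambda_*>0$, then $\displaystyle \mathbb{E}_{\delta_{(r,\upsilon)}}\Big[\big(\Psi^{\mathrm{br}}_k[g](t,r,\upsilon)^{1/t}-e^{\lambda_*}\big)^2\Big]\le \frac{\kappa_{[2]}}{k}+\frac{\kappa_{[0]}}{t^2}$; (iii) if $\lambda_*<0$, then $\displaystyle \mathbb{E}_{\delta_{(r,\upsilon)}}\Big[\big(\Psi^{\mathrm{br}}_k[g](t,r,\upsilon)^{1/t}-e^{\lambda_*}\big)^2\Big]\le \frac{\kappa_{[3]}e^{-\lambda_* t}}{k}+\frac{\kappa_{[0]}}{t^2}$. Moreover, let $C_{[0]}:=\langle\tilde\varphi,g\rangle\varphi(r,\upsilon)$ and let $C_{[1]},C_{[2]},C_{[3]}$ be as defined in the context. If $C_{[0]}\neq 1$, then for any $\eta>0$, with the choices $$\kappa_{[0]}:=2\big[\log(C_{[0]})\,e^{\lambda_*}\big]^2+\eta,\qquad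 \kappa_{[i]}:=2C_{[i]}C_{[0]}^{-2}+\eta,\quad i=1,2,3,$$ the expectation $\mathbb{E}_{\delta_{(r,\upsilon)}}\big[(\Psi^{\mathrm{br}}_k[g](t,r,\upsilon)^{1/t}-e^{\lambda_*})^2\big]$ is, for all $t,k$ sufficiently large, at most $\frac{\kappa_{[1]}t}{k}+\frac{\kappa_{[0]}}{t^2}$ if $\lambda_*=0$, at most $\frac{\kappa_{[2]}}{k}+\frac{\kappa_{[0]}}{t^2}$ if $\lambda_*>0$, and at most $\frac{\kappa_{[3]}e^{-\lambda_* t}}{k}+\frac{\kappa_{[0]}}{t^2}$ if $\lambda_*<0$. In particular, for each such $(r,\upsilon)$ and $g$ there exists a sequence $k(t)$, increasing in $t$ with $k(t)\to\infty$, such that $$\lim_{t\to\infty}\mathbb{E}_{\delta_{(r,\upsilon)}}\Big[\big(\Psi^{\mathrm{br}}_{k(t)}[g](t,r,\upsilon)^{1/t}-e^{\lambda_*}\big)^2\Big]=0 .$$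
   Context: Domain and cross-sections. $D\subset\mathbb{R}^3$ is non-empty, open, smooth, bounded and convex; $V=\{\upsilon\in\mathbb{R}^3:\upsilon_{\min}\le|\upsilon|\le\upsilon_{\max}\}$ with $0<\upsilon_{\min}<\upsilon_{\max}<\infty$. $L^+_\infty(D\times V)$ is the set of non-negative bounded measurable functions on $D\times V$; $\langle f,g\rangle=\int_{D\times V}f g\,dr\,d\upsilon$. Measurable non-negative functions $\sigma_{\mathrm s}(r,\upsilon),\sigma_{\mathrm f}(r,\upsilon),\pi_{\mathrm s}(r,\upsilon,\upsilon'),\pi_{\mathrm f}(r,\upsilon,\upsilon')$ are given, with $\int_V\pi_{\mathrm s}(r,\upsilon,\upsilon')d\upsilon'=1$. Standing assumptions: all four functions are bounded; $\inf_{r\in D,\upsilon,\upsilon'\in V}(\sigma_{\mathrm s}(r,\upsilon)\pi_{\mathrm s}(r,\upsilon,\upsilon')+\sigma_{\mathrm f}(r,\upsilon)\pi_{\mathrm f}(r,\upsilon,\upsilon'))>0$; there is an open ball $B$ compactly embedded in $D$ with $\inf_{r\in B,\upsilon,\upsilon'\in V}\sigma_{\mathrm f}(r,\upsilon)\pi_{\mathrm f}(r,\upsilon,\upsilon')>0$; the number of fission offspring is bounded by a constant $n_{\max}>1$. Neutron branching process (NBP). Particles have configurations in $D\times V$ and evolve independently. A particle at $(r,\upsilon)$ moves along $r+\upsilon t$ until: it leaves $D$ (it is killed); or it scatters, at rate $\sigma_{\mathrm s}$ along its path, taking a new velocity $\upsilon'$ with density $\pi_{\mathrm s}(r,\upsilon,\cdot)$;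 or fission occurs, at rate $\sigma_{\mathrm f}$ along its path, when the particle is replaced by a random number $N\ge0$ of particles at the same position with velocities $\upsilon_1,\dots,\upsilon_N$, whose joint law $\mathcal P_{(r,\upsilon)}$ (expectation $\mathcal E_{(r,\upsilon)}$) satisfies $\mathcal E_{(r,\upsilon)}[\sum_{i=1}^N g(\upsilon_i)]=\int_Vg(\upsilon')\pi_{\mathrm f}(r,\upsilon,\upsilon')d\upsilon'$ for bounded measurable $g\geq 0$. $X_t$ is the sum of the Dirac masses at the configurations of the particles alive at time $t$; $\langle g,X_t\rangle$ is the sum of $g$ over these particles; $\mathbb{P}_{\delta_{(r,\upsilon)}}$ is the law when starting from one particle at $(r,\upsilon)$. Put $\psi_t[g](r,\upsilon)=\mathbb{E}_{\delta_{(r,\upsilon)}}[\langle g,X_t\rangle]$. Leading eigen-triple (known): there exist $\lambda_*\in\mathbb{R}$ and $\varphi,\tilde\varphi\in L^+_\infty(D\times V)$, with $\varphi$ positive and $\varphi$ (resp. $\tilde\varphi$) bounded away from $0$ (resp. a.e.) on compactly embedded subsets of $D\times V$, such that $\psi_t[\varphi]=e^{\lambda_*t}\varphi$, $\langle\tilde\varphi,\psi_t[g]\rangle=e^{\lambda_*t}\langle\tilde\varphi,g\rangle$, and for some $\varepsilon>0$, $\sup_{\|g\|_\infty\le1}\|e^{-\lambda_*t}\varphi^{-1}\psi_t[g]-\langle\tilde\varphi,g\rangle\|_\infty=O(e^{-\varepsilon t})$ as $t\to\infty$ (in particular $\langle\varphi,\tilde\varphi\rangle=1$). Estimator. $\Psi^{\mathrm{br}}_k[g](t,r,\upsilon)=\frac1k\sum_{i=1}^k\langle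 g,X^i_t\rangle$, where $X^1,\dots,X^k$ are independent copies of $X$ under $\mathbb{P}_{\delta_{(r,\upsilon)}}$. Constants. With $\eta_{\mathrm f}[f](r,\upsilon)=\sigma_{\mathrm f}(r,\upsilon)\,\mathcal E_{(r,\upsilon)}\big[\sum_{i\ne j}f(r,\upsilon_i)f(r,\upsilon_j)\big]$: $C_{[1]}=\langle\eta_{\mathrm f}[\varphi],\tilde\varphi\rangle\langle g,\tilde\varphi\rangle^2\varphi(r,\upsilon)$ (used when $\lambda_*=0$); $C_{[2]}=\langle g,\tilde\varphi\rangle^2\big(\int_0^\infty e^{-2\lambda_*s}\psi_s[\eta_{\mathrm f}[\varphi]](r,\upsilon)ds-\varphi(r,\upsilon)^2\big)$ (used when $\lambda_*>0$); $C_{[3]}=\varphi(r,\upsilon)\big\{\langle g^2,\tilde\varphi\rangle+\int_0^\infty e^{-\lambda_*s}\langle\tilde\varphi,\eta_{\mathrm f}[\psi_s[g]]\rangle ds\big\}$ (used when $\lambda_*<0$).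
   Formalization: In (i)–(iii), "for all t>0" is false as t→0 (take g=2, k=1: the error is at least e^{-ct}(2^{1/t}-e^{λ})²); proved instead for all t≥t0, with t0>0 arbitrary and constants κ that may also depend on t0; k(t) is increasing in the non-strict sense. *)

theory Defs
  imports "HOL-Probability.Probability"
begin

type_synonym r3 = "real ^ 3"

type_synonym config = "r3 \<times> r3"  \<comment> \<open>(position, velocity)\<close>

text \<open>The fission law is the joint law of the offspring velocities, listed as
  \<open>[v\<^sub>1, \<dots>, v\<^sub>N]\<close>; the number of offspring \<open>N\<close> is the length of the list.\<close>

record nbp_model =
  dom_D :: "r3 set"
  v_min :: real
  v_max :: real
  sigma_s :: "r3 \<Rightarrow> r3 \<Rightarrow> real"
  sigma_f :: "r3 \<Rightarrow> r3 \<Rightarrow> real"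
  pi_s :: "r3 \<Rightarrow> r3 \<Rightarrow> r3 \<Rightarrow> real"
  pi_f :: "r3 \<Rightarrow> r3 \<Rightarrow> r3 \<Rightarrow> real"
  fission_law :: "r3 \<Rightarrow> r3 \<Rightarrow> r3 list measure"

definition vel_V :: "nbp_model \<Rightarrow> r3 set" where
  "vel_V M = {v. v_min M \<le> norm v \<and> norm v \<le> v_max M}"

definition phase :: "nbp_model \<Rightarrow> config set" where
  "phase M = dom_D M \<times> vel_V M"

definition Linf_plus :: "nbp_model \<Rightarrow> (config \<Rightarrow> real) set" where
  "Linf_plus M = {f. f \<in> borel_measurable (restrict_space borel (phase M)) \<and>
     (\<forall>x\<in>phase M. 0 \<le> f x) \<and> (\<exists>c. \<forall>x\<in>phase M. f x \<le> c)}"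

definition pairing :: "nbp_model \<Rightarrow> (config \<Rightarrow> real) \<Rightarrow> (config \<Rightarrow> real) \<Rightarrow> real" where
  "pairing M f g = (LINT x:phase M|lborel. f x * g x)"

text \<open>Finite lists over a measurable space, with the \<open>\<sigma>\<close>-algebra of the disjoint union
  of the product spaces of all finite lengths.\<close>

definition list_space :: "'a measure \<Rightarrow> 'a list measure" where
  "list_space N = sigma (lists (space N)) {listset As | As. set As \<subseteq> sets N}"


text \<open>For open \<open>S\<close>: \<open>f\<close> is \<open>C\<^sup>\<infinity>\<close> on \<open>S\<close>, i.e. \<open>f\<close> and all its iterated directional derivatives
  are differentiable on \<open>S\<close>.\<close>

coinductive smooth_on :: "r3 set \<Rightarrow> (r3 \<Rightarrow> real) \<Rightarrow> bool" for S where
  "(\<forall>x\<in>S. f differentiable (at x)) \<Longrightarrow>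
   (\<forall>w. smooth_on S (\<lambda>x. frechet_derivative f (at x) w)) \<Longrightarrow> smooth_on S f"

definition smooth_domain :: "r3 set \<Rightarrow> bool" where
  "smooth_domain D \<longleftrightarrow> (\<forall>x\<in>frontier D. \<exists>U F. open U \<and> x \<in> U \<and> smooth_on U F \<and>
     (\<forall>y\<in>U. frechet_derivative F (at y) \<noteq> (\<lambda>_. 0)) \<and> D \<inter> U = {y\<in>U. F y < 0})"


definition nbp_setting :: "nbp_model \<Rightarrow> bool" where
  "nbp_setting M \<longleftrightarrow>
    dom_D M \<noteq> {} \<and> open (dom_D M) \<and> bounded (dom_D M) \<and> convex (dom_D M) \<and>
    smooth_domain (dom_D M) \<and> 0 < v_min M \<and> v_min M < v_max M \<and>
    (\<lambda>(r, v). sigma_s M r v) \<in> borel_measurable (restrict_space borel (dom_D M \<times> vel_V M)) \<and>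
    (\<lambda>(r, v). sigma_f M r v) \<in> borel_measurable (restrict_space borel (dom_D M \<times> vel_V M)) \<and>
    (\<lambda>(r, v, w). pi_s M r v w)
      \<in> borel_measurable (restrict_space borel (dom_D M \<times> vel_V M \<times> vel_V M)) \<and>
    (\<lambda>(r, v, w). pi_f M r v w)
      \<in> borel_measurable (restrict_space borel (dom_D M \<times> vel_V M \<times> vel_V M)) \<and>
    (\<exists>c. \<forall>r\<in>dom_D M. \<forall>v\<in>vel_V M.
       sigma_s M r v \<in> {0..c} \<and> sigma_f M r v \<in> {0..c} \<and>
       (\<forall>w\<in>vel_V M. pi_s M r v w \<in> {0..c} \<and> pi_f M r v w \<in> {0..c})) \<and>
    (\<forall>r\<in>dom_D M. \<forall>v\<in>vel_V M. (LINT w:vel_V M|lborel. pi_s M r v w) = 1) \<and>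
    (\<exists>c>0. \<forall>r\<in>dom_D M. \<forall>v\<in>vel_V M. \<forall>w\<in>vel_V M.
       c \<le> sigma_s M r v * pi_s M r v w + sigma_f M r v * pi_f M r v w) \<and>
    (\<exists>z \<rho>. 0 < \<rho> \<and> closure (ball z \<rho>) \<subseteq> dom_D M \<and>
       (\<exists>c>0. \<forall>r\<in>ball z \<rho>. \<forall>v\<in>vel_V M. \<forall>w\<in>vel_V M. c \<le> sigma_f M r v * pi_f M r v w)) \<and>
    (\<lambda>(r, v). fission_law M r v)
      \<in> measurable (restrict_space borel (dom_D M \<times> vel_V M))
          (subprob_algebra (list_space (restrict_space borel (vel_V M)))) \<and>
    (\<forall>r\<in>dom_D M. \<forall>v\<in>vel_V M. prob_space (fission_law M r v)) \<and>
    (\<forall>r\<in>dom_D M. \<forall>v\<in>vel_V M. \<forall>g\<in>borel_measurable (restrict_space borel (vel_V M)).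
       (\<forall>w\<in>vel_V M. 0 \<le> g w) \<and> (\<exists>c. \<forall>w\<in>vel_V M. g w \<le> c) \<longrightarrow>
       (LINT ws|fission_law M r v. (\<Sum>w\<leftarrow>ws. g w)) = (LINT w:vel_V M|lborel. g w * pi_f M r v w)) \<and>
    (\<exists>n_max::nat. 1 < n_max \<and>
       (\<forall>r\<in>dom_D M. \<forall>v\<in>vel_V M. AE ws in fission_law M r v. length ws \<le> n_max))"


definition exit_time :: "nbp_model \<Rightarrow> r3 \<Rightarrow> r3 \<Rightarrow> real" where
  "exit_time M r v = Inf {t. 0 \<le> t \<and> r + t *\<^sub>R v \<notin> dom_D M}"

text \<open>An event of rate \<open>h\<close> along the path \<open>r + t v\<close> occurs when the accumulated rate reaches
  a unit exponential variable \<open>a\<close>; the value is \<open>\<infinity>\<close> if this does not happen inside \<open>D\<close>.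
  For exponential \<open>a\<close>, the probability of no event by a time \<open>t\<close> before the exit is thus
  \<open>exp (- (LBINT s:{0..t}. h (r + s v) v))\<close>.\<close>

definition clock :: "nbp_model \<Rightarrow> (r3 \<Rightarrow> r3 \<Rightarrow> real) \<Rightarrow> r3 \<Rightarrow> r3 \<Rightarrow> real \<Rightarrow> ereal" where
  "clock M h r v a =
     (INF t \<in> {t. 0 \<le> t \<and> t < exit_time M r v \<and> a \<le> (LBINT s:{0..t}. h (r + s *\<^sub>R v) v)}. ereal t)"

text \<open>The life of a particle runs up to its first event (exit, scattering or fission). Its law
  is that of the pair (duration, velocities after the event): the list is \<open>[]\<close> for an exit, has
  one entry for a scattering, and is drawn from the fission law for a fission. So a scattered
  particle is recorded as a new particle. The value outside \<open>D \<times> V\<close> is a dummy.\<close>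

definition life :: "nbp_model \<Rightarrow> config \<Rightarrow> (real \<times> r3 list) measure" where
  "life M = (\<lambda>(r, v).
     if (r, v) \<in> phase M then
       do {
         a \<leftarrow> density lborel (exponential_density 1);
         b \<leftarrow> density lborel (exponential_density 1);
         let t_s = clock M (sigma_s M) r v a;
             t_f = clock M (sigma_f M) r v b
         in if t_s = \<infinity> \<and> t_f = \<infinity> then
              return (borel \<Otimes>\<^sub>M list_space borel) (exit_time M r v, [])
            else if t_s < t_f then
              let t = real_of_ereal t_s in
              distr (density lborel (\<lambda>w. indicator (vel_V M) w * pi_s M (r + t *\<^sub>R v) v w))
                (borel \<Otimes>\<^sub>M list_space borel) (\<lambda>w. (t, [w]))
            else
              let t = real_of_ereal t_f in
              distr (fission_law M (r + t *\<^sub>R v) v)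
                (borel \<Otimes>\<^sub>M list_space borel) (\<lambda>ws. (t, ws))
       }
     else return (borel \<Otimes>\<^sub>M list_space borel) (0, []))"

type_synonym newborn = "real \<times> config"  \<comment> \<open>birth time and configuration at birth\<close>
type_synonym individual = "newborn \<times> (real \<times> r3 list)"  \<comment> \<open>with its life\<close>

definition newborn_space :: "newborn measure" where
  "newborn_space = borel \<Otimes>\<^sub>M borel"

definition individual_space :: "individual measure" where
  "individual_space = newborn_space \<Otimes>\<^sub>M (borel \<Otimes>\<^sub>M list_space borel)"

fun children :: "individual \<Rightarrow> newborn list" where
  "children ((b, (r, v)), (\<tau>, ws)) = map (\<lambda>w. (b + \<tau>, (r + \<tau> *\<^sub>R v, w))) ws"

primrec live :: "nbp_model \<Rightarrow> newborn list \<Rightarrow> individual list measure" where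
  "live M [] = return (list_space individual_space) []"
| "live M (x # xs) =
     do {
       l \<leftarrow> life M (snd x);
       ys \<leftarrow> live M xs;
       return (list_space individual_space) ((x, l) # ys)
     }"

text \<open>The law of the family tree, generation by generation, as the (Ionescu-Tulcea) law of
  a Markov chain with values in the lists of individuals.\<close>

type_synonym genealogy = "nat \<Rightarrow> individual list"

definition generation_kernel ::
    "nbp_model \<Rightarrow> config \<Rightarrow> nat \<Rightarrow> genealogy \<Rightarrow> individual list measure" where
  "generation_kernel M x n \<omega> =
     (case n of 0 \<Rightarrow> live M [(0, x)] | Suc m \<Rightarrow> live M (concat (map children (\<omega> m))))"

definition nbp_law :: "nbp_model \<Rightarrow> config \<Rightarrow> genealogy measure" where
  "nbp_law M x =
     projective_family.lim UNIV
       (Ionescu_Tulcea.CI (generation_kernel M x) (\<lambda>_. list_space individual_space))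
       (\<lambda>_. list_space individual_space)"

fun config_at :: "real \<Rightarrow> individual \<Rightarrow> config" where
  "config_at t ((b, (r, v)), _) = (r + (t - b) *\<^sub>R v, v)"

text \<open>The condition on \<open>config_at\<close> holds almost surely whenever the time condition does; it makes
  \<open>X\<close> take its values in configurations in \<open>D \<times> V\<close> surely.\<close>

fun alive_at :: "nbp_model \<Rightarrow> real \<Rightarrow> individual \<Rightarrow> bool" where
  "alive_at M t ((b, x), (\<tau>, ws)) \<longleftrightarrow>
     b \<le> t \<and> t < b + \<tau> \<and> config_at t ((b, x), (\<tau>, ws)) \<in> phase M"

definition alive :: "nbp_model \<Rightarrow> real \<Rightarrow> genealogy \<Rightarrow> (nat \<times> nat) set" where
  "alive M t \<omega> = {(n, i). i < length (\<omega> n) \<and> alive_at M t (\<omega> n ! i)}"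

text \<open>The finite point measure \<open>X\<^sub>t\<close> is encoded as the multiset of its atoms. (On the null event
  that \<open>alive M t \<omega>\<close> is infinite, it is empty.)\<close>

definition X :: "nbp_model \<Rightarrow> real \<Rightarrow> genealogy \<Rightarrow> config multiset" where
  "X M t \<omega> = image_mset (\<lambda>(n, i). config_at t (\<omega> n ! i)) (mset_set (alive M t \<omega>))"

definition X_pairing :: "nbp_model \<Rightarrow> (config \<Rightarrow> real) \<Rightarrow> real \<Rightarrow> genealogy \<Rightarrow> real" where
  "X_pairing M g t \<omega> = (\<Sum>x\<in>#X M t \<omega>. g x)"

definition psi :: "nbp_model \<Rightarrow> real \<Rightarrow> (config \<Rightarrow> real) \<Rightarrow> config \<Rightarrow> real" where
  "psi M t g x = (LINT \<omega>|nbp_law M x. X_pairing M g t \<omega>)"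


definition leading_triple ::
    "nbp_model \<Rightarrow> real \<Rightarrow> (config \<Rightarrow> real) \<Rightarrow> (config \<Rightarrow> real) \<Rightarrow> bool" where
  "leading_triple M lam phi phit \<longleftrightarrow>
     phi \<in> Linf_plus M \<and> phit \<in> Linf_plus M \<and>
     (\<forall>x\<in>phase M. 0 < phi x) \<and>
     (\<forall>K. compact (closure K) \<and> closure K \<subseteq> phase M \<longrightarrow>
        (\<exists>c>0. \<forall>x\<in>K. c \<le> phi x) \<and> (\<exists>c>0. AE x in lborel. x \<in> K \<longrightarrow> c \<le> phit x)) \<and>
     (\<forall>t\<ge>0. \<forall>x\<in>phase M. psi M t phi x = exp (lam * t) * phi x) \<and>
     (\<forall>t\<ge>0. \<forall>g\<in>Linf_plus M. pairing M phit (psi M t g) = exp (lam * t) * pairing M phit g) \<and>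
     (\<exists>\<epsilon>>0. \<exists>c T. \<forall>t\<ge>T. \<forall>g\<in>Linf_plus M. (\<forall>x\<in>phase M. g x \<le> 1) \<longrightarrow>
        (\<forall>x\<in>phase M. \<bar>exp (- lam * t) * psi M t g x / phi x - pairing M phit g\<bar>
                        \<le> c * exp (- \<epsilon> * t)))"


text \<open>A sample point is a family of genealogies indexed by \<open>{1..k}\<close>; under the product measure
  these are independent copies.\<close>

definition Psi_br ::
    "nbp_model \<Rightarrow> nat \<Rightarrow> (config \<Rightarrow> real) \<Rightarrow> real \<Rightarrow> (nat \<Rightarrow> genealogy) \<Rightarrow> real" where
  "Psi_br M k g t \<omega> = (\<Sum>i=1..k. X_pairing M g t (\<omega> i)) / real k"

text \<open>The expectation is taken in \<open>[0, \<infinity>]\<close>, so that upper bounds for it entail integrability.\<close>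

definition mse :: "nbp_model \<Rightarrow> real \<Rightarrow> (config \<Rightarrow> real) \<Rightarrow> config \<Rightarrow> nat \<Rightarrow> real \<Rightarrow> ennreal" where
  "mse M lam g x k t =
     (\<integral>\<^sup>+ \<omega>. ennreal ((Psi_br M k g t \<omega> powr (1 / t) - exp lam)\<^sup>2) \<partial>(\<Pi>\<^sub>M i\<in>{1..k}. nbp_law M x))"

definition eta_f :: "nbp_model \<Rightarrow> (config \<Rightarrow> real) \<Rightarrow> config \<Rightarrow> real" where
  "eta_f M f = (\<lambda>(r, v). sigma_f M r v *
     (LINT ws|fission_law M r v.
        (\<Sum>i<length ws. \<Sum>j\<in>{..<length ws} - {i}. f (r, ws ! i) * f (r, ws ! j))))"

definition C0 :: "nbp_model \<Rightarrow> (config \<Rightarrow> real) \<Rightarrow> (config \<Rightarrow> real) \<Rightarrow> (config \<Rightarrow> real) \<Rightarrow> config \<Rightarrow> real"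
  where "C0 M phi phit g x = pairing M phit g * phi x"

definition C1 :: "nbp_model \<Rightarrow> (config \<Rightarrow> real) \<Rightarrow> (config \<Rightarrow> real) \<Rightarrow> (config \<Rightarrow> real) \<Rightarrow> config \<Rightarrow> real"
  where "C1 M phi phit g x = pairing M (eta_f M phi) phit * (pairing M g phit)\<^sup>2 * phi x"

definition C2 ::
    "nbp_model \<Rightarrow> real \<Rightarrow> (config \<Rightarrow> real) \<Rightarrow> (config \<Rightarrow> real) \<Rightarrow> (config \<Rightarrow> real) \<Rightarrow> config \<Rightarrow> real"
  where "C2 M lam phi phit g x = (pairing M g phit)\<^sup>2 *
    ((LBINT s:{0..}. exp (- 2 * lam * s) * psi M s (eta_f M phi) x) - (phi x)\<^sup>2)"

definition C3 ::
    "nbp_model \<Rightarrow> real \<Rightarrow> (config \<Rightarrow> real) \<Rightarrow> (config \<Rightarrow> real) \<Rightarrow> (config \<Rightarrow> real) \<Rightarrow> config \<Rightarrow> real"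
  where "C3 M lam phi phit g x = phi x *
    (pairing M (\<lambda>y. (g y)\<^sup>2) phit +
     (LBINT s:{0..}. exp (- lam * s) * pairing M phit (eta_f M (psi M s g))))"

end

theory Submission
  imports Defs "HOL-Real_Asymp.Real_Asymp"
begin

text \<open>Summing over the generations of the family tree gives
  \<open>E[\<langle>g, X\<^sub>t\<rangle>\<^sup>2] \<le> \<psi>\<^sub>t[g\<^sup>2] + \<integral>\<^sub>0\<^sup>t \<psi>\<^sub>s[\<eta>\<^sub>f[\<psi>\<^sub>t\<^sub>-\<^sub>s[g]]] ds\<close>, and the spectral asymptotics of \<open>\<psi>\<close> turn this into
  a bound by \<open>C t\<close>, \<open>C e\<^sup>2\<^sup>\<lambda>\<^sup>t\<close> or \<open>C e\<^sup>\<lambda>\<^sup>t\<close> according to the sign of \<open>\<lambda>\<close>, with \<open>C\<close> close to \<open>C\<^sub>1\<close> if \<open>\<lambda> = 0\<close> and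
  to \<open>C\<^sub>3\<close> if \<open>\<lambda> < 0\<close>.

  Let \<open>m = \<psi>\<^sub>t[g]\<close>, \<open>p = 1 / t\<close> and \<open>\<Psi> = m y\<close>. Then
  \<open>(\<Psi>\<^sup>p - e\<^sup>\<lambda>)\<^sup>2 \<le> 2 m\<^sup>2\<^sup>p (y\<^sup>p - 1)\<^sup>2 + 2 (m\<^sup>p - e\<^sup>\<lambda>)\<^sup>2\<close>. As \<open>m e\<^sup>-\<^sup>\<lambda>\<^sup>t\<close> tends to \<open>C\<^sub>0\<close>, \<open>m\<^sup>p - e\<^sup>\<lambda>\<close> is equivalent
  to \<open>e\<^sup>\<lambda> ln C\<^sub>0 / t\<close>. For \<open>t \<ge> 1\<close> the other term is at most \<open>2 m\<^sup>2\<^sup>p (y - 1)\<^sup>2\<close>, hence in the mean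
  a multiple of \<open>E[\<langle>g, X\<^sub>t\<rangle>\<^sup>2] / (k m\<^sup>2)\<close>. If \<open>\<lambda> > 0\<close>, the factor \<open>m\<^sup>2\<^sup>p\<close> tends to \<open>e\<^sup>2\<^sup>\<lambda>\<close>, which is too large; but
  \<open>(y\<^sup>p - 1)\<^sup>2\<close> is of order \<open>p\<^sup>2 (y - 1)\<^sup>2\<close> for \<open>y \<ge> 1 / 2\<close>, and the event \<open>y < 1 / 2\<close> has exponentially small
  probability in \<open>k\<close>, so this term is \<open>o(1 / k)\<close>. Small \<open>t\<close> are handled by Jensen's inequality for high
  moments, which are finite because the number of particles has an exponential moment.\<close>

section \<open>Measurability of list operations\<close>

text \<open>The law of the process is a chain of generations, whereas the particles alive at a time
  t are spread over all generations. Conditioning on a single life therefore replaces the Markov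
  property in time: moments are computed by recursion over finitely many generations, with values in
  [0, \<infinity>], so that integrability is not an issue there, and monotone convergence gives the
  limit. Only an upper bound of the second moment is required, which permits replacing the mean of a
  truncated subtree by that of the full one. The integral with \<eta> arises because a sum over
  fission events has the same mean as the integral of the fission rate over the time lived.

  As t tends to 0, no multiple of 1 / t^2 can serve as a bound in general: if the pairing of g with
  the initial particle exceeds 1, its power with exponent 1 / t grows exponentially in 1 / t. This
  is why the first family of constants depends on a lower bound for t.\<close>

lemma listset_subset_lists: "set As \<subseteq> sets N \<Longrightarrow> listset As \<subseteq> lists (space N)"
proof (induction As)
  case (Cons A As)
  then have "A \<subseteq> space N" "listset As \<subseteq> lists (space N)"
    by (auto dest: sets.sets_into_space)
  then show ?case by (fastforce simp: set_Cons_def)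
qed auto

lemma space_list_space [simp]: "space (list_space N) = lists (space N)"
  unfolding list_space_def using listset_subset_lists by (subst space_measure_of) auto

lemma sets_list_space:
  "sets (list_space N) = sigma_sets (lists (space N)) {listset As | As. set As \<subseteq> sets N}"
  unfolding list_space_def using listset_subset_lists by (subst sets_measure_of) auto

lemma listset_in_sets_list_space: "set As \<subseteq> sets N \<Longrightarrow> listset As \<in> sets (list_space N)"
  by (auto simp: sets_list_space)

lemma listset_replicate: "listset (replicate n A) = {xs. length xs = n \<and> set xs \<subseteq> A}"
proof (induction n)
  case (Suc n)
  show ?case
    unfolding replicate_Suc listset.simps Suc
    by (auto simp: set_Cons_def length_Suc_conv)
qed auto

lemma measurable_list_spaceI:
  assumes "\<And>x. x \<in> space P \<Longrightarrow> f x \<in> lists (space N)"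
    and "\<And>As. set As \<subseteq> sets N \<Longrightarrow> f -` listset As \<inter> space P \<in> sets P"
  shows "f \<in> measurable P (list_space N)"
  unfolding list_space_def
proof (rule measurable_measure_of)
  show "{listset As |As. set As \<subseteq> sets N} \<subseteq> Pow (lists (space N))"
    using listset_subset_lists[of _ N] by blast
qed (use assms in auto)

lemma measurable_length_list_space [measurable]:
  "length \<in> measurable (list_space N) (count_space UNIV)"
proof (subst measurable_count_space_eq2_countable, safe)
  fix n
  have "length -` {n} \<inter> space (list_space N) = listset (replicate n (space N))"
    by (auto simp: listset_replicate)
  then show "length -` {n} \<inter> space (list_space N) \<in> sets (list_space N)"
    by (auto intro!: listset_in_sets_list_space)
qed auto

lemma sets_list_space_Nil [measurable]: "{xs\<in>space (list_space N). xs = []} \<in> sets (list_space N)"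
proof -
  have "{xs\<in>space (list_space N). xs = []} = listset []"
    by auto
  then show ?thesis using listset_in_sets_list_space[of "[]" N] by simp
qed

lemma measurable_Cons [measurable]:
  "(\<lambda>(x, xs). x # xs) \<in> measurable (N \<Otimes>\<^sub>M list_space N) (list_space N)"
proof (rule measurable_list_spaceI)
  fix As assume As: "set As \<subseteq> sets N"
  show "(\<lambda>(x, xs). x # xs) -` listset As \<inter> space (N \<Otimes>\<^sub>M list_space N) \<in> sets (N \<Otimes>\<^sub>M list_space N)"
  proof (cases As)
    case Nil
    then have "(\<lambda>(x, xs). x # xs) -` listset As \<inter> space (N \<Otimes>\<^sub>M list_space N) = {}"
      by auto
    then show ?thesis by (simp only: sets.empty_sets)
  next
    case (Cons A Bs)
    have "(\<lambda>(x, xs). x # xs) -` listset As \<inter> space (N \<Otimes>\<^sub>M list_space N) = A \<times> listset Bs"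
      using As listset_subset_lists[of Bs N] sets.sets_into_space[of A N]
      by (auto simp: Cons set_Cons_def space_pair_measure)
    then show ?thesis
      using As by (auto simp: Cons intro!: pair_measureI listset_in_sets_list_space)
  qed
qed (auto simp: space_pair_measure)

text \<open>\<open>hd []\<close> is unspecified, hence the restriction to nonempty lists. A
  generator of the \<sigma>-algebra fixes the length of its lists, so the preimage of A is a
  countable union of generators, one for each length.\<close>

lemma measurable_hd_list_space:
  "hd \<in> measurable (restrict_space (list_space N) {xs. xs \<noteq> []}) N"
proof (rule measurableI)
  fix A assume A: "A \<in> sets N"
  define B where "B = (\<Union>n. listset (A # replicate n (space N)))"
  have "hd -` A \<inter> space (restrict_space (list_space N) {xs. xs \<noteq> []}) = {xs. xs \<noteq> []} \<inter> B"
    using sets.sets_into_space[OF A]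
    by (auto simp: B_def space_restrict_space listset_replicate set_Cons_def neq_Nil_conv)
  moreover have "B \<in> sets (list_space N)"
    unfolding B_def using A
    by (intro sets.countable_UN) (auto intro!: listset_in_sets_list_space simp del: listset.simps)
  ultimately show "hd -` A \<inter> space (restrict_space (list_space N) {xs. xs \<noteq> []})
      \<in> sets (restrict_space (list_space N) {xs. xs \<noteq> []})"
    unfolding sets_restrict_space by simp
qed (auto simp: space_restrict_space neq_Nil_conv)

lemma measurable_tl_list_space:
  "tl \<in> measurable (restrict_space (list_space N) {xs. xs \<noteq> []}) (list_space N)"
proof (rule measurable_list_spaceI)
  fix As assume As: "set As \<subseteq> sets N"
  define B where "B = listset (space N # As)"
  have "tl -` listset As \<inter> space (restrict_space (list_space N) {xs. xs \<noteq> []}) = {xs. xs \<noteq> []} \<inter> B"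
    using listset_subset_lists[OF As]
    by (fastforce simp: B_def space_restrict_space set_Cons_def neq_Nil_conv)
  moreover have "B \<in> sets (list_space N)"
    unfolding B_def using As by (intro listset_in_sets_list_space) auto
  ultimately show "tl -` listset As \<inter> space (restrict_space (list_space N) {xs. xs \<noteq> []})
      \<in> sets (restrict_space (list_space N) {xs. xs \<noteq> []})"
    unfolding sets_restrict_space by simp
qed (auto simp: space_restrict_space neq_Nil_conv)

lemma measurable_case_list_space:
  assumes c: "c \<in> measurable P K"
    and h: "(\<lambda>(p, x, xs). h p x xs) \<in> measurable (P \<Otimes>\<^sub>M N \<Otimes>\<^sub>M list_space N) K"
  shows "(\<lambda>(p, xs). case xs of [] \<Rightarrow> c p | x # xs \<Rightarrow> h p x xs) \<in> measurable (P \<Otimes>\<^sub>M list_space N) K"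
proof -
  let ?M = "P \<Otimes>\<^sub>M list_space N"
  let ?R = "restrict_space (list_space N) {xs. xs \<noteq> []}"
  have Q: "snd \<in> measurable (restrict_space ?M {z. snd z \<noteq> []}) ?R"
    by (rule measurable_restrict_space2)
      (auto simp: space_restrict_space space_pair_measure intro!: measurable_restrict_space1)
  have "(\<lambda>z. (fst z, hd (snd z), tl (snd z)))
      \<in> measurable (restrict_space ?M {z. snd z \<noteq> []}) (P \<Otimes>\<^sub>M N \<Otimes>\<^sub>M list_space N)"
    by (intro measurable_Pair measurable_compose[OF Q measurable_hd_list_space]
        measurable_compose[OF Q measurable_tl_list_space] measurable_restrict_space1 measurable_fst)
  from measurable_compose[OF this h]
  have 1: "(\<lambda>z. h (fst z) (hd (snd z)) (tl (snd z))) \<in> measurable (restrict_space ?M {z. snd z \<noteq> []}) K"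
    by simp
  have "(\<lambda>z. if snd z = [] then c (fst z) else h (fst z) (hd (snd z)) (tl (snd z))) \<in> measurable ?M K"
  proof (subst measurable_If_restrict_space_iff, safe)
    have "{x \<in> space ?M. snd x = []} = snd -` {xs\<in>space (list_space N). xs = []} \<inter> space ?M"
      by (auto simp: space_pair_measure)
    then show "{x \<in> space ?M. snd x = []} \<in> sets ?M"
      using measurable_sets[OF measurable_snd sets_list_space_Nil] by metis
  next
    show "(\<lambda>x. c (fst x)) \<in> measurable (restrict_space ?M {x. snd x = []}) K"
      by (intro measurable_restrict_space1 measurable_compose[OF measurable_fst c])
  qed (use 1 in simp)
  then show ?thesis
    by (rule measurable_cong[THEN iffD1, rotated]) (auto split: list.splits)
qed

text \<open>A list cut to length n is processed by a recursion of bounded depth, so induction on n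
  applies. As the length is a measurable map into a countable space, n may then be replaced by the
  length of the list itself. The parameter p admits functions that depend on a further variable,
  such as a time.\<close>

lemma measurable_rec_list_space:
  assumes c: "c \<in> measurable P K"
    and F: "(\<lambda>(p, x, r). F p x r) \<in> measurable (P \<Otimes>\<^sub>M N \<Otimes>\<^sub>M K) K"
    and f: "\<And>p. p \<in> space P \<Longrightarrow> f p [] = c p"
      "\<And>p x xs. p \<in> space P \<Longrightarrow> x \<in> space N \<Longrightarrow> xs \<in> lists (space N) \<Longrightarrow> f p (x # xs) = F p x (f p xs)"
  shows "(\<lambda>(p, xs). f p xs) \<in> measurable (P \<Otimes>\<^sub>M list_space N) K"
proof -
  have *: "(\<lambda>(p, xs). f p (take n xs)) \<in> measurable (P \<Otimes>\<^sub>M list_space N) K" for n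
  proof (induction n)
    case 0
    have "(\<lambda>z. c (fst z)) \<in> measurable (P \<Otimes>\<^sub>M list_space N) K"
      by (rule measurable_compose[OF measurable_fst c])
    then show ?case
      by (rule measurable_cong[THEN iffD1, rotated]) (auto simp: f space_pair_measure)
  next
    case (Suc n)
    have "(\<lambda>z. (fst z, fst (snd z), (\<lambda>(p, xs). f p (take n xs)) (fst z, snd (snd z))))
       \<in> measurable (P \<Otimes>\<^sub>M N \<Otimes>\<^sub>M list_space N) (P \<Otimes>\<^sub>M N \<Otimes>\<^sub>M K)"
      by (intro measurable_Pair measurable_compose[OF _ Suc]) simp_all
    from measurable_compose[OF this F]
    have "(\<lambda>(p, x, xs). F p x (f p (take n xs))) \<in> measurable (P \<Otimes>\<^sub>M N \<Otimes>\<^sub>M list_space N) K"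
      by (simp add: split_beta')
    from measurable_case_list_space[OF c this] show ?case
      by (rule measurable_cong[THEN iffD1, rotated])
        (auto simp: space_pair_measure in_lists_conv_set f(1) intro!: f(2)[symmetric] dest!: in_set_takeD split: list.splits)
  qed
  have "(\<lambda>z. (\<lambda>(p, xs). f p (take (length (snd z)) xs)) z) \<in> measurable (P \<Otimes>\<^sub>M list_space N) K"
    by (rule measurable_compose_countable[where f="\<lambda>n (p, xs). f p (take n xs)", OF *])
       (rule measurable_compose[OF measurable_snd measurable_length_list_space])
  then show ?thesis by (simp add: split_beta')
qed

lemma measurable_rec_list_space':
  assumes c: "c \<in> measurable P K"
    and F: "(\<lambda>(p, x, r). F p x r) \<in> measurable (P \<Otimes>\<^sub>M N \<Otimes>\<^sub>M K) K"
    and f: "\<And>p. p \<in> space P \<Longrightarrow> f p [] = c p"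
      "\<And>p x xs. p \<in> space P \<Longrightarrow> x \<in> space N \<Longrightarrow> xs \<in> lists (space N) \<Longrightarrow> f p (x # xs) = F p x (f p xs)"
    and g: "g \<in> measurable P (list_space N)"
  shows "(\<lambda>p. f p (g p)) \<in> measurable P K"
  using measurable_compose[OF measurable_Pair[OF measurable_ident g] measurable_rec_list_space[OF c F f]]
  by simp

lemma measurable_append_list_space [measurable (raw)]:
  assumes [measurable]: "f \<in> measurable P (list_space N)" "g \<in> measurable P (list_space N)"
  shows "(\<lambda>p. f p @ g p) \<in> measurable P (list_space N)"
  by (rule measurable_rec_list_space'[where c=g and F="\<lambda>p x r. x # r" and N=N and f="\<lambda>p xs. xs @ g p" and g=f])
     (simp_all add: split_beta')

lemma measurable_map_list_space:
  assumes [measurable]: "(\<lambda>(p, x). h p x) \<in> measurable (P \<Otimes>\<^sub>M N) L" "f \<in> measurable P (list_space N)"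
  shows "(\<lambda>p. map (h p) (f p)) \<in> measurable P (list_space L)"
  by (rule measurable_rec_list_space'[where c="\<lambda>_. []" and F="\<lambda>p x r. h p x # r" and N=N and
        f="\<lambda>p xs. map (h p) xs" and g=f])
     (simp_all add: split_beta' measurable_const)

lemma measurable_concat_map_list_space:
  assumes [measurable]: "h \<in> measurable N (list_space L)" "f \<in> measurable P (list_space N)"
  shows "(\<lambda>p. concat (map h (f p))) \<in> measurable P (list_space L)"
  by (rule measurable_rec_list_space'[where c="\<lambda>_. []" and F="\<lambda>p x r. h x @ r" and N=N and
        f="\<lambda>p xs. concat (map h xs)" and g=f])
     (simp_all add: split_beta' measurable_const)

lemma measurable_sum_list_space:
  fixes h :: "_ \<Rightarrow> _ \<Rightarrow> ennreal"
  assumes [measurable]: "(\<lambda>(p, x). h p x) \<in> borel_measurable (P \<Otimes>\<^sub>M N)" "f \<in> measurable P (list_space N)"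
  shows "(\<lambda>p. sum_list (map (h p) (f p))) \<in> borel_measurable P"
  by (rule measurable_rec_list_space'[where c="\<lambda>_. 0" and F="\<lambda>p x r. h p x + r" and N=N and
        f="\<lambda>p xs. sum_list (map (h p) xs)" and g=f])
     (simp_all add: split_beta')

lemma measurable_prod_list_space:
  fixes h :: "_ \<Rightarrow> _ \<Rightarrow> ennreal"
  assumes [measurable]: "(\<lambda>(p, x). h p x) \<in> borel_measurable (P \<Otimes>\<^sub>M N)" "f \<in> measurable P (list_space N)"
  shows "(\<lambda>p. prod_list (map (h p) (f p))) \<in> borel_measurable P"
  by (rule measurable_rec_list_space'[where c="\<lambda>_. 1" and F="\<lambda>p x r. h p x * r" and N=N and
        f="\<lambda>p xs. prod_list (map (h p) xs)" and g=f])
     (simp_all add: split_beta')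

lemma measurable_list_space_subset:
  assumes "(\<lambda>x. x) \<in> measurable N L"
  shows "(\<lambda>x. x) \<in> measurable (list_space N) (list_space L)"
proof -
  have [measurable]: "(\<lambda>x. x) \<in> measurable N L" by fact
  have "(\<lambda>p. map (\<lambda>x. x) (id p)) \<in> measurable (list_space N) (list_space L)"
    by (rule measurable_map_list_space[where N=N]) simp_all
  then show ?thesis by simp
qed

text \<open>This is \<open>\<Sum>\<^sub>i\<^sub>\<noteq>\<^sub>j x\<^sub>i x\<^sub>j\<close>, as in \<open>\<eta>\<^sub>f\<close>.\<close>

fun cross_sum :: "'a::comm_semiring_1 list \<Rightarrow> 'a" where
  "cross_sum [] = 0"
| "cross_sum (x # xs) = 2 * x * sum_list xs + cross_sum xs"

lemma measurable_cross_sum_list_space: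
  fixes h :: "_ \<Rightarrow> _ \<Rightarrow> ennreal"
  assumes [measurable]: "(\<lambda>(p, x). h p x) \<in> borel_measurable (P \<Otimes>\<^sub>M N)" "f \<in> measurable P (list_space N)"
  shows "(\<lambda>p. cross_sum (map (h p) (f p))) \<in> borel_measurable P"
proof -
  \<comment> \<open>The recursion for \<open>cross_sum\<close> needs the sum of the tail, which is
    not passed on by the recursion lemma. The pair of both quantities satisfies a recursion of the
    required form.\<close>
  have "(\<lambda>p. (sum_list (map (h p) (f p)), cross_sum (map (h p) (f p)))) \<in> borel_measurable P"
    unfolding borel_prod[symmetric]
    by (rule measurable_rec_list_space'[where c="\<lambda>_. (0, 0)" and
        F="\<lambda>p x r. (h p x + fst r, 2 * h p x * fst r + snd r)" and N=N and
        f="\<lambda>p xs. (sum_list (map (h p) xs), cross_sum (map (h p) xs))" and g=f])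
      (simp_all add: split_beta')
  then have "(\<lambda>p. snd (sum_list (map (h p) (f p)), cross_sum (map (h p) (f p)))) \<in> borel_measurable P"
    unfolding borel_prod[symmetric] by (rule measurable_compose[OF _ measurable_snd])
  then show ?thesis by simp
qed

lemma square_sum_list:
  "(sum_list xs)\<^sup>2 = sum_list (map (\<lambda>x. x\<^sup>2) xs) + cross_sum (xs :: 'a::comm_semiring_1 list)"
  by (induction xs) (simp_all add: power2_eq_square algebra_simps mult_2 mult_2_right)

text \<open>Both sides are the square of the sum minus the sum of the squares. The index form is
  that of \<open>eta_f\<close>; the recursive form also makes sense in [0, \<infinity>], where
  nothing can be subtracted.\<close>

lemma sum_cross_eq_cross_sum:
  fixes f :: "'a \<Rightarrow> real"
  shows "(\<Sum>i<length ws. \<Sum>j\<in>{..<length ws} - {i}. f (ws ! i) * f (ws ! j)) = cross_sum (map f ws)"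
proof -
  have s: "sum_list (map h ws) = (\<Sum>i<length ws. h (ws ! i))" for h :: "'a \<Rightarrow> real"
    by (simp add: sum_list_sum_nth atLeast0LessThan)
  have "(\<Sum>i<length ws. \<Sum>j\<in>{..<length ws} - {i}. f (ws ! i) * f (ws ! j))
      = (\<Sum>i<length ws. (\<Sum>j<length ws. f (ws ! i) * f (ws ! j)) - (f (ws ! i))\<^sup>2)"
    by (intro sum.cong refl) (auto simp: sum_diff1 power2_eq_square)
  also have "\<dots> = (sum_list (map f ws))\<^sup>2 - sum_list (map (\<lambda>w. (f w)\<^sup>2) ws)"
    by (simp add: s sum_subtractf power2_eq_square sum_product)
  also have "\<dots> = cross_sum (map f ws)"
    using square_sum_list[of "map f ws"] by (simp add: comp_def)
  finally show ?thesis .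
qed

lemma cross_sum_ennreal:
  assumes "\<And>x. x \<in> set xs \<Longrightarrow> 0 \<le> x"
  shows "cross_sum (map ennreal xs) = ennreal (cross_sum xs)" "0 \<le> cross_sum xs"
proof -
  have "cross_sum (map ennreal xs) = ennreal (cross_sum xs) \<and> 0 \<le> cross_sum xs"
    using assms
  proof (induction xs)
    case (Cons x xs)
    have 1: "sum_list (map ennreal xs) = ennreal (sum_list xs)"
      using Cons.prems by (induction xs) (auto simp: ennreal_plus sum_list_nonneg)
    have 2: "0 \<le> sum_list xs" using Cons.prems by (auto intro: sum_list_nonneg)
    have "0 \<le> x" using Cons.prems by simp
    then have "2 * ennreal x * ennreal (sum_list xs) = ennreal (2 * x * sum_list xs)"
      using 2 by (simp add: ennreal_mult' ennreal_mult)
    then show ?case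
      using Cons 2 \<open>0 \<le> x\<close> by (simp add: 1 ennreal_plus)
  qed simp
  then show "cross_sum (map ennreal xs) = ennreal (cross_sum xs)" "0 \<le> cross_sum xs" by auto
qed

lemma set_integrable_bounded:
  fixes f :: "real \<Rightarrow> real"
  assumes "f \<in> borel_measurable borel" "\<And>x. x \<in> {a..b} \<Longrightarrow> \<bar>f x\<bar> \<le> c" "A \<in> sets borel" "A \<subseteq> {a..b}"
  shows "set_integrable lborel A f"
proof -
  have "emeasure lborel A \<le> emeasure lborel {a..b}"
    using assms by (intro emeasure_mono) auto
  also have "\<dots> < \<infinity>" by (simp add: emeasure_lborel_Icc_eq)
  finally have "emeasure lborel A < \<infinity>" .
  then show ?thesis
    unfolding set_integrable_def using assms
    by (intro integrableI_bounded_set_indicator[where B=c]) (auto intro!: AE_I2)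
qed

section \<open>Exponential clocks\<close>

text \<open>This is \<open>clock\<close> freed from the model: F is an accumulated rate, e the exit
  time and a the level set by the exponential variable. If the level is not reached strictly before
  e, the infimum over the empty set is \<infinity>.\<close>

definition hit :: "(real \<Rightarrow> real) \<Rightarrow> real \<Rightarrow> real \<Rightarrow> ereal" where
  "hit F e a = (INF t \<in> {t. 0 \<le> t \<and> t < e \<and> a \<le> F t}. ereal t)"

lemma hit_finite_iff: "hit F e a \<noteq> \<infinity> \<longleftrightarrow> (\<exists>t\<ge>0. t < e \<and> a \<le> F t)"
proof -
  have "hit F e a \<noteq> \<infinity> \<longleftrightarrow> hit F e a < \<infinity>" by (simp add: less_top[symmetric])
  also have "\<dots> \<longleftrightarrow> (\<exists>t\<ge>0. t < e \<and> a \<le> F t)"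
    unfolding hit_def INF_less_iff by auto
  finally show ?thesis .
qed

text \<open>Once the level is reached, monotonicity keeps it reached, and the strict bounds by e and
  S leave room for a rational time. The event is thus a countable union, which gives measurability
  in all arguments at once.\<close>

lemma hit_less_iff:
  assumes "mono F"
  shows "hit F e a < S \<longleftrightarrow> (\<exists>q\<in>\<rat>. 0 \<le> q \<and> q < e \<and> ereal q < S \<and> a \<le> F q)"
proof
  assume "hit F e a < S"
  then obtain t where t: "0 \<le> t" "t < e" "a \<le> F t" "ereal t < S"
    unfolding hit_def by (auto simp: INF_less_iff)
  obtain s where s: "t < s" "s < e" "ereal s < S"
  proof (cases S)
    case (real x)
    with t have "t < min x e" by simp
    then obtain s where "t < s" "s < min x e" using dense by blast
    with that real show ?thesis by auto
  next
    case PInf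
    obtain s where "t < s" "s < e" using dense[OF t(2)] by blast
    with that PInf show ?thesis by auto
  qed (use t in auto)
  obtain q where q: "q \<in> \<rat>" "t < q" "q < s" using Rats_dense_in_real[OF s(1)] by auto
  have "ereal q < S" using q(3) s(3) by (metis ereal_less(2) ereal_less_eq(3) less_le_not_le order_less_trans less_ereal.simps(1))
  with q s t \<open>mono F\<close> show "\<exists>q\<in>\<rat>. 0 \<le> q \<and> q < e \<and> ereal q < S \<and> a \<le> F q"
    by (intro bexI[of _ q]) (auto dest: monoD[of F t q])
qed (auto simp: hit_def INF_less_iff)

lemma measurable_hit:
  assumes [measurable]: "(\<lambda>(p, t). F p t) \<in> borel_measurable (P \<Otimes>\<^sub>M borel)"
    and e[measurable]: "e \<in> borel_measurable P"
    and a[measurable]: "a \<in> borel_measurable P"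
    and F: "\<And>p. p \<in> space P \<Longrightarrow> mono (F p)"
  shows "(\<lambda>p. hit (F p) (e p) (a p)) \<in> borel_measurable P"
proof (rule borel_measurableI_less)
  fix S
  have [measurable]: "(\<lambda>p. F p q) \<in> borel_measurable P" for q
  proof -
    have "(\<lambda>p. (\<lambda>(p, t). F p t) (p, q)) \<in> borel_measurable P" by measurable
    then show ?thesis by simp
  qed
  have "{p \<in> space P. hit (F p) (e p) (a p) < S}
      = (\<Union>q\<in>\<rat>. {p\<in>space P. 0 \<le> q \<and> q < e p \<and> ereal q < S \<and> a p \<le> F p q})"
    using hit_less_iff[OF F] by auto
  also have "\<dots> \<in> sets P"
    by (intro sets.countable_UN'' countable_rat) measurable
  finally show "{p \<in> space P. hit (F p) (e p) (a p) < S} \<in> sets P" .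
qed

abbreviation exp1 :: "real measure" where
  "exp1 \<equiv> density lborel (exponential_density 1)"

lemma prob_space_exp1: "prob_space exp1"
  by (rule prob_space_exponential_density) simp

lemma emeasure_exp1_atMost:
  assumes "0 \<le> x"
  shows "emeasure exp1 {..x} = ennreal (1 - exp (- x))"
proof -
  interpret prob_space exp1 by (rule prob_space_exp1)
  have "distributed exp1 lborel (\<lambda>x. x) (exponential_density 1)"
    by (auto simp: distributed_def distr_id2 intro!: exponential_density_nonneg)
  from exponential_distributedD_le[OF this assms]
  have "measure exp1 {..x} = 1 - exp (- x)"
    by (simp add: atMost_def)
  then show ?thesis by (simp add: emeasure_eq_measure)
qed

lemma AE_exp1_neq: "AE b in exp1. b \<noteq> x"
proof -
  have "AE b in lborel. b \<noteq> x"
    by (rule AE_lborel_singleton)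
  then show ?thesis by (subst AE_density) auto
qed

text \<open>Increments of second order force the derivative to vanish everywhere. This stands in for
  the fundamental theorem of calculus when the rate is merely measurable, so that its integral need
  not be differentiable at every point.\<close>

lemma constant_if_square_bound:
  fixes K :: "real \<Rightarrow> real"
  assumes K: "\<And>x y. x \<le> y \<Longrightarrow> \<bar>K y - K x\<bar> \<le> C * (y - x)\<^sup>2"
  shows "K x = K y"
proof -
  have "(K has_real_derivative 0) (at x)" for x
  proof -
  have K': "\<bar>K y - K x\<bar> \<le> C * (y - x)\<^sup>2" for y
    using K[of x y] K[of y x] by (cases "x \<le> y") (auto simp: abs_minus_commute power2_commute)
  have "((\<lambda>y. (K y - K x) / (y - x)) \<longlongrightarrow> 0) (at x)"
  proof (rule Lim_null_comparison)
    show "\<forall>\<^sub>F y in at x. norm ((K y - K x) / (y - x)) \<le> C * \<bar>y - x\<bar>"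
    proof (rule eventually_at_filter[THEN iffD2, OF always_eventually], safe)
      fix y :: real assume "y \<noteq> x"
      then show "norm ((K y - K x) / (y - x)) \<le> C * \<bar>y - x\<bar>"
        using K'[of y] by (simp add: abs_divide divide_le_eq power2_eq_square abs_mult_self_eq mult.assoc)
    qed
    have "((\<lambda>y. C * \<bar>y - x\<bar>) \<longlongrightarrow> C * \<bar>x - x\<bar>) (at x)" by (intro tendsto_intros)
    then show "((\<lambda>y. C * \<bar>y - x\<bar>) \<longlongrightarrow> 0) (at x)" by simp
  qed
  then show ?thesis
    by (simp add: has_field_derivative_iff)
  qed
  then show ?thesis by (auto intro: DERIV_isconst_all)
qed

locale bounded_rate =
  fixes h :: "real \<Rightarrow> real" and c :: real
  assumes h_meas [measurable]: "h \<in> borel_measurable borel"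
    and h_nonneg: "\<And>s. 0 \<le> h s"
    and h_le: "\<And>s. h s \<le> c"
begin

definition F :: "real \<Rightarrow> real" where
  "F t = (LBINT s:{0..t}. h s)"

lemma c_nonneg: "0 \<le> c"
  using h_nonneg[of 0] h_le[of 0] by simp

lemma h_integrable: "A \<in> sets borel \<Longrightarrow> A \<subseteq> {a..b} \<Longrightarrow> set_integrable lborel A h"
  using h_nonneg h_le by (intro set_integrable_bounded[of h a b c]) auto

lemma F_nonpos [simp]: "t \<le> 0 \<Longrightarrow> F t = 0"
proof -
  assume "t \<le> 0"
  have "AE s in lborel. s \<noteq> (0::real)" by (rule AE_lborel_singleton)
  then have "AE s in lborel. indicator {0..t} s *\<^sub>R h s = 0"
    by eventually_elim (use \<open>t \<le> 0\<close> in \<open>auto simp: indicator_def\<close>)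
  then show ?thesis
    unfolding F_def set_lebesgue_integral_def by (rule integral_eq_zero_AE)
qed

lemma F_diff:
  assumes "0 \<le> x" "x \<le> y"
  shows "F y = F x + (LBINT s:{x<..y}. h s)"
proof -
  have "(LBINT s:{0..x} \<union> {x<..y}. h s) = (LBINT s:{0..x}. h s) + (LBINT s:{x<..y}. h s)"
    by (intro set_integral_Un h_integrable[of _ 0 y]) (use assms in auto)
  moreover have "{0..y} = {0..x} \<union> {x<..y}" using assms by auto
  ultimately show ?thesis by (simp add: F_def)
qed

lemma F_increment:
  assumes "0 \<le> x" "x \<le> y"
  shows "0 \<le> F y - F x" "F y - F x \<le> c * (y - x)"
proof -
  have "(LBINT s:{x<..y}. h s) \<le> (LBINT s:{x<..y}. c)"
    using h_nonneg h_le assms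
    by (intro set_integral_mono h_integrable[of _ x y] set_integrable_bounded[of _ x y "\<bar>c\<bar>"]) auto
  also have "\<dots> = c * (y - x)"
    using assms by (simp add: set_lebesgue_integral_def)
  finally show "F y - F x \<le> c * (y - x)"
    using F_diff[OF assms] by simp
  have "0 \<le> (LBINT s:{x<..y}. h s)"
    unfolding set_lebesgue_integral_def using h_nonneg
    by (intro Bochner_Integration.integral_nonneg) auto
  then show "0 \<le> F y - F x" using F_diff[OF assms] by simp
qed

lemma mono_F: "mono F"
proof (rule monoI)
  fix x y :: real assume "x \<le> y"
  then show "F x \<le> F y"
    using F_increment[of x y] F_increment[of 0 y] by (cases "0 \<le> x"; cases "0 \<le> y") auto
qed

lemma F_nonneg: "0 \<le> F t"
  using F_increment[of 0 t] by (cases "0 \<le> t") auto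

lemma F_meas [measurable]: "F \<in> borel_measurable borel"
  by (rule borel_measurable_mono[OF mono_F])

lemma right_continuous_F:
  assumes "0 \<le> s" "s < e" and a: "\<And>u. s < u \<Longrightarrow> u < e \<Longrightarrow> a \<le> F u"
  shows "a \<le> F s"
proof (rule ccontr)
  assume "\<not> a \<le> F s"
  \<comment> \<open>On an interval of length d, F grows by at most half of the gap a - F s. The
    summand 1 covers the case c = 0.\<close>
  define d where "d = (a - F s) / (2 * (c + 1))"
  have "0 < d" using \<open>\<not> a \<le> F s\<close> c_nonneg by (simp add: d_def)
  define u where "u = min (s + d) ((s + e) / 2)"
  have "(s + e) / 2 < e" "s < (s + e) / 2" using \<open>s < e\<close> by simp_all
  then have u: "s < u" "u < e" "u - s \<le> d" using \<open>0 < d\<close> unfolding u_def by linarith+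
  have "F u - F s \<le> c * (u - s)" using u \<open>0 \<le> s\<close> by (intro F_increment) auto
  also have "\<dots> \<le> c * d" using u c_nonneg by (intro mult_left_mono) auto
  also have "\<dots> \<le> (c + 1) * d" using \<open>0 < d\<close> by (simp add: distrib_right)
  also have "\<dots> = (a - F s) / 2" using c_nonneg by (simp add: d_def divide_simps)
  finally show False using a[OF u(1,2)] \<open>\<not> a \<le> F s\<close> by simp
qed

text \<open>F is continuous, so the infimum is attained; s < e leaves room to approach s from the
  right before e.\<close>

lemma hit_le_iff:
  assumes "0 \<le> s" "s < e"
  shows "hit F e a \<le> ereal s \<longleftrightarrow> a \<le> F s"
proof
  assume *: "hit F e a \<le> ereal s"
  show "a \<le> F s"
  proof (rule right_continuous_F[OF assms])
    fix u assume "s < u" "u < e"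
    then have "hit F e a < ereal u" using * by (auto intro: order_le_less_trans)
    then obtain t where "t < u" "a \<le> F t"
      unfolding hit_def by (auto simp: INF_less_iff)
    then show "a \<le> F u" using monoD[OF mono_F, of t u] by simp
  qed
next
  assume "a \<le> F s"
  then show "hit F e a \<le> ereal s"
    unfolding hit_def using assms by (auto intro!: INF_lower)
qed

lemma hit_nonneg: "0 \<le> hit F e a"
  unfolding hit_def by (auto intro!: INF_greatest)

lemma hit_finite_less: "hit F e a < \<infinity> \<Longrightarrow> hit F e a < ereal e"
  using hit_finite_iff[of F e a] unfolding hit_def by (auto simp: INF_less_iff)

lemma hit_real: "hit F e a < \<infinity> \<Longrightarrow> ereal (real_of_ereal (hit F e a)) = hit F e a"
  using hit_nonneg[of e a] by (cases "hit F e a") auto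

lemma hit_meas [measurable]: "hit F e \<in> borel_measurable borel"
proof -
  have "(\<lambda>a. hit F e a) \<in> borel_measurable borel"
    by (rule measurable_hit) (auto simp: mono_F)
  then show ?thesis by simp
qed

text \<open>For continuous h the integrand is the derivative of \<open>- exp (- F s)\<close>. For
  measurable h, let K be the integral plus \<open>exp (- F t)\<close>. With D = F y - F x, the
  integral over (x, y] lies between \<open>D * exp (- F y)\<close> and
  \<open>D * exp (- F x)\<close>, and both differ from \<open>exp (- F x) - exp (- F y)\<close> by
  at most D^2. So K has increments of second order and is constant.\<close>

lemma integral_h_exp:
  assumes "0 \<le> t"
  shows "(LBINT s:{0..t}. h s * exp (- F s)) = 1 - exp (- F t)"
proof -
  define g where "g s = h s * exp (- F s)" for s
  have [measurable]: "g \<in> borel_measurable borel" unfolding g_def[abs_def] by measurable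
  have g: "0 \<le> g s" "\<bar>g s\<bar> \<le> c" for s
    using h_nonneg[of s] h_le[of s] F_nonneg[of s] c_nonneg mult_mono[of "h s" c "exp (- F s)" 1]
    by (auto simp: g_def)
  have gi: "A \<in> sets borel \<Longrightarrow> A \<subseteq> {a..b} \<Longrightarrow> set_integrable lborel A g" for A a b
    using g by (intro set_integrable_bounded[of g a b c]) auto
  define K where "K t = (LBINT s:{0..t}. g s) + exp (- F t)" for t
  have K0: "\<bar>K y - K x\<bar> \<le> c\<^sup>2 * (y - x)\<^sup>2" if xy: "0 \<le> x" "x \<le> y" for x y
  proof -
    define D where "D = F y - F x"
    have D: "0 \<le> D" "D \<le> c * (y - x)" "D = (LBINT s:{x<..y}. h s)"
      using F_increment[OF xy] F_diff[OF xy] by (auto simp: D_def)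
    have "{0..y} = {0..x} \<union> {x<..y}" using xy by auto
    then have "(LBINT s:{0..y}. g s) = (LBINT s:{0..x}. g s) + (LBINT s:{x<..y}. g s)"
      by (simp only:) (intro set_integral_Un gi[of _ 0 y], use xy in auto)
    then have *: "K y - K x = (LBINT s:{x<..y}. g s) + exp (- F y) - exp (- F x)"
      by (simp add: K_def)
    have "(LBINT s:{x<..y}. g s) \<le> (LBINT s:{x<..y}. h s * exp (- F x))"
      using h_nonneg monoD[OF mono_F, of x]
      by (intro set_integral_mono gi[of _ x y] set_integrable_mult_left h_integrable[of _ x y])
         (auto simp: g_def intro!: mult_left_mono)
    then have up: "(LBINT s:{x<..y}. g s) \<le> D * exp (- F x)"
      by (simp add: D(3))
    have "(LBINT s:{x<..y}. h s * exp (- F y)) \<le> (LBINT s:{x<..y}. g s)"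
      using h_nonneg monoD[OF mono_F, of _ y]
      by (intro set_integral_mono gi[of _ x y] set_integrable_mult_left h_integrable[of _ x y])
         (auto simp: g_def intro!: mult_left_mono)
    then have lo: "D * exp (- F y) \<le> (LBINT s:{x<..y}. g s)"
      by (simp add: D(3))
    have Fy: "exp (- F y) = exp (- F x) * exp (- D)"
      by (simp add: D_def exp_add[symmetric])
    have e1: "exp (- F x) \<le> 1" using F_nonneg[of x] by simp
    have "exp (- D) \<le> 1 / (1 + D)"
      using exp_ge_add_one_self[of D] D(1) by (simp add: exp_minus field_simps)
    then have "D + exp (- D) - 1 \<le> D + 1 / (1 + D) - 1" by simp
    also have "\<dots> = D\<^sup>2 / (1 + D)" using D(1) by (simp add: field_simps power2_eq_square)
    also have "\<dots> \<le> D\<^sup>2 / 1" using D(1) by (intro divide_left_mono) auto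
    finally have u: "D + exp (- D) - 1 \<le> D\<^sup>2" by simp
    have "K y - K x \<le> exp (- F x) * (D + exp (- D) - 1)"
      using up unfolding * Fy by (simp add: algebra_simps)
    also have "\<dots> \<le> 1 * D\<^sup>2"
      using u e1 D(1) exp_ge_add_one_self[of "- D"] by (intro mult_mono) auto
    finally have U: "K y - K x \<le> D\<^sup>2" by simp
    have "1 - D\<^sup>2 \<le> (1 + D) * exp (- D)"
      using mult_left_mono[OF exp_ge_add_one_self[of "- D"], of "1 + D"] D(1)
      by (simp add: algebra_simps power2_eq_square)
    then have l: "- (D\<^sup>2) \<le> D * exp (- D) + exp (- D) - 1" by (simp add: algebra_simps)
    have "- (D\<^sup>2) \<le> exp (- F x) * - (D\<^sup>2)" 
      using e1 mult_right_mono[of "exp (- F x)" 1 "D\<^sup>2"] by simp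
    also have "\<dots> \<le> exp (- F x) * (D * exp (- D) + exp (- D) - 1)"
      using l by (intro mult_left_mono) auto
    also have "\<dots> \<le> K y - K x"
      using lo unfolding * Fy by (simp add: algebra_simps)
    finally have "\<bar>K y - K x\<bar> \<le> D\<^sup>2" using U by simp
    also have "\<dots> \<le> (c * (y - x))\<^sup>2" using D by (intro power_mono) auto
    finally show ?thesis by (simp add: power_mult_distrib)
  qed
  \<comment> \<open>The increment bound is known for nonnegative arguments only; freezing K to the
    left of 0 extends it to the whole line.\<close>
  have "K (max 0 t) = K (max 0 0)"
  proof (rule constant_if_square_bound[where K="\<lambda>t. K (max 0 t)"])
    fix x y :: real assume "x \<le> y"
    have "\<bar>K (max 0 y) - K (max 0 x)\<bar> \<le> c\<^sup>2 * (max 0 y - max 0 x)\<^sup>2"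
      using \<open>x \<le> y\<close> by (intro K0) auto
    also have "\<dots> \<le> c\<^sup>2 * (y - x)\<^sup>2"
      using \<open>x \<le> y\<close> by (intro mult_left_mono power_mono) auto
    finally show "\<bar>K (max 0 y) - K (max 0 x)\<bar> \<le> c\<^sup>2 * (y - x)\<^sup>2" .
  qed
  moreover have "K 0 = 1"
  proof -
    have "(LBINT s:{0..0}. g s) = 0"
    proof -
      have "AE s in lborel. s \<noteq> (0::real)" by (rule AE_lborel_singleton)
      then have "AE s in lborel. indicator {0..0} s *\<^sub>R g s = 0"
        by eventually_elim (auto simp: indicator_def)
      then show ?thesis
        unfolding set_lebesgue_integral_def by (rule integral_eq_zero_AE)
    qed
    then show ?thesis by (simp add: K_def)
  qed
  ultimately show ?thesis using assms by (simp add: K_def g_def)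
qed

lemma nn_integral_h_exp:
  assumes "0 \<le> t"
  shows "(\<integral>\<^sup>+s. ennreal (h s * exp (- F s)) * indicator {0..t} s \<partial>lborel) = ennreal (1 - exp (- F t))"
proof -
  have *: "\<bar>h s * exp (- F s)\<bar> \<le> c" for s
    using h_nonneg[of s] h_le[of s] F_nonneg[of s] c_nonneg mult_mono[of "h s" c "exp (- F s)" 1]
    by (auto simp: abs_mult)
  have "(\<integral>\<^sup>+s. ennreal (h s * exp (- F s)) * indicator {0..t} s \<partial>lborel)
     = (\<integral>\<^sup>+s. ennreal (indicator {0..t} s *\<^sub>R (h s * exp (- F s))) \<partial>lborel)"
    by (intro nn_integral_cong) (auto split: split_indicator)
  also have "\<dots> = ennreal (LBINT s:{0..t}. h s * exp (- F s))"
    unfolding set_lebesgue_integral_def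
    using set_integrable_bounded[of "\<lambda>s. h s * exp (- F s)" 0 t c "{0..t}"] *
    by (intro nn_integral_eq_integral) (auto simp: h_nonneg set_integrable_def)
  finally show ?thesis using integral_h_exp[OF assms] by simp
qed

section \<open>Clocks whose rate vanishes after an exit time\<close>

context
  fixes e :: real
  assumes e_pos: "0 < e" and h_zero: "\<And>s. e \<le> s \<Longrightarrow> h s = 0"
begin

lemma F_after: "e \<le> s \<Longrightarrow> F s = F e"
proof -
  assume "e \<le> s"
  have "(LBINT u:{e<..s}. h u) = (LBINT u:{e<..s}. 0)"
    by (intro set_lebesgue_integral_cong) (auto simp: h_zero)
  then show ?thesis using F_diff[of e s] e_pos \<open>e \<le> s\<close> by simp
qed

text \<open>Before e the equivalence holds for every b. From e on, F keeps the value F e, and the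
  level b = F e may be reached at e only, a time that \<open>hit\<close> excludes; an exponential
  variable takes this value with probability 0.\<close>

lemma AE_hit_le_iff:
  assumes "0 \<le> s"
  shows "AE b in exp1. (hit F e b < \<infinity> \<and> hit F e b \<le> ereal s) \<longleftrightarrow> b \<le> F s"
proof (cases "s < e")
  case True
  then show ?thesis using hit_le_iff[OF assms True]
    by (auto intro!: AE_I2)
       (metis ereal_infty_less(1) less_ereal.simps(4) order_le_less_trans PInfty_neq_ereal(1) ereal_infty_less_eq(1) hit_le_iff)
next
  case False
  show ?thesis using AE_exp1_neq[of "F s"]
  proof eventually_elim
    case (elim b)
    show ?case
    proof
      assume "hit F e b < \<infinity> \<and> hit F e b \<le> ereal s"
      then obtain t where "t < e" "b \<le> F t" using hit_finite_iff[of F e b] by auto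
      then show "b \<le> F s" using monoD[OF mono_F, of t s] False by simp
    next
      assume "b \<le> F s"
      with elim F_after[of s] False have "b < F e" by simp
      have "\<exists>u. 0 \<le> u \<and> u < e \<and> b \<le> F u"
      proof (rule ccontr)
        assume "\<not> ?thesis"
        then have *: "F u < b" if "0 \<le> u" "u < e" for u using that by force
        \<comment> \<open>F loses less than F e - b over an interval of length d, so b is already
          exceeded at e - d, a time in [0, e).\<close>
        define d where "d = min e ((F e - b) / (c + 1))"
        have d: "0 < d" "d \<le> e" using \<open>b < F e\<close> c_nonneg e_pos by (auto simp: d_def)
        have "F e - F (e - d) \<le> c * d" using F_increment[of "e - d" e] d by simp
        also have "\<dots> < (c + 1) * d" using d by (simp add: distrib_right)
        also have "\<dots> \<le> (c + 1) * ((F e - b) / (c + 1))"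
          using c_nonneg by (intro mult_left_mono) (auto simp: d_def)
        also have "\<dots> = F e - b" using c_nonneg by simp
        finally show False using *[of "e - d"] d by simp
      qed
      then obtain u where u: "0 \<le> u" "u < e" "b \<le> F u" by auto
      then have "hit F e b \<le> ereal u" by (auto simp: hit_le_iff)
      moreover have "ereal u < ereal s" using False u by simp
      ultimately show "hit F e b < \<infinity> \<and> hit F e b \<le> ereal s"
        by (metis ereal_less_PInfty order_le_less_trans less_imp_le)
    qed
  qed
qed

lemma emeasure_hit_le:
  assumes "0 \<le> s"
  shows "emeasure exp1 {b. hit F e b < \<infinity> \<and> hit F e b \<le> ereal s} = ennreal (1 - exp (- F s))"
proof -
  have "emeasure exp1 {b. hit F e b < \<infinity> \<and> hit F e b \<le> ereal s} = emeasure exp1 {..F s}"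
    using AE_hit_le_iff[OF assms] by (intro emeasure_eq_AE) (auto simp: pred_def)
  then show ?thesis using emeasure_exp1_atMost[OF F_nonneg] by simp
qed

text \<open>Both measures give {..a} the mass \<open>1 - exp (- F a)\<close> for a \<ge> 0. The
  exponential law is cut down to the clocks that ring, because \<open>real_of_ereal\<close> would
  send \<infinity> to 0 and create an atom there.\<close>

lemma distr_hit:
  "distr (density exp1 (indicator {b. hit F e b < \<infinity>})) borel (\<lambda>b. real_of_ereal (hit F e b))
    = density lborel (\<lambda>u. ennreal (h u * exp (- F u)) * indicator {0..} u)" (is "?L = ?R")
proof (rule measure_eqI_generator_eq[where E="range (\<lambda>a. {..a::real})" and \<Omega>=UNIV and A="\<lambda>i. {..real i}"])
  have L: "emeasure ?L {..a} = (if 0 \<le> a then ennreal (1 - exp (- F a)) else 0)" for a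
  proof -
    have "emeasure ?L {..a} = emeasure exp1 ({b. hit F e b < \<infinity>} \<inter> {b. real_of_ereal (hit F e b) \<le> a})"
      by (subst emeasure_distr) (auto simp: emeasure_restricted vimage_def)
    also have "{b. hit F e b < \<infinity>} \<inter> {b. real_of_ereal (hit F e b) \<le> a}
       = {b. hit F e b < \<infinity> \<and> hit F e b \<le> ereal a}"
      using hit_real[of e] by auto (metis ereal_less_eq(3))+
    also have "emeasure exp1 \<dots> = (if 0 \<le> a then ennreal (1 - exp (- F a)) else 0)"
    proof (cases "0 \<le> a")
      case False
      then have "{b. hit F e b < \<infinity> \<and> hit F e b \<le> ereal a} = {}"
        using hit_nonneg[of e] by (auto simp: not_le) (meson ereal_less(2) order.trans not_le zero_ereal_def ereal_less_eq(5))
      then show ?thesis using False by (simp only: emeasure_empty if_False)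
    next
      case True
      then show ?thesis using emeasure_hit_le[OF True] by (simp only: if_True)
    qed
    finally show ?thesis .
  qed
  have R: "emeasure ?R {..a} = (if 0 \<le> a then ennreal (1 - exp (- F a)) else 0)" for a
  proof -
    have "emeasure ?R {..a} = (\<integral>\<^sup>+u. ennreal (h u * exp (- F u)) * indicator {0..a} u \<partial>lborel)"
      by (subst emeasure_density) (auto intro!: nn_integral_cong split: split_indicator)
    then show ?thesis using nn_integral_h_exp[of a] by (cases "0 \<le> a") auto
  qed
  show "emeasure ?L X = emeasure ?R X" if "X \<in> range (\<lambda>a. {..a})" for X
    using that L R by auto
  show "emeasure ?L {..real i} \<noteq> \<infinity>" for i
    using L[of "real i"] by auto
  show "Int_stable (range (\<lambda>a. {..a::real}))"
    by (auto simp: Int_stable_def) (metis atMost_iff min_le_iff_disj Int_atMost)?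
  show "(\<Union>i. {..real i}) = UNIV"
    by (auto simp: real_arch_simple)
qed (auto simp: borel_eq_atMost)

lemma nn_integral_hit:
  assumes [measurable]: "G \<in> borel_measurable borel"
  shows "(\<integral>\<^sup>+b. (if hit F e b < \<infinity> then G (real_of_ereal (hit F e b)) else 0) \<partial>exp1)
    = (\<integral>\<^sup>+u. ennreal (h u * exp (- F u)) * indicator {0..} u * G u \<partial>lborel)"
proof -
  have "(\<integral>\<^sup>+b. (if hit F e b < \<infinity> then G (real_of_ereal (hit F e b)) else 0) \<partial>exp1)
     = (\<integral>\<^sup>+b. indicator {b. hit F e b < \<infinity>} b * G (real_of_ereal (hit F e b)) \<partial>exp1)"
    by (intro nn_integral_cong) (auto split: split_indicator)
  also have "\<dots> = (\<integral>\<^sup>+u. G u \<partial>distr (density exp1 (indicator {b. hit F e b < \<infinity>})) borel (\<lambda>b. real_of_ereal (hit F e b)))"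
    by (subst nn_integral_distr, simp, simp, subst nn_integral_density) simp_all
  also have "\<dots> = (\<integral>\<^sup>+u. ennreal (h u * exp (- F u)) * indicator {0..} u * G u \<partial>lborel)"
    unfolding distr_hit by (subst nn_integral_density) simp_all
  finally show ?thesis .
qed

lemma emeasure_le_hit:
  assumes "0 \<le> s"
  shows "emeasure exp1 {b. ereal s \<le> hit F e b} = ennreal (exp (- F s))"
proof -
  interpret prob_space exp1 by (rule prob_space_exp1)
  define q where "q = (\<integral>\<^sup>+u. ennreal (h u * exp (- F u)) * indicator {0..} u * indicator {..<s} u \<partial>lborel)"
  have "AE u in lborel. u \<noteq> s" by (rule AE_lborel_singleton)
  then have "q = (\<integral>\<^sup>+u. ennreal (h u * exp (- F u)) * indicator {0..s} u \<partial>lborel)"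
    unfolding q_def by (intro nn_integral_cong_AE) (auto split: split_indicator)
  then have q: "q = ennreal (1 - exp (- F s))"
    using nn_integral_h_exp[OF assms] by simp
  have "q = (\<integral>\<^sup>+b. indicator {b. hit F e b < ereal s} b \<partial>exp1)"
    unfolding q_def nn_integral_hit[of "indicator {..<s}", simplified, symmetric]
    using hit_real[of e] 
    by (intro nn_integral_cong) (auto split: split_indicator simp: less_top[symmetric], (metis less_ereal.simps(1))+)
  then have "emeasure exp1 {b. hit F e b < ereal s} = ennreal (1 - exp (- F s))"
    using q by simp
  then have "prob {b. hit F e b < ereal s} = 1 - exp (- F s)"
    using F_nonneg[of s] by (simp add: emeasure_eq_measure)
  moreover have "prob {b. ereal s \<le> hit F e b} = 1 - prob {b. hit F e b < ereal s}"
    by (subst prob_compl[symmetric]) (auto intro!: arg_cong[where f=prob])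
  ultimately show ?thesis by (simp add: emeasure_eq_measure)
qed

lemma emeasure_less_hit:
  assumes "0 \<le> s"
  shows "emeasure exp1 {b. hit F e b = \<infinity> \<or> ereal s < hit F e b} = ennreal (exp (- F s))"
proof -
  interpret prob_space exp1 by (rule prob_space_exp1)
  have "prob {b. hit F e b < \<infinity> \<and> hit F e b \<le> ereal s} = 1 - exp (- F s)"
    using emeasure_hit_le[OF assms] F_nonneg[of s] by (simp add: emeasure_eq_measure)
  moreover have "prob {b. hit F e b = \<infinity> \<or> ereal s < hit F e b} = 1 - prob {b. hit F e b < \<infinity> \<and> hit F e b \<le> ereal s}"
    by (subst prob_compl[symmetric]) (auto intro!: arg_cong[where f=prob] simp: less_top[symmetric])
  ultimately show ?thesis by (simp add: emeasure_eq_measure)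
qed

lemma emeasure_hit_infinite: "emeasure exp1 {b. hit F e b = \<infinity>} = ennreal (exp (- F e))"
proof -
  have "{b. hit F e b = \<infinity> \<or> ereal e < hit F e b} = {b. hit F e b = \<infinity>}"
    using hit_finite_less[of e] by (auto simp: less_top) (metis less_ereal.simps(1) order_less_imp_not_less less_top infinity_ereal_def)
  then show ?thesis using emeasure_less_hit[of e] e_pos by simp
qed

end

end

text \<open>Competing risks: by independence, the density \<open>h1 u * exp (- F1 u)\<close> of a
  ring of clock 1 at u is multiplied by the probability \<open>exp (- F2 u)\<close> that clock 2 is
  silent until then, and conversely. Ties go to clock 2, as in \<open>life\<close>; the strict and
  the weak comparison have the same probability, so the formula is symmetric.\<close>

lemma nn_integral_two_clocks:
  assumes h1: "bounded_rate h1 c" and h2: "bounded_rate h2 c" and e: "0 < e"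
    and z1: "\<And>s. e \<le> s \<Longrightarrow> h1 s = 0" and z2: "\<And>s. e \<le> s \<Longrightarrow> h2 s = 0"
    and [measurable]: "G1 \<in> borel_measurable borel" "G2 \<in> borel_measurable borel"
  defines "F1 \<equiv> bounded_rate.F h1" and "F2 \<equiv> bounded_rate.F h2"
  shows "(\<integral>\<^sup>+a. \<integral>\<^sup>+b. (if hit F1 e a = \<infinity> \<and> hit F2 e b = \<infinity> then G0
           else if hit F1 e a < hit F2 e b then G1 (real_of_ereal (hit F1 e a))
           else G2 (real_of_ereal (hit F2 e b))) \<partial>exp1 \<partial>exp1)
       = ennreal (exp (- (F1 e + F2 e))) * G0 +
         (\<integral>\<^sup>+u. indicator {0..} u * ennreal (exp (- (F1 u + F2 u))) *
             (ennreal (h1 u) * G1 u + ennreal (h2 u) * G2 u) \<partial>lborel)"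
proof -
  interpret A: bounded_rate h1 c by fact
  interpret B: bounded_rate h2 c by fact
  interpret P: prob_space exp1 by (rule prob_space_exp1)
  interpret PP: pair_prob_space exp1 exp1 ..
  define X where "X a = hit F1 e a" for a
  define Y where "Y b = hit F2 e b" for b
  have [measurable]: "X \<in> borel_measurable borel" "Y \<in> borel_measurable borel"
    unfolding X_def[abs_def] Y_def[abs_def] F1_def F2_def by measurable
  define RX where "RX a = real_of_ereal (X a)" for a
  define RY where "RY b = real_of_ereal (Y b)" for b
  have [measurable]: "RX \<in> borel_measurable borel" "RY \<in> borel_measurable borel"
    unfolding RX_def[abs_def] RY_def[abs_def] by measurable
  have RX: "X a = ereal (RX a)" "0 \<le> RX a" if "X a < \<infinity>" for a
    using that A.hit_real[of e a] A.hit_nonneg[of e a] by (auto simp: X_def RX_def F1_def real_of_ereal_pos)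
  have RY: "Y a = ereal (RY a)" "0 \<le> RY a" if "Y a < \<infinity>" for a
    using that B.hit_real[of e a] B.hit_nonneg[of e a] by (auto simp: Y_def RY_def F2_def real_of_ereal_pos)
  \<comment> \<open>The three terms belong to the events that no clock rings, that clock 1 is
    strictly first, and that clock 2 is first or ties. In the last one the inner integral has to run
    over a, hence the exchange of integrals for \<open>?t3\<close>.\<close>
  let ?t1 = "\<lambda>a b. indicator {a. X a = \<infinity>} a * (indicator {b. Y b = \<infinity>} b * G0)"
  let ?t2 = "\<lambda>a b. (if X a < \<infinity> then G1 (RX a) else 0) * indicator {b. Y b = \<infinity> \<or> ereal (RX a) < Y b} b"
  let ?t3 = "\<lambda>a b. (if Y b < \<infinity> then G2 (RY b) else 0) * indicator {a. ereal (RY b) \<le> X a} a"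
  have split: "(if X a = \<infinity> \<and> Y b = \<infinity> then G0 else if X a < Y b then G1 (RX a) else G2 (RY b))
      = ?t1 a b + ?t2 a b + ?t3 a b" for a b
  proof -
    consider "X a = \<infinity>" "Y b = \<infinity>" | "X a = \<infinity>" "Y b < \<infinity>" | "X a < \<infinity>" "Y b = \<infinity>" | "X a < \<infinity>" "Y b < \<infinity>"
      by (auto simp: less_top[symmetric])
    then show ?thesis
    proof cases
      case 4
      then show ?thesis using RX(1)[OF 4(1)] RY(1)[OF 4(2)] by (auto simp: indicator_def)
    qed (auto simp: indicator_def)
  qed
  have S2: "(\<integral>\<^sup>+a. \<integral>\<^sup>+b. ?t2 a b \<partial>exp1 \<partial>exp1)
      = (\<integral>\<^sup>+u. ennreal (h1 u * exp (- F1 u)) * indicator {0..} u * (G1 u * ennreal (exp (- F2 u))) \<partial>lborel)"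
  proof -
    have "(\<integral>\<^sup>+a. \<integral>\<^sup>+b. ?t2 a b \<partial>exp1 \<partial>exp1)
        = (\<integral>\<^sup>+a. (if X a < \<infinity> then G1 (RX a) * ennreal (exp (- F2 (RX a))) else 0) \<partial>exp1)"
    proof (intro nn_integral_cong)
      fix a
      have "(\<integral>\<^sup>+b. ?t2 a b \<partial>exp1)
         = (if X a < \<infinity> then G1 (RX a) else 0) * emeasure exp1 {b. Y b = \<infinity> \<or> ereal (RX a) < Y b}"
        by (subst nn_integral_cmult_indicator) auto
      then show "(\<integral>\<^sup>+b. ?t2 a b \<partial>exp1)
         = (if X a < \<infinity> then G1 (RX a) * ennreal (exp (- F2 (RX a))) else 0)"
        using RX(2)[of a] B.emeasure_less_hit[OF e z2, of "RX a"] by (auto simp: Y_def F2_def)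
    qed
    also have "\<dots> = (\<integral>\<^sup>+u. ennreal (h1 u * exp (- F1 u)) * indicator {0..} u * (G1 u * ennreal (exp (- F2 u))) \<partial>lborel)"
      unfolding X_def RX_def F1_def F2_def
      by (rule A.nn_integral_hit[OF e z1]) measurable
    finally show ?thesis .
  qed
  have S3: "(\<integral>\<^sup>+a. \<integral>\<^sup>+b. ?t3 a b \<partial>exp1 \<partial>exp1)
      = (\<integral>\<^sup>+u. ennreal (h2 u * exp (- F2 u)) * indicator {0..} u * (G2 u * ennreal (exp (- F1 u))) \<partial>lborel)"
  proof -
    have "(\<integral>\<^sup>+a. \<integral>\<^sup>+b. ?t3 a b \<partial>exp1 \<partial>exp1) = (\<integral>\<^sup>+b. \<integral>\<^sup>+a. ?t3 a b \<partial>exp1 \<partial>exp1)"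
      by (rule PP.Fubini'[symmetric]) (simp add: split_beta')
    also have "\<dots> = (\<integral>\<^sup>+b. (if Y b < \<infinity> then G2 (RY b) * ennreal (exp (- F1 (RY b))) else 0) \<partial>exp1)"
    proof (intro nn_integral_cong)
      fix b
      have "(\<integral>\<^sup>+a. ?t3 a b \<partial>exp1)
         = (if Y b < \<infinity> then G2 (RY b) else 0) * emeasure exp1 {a. ereal (RY b) \<le> X a}"
        by (subst nn_integral_cmult_indicator) auto
      then show "(\<integral>\<^sup>+a. ?t3 a b \<partial>exp1)
         = (if Y b < \<infinity> then G2 (RY b) * ennreal (exp (- F1 (RY b))) else 0)"
        using RY(2)[of b] A.emeasure_le_hit[OF e z1, of "RY b"] by (auto simp: X_def F1_def)
    qed
    also have "\<dots> = (\<integral>\<^sup>+u. ennreal (h2 u * exp (- F2 u)) * indicator {0..} u * (G2 u * ennreal (exp (- F1 u))) \<partial>lborel)"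
      unfolding Y_def RY_def F1_def F2_def
      by (rule B.nn_integral_hit[OF e z2]) measurable
    finally show ?thesis .
  qed
  have S1: "(\<integral>\<^sup>+a. \<integral>\<^sup>+b. ?t1 a b \<partial>exp1 \<partial>exp1) = ennreal (exp (- (F1 e + F2 e))) * G0"
  proof -
    have 1: "emeasure exp1 {a. X a = \<infinity>} = ennreal (exp (- F1 e))"
      using A.emeasure_hit_infinite[OF e z1] by (simp add: X_def F1_def)
    have 2: "emeasure exp1 {a. Y a = \<infinity>} = ennreal (exp (- F2 e))"
      using B.emeasure_hit_infinite[OF e z2] by (simp add: Y_def F2_def)
    have "(\<integral>\<^sup>+a. \<integral>\<^sup>+b. ?t1 a b \<partial>exp1 \<partial>exp1)
        = (\<integral>\<^sup>+a. indicator {a. X a = \<infinity>} a * (\<integral>\<^sup>+b. indicator {b. Y b = \<infinity>} b * G0 \<partial>exp1) \<partial>exp1)"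
      by (intro nn_integral_cong nn_integral_cmult) simp
    also have "\<dots> = emeasure exp1 {a. X a = \<infinity>} * (emeasure exp1 {b. Y b = \<infinity>} * G0)"
      by (simp add: nn_integral_multc)
    also have "\<dots> = ennreal (exp (- F1 e) * exp (- F2 e)) * G0"
      unfolding 1 2 by (simp add: ennreal_mult mult.assoc)
    finally show ?thesis by (simp add: exp_add[symmetric])
  qed
  have "(\<integral>\<^sup>+a. \<integral>\<^sup>+b. (if X a = \<infinity> \<and> Y b = \<infinity> then G0 else if X a < Y b then G1 (RX a) else G2 (RY b)) \<partial>exp1 \<partial>exp1)
     = (\<integral>\<^sup>+a. \<integral>\<^sup>+b. ?t1 a b \<partial>exp1 \<partial>exp1) + (\<integral>\<^sup>+a. \<integral>\<^sup>+b. ?t2 a b \<partial>exp1 \<partial>exp1)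
       + (\<integral>\<^sup>+a. \<integral>\<^sup>+b. ?t3 a b \<partial>exp1 \<partial>exp1)"
    unfolding split by (simp add: nn_integral_add)
  also have "\<dots> = ennreal (exp (- (F1 e + F2 e))) * G0 +
    ((\<integral>\<^sup>+u. ennreal (h1 u * exp (- F1 u)) * indicator {0..} u * (G1 u * ennreal (exp (- F2 u))) \<partial>lborel) +
     (\<integral>\<^sup>+u. ennreal (h2 u * exp (- F2 u)) * indicator {0..} u * (G2 u * ennreal (exp (- F1 u))) \<partial>lborel))"
    unfolding S1 S2 S3 by (simp add: add.assoc)
  also have "(\<integral>\<^sup>+u. ennreal (h1 u * exp (- F1 u)) * indicator {0..} u * (G1 u * ennreal (exp (- F2 u))) \<partial>lborel) +
     (\<integral>\<^sup>+u. ennreal (h2 u * exp (- F2 u)) * indicator {0..} u * (G2 u * ennreal (exp (- F1 u))) \<partial>lborel)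
    = (\<integral>\<^sup>+u. indicator {0..} u * ennreal (exp (- (F1 u + F2 u))) *
             (ennreal (h1 u) * G1 u + ennreal (h2 u) * G2 u) \<partial>lborel)"
  proof -
    have E: "ennreal (exp (- (p + q))) = ennreal (exp (- p)) * ennreal (exp (- q))" for p q
      by (simp add: ennreal_mult[symmetric] exp_add[symmetric])
    have *: "ennreal (h1 u * exp (- F1 u)) * indicator {0..} u * (G1 u * ennreal (exp (- F2 u))) +
        ennreal (h2 u * exp (- F2 u)) * indicator {0..} u * (G2 u * ennreal (exp (- F1 u)))
      = indicator {0..} u * ennreal (exp (- (F1 u + F2 u))) * (ennreal (h1 u) * G1 u + ennreal (h2 u) * G2 u)" for u
      unfolding E ennreal_mult[OF A.h_nonneg exp_ge_zero] ennreal_mult[OF B.h_nonneg exp_ge_zero]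
      by (simp only: distrib_left mult.assoc mult.commute mult.left_commute)
    have [measurable]: "F1 \<in> borel_measurable borel" "F2 \<in> borel_measurable borel"
      unfolding F1_def F2_def by measurable
    show ?thesis unfolding *[symmetric] by (rule nn_integral_add[symmetric]) measurable
  qed
  finally show ?thesis unfolding X_def Y_def RX_def RY_def .
qed

section \<open>The law of a life\<close>

definition flow :: "config \<Rightarrow> real \<Rightarrow> config" where
  "flow x u = (fst x + u *\<^sub>R snd x, snd x)"

lemma flow_0 [simp]: "flow x 0 = x"
  by (simp add: flow_def)

lemma measurable_flow [measurable (raw)]:
  assumes [measurable]: "f \<in> borel_measurable P" "g \<in> borel_measurable P"
  shows "(\<lambda>p. flow (f p) (g p)) \<in> borel_measurable P"
proof -
  have f: "f \<in> measurable P (borel \<Otimes>\<^sub>M borel)" using assms(1) by (simp add: borel_prod)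
  have [measurable]: "(\<lambda>p. fst (f p)) \<in> borel_measurable P" "(\<lambda>p. snd (f p)) \<in> borel_measurable P"
    using measurable_compose[OF f measurable_fst] measurable_compose[OF f measurable_snd] by auto
  show ?thesis unfolding flow_def borel_prod[symmetric] by measurable
qed

text \<open>The bounds whose existence the setting asserts become parameters, because the constants
  of the exponential moment are built from them.\<close>

locale nbp =
  fixes M :: nbp_model and cb :: real and nmax :: nat
  assumes setting: "nbp_setting M"
    and bounded_data: "\<And>r v. r \<in> dom_D M \<Longrightarrow> v \<in> vel_V M \<Longrightarrow>
       sigma_s M r v \<in> {0..cb} \<and> sigma_f M r v \<in> {0..cb} \<and>
       (\<forall>w\<in>vel_V M. pi_s M r v w \<in> {0..cb} \<and> pi_f M r v w \<in> {0..cb})"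
    and nmax: "1 < nmax"
    and nmax_bound: "\<And>r v. r \<in> dom_D M \<Longrightarrow> v \<in> vel_V M \<Longrightarrow> AE ws in fission_law M r v. length ws \<le> nmax"
begin

lemma dom_D: "open (dom_D M)" "bounded (dom_D M)" "convex (dom_D M)"
  using setting by (auto simp: nbp_setting_def)

lemma v_min_pos: "0 < v_min M"
  using setting by (auto simp: nbp_setting_def)

lemma vel_V_closed: "closed (vel_V M)"
proof -
  have "vel_V M = norm -` {v_min M..v_max M}" by (auto simp: vel_V_def)
  then show ?thesis by (simp add: closed_vimage continuous_on_norm_id)
qed

lemma vel_V_meas [measurable]: "vel_V M \<in> sets borel"
  using vel_V_closed by simp

lemma vel_V_nonzero: "v \<in> vel_V M \<Longrightarrow> v \<noteq> 0"
  using v_min_pos by (auto simp: vel_V_def)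

lemma phase_meas [measurable]: "phase M \<in> sets borel"
  unfolding phase_def borel_prod[symmetric] using dom_D by (intro pair_measureI) auto

lemma emeasure_phase: "emeasure lborel (phase M) < \<infinity>"
proof (rule emeasure_bounded_finite)
  have "bounded (vel_V M)" by (auto simp: bounded_iff vel_V_def)
  then show "bounded (phase M)" using dom_D by (simp add: phase_def bounded_Times)
qed

lemma phase_iff: "x \<in> phase M \<longleftrightarrow> fst x \<in> dom_D M \<and> snd x \<in> vel_V M"
  by (cases x) (auto simp: phase_def)

definition exit_at :: "config \<Rightarrow> real" where
  "exit_at x = exit_time M (fst x) (snd x)"

lemma leaves:
  assumes "v \<noteq> 0"
  shows "\<exists>t\<ge>0. r + t *\<^sub>R v \<notin> dom_D M"
proof -
  obtain B where B: "\<And>x. x \<in> dom_D M \<Longrightarrow> norm x \<le> B" using dom_D(2) by (auto simp: bounded_iff)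
  define t where "t = (\<bar>B\<bar> + norm r + 1) / norm v"
  have "norm (t *\<^sub>R v) = \<bar>B\<bar> + norm r + 1" using assms by (simp add: t_def)
  then have "norm (r + t *\<^sub>R v) \<ge> \<bar>B\<bar> + 1"
    using norm_triangle_ineq2[of "t *\<^sub>R v" "- r"] by (simp add: add.commute)
  then have "r + t *\<^sub>R v \<notin> dom_D M" using B by fastforce
  moreover have "0 \<le> t" by (simp add: t_def)
  ultimately show ?thesis by auto
qed

text \<open>Convexity makes the times spent in D an interval that starts at 0, and openness excludes
  its right end point. Since D is bounded and the velocity is nonzero, the set in the definition of
  the exit time is nonempty, so its infimum is meaningful.\<close>

lemma less_exit_iff:
  assumes x: "x \<in> phase M" and t: "0 \<le> t"
  shows "t < exit_at x \<longleftrightarrow> flow x t \<in> phase M"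
proof -
  obtain r v where xr: "x = (r, v)" by (cases x)
  let ?S = "{t. 0 \<le> t \<and> r + t *\<^sub>R v \<notin> dom_D M}"
  have r: "r \<in> dom_D M" and v: "v \<in> vel_V M" using x by (auto simp: xr phase_def)
  have ne: "?S \<noteq> {}" using leaves[OF vel_V_nonzero[OF v], of r] by auto
  have bdd: "bdd_below ?S" by (auto intro!: bdd_belowI[of _ 0])
  have ex: "exit_at x = Inf ?S" by (simp add: exit_at_def exit_time_def xr)
  have conv: "r + s *\<^sub>R v \<in> dom_D M" if "r + u *\<^sub>R v \<in> dom_D M" "0 \<le> s" "s \<le> u" for s u
  proof (cases "u = 0")
    case False
    then have "0 < u" using that by simp
    have "(1 - s / u) *\<^sub>R r + (s / u) *\<^sub>R (r + u *\<^sub>R v) \<in> dom_D M"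
      using dom_D(3) r that \<open>0 < u\<close> by (intro convexD) (auto simp: field_simps)
    also have "(1 - s / u) *\<^sub>R r + (s / u) *\<^sub>R (r + u *\<^sub>R v) = r + s *\<^sub>R v"
      using \<open>0 < u\<close> by (simp add: algebra_simps)
    finally show ?thesis .
  qed (use r that in auto)
  have "t < Inf ?S \<longleftrightarrow> r + t *\<^sub>R v \<in> dom_D M"
  proof
    assume "t < Inf ?S"
    then have "t \<notin> ?S" using cInf_lower[OF _ bdd, of t] by auto
    then show "r + t *\<^sub>R v \<in> dom_D M" using t by auto
  next
    assume *: "r + t *\<^sub>R v \<in> dom_D M"
    have "open ((\<lambda>u. r + u *\<^sub>R v) -` dom_D M)"
      by (intro open_vimage dom_D continuous_intros)
    then obtain d where d: "0 < d" "ball t d \<subseteq> (\<lambda>u. r + u *\<^sub>R v) -` dom_D M"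
      using * unfolding open_contains_ball by force
    then have "t + d / 2 \<in> (\<lambda>u. r + u *\<^sub>R v) -` dom_D M"
      by (intro subsetD[OF d(2)]) (auto simp: dist_real_def)
    then have "r + (t + d / 2) *\<^sub>R v \<in> dom_D M" by simp
    then have "t + d / 2 \<le> Inf ?S"
      using conv[of "t + d / 2"] by (intro cInf_greatest[OF ne]) force
    then show "t < Inf ?S" using d by simp
  qed
  then show ?thesis unfolding ex using v by (auto simp: flow_def phase_def xr)
qed

lemma exit_pos: "x \<in> phase M \<Longrightarrow> 0 < exit_at x"
  using less_exit_iff[of x 0] by simp

lemma exit_at_meas [measurable]: "(\<lambda>x. if x \<in> phase M then exit_at x else 0) \<in> borel_measurable borel"
proof (rule borel_measurableI_greater)
  fix t :: real
  show "{x \<in> space borel. t < (if x \<in> phase M then exit_at x else 0)} \<in> sets borel"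
  proof (cases "0 \<le> t")
    case True
    then have "{x \<in> space borel. t < (if x \<in> phase M then exit_at x else 0)}
      = {x \<in> space borel. x \<in> phase M \<and> flow x t \<in> phase M}"
      using less_exit_iff by (auto split: if_splits)
    then show ?thesis by simp
  next
    case False
    then have "{x \<in> space borel. t < (if x \<in> phase M then exit_at x else 0)} = space borel"
      using exit_pos by (force split: if_splits)
    then show ?thesis by (simp only: sets.top)
  qed
qed

text \<open>With the value 0 outside the phase space, the accumulated rate is defined along the
  whole ray and constant after the exit, which the clock lemmas presuppose. By convexity the ray
  does not enter D again.\<close>

definition rate_s :: "config \<Rightarrow> real" where
  "rate_s x = (if x \<in> phase M then sigma_s M (fst x) (snd x) else 0)"

definition rate_f :: "config \<Rightarrow> real" where
  "rate_f x = (if x \<in> phase M then sigma_f M (fst x) (snd x) else 0)"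

lemma borel_measurable_extend:
  assumes "f \<in> borel_measurable (restrict_space borel (phase M))"
  shows "(\<lambda>x. if x \<in> phase M then f x else 0) \<in> borel_measurable borel"
  by (subst measurable_If_restrict_space_iff) (use assms in auto)

lemma rate_s_meas [measurable]: "rate_s \<in> borel_measurable borel"
  using borel_measurable_extend[of "\<lambda>(r, v). sigma_s M r v"] setting
  by (auto simp: nbp_setting_def rate_s_def[abs_def] phase_def split_beta' cong: if_cong)

lemma rate_f_meas [measurable]: "rate_f \<in> borel_measurable borel"
  using borel_measurable_extend[of "\<lambda>(r, v). sigma_f M r v"] setting
  by (auto simp: nbp_setting_def rate_f_def[abs_def] phase_def split_beta' cong: if_cong)

lemma rate_bounds: "0 \<le> rate_s x" "rate_s x \<le> cb" "0 \<le> rate_f x" "rate_f x \<le> cb" and cb_nonneg: "0 \<le> cb"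
proof -
  obtain r where r: "r \<in> dom_D M" using setting by (auto simp: nbp_setting_def)
  have "v_min M < v_max M" using setting by (auto simp: nbp_setting_def)
  then have "v_min M *\<^sub>R axis 1 1 \<in> vel_V M" using v_min_pos by (auto simp: vel_V_def norm_axis_1)
  with r show cb: "0 \<le> cb" using bounded_data[of r "v_min M *\<^sub>R axis 1 1"] by auto
  show "0 \<le> rate_s x" "rate_s x \<le> cb" "0 \<le> rate_f x" "rate_f x \<le> cb"
    using bounded_data[of "fst x" "snd x"] cb by (auto simp: rate_s_def rate_f_def phase_iff)
qed

lemma bounded_rate_flow:
  "bounded_rate (\<lambda>s. rate_s (flow x s)) cb" "bounded_rate (\<lambda>s. rate_f (flow x s)) cb"
  "bounded_rate (\<lambda>s. rate_s (flow x s) + rate_f (flow x s)) (2 * cb)"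
proof -
  have "rate_s (flow x s) + rate_f (flow x s) \<le> 2 * cb" for s
    using rate_bounds[of "flow x s"] by simp
  then show "bounded_rate (\<lambda>s. rate_s (flow x s)) cb" "bounded_rate (\<lambda>s. rate_f (flow x s)) cb"
    "bounded_rate (\<lambda>s. rate_s (flow x s) + rate_f (flow x s)) (2 * cb)"
    using rate_bounds by (auto simp: bounded_rate_def)
qed

lemma rate_after_exit:
  assumes "x \<in> phase M" "exit_at x \<le> s"
  shows "rate_s (flow x s) = 0" "rate_f (flow x s) = 0"
  using assms exit_pos[of x] less_exit_iff[of x s] by (auto simp: rate_s_def rate_f_def)

definition cum_s :: "config \<Rightarrow> real \<Rightarrow> real" where
  "cum_s x = bounded_rate.F (\<lambda>s. rate_s (flow x s))"

definition cum_f :: "config \<Rightarrow> real \<Rightarrow> real" where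
  "cum_f x = bounded_rate.F (\<lambda>s. rate_f (flow x s))"

lemma cum_eq: "cum_s x t = (LBINT s:{0..t}. rate_s (flow x s))" "cum_f x t = (LBINT s:{0..t}. rate_f (flow x s))"
  by (simp_all add: cum_s_def cum_f_def bounded_rate.F_def[OF bounded_rate_flow(1)] bounded_rate.F_def[OF bounded_rate_flow(2)])

lemma cum_mono: "mono (cum_s x)" "mono (cum_f x)"
  by (simp_all add: cum_s_def cum_f_def bounded_rate.mono_F[OF bounded_rate_flow(1)] bounded_rate.mono_F[OF bounded_rate_flow(2)])

lemma cum_meas [measurable]:
  "(\<lambda>(x, t). cum_s x t) \<in> borel_measurable (borel \<Otimes>\<^sub>M borel)"
  "(\<lambda>(x, t). cum_f x t) \<in> borel_measurable (borel \<Otimes>\<^sub>M borel)"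
proof -
  have "(\<lambda>(x, t). \<integral>s. (if 0 \<le> s \<and> s \<le> t then rate_s (flow x s) else 0) \<partial>lborel) \<in> borel_measurable (borel \<Otimes>\<^sub>M borel)"
    by measurable
  also have "(\<lambda>(x, t). \<integral>s. (if 0 \<le> s \<and> s \<le> t then rate_s (flow x s) else 0) \<partial>lborel) = (\<lambda>(x, t). cum_s x t)"
    by (auto simp: cum_eq set_lebesgue_integral_def intro!: Bochner_Integration.integral_cong)
  finally show "(\<lambda>(x, t). cum_s x t) \<in> borel_measurable (borel \<Otimes>\<^sub>M borel)" .
  have "(\<lambda>(x, t). \<integral>s. (if 0 \<le> s \<and> s \<le> t then rate_f (flow x s) else 0) \<partial>lborel) \<in> borel_measurable (borel \<Otimes>\<^sub>M borel)"
    by measurable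
  also have "(\<lambda>(x, t). \<integral>s. (if 0 \<le> s \<and> s \<le> t then rate_f (flow x s) else 0) \<partial>lborel) = (\<lambda>(x, t). cum_f x t)"
    by (auto simp: cum_eq set_lebesgue_integral_def intro!: Bochner_Integration.integral_cong)
  finally show "(\<lambda>(x, t). cum_f x t) \<in> borel_measurable (borel \<Otimes>\<^sub>M borel)" .
qed

lemma clock_eq:
  assumes x: "x \<in> phase M"
  shows "clock M (sigma_s M) (fst x) (snd x) a = hit (cum_s x) (exit_at x) a"
    "clock M (sigma_f M) (fst x) (snd x) a = hit (cum_f x) (exit_at x) a"
proof -
  have *: "flow x s \<in> phase M" if "0 \<le> s" "s \<le> t" "t < exit_at x" for s t
    using less_exit_iff[OF x, of s] that by simp
  have "(LBINT s:{0..t}. sigma_s M (fst x + s *\<^sub>R snd x) (snd x)) = cum_s x t" if "t < exit_at x" for t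
    unfolding cum_eq by (intro set_lebesgue_integral_cong) (use *[of _ t] that in \<open>auto simp: rate_s_def flow_def\<close>)
  then show "clock M (sigma_s M) (fst x) (snd x) a = hit (cum_s x) (exit_at x) a"
    unfolding clock_def hit_def exit_at_def[symmetric] by (auto intro!: arg_cong[where f=Inf] image_cong)
  have "(LBINT s:{0..t}. sigma_f M (fst x + s *\<^sub>R snd x) (snd x)) = cum_f x t" if "t < exit_at x" for t
    unfolding cum_eq by (intro set_lebesgue_integral_cong) (use *[of _ t] that in \<open>auto simp: rate_f_def flow_def\<close>)
  then show "clock M (sigma_f M) (fst x) (snd x) a = hit (cum_f x) (exit_at x) a"
    unfolding clock_def hit_def exit_at_def[symmetric] by (auto intro!: arg_cong[where f=Inf] image_cong)
qed

definition dens_s :: "config \<Rightarrow> r3 \<Rightarrow> real" where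
  "dens_s x w = (if x \<in> phase M \<and> w \<in> vel_V M then pi_s M (fst x) (snd x) w else 0)"

lemma dens_s_meas [measurable]: "(\<lambda>(x, w). dens_s x w) \<in> borel_measurable (borel \<Otimes>\<^sub>M borel)"
proof -
  let ?S = "dom_D M \<times> vel_V M \<times> vel_V M"
  have S: "?S \<in> sets borel"
    unfolding borel_prod[symmetric] using dom_D by (intro pair_measureI) auto
  have "(\<lambda>y. if y \<in> ?S then (\<lambda>(r, v, w). pi_s M r v w) y else 0) \<in> borel_measurable borel"
    using setting S by (subst measurable_If_restrict_space_iff) (auto simp: nbp_setting_def)
  then have "(\<lambda>y. if y \<in> ?S then (\<lambda>(r, v, w). pi_s M r v w) y else 0) \<in> borel_measurable (borel \<Otimes>\<^sub>M borel \<Otimes>\<^sub>M borel)"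
    by (simp add: borel_prod)
  from measurable_compose[OF _ this, of "\<lambda>((r, v), w). (r, v, w)" "(borel \<Otimes>\<^sub>M borel) \<Otimes>\<^sub>M borel"]
  have "(\<lambda>z. (\<lambda>y. if y \<in> ?S then (\<lambda>(r, v, w). pi_s M r v w) y else 0) ((\<lambda>((r, v), w). (r, v, w)) z))
    \<in> borel_measurable ((borel \<Otimes>\<^sub>M borel) \<Otimes>\<^sub>M borel)"
    by (simp add: split_beta')
  then have "(\<lambda>z. (\<lambda>y. if y \<in> ?S then (\<lambda>(r, v, w). pi_s M r v w) y else 0) ((\<lambda>((r, v), w). (r, v, w)) z))
    \<in> borel_measurable (borel \<Otimes>\<^sub>M borel)" by (simp add: borel_prod)
  moreover have "(\<lambda>z. (\<lambda>y. if y \<in> ?S then (\<lambda>(r, v, w). pi_s M r v w) y else 0) ((\<lambda>((r, v), w). (r, v, w)) z))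
    = (\<lambda>(x, w). dens_s x w)"
    by (auto simp: dens_s_def phase_def fun_eq_iff)
  ultimately show ?thesis by simp
qed

lemma dens_s_nonneg: "0 \<le> dens_s x w"
  using bounded_data[of "fst x" "snd x"] by (auto simp: dens_s_def phase_iff)

lemma nn_integral_dens_s:
  assumes x: "x \<in> phase M"
  shows "(\<integral>\<^sup>+w. ennreal (dens_s x w) \<partial>lborel) = 1"
proof -
  have "(LINT w:vel_V M|lborel. pi_s M (fst x) (snd x) w) = 1"
    using setting x by (auto simp: nbp_setting_def phase_iff)
  then have *: "(\<integral>w. dens_s x w \<partial>lborel) = 1"
    using x by (auto simp: set_lebesgue_integral_def dens_s_def indicator_def if_distrib cong: if_cong
        intro!: Bochner_Integration.integral_cong elim!: back_subst[of "\<lambda>a. a = 1"])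
  then have "integrable lborel (dens_s x)"
    using not_integrable_integral_eq[of lborel "dens_s x"] by auto
  then show ?thesis using * by (subst nn_integral_eq_integral) (auto simp: dens_s_nonneg)
qed

text \<open>The point mass outside the phase space is a dummy: it makes this a probability kernel on
  the whole space, so that later maps are defined and measurable everywhere.\<close>

definition scatter_law :: "config \<Rightarrow> r3 measure" where
  "scatter_law x = (if x \<in> phase M then density lborel (\<lambda>w. ennreal (dens_s x w)) else return borel 0)"

lemma scatter_law_kernel [measurable]: "scatter_law \<in> measurable borel (prob_algebra borel)"
proof (rule measurable_prob_algebraI)
  have *: "prob_space (density lborel (\<lambda>w. ennreal (dens_s x w)))" if "x \<in> phase M" for x
    by (rule prob_spaceI) (use nn_integral_dens_s[OF that] in \<open>simp add: emeasure_density\<close>)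
  show "prob_space (scatter_law x)" for x
    using * by (auto simp: scatter_law_def intro!: prob_space_return)
  show "scatter_law \<in> measurable borel (subprob_algebra borel)"
    unfolding scatter_law_def[abs_def]
  proof (subst measurable_If_restrict_space_iff, safe)
    show "(\<lambda>x. density lborel (\<lambda>w. ennreal (dens_s x w)))
       \<in> restrict_space borel {x. x \<in> phase M} \<rightarrow>\<^sub>M subprob_algebra borel"
    proof (rule measurable_subprob_algebra)
      fix A :: "r3 set" assume [measurable]: "A \<in> sets borel"
      have "(\<lambda>x. \<integral>\<^sup>+w. ennreal (dens_s x w) * indicator A w \<partial>lborel) \<in> borel_measurable borel"
        by measurable
      then show "(\<lambda>x. emeasure (density lborel (\<lambda>w. ennreal (dens_s x w))) A)
        \<in> borel_measurable (restrict_space borel {x. x \<in> phase M})"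
        by (intro measurable_restrict_space1) (simp add: emeasure_density)
    qed (use * in \<open>auto simp: space_restrict_space intro: prob_space_imp_subprob_space\<close>)
  qed auto
qed

text \<open>The fission law lives on lists of velocities in V. Its image on lists over all of R^3
  carries the \<sigma>-algebra that \<open>life\<close> prescribes for the second component.\<close>

definition offspring_law :: "config \<Rightarrow> r3 list measure" where
  "offspring_law x = (if x \<in> phase M then distr (fission_law M (fst x) (snd x)) (list_space borel) (\<lambda>ws. ws)
     else return (list_space borel) [])"

lemma fission_law_kernel:
  "(\<lambda>x. fission_law M (fst x) (snd x)) \<in> measurable (restrict_space borel (phase M))
     (subprob_algebra (list_space (restrict_space borel (vel_V M))))"
  using setting by (simp add: nbp_setting_def phase_def split_beta')

lemma sets_fission_law: "x \<in> phase M \<Longrightarrow>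
  sets (fission_law M (fst x) (snd x)) = sets (list_space (restrict_space borel (vel_V M)))"
  using fission_law_kernel by (intro sets_kernel[OF fission_law_kernel]) (simp add: space_restrict_space)

lemma measurable_vel_lists: "(\<lambda>ws. ws) \<in> measurable (list_space (restrict_space borel (vel_V M))) (list_space borel)"
  by (intro measurable_list_space_subset measurable_restrict_space1) simp

lemma measurable_fission_law_ident:
  "x \<in> phase M \<Longrightarrow> (\<lambda>ws. ws) \<in> measurable (fission_law M (fst x) (snd x)) (list_space borel)"
  using measurable_vel_lists measurable_cong_sets[OF sets_fission_law refl] by blast

lemma prob_space_fission_law: "x \<in> phase M \<Longrightarrow> prob_space (fission_law M (fst x) (snd x))"
  using setting by (auto simp: nbp_setting_def phase_iff)

lemma offspring_law_kernel [measurable]: "offspring_law \<in> measurable borel (prob_algebra (list_space borel))"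
proof (rule measurable_prob_algebraI)
  show "prob_space (offspring_law x)" for x
    by (auto simp: offspring_law_def intro!: prob_space_return prob_space.prob_space_distr
       prob_space_fission_law measurable_fission_law_ident)
  show "offspring_law \<in> measurable borel (subprob_algebra (list_space borel))"
    unfolding offspring_law_def[abs_def]
  proof (subst measurable_If_restrict_space_iff, safe)
    show "(\<lambda>x. distr (fission_law M (fst x) (snd x)) (list_space borel) (\<lambda>ws. ws))
       \<in> restrict_space borel {x. x \<in> phase M} \<rightarrow>\<^sub>M subprob_algebra (list_space borel)"
      using measurable_compose[OF fission_law_kernel measurable_distr[OF measurable_vel_lists]]
      by simp
  qed auto
qed

lemma AE_offspring_law:
  assumes x: "x \<in> phase M"
  shows "AE ws in offspring_law x. length ws \<le> nmax \<and> set ws \<subseteq> vel_V M"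
proof -
  have S: "space (fission_law M (fst x) (snd x)) = lists (vel_V M)"
    using sets_eq_imp_space_eq[OF sets_fission_law[OF x]] by (simp add: space_restrict_space)
  have *: "{ws. length ws \<le> nmax \<and> set ws \<subseteq> vel_V M} = (\<Union>n\<le>nmax. listset (replicate n (vel_V M)))"
    by (auto simp: listset_replicate)
  have "{ws. length ws \<le> nmax \<and> set ws \<subseteq> vel_V M} \<in> sets (list_space borel)"
    unfolding * by (intro sets.finite_UN) (auto intro!: listset_in_sets_list_space)
  then have m: "Measurable.pred (list_space borel) (\<lambda>ws. length ws \<le> nmax \<and> set ws \<subseteq> vel_V M)"
    by (simp add: pred_def)
  have "AE ws in fission_law M (fst x) (snd x). length ws \<le> nmax \<and> set ws \<subseteq> vel_V M"
    using nmax_bound[of "fst x" "snd x"] x AE_space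
    by (auto simp: phase_iff S elim!: AE_mp intro!: AE_I2)
  then have "AE ws in distr (fission_law M (fst x) (snd x)) (list_space borel) (\<lambda>ws. ws).
      length ws \<le> nmax \<and> set ws \<subseteq> vel_V M"
    using m by (subst AE_distr_iff[OF measurable_fission_law_ident[OF x]]) (simp_all only: pred_def)
  then show ?thesis using x by (simp only: offspring_law_def if_True)
qed

abbreviation life_space :: "(real \<times> r3 list) measure" where
  "life_space \<equiv> borel \<Otimes>\<^sub>M list_space borel"

definition exit_ext :: "config \<Rightarrow> real" where
  "exit_ext x = (if x \<in> phase M then exit_at x else 0)"

lemma exit_ext_meas [measurable]: "exit_ext \<in> borel_measurable borel"
  using exit_at_meas by (simp add: exit_ext_def[abs_def])

text \<open>The body of \<open>life\<close> with the extended data in place of the given ones. It is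
  jointly measurable in (x, a, b) on the whole space, whereas the original data are only controlled
  on the phase space.\<close>

definition life_kernel :: "config \<Rightarrow> real \<Rightarrow> real \<Rightarrow> (real \<times> r3 list) measure" where
  "life_kernel x a b =
    (if hit (cum_s x) (exit_ext x) a = \<infinity> \<and> hit (cum_f x) (exit_ext x) b = \<infinity>
     then return life_space (exit_ext x, [])
     else if hit (cum_s x) (exit_ext x) a < hit (cum_f x) (exit_ext x) b
     then distr (scatter_law (flow x (real_of_ereal (hit (cum_s x) (exit_ext x) a)))) life_space
            (\<lambda>w. (real_of_ereal (hit (cum_s x) (exit_ext x) a), [w]))
     else distr (offspring_law (flow x (real_of_ereal (hit (cum_f x) (exit_ext x) b)))) life_space
            (\<lambda>ws. (real_of_ereal (hit (cum_f x) (exit_ext x) b), ws)))"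

lemma hit_cum_meas [measurable]:
  "(\<lambda>(x, a). hit (cum_s x) (exit_ext x) a) \<in> borel_measurable (borel \<Otimes>\<^sub>M borel)"
  "(\<lambda>(x, a). hit (cum_f x) (exit_ext x) a) \<in> borel_measurable (borel \<Otimes>\<^sub>M borel)"
  unfolding split_beta' by (intro measurable_hit; simp add: cum_mono)+

lemma life_kernel_meas [measurable]:
  "(\<lambda>(x, a, b). life_kernel x a b) \<in> measurable (borel \<Otimes>\<^sub>M borel \<Otimes>\<^sub>M borel) (prob_algebra life_space)"
  unfolding life_kernel_def by measurable

lemma life_eq:
  "life M x = (if x \<in> phase M then exp1 \<bind> (\<lambda>a. exp1 \<bind> (\<lambda>b. life_kernel x a b))
     else return life_space (0, []))"
proof (cases "x \<in> phase M")
  case True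
  obtain r v where xr: "x = (r, v)" by (cases x)
  have k: "life_kernel x a b = (let t_s = clock M (sigma_s M) r v a; t_f = clock M (sigma_f M) r v b
         in if t_s = \<infinity> \<and> t_f = \<infinity> then
              return (borel \<Otimes>\<^sub>M list_space borel) (exit_time M r v, [])
            else if t_s < t_f then
              let t = real_of_ereal t_s in
              distr (density lborel (\<lambda>w. indicator (vel_V M) w * pi_s M (r + t *\<^sub>R v) v w))
                (borel \<Otimes>\<^sub>M list_space borel) (\<lambda>w. (t, [w]))
            else
              let t = real_of_ereal t_f in
              distr (fission_law M (r + t *\<^sub>R v) v)
                (borel \<Otimes>\<^sub>M list_space borel) (\<lambda>ws. (t, ws)))" for a b
  proof -
    define ts where "ts = hit (cum_s x) (exit_at x) a"
    define tf where "tf = hit (cum_f x) (exit_at x) b"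
    interpret A: bounded_rate "\<lambda>s. rate_s (flow x s)" cb by (rule bounded_rate_flow)
    interpret B: bounded_rate "\<lambda>s. rate_f (flow x s)" cb by (rule bounded_rate_flow)
    have cl: "clock M (sigma_s M) r v a = ts" "clock M (sigma_f M) r v b = tf"
      using clock_eq[OF True] by (auto simp: xr ts_def tf_def)
    \<comment> \<open>A clock that rings does so strictly before the exit. The event therefore
      happens in the phase space, where extended and given data agree.\<close>
    have ss: "flow x (real_of_ereal ts) \<in> phase M" if "ts < \<infinity>"
      using that less_exit_iff[OF True, of "real_of_ereal ts"] A.hit_real[of "exit_at x" a]
        A.hit_nonneg[of "exit_at x" a] A.hit_finite_less[of "exit_at x" a]
      by (auto simp: ts_def cum_s_def real_of_ereal_pos) (metis less_ereal.simps(1))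
    have ff: "flow x (real_of_ereal tf) \<in> phase M" if "tf < \<infinity>"
      using that less_exit_iff[OF True, of "real_of_ereal tf"] B.hit_real[of "exit_at x" b]
        B.hit_nonneg[of "exit_at x" b] B.hit_finite_less[of "exit_at x" b]
      by (auto simp: tf_def cum_f_def real_of_ereal_pos) (metis less_ereal.simps(1))
    have ss': "scatter_law (flow x (real_of_ereal ts))
       = density lborel (\<lambda>w. indicator (vel_V M) w * pi_s M (r + real_of_ereal ts *\<^sub>R v) v w)" if "ts < \<infinity>"
    proof -
      have "(\<lambda>w. ennreal (dens_s (flow x (real_of_ereal ts)) w))
        = (\<lambda>w. ennreal (indicator (vel_V M) w * pi_s M (r + real_of_ereal ts *\<^sub>R v) v w))"
        using ss[OF that] by (auto simp: dens_s_def flow_def xr fun_eq_iff indicator_def)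
      then show ?thesis using ss[OF that] by (simp add: scatter_law_def)
    qed
    have ff': "distr (offspring_law (flow x (real_of_ereal tf))) life_space (\<lambda>ws. (real_of_ereal tf, ws))
       = distr (fission_law M (r + real_of_ereal tf *\<^sub>R v) v) life_space (\<lambda>ws. (real_of_ereal tf, ws))" if "tf < \<infinity>"
    proof -
      have "distr (distr (fission_law M (r + real_of_ereal tf *\<^sub>R v) v) (list_space borel) (\<lambda>ws. ws)) life_space (\<lambda>ws. (real_of_ereal tf, ws))
        = distr (fission_law M (r + real_of_ereal tf *\<^sub>R v) v) life_space (\<lambda>ws. (real_of_ereal tf, ws))"
        using measurable_fission_law_ident[OF ff[OF that]]
        by (subst distr_distr) (auto simp: comp_def flow_def xr)
      then show ?thesis using ff[OF that] by (simp add: offspring_law_def flow_def xr)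
    qed
    have lk: "life_kernel x a b = (if ts = \<infinity> \<and> tf = \<infinity> then return life_space (exit_at x, [])
       else if ts < tf then distr (scatter_law (flow x (real_of_ereal ts))) life_space (\<lambda>w. (real_of_ereal ts, [w]))
       else distr (offspring_law (flow x (real_of_ereal tf))) life_space (\<lambda>ws. (real_of_ereal tf, ws)))"
      by (simp only: life_kernel_def exit_ext_def True if_True ts_def tf_def)
    have ex: "exit_at x = exit_time M r v" by (simp add: exit_at_def xr)
    consider "ts = \<infinity>" "tf = \<infinity>" | "ts < tf" "\<not> (ts = \<infinity> \<and> tf = \<infinity>)" "ts < \<infinity>"
      | "\<not> ts < tf" "\<not> (ts = \<infinity> \<and> tf = \<infinity>)" "tf < \<infinity>"
      by (cases ts; cases tf) auto
    then show ?thesis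
    proof cases
      case 1
      then show ?thesis unfolding lk cl Let_def ex by (simp only: simp_thms if_True)
    next
      case 2
      show ?thesis unfolding lk cl Let_def if_not_P[OF 2(2)] if_P[OF 2(1)] ss'[OF 2(3)] ..
    next
      case 3
      show ?thesis unfolding lk cl Let_def if_not_P[OF 3(2)] if_not_P[OF 3(1)] ff'[OF 3(3)] ..
    qed
  qed
  show ?thesis unfolding life_def k using True by (simp add: xr)
qed (auto simp: life_def split: prod.split)

lemma life_kernel_meas' [measurable]:
  "(\<lambda>x. life_kernel (fst (fst x)) (snd (fst x)) (snd x))
    \<in> measurable ((borel \<Otimes>\<^sub>M borel) \<Otimes>\<^sub>M borel) (prob_algebra life_space)"
proof -
  have "(\<lambda>x. (fst (fst x), snd (fst x), snd x)) \<in> measurable ((borel \<Otimes>\<^sub>M borel) \<Otimes>\<^sub>M borel) (borel \<Otimes>\<^sub>M borel \<Otimes>\<^sub>M borel)"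
    by measurable
  from measurable_compose[OF this life_kernel_meas] show ?thesis by simp
qed

lemma life_dummy [measurable]: "return life_space (0, []) \<in> space (prob_algebra life_space)"
  by (auto simp: space_prob_algebra space_pair_measure intro!: prob_space_return)

lemma life_prob [measurable]: "life M \<in> measurable borel (prob_algebra life_space)"
proof -
  have [measurable]: "exp1 \<in> space (prob_algebra borel)"
    using prob_space_exp1 by (simp add: space_prob_algebra)
  have "(\<lambda>x. if x \<in> phase M then exp1 \<bind> (\<lambda>a. exp1 \<bind> (\<lambda>b. life_kernel x a b))
     else return life_space (0, [])) \<in> measurable borel (prob_algebra life_space)"
    using life_kernel_meas' life_dummy by measurable
  then show ?thesis using life_eq by presburger
qed

lemma prob_space_life: "prob_space (life M x)"
  using measurable_space[OF life_prob, of x] by (simp add: space_prob_algebra)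

lemma sets_life [measurable_cong]: "sets (life M x) = sets life_space"
  using measurable_space[OF life_prob, of x] by (simp add: space_prob_algebra)

definition cum :: "config \<Rightarrow> real \<Rightarrow> real" where
  "cum x t = cum_s x t + cum_f x t"

text \<open>The three ways to end a life appear separately: exit, scattering at time u, fission at
  time u. \<open>cum\<close> is the sum of the accumulated rates because the clocks are independent.
  The integral may run over all u \<ge> 0, as the rates vanish after the exit. The later
  expectations over one life are evaluated with this formula.\<close>

lemma nn_integral_life:
  assumes x: "x \<in> phase M" and [measurable]: "G \<in> borel_measurable life_space"
  shows "(\<integral>\<^sup>+l. G l \<partial>life M x) = ennreal (exp (- cum x (exit_at x))) * G (exit_at x, []) +
     (\<integral>\<^sup>+u. indicator {0..} u * ennreal (exp (- cum x u)) *
        (ennreal (rate_s (flow x u)) * (\<integral>\<^sup>+w. G (u, [w]) \<partial>scatter_law (flow x u)) +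
         ennreal (rate_f (flow x u)) * (\<integral>\<^sup>+ws. G (u, ws) \<partial>offspring_law (flow x u))) \<partial>lborel)"
proof -
  have e1: "exp1 \<in> space (prob_algebra borel)"
    using prob_space_exp1 by (simp add: space_prob_algebra)
  note [measurable] = e1
  have sk: "sets (scatter_law y) = sets borel" "sets (offspring_law y) = sets (list_space borel)" for y
    using measurable_space[OF scatter_law_kernel, of y] measurable_space[OF offspring_law_kernel, of y]
    by (auto simp: space_prob_algebra)
  note [measurable_cong] = sk
  define G1 where "G1 u = (\<integral>\<^sup>+w. G (u, [w]) \<partial>scatter_law (flow x u))" for u
  define G2 where "G2 u = (\<integral>\<^sup>+ws. G (u, ws) \<partial>offspring_law (flow x u))" for u
  have [measurable]: "scatter_law \<in> measurable borel (subprob_algebra borel)"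
    "offspring_law \<in> measurable borel (subprob_algebra (list_space borel))"
    by (auto intro: measurable_prob_algebraD)
  have [measurable]: "G1 \<in> borel_measurable borel" "G2 \<in> borel_measurable borel"
    unfolding G1_def[abs_def] G2_def[abs_def]
    by (rule nn_integral_measurable_subprob_algebra2[where N=borel]; measurable)
       (rule nn_integral_measurable_subprob_algebra2[where N="list_space borel"]; measurable)
  have m2: "(\<lambda>b. life_kernel x a b) \<in> measurable borel (subprob_algebra life_space)" for a
  proof -
    have "(\<lambda>b. (\<lambda>(x, a, b). life_kernel x a b) (x, a, b)) \<in> measurable borel (prob_algebra life_space)"
      by measurable
    then show ?thesis by (auto intro: measurable_prob_algebraD)
  qed
  have m1: "(\<lambda>a. exp1 \<bind> (\<lambda>b. life_kernel x a b)) \<in> measurable borel (subprob_algebra life_space)"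
  proof -
    have "(\<lambda>a. exp1 \<bind> (\<lambda>b. (\<lambda>(x, a, b). life_kernel x a b) (x, a, b))) \<in> measurable borel (prob_algebra life_space)"
      by measurable
    then show ?thesis by (auto intro: measurable_prob_algebraD)
  qed
  have k: "(\<integral>\<^sup>+l. G l \<partial>life_kernel x a b) =
    (if hit (cum_s x) (exit_at x) a = \<infinity> \<and> hit (cum_f x) (exit_at x) b = \<infinity> then G (exit_at x, [])
     else if hit (cum_s x) (exit_at x) a < hit (cum_f x) (exit_at x) b
       then G1 (real_of_ereal (hit (cum_s x) (exit_at x) a))
     else G2 (real_of_ereal (hit (cum_f x) (exit_at x) b)))" for a b
    unfolding life_kernel_def G1_def G2_def using x
    by (auto simp: exit_ext_def nn_integral_return nn_integral_distr space_pair_measure sk)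
  have "(\<integral>\<^sup>+l. G l \<partial>life M x) = (\<integral>\<^sup>+a. \<integral>\<^sup>+l. G l \<partial>(exp1 \<bind> (\<lambda>b. life_kernel x a b)) \<partial>exp1)"
    unfolding life_eq using x m1 by (simp, subst nn_integral_bind[where B=life_space]) auto
  also have "\<dots> = (\<integral>\<^sup>+a. \<integral>\<^sup>+b. \<integral>\<^sup>+l. G l \<partial>life_kernel x a b \<partial>exp1 \<partial>exp1)"
    using m2 by (intro nn_integral_cong, subst nn_integral_bind[where B=life_space]) auto
  also have "\<dots> = ennreal (exp (- (cum_s x (exit_at x) + cum_f x (exit_at x)))) * G (exit_at x, []) +
         (\<integral>\<^sup>+u. indicator {0..} u * ennreal (exp (- (cum_s x u + cum_f x u))) *
             (ennreal (rate_s (flow x u)) * G1 u + ennreal (rate_f (flow x u)) * G2 u) \<partial>lborel)"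
    unfolding k cum_s_def cum_f_def
    by (rule nn_integral_two_clocks[OF bounded_rate_flow(1,2) exit_pos[OF x]])
       (use rate_after_exit[OF x] in auto)
  finally show ?thesis by (simp add: cum_def G1_def G2_def)
qed

end

section \<open>Measurability of births and of the passage to the next generation\<close>

lemma space_newborn_space [simp]: "space newborn_space = UNIV"
  by (simp add: newborn_space_def space_pair_measure)

lemma space_individual_space [simp]: "space individual_space = UNIV"
  by (simp add: individual_space_def space_pair_measure)

lemma children_eq:
  "children i = map (\<lambda>w. (fst (fst i) + fst (snd i), (fst (flow (snd (fst i)) (fst (snd i))), w))) (snd (snd i))"
  by (cases i rule: children.cases) (simp add: flow_def)

lemma measurable_individual_parts [measurable]:
  "(\<lambda>i. fst (fst i)) \<in> borel_measurable individual_space"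
  "(\<lambda>i. snd (fst i)) \<in> borel_measurable individual_space"
  "(\<lambda>i. fst (snd i)) \<in> borel_measurable individual_space"
  "(\<lambda>i. snd (snd i)) \<in> measurable individual_space (list_space borel)"
  "fst \<in> borel_measurable newborn_space"
  "snd \<in> borel_measurable newborn_space"
  unfolding individual_space_def newborn_space_def by measurable

lemma measurable_fst_config [measurable]: "fst \<in> (borel :: config measure) \<rightarrow>\<^sub>M borel"
  "snd \<in> (borel :: config measure) \<rightarrow>\<^sub>M borel"
  unfolding borel_prod[symmetric] by measurable

lemma measurable_newborn_Pair:
  assumes [measurable]: "b \<in> borel_measurable P" "r \<in> borel_measurable P" "v \<in> borel_measurable P"
  shows "(\<lambda>p. (b p, (r p, v p))) \<in> measurable P newborn_space"
  unfolding newborn_space_def borel_prod[symmetric] by measurable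

lemma measurable_individual_Pair [measurable (raw)]:
  assumes "x \<in> measurable P newborn_space" "l \<in> measurable P (borel \<Otimes>\<^sub>M list_space borel)"
  shows "(\<lambda>p. (x p, l p)) \<in> measurable P individual_space"
  unfolding individual_space_def using assms by measurable

lemma measurable_children [measurable]: "children \<in> measurable individual_space (list_space newborn_space)"
proof -
  have "(\<lambda>i. fst (flow (snd (fst i)) (fst (snd i)))) \<in> borel_measurable individual_space"
    by measurable
  then have "(\<lambda>i. map (\<lambda>w. (fst (fst i) + fst (snd i), (fst (flow (snd (fst i)) (fst (snd i))), w))) (snd (snd i)))
    \<in> measurable individual_space (list_space newborn_space)"
    by (intro measurable_map_list_space[where N=borel])
       (auto simp: split_beta' intro!: measurable_newborn_Pair)
  then show ?thesis by (simp add: children_eq[abs_def])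
qed

lemma measurable_next_generation [measurable (raw)]:
  assumes "f \<in> measurable P (list_space individual_space)"
  shows "(\<lambda>p. concat (map children (f p))) \<in> measurable P (list_space newborn_space)"
  using assms by (intro measurable_concat_map_list_space[where N=individual_space]) auto

lemma measurable_sum_list_space' [measurable (raw)]:
  fixes h :: "_ \<Rightarrow> ennreal"
  assumes [measurable]: "h \<in> borel_measurable N" and f: "f \<in> measurable P (list_space N)"
  shows "(\<lambda>p. sum_list (map h (f p))) \<in> borel_measurable P"
  by (rule measurable_sum_list_space[OF _ f]) measurable

lemma measurable_prod_list_space' [measurable (raw)]:
  fixes h :: "_ \<Rightarrow> ennreal"
  assumes [measurable]: "h \<in> borel_measurable N" and f: "f \<in> measurable P (list_space N)"
  shows "(\<lambda>p. prod_list (map h (f p))) \<in> borel_measurable P"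
  by (rule measurable_prod_list_space[OF _ f]) measurable

lemma measurable_cross_sum_list_space' [measurable (raw)]:
  fixes h :: "_ \<Rightarrow> ennreal"
  assumes [measurable]: "h \<in> borel_measurable N" and f: "f \<in> measurable P (list_space N)"
  shows "(\<lambda>p. cross_sum (map h (f p))) \<in> borel_measurable P"
  by (rule measurable_cross_sum_list_space[OF _ f]) measurable

lemma cross_sum_append:
  "cross_sum (xs @ ys) = cross_sum xs + 2 * sum_list xs * sum_list ys + cross_sum (ys :: 'a::comm_semiring_1 list)"
  by (induction xs) (simp_all add: algebra_simps)

section \<open>Generations of the family tree\<close>

text \<open>A statistic of the generations before n, updated one generation at a time from the
  initial value s. Sums and products over the first generations have this form.\<close>

primrec accum :: "('s \<Rightarrow> individual list \<Rightarrow> 's) \<Rightarrow> 's \<Rightarrow> nat \<Rightarrow> genealogy \<Rightarrow> 's" where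
  "accum U s 0 \<omega> = s"
| "accum U s (Suc n) \<omega> = U (accum U s n \<omega>) (\<omega> n)"

lemma accum_cong: "(\<And>i. i < n \<Longrightarrow> \<omega> i = \<omega>' i) \<Longrightarrow> accum U s n \<omega> = accum U s n \<omega>'"
  by (induction n) auto

lemma measurable_accum:
  assumes U: "(\<lambda>(s, ys). U s ys) \<in> measurable (S \<Otimes>\<^sub>M N) S" and "s \<in> space S" "{0..<n} \<subseteq> I"
  shows "accum U s n \<in> measurable (PiM I (\<lambda>_. N)) S"
  using assms(3)
proof (induction n)
  case (Suc n)
  from Suc.prems have "{0..<n} \<subseteq> I" "n \<in> I" by auto
  with Suc.IH have [measurable]: "accum U s n \<in> measurable (PiM I (\<lambda>_. N)) S"
    "(\<lambda>\<omega>. \<omega> n) \<in> measurable (PiM I (\<lambda>_. N)) N"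
    by (auto intro!: measurable_component_singleton)
  have "(\<lambda>\<omega>. (\<lambda>(s, ys). U s ys) (accum U s n \<omega>, \<omega> n)) \<in> measurable (PiM I (\<lambda>_. N)) S"
    by (rule measurable_compose[OF _ U]) measurable
  then show ?case by simp
next
  case 0
  have "accum U s 0 = (\<lambda>_. s)" by (simp add: fun_eq_iff)
  then show ?case using \<open>s \<in> space S\<close> by simp
qed

context nbp
begin

lemma live_prob [measurable]: "live M \<in> measurable (list_space newborn_space) (prob_algebra (list_space individual_space))"
proof -
  let ?K = "prob_algebra (list_space individual_space)"
  have nil: "return (list_space individual_space) [] \<in> space ?K"
    by (auto simp: space_prob_algebra intro!: prob_space_return)
  \<comment> \<open>\<open>live M\<close> depends on the list alone, so the parameter of the
    recursion is trivial. The state of the recursion is itself a measure, an element of the space of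
    \<open>?K\<close>.\<close>
  let ?P = "count_space (UNIV :: unit set)"
  have 1: "(\<lambda>z. return (list_space individual_space) ((fst (snd (fst (fst z))), snd (fst z)) # snd z))
     \<in> measurable (((?P \<Otimes>\<^sub>M newborn_space \<Otimes>\<^sub>M ?K) \<Otimes>\<^sub>M life_space) \<Otimes>\<^sub>M list_space individual_space) ?K"
    by (rule measurable_compose[OF _ measurable_return_prob_space]) measurable
  have 2: "(\<lambda>z. snd (snd (fst z)) \<bind> (\<lambda>ys. return (list_space individual_space) ((fst (snd (fst z)), snd z) # ys)))
     \<in> measurable ((?P \<Otimes>\<^sub>M newborn_space \<Otimes>\<^sub>M ?K) \<Otimes>\<^sub>M life_space) ?K"
    by (rule measurable_bind_prob_space2[where N="list_space individual_space"]) (use 1 in \<open>auto simp: split_beta'\<close>)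
  have 3: "(\<lambda>(p, x, r). life M (snd x) \<bind> (\<lambda>l. r \<bind> (\<lambda>ys. return (list_space individual_space) ((x, l) # ys))))
     \<in> measurable (?P \<Otimes>\<^sub>M newborn_space \<Otimes>\<^sub>M ?K) ?K"
    unfolding split_beta'
  proof (rule measurable_bind_prob_space2[where N=life_space])
    show "(\<lambda>z. life M (snd (fst (snd z)))) \<in> measurable (?P \<Otimes>\<^sub>M newborn_space \<Otimes>\<^sub>M ?K) (prob_algebra life_space)"
      by (rule measurable_compose[OF _ life_prob]) measurable
  qed (use 2 in \<open>simp add: split_beta'\<close>)
  have "(\<lambda>xs. (\<lambda>_. live M) () xs) \<in> measurable (list_space newborn_space) ?K"
    by (rule measurable_compose[OF _ measurable_rec_list_space[where P="?P" and N=newborn_space and K="?K"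
       and f="\<lambda>_. live M" and c="\<lambda>_. return (list_space individual_space) []", OF _ 3], of "\<lambda>xs. ((), xs)", simplified])
      (use nil in auto)
  then show ?thesis by simp
qed

lemma sets_live [measurable_cong]: "sets (live M xs) = sets (list_space individual_space)"
  using measurable_space[OF live_prob, of xs] by (simp add: space_prob_algebra)

lemma prob_space_live: "prob_space (live M xs)"
  using measurable_space[OF live_prob, of xs] by (simp add: space_prob_algebra)

lemma nn_integral_live_Cons:
  assumes [measurable]: "f \<in> borel_measurable (list_space individual_space)"
  shows "(\<integral>\<^sup>+ys. f ys \<partial>live M (x # xs)) = (\<integral>\<^sup>+l. \<integral>\<^sup>+ys. f ((x, l) # ys) \<partial>live M xs \<partial>life M (snd x))"
proof -
  have [measurable]: "x \<in> space newborn_space" by simp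
  let ?S = "subprob_algebra (list_space individual_space)"
  have K: "live M xs \<in> space (prob_algebra (list_space individual_space))"
    using measurable_space[OF live_prob, of xs] by simp
  have 1: "(\<lambda>ys. return (list_space individual_space) ((x, l) # ys)) \<in> measurable (live M xs) ?S" if "l \<in> space life_space" for l
    using that by measurable
  have 2: "(\<lambda>l. live M xs \<bind> (\<lambda>ys. return (list_space individual_space) ((x, l) # ys)))
      \<in> measurable life_space (prob_algebra (list_space individual_space))"
  proof (rule measurable_bind_prob_space2[where N="list_space individual_space"])
    show "(\<lambda>(l, ys). return (list_space individual_space) ((x, l) # ys))
      \<in> measurable (life_space \<Otimes>\<^sub>M list_space individual_space) (prob_algebra (list_space individual_space))"
      unfolding split_beta' by (rule measurable_compose[OF _ measurable_return_prob_space]) measurable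
  qed (use K in auto)
  have "(\<integral>\<^sup>+ys. f ys \<partial>live M (x # xs))
    = (\<integral>\<^sup>+l. \<integral>\<^sup>+ys. f ys \<partial>(live M xs \<bind> (\<lambda>ys. return (list_space individual_space) ((x, l) # ys))) \<partial>life M (snd x))"
    unfolding live.simps using measurable_prob_algebraD[OF 2] measurable_cong_sets[OF sets_life refl]
    by (intro nn_integral_bind[where B="list_space individual_space"]) auto
  also have "\<dots> = (\<integral>\<^sup>+l. \<integral>\<^sup>+ys. f ((x, l) # ys) \<partial>live M xs \<partial>life M (snd x))"
  proof (intro nn_integral_cong)
    fix l assume "l \<in> space (life M (snd x))"
    then have l: "l \<in> space life_space" using sets_eq_imp_space_eq[OF sets_life] by auto
    show "(\<integral>\<^sup>+ys. f ys \<partial>(live M xs \<bind> (\<lambda>ys. return (list_space individual_space) ((x, l) # ys))))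
       = (\<integral>\<^sup>+ys. f ((x, l) # ys) \<partial>live M xs)"
      by (subst nn_integral_bind[OF assms 1[OF l]]) (simp add: nn_integral_return)
  qed
  finally show ?thesis .
qed

lemma emeasure_live_space [simp]: "emeasure (live M xs) (space (live M xs)) = 1"
  "emeasure (life M x) (space (life M x)) = 1"
  by (rule prob_space.emeasure_space_1; rule prob_space_live prob_space_life)+

lemma measurable_life_section:
  assumes "a \<in> borel_measurable individual_space"
  shows "(\<lambda>l. a (x, l)) \<in> borel_measurable life_space"
  using assms by (rule measurable_compose[rotated]) (simp add: individual_space_def)

lemma nn_integral_live_const: "(\<integral>\<^sup>+l. c \<partial>live M xs) = (c::ennreal)"
  by (simp add: emeasure_live_space)

lemma nn_integral_live_sum:
  assumes [measurable]: "a \<in> borel_measurable individual_space"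
  shows "(\<integral>\<^sup>+ys. sum_list (map a ys) \<partial>live M xs) = sum_list (map (\<lambda>x. \<integral>\<^sup>+l. a (x, l) \<partial>life M (snd x)) xs)"
proof (induction xs)
  case (Cons x xs)
  note [measurable] = measurable_life_section[OF assms]
  have "(\<integral>\<^sup>+ys. sum_list (map a ys) \<partial>live M (x # xs))
     = (\<integral>\<^sup>+l. \<integral>\<^sup>+ys. a (x, l) + sum_list (map a ys) \<partial>live M xs \<partial>life M (snd x))"
    by (subst nn_integral_live_Cons) simp_all
  also have "\<dots> = (\<integral>\<^sup>+l. a (x, l) + (\<integral>\<^sup>+ys. sum_list (map a ys) \<partial>live M xs) \<partial>life M (snd x))"
    by (intro nn_integral_cong) (subst nn_integral_add, auto simp: nn_integral_live_const)
  also have "\<dots> = (\<integral>\<^sup>+l. a (x, l) \<partial>life M (snd x)) + (\<integral>\<^sup>+ys. sum_list (map a ys) \<partial>live M xs)"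
    by (subst nn_integral_add) auto
  finally show ?case using Cons by simp
qed (simp add: nn_integral_return)

lemma nn_integral_live_prod:
  assumes [measurable]: "a \<in> borel_measurable individual_space"
  shows "(\<integral>\<^sup>+ys. prod_list (map a ys) \<partial>live M xs) = prod_list (map (\<lambda>x. \<integral>\<^sup>+l. a (x, l) \<partial>life M (snd x)) xs)"
proof (induction xs)
  case (Cons x xs)
  note [measurable] = measurable_life_section[OF assms]
  have "(\<integral>\<^sup>+ys. prod_list (map a ys) \<partial>live M (x # xs))
     = (\<integral>\<^sup>+l. \<integral>\<^sup>+ys. a (x, l) * prod_list (map a ys) \<partial>live M xs \<partial>life M (snd x))"
    by (subst nn_integral_live_Cons) simp_all
  also have "\<dots> = (\<integral>\<^sup>+l. a (x, l) * (\<integral>\<^sup>+ys. prod_list (map a ys) \<partial>live M xs) \<partial>life M (snd x))"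
    by (intro nn_integral_cong nn_integral_cmult) measurable
  also have "\<dots> = (\<integral>\<^sup>+l. a (x, l) \<partial>life M (snd x)) * (\<integral>\<^sup>+ys. prod_list (map a ys) \<partial>live M xs)"
    by (intro nn_integral_multc) measurable
  finally show ?case using Cons by simp
qed (simp add: nn_integral_return)

text \<open>The members of a generation live independently of each other, and
  \<open>cross_sum\<close> multiplies entries of different members only, so the means may be taken
  factor by factor.\<close>

lemma nn_integral_live_cross:
  assumes [measurable]: "a \<in> borel_measurable individual_space"
  shows "(\<integral>\<^sup>+ys. cross_sum (map a ys) \<partial>live M xs) = cross_sum (map (\<lambda>x. \<integral>\<^sup>+l. a (x, l) \<partial>life M (snd x)) xs)"
proof (induction xs)
  case (Cons x xs)
  note [measurable] = measurable_life_section[OF assms]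
  let ?S = "\<integral>\<^sup>+ys. sum_list (map a ys) \<partial>live M xs" and ?C = "\<integral>\<^sup>+ys. cross_sum (map a ys) \<partial>live M xs"
  have "(\<integral>\<^sup>+ys. cross_sum (map a ys) \<partial>live M (x # xs))
     = (\<integral>\<^sup>+l. \<integral>\<^sup>+ys. 2 * a (x, l) * sum_list (map a ys) + cross_sum (map a ys) \<partial>live M xs \<partial>life M (snd x))"
    by (subst nn_integral_live_Cons) simp_all
  also have "\<dots> = (\<integral>\<^sup>+l. 2 * a (x, l) * ?S + ?C \<partial>life M (snd x))"
    by (intro nn_integral_cong) (subst nn_integral_add, auto simp: nn_integral_cmult)
  also have "\<dots> = (\<integral>\<^sup>+l. 2 * a (x, l) * ?S \<partial>life M (snd x)) + ?C"
    by (subst nn_integral_add) auto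
  also have "(\<integral>\<^sup>+l. 2 * a (x, l) * ?S \<partial>life M (snd x)) = 2 * (\<integral>\<^sup>+l. a (x, l) \<partial>life M (snd x)) * ?S"
    by (subst nn_integral_multc, simp) (subst nn_integral_cmult, auto)
  finally show ?case using Cons by (simp add: nn_integral_live_sum)
qed (simp add: nn_integral_return)

definition parents :: "config \<Rightarrow> nat \<Rightarrow> genealogy \<Rightarrow> newborn list" where
  "parents x n \<omega> = (case n of 0 \<Rightarrow> [(0, x)] | Suc m \<Rightarrow> concat (map children (\<omega> m)))"

lemma generation_kernel_eq: "generation_kernel M x n \<omega> = live M (parents x n \<omega>)"
  by (simp add: generation_kernel_def parents_def split: nat.split)

lemma parents_meas [measurable]:
  "parents x n \<in> measurable (PiM {0..<n} (\<lambda>_. list_space individual_space)) (list_space newborn_space)"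
  by (cases n) (auto simp: parents_def[abs_def] intro!: measurable_next_generation measurable_component_singleton)

lemma Ionescu_Tulcea_nbp: "Ionescu_Tulcea (generation_kernel M x) (\<lambda>_. list_space individual_space)"
  unfolding Ionescu_Tulcea_def
proof (intro conjI allI impI)
  fix i
  have "(\<lambda>\<omega>. live M (parents x i \<omega>)) \<in> measurable (PiM {0..<i} (\<lambda>_. list_space individual_space))
     (prob_algebra (list_space individual_space))"
    by measurable
  then have *: "generation_kernel M x i \<in> measurable (PiM {0..<i} (\<lambda>_. list_space individual_space))
     (prob_algebra (list_space individual_space))"
    by (simp add: generation_kernel_eq[abs_def])
  then show "generation_kernel M x i \<in> measurable (PiM {0..<i} (\<lambda>_. list_space individual_space))
     (subprob_algebra (list_space individual_space))"
    by (rule measurable_prob_algebraD)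
next
  fix i \<omega>
  show "prob_space (generation_kernel M x i \<omega>)"
    by (simp add: generation_kernel_eq prob_space_live)
qed

lemma sets_nbp_law [measurable_cong]:
  "sets (nbp_law M x) = sets (PiM UNIV (\<lambda>_. list_space individual_space))"
proof -
  interpret IT: Ionescu_Tulcea "generation_kernel M x" "\<lambda>_. list_space individual_space"
    by (rule Ionescu_Tulcea_nbp)
  show ?thesis by (simp add: nbp_law_def)
qed

text \<open>The projective limit is reached through its marginals: a functional of the first n
  generations is integrated with the n-step kernel of the chain.\<close>

lemma nn_integral_nbp_law_prefix:
  assumes [measurable]: "f \<in> borel_measurable (PiM {0..<n} (\<lambda>_. list_space individual_space))"
  shows "(\<integral>\<^sup>+\<omega>. f (restrict \<omega> {0..<n}) \<partial>nbp_law M x)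
     = (\<integral>\<^sup>+\<omega>. f \<omega> \<partial>Ionescu_Tulcea.C (generation_kernel M x) (\<lambda>_. list_space individual_space) 0 n (\<lambda>_. undefined))"
proof -
  interpret IT: Ionescu_Tulcea "generation_kernel M x" "\<lambda>_. list_space individual_space"
    by (rule Ionescu_Tulcea_nbp)
  have u: "IT.up_to {0..<n} = n"
    using IT.up_to_less[of "{0..<n}" "IT.up_to {0..<n}"]
    by (cases "IT.up_to {0..<n} < n") (auto intro!: antisym simp: IT.up_to_iff not_less)
  have "(\<integral>\<^sup>+\<omega>. f (restrict \<omega> {0..<n}) \<partial>nbp_law M x)
    = (\<integral>\<^sup>+\<omega>. f \<omega> \<partial>distr IT.PF.lim (PiM {0..<n} (\<lambda>_. list_space individual_space)) (\<lambda>\<omega>. restrict \<omega> {0..<n}))"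
    unfolding nbp_law_def
    by (subst nn_integral_distr) (auto intro!: measurable_restrict measurable_component_singleton simp: measurable_cong_sets[OF IT.PF.sets_lim refl])
  also have "\<dots> = (\<integral>\<^sup>+\<omega>. f \<omega> \<partial>distr (IT.C 0 n (\<lambda>_. undefined)) (PiM {0..<n} (\<lambda>_. list_space individual_space)) (\<lambda>\<omega>. restrict \<omega> {0..<n}))"
    by (subst IT.distr_lim) (auto simp: IT.CI_def u)
  also have "\<dots> = (\<integral>\<^sup>+\<omega>. f (restrict \<omega> {0..<n}) \<partial>IT.C 0 n (\<lambda>_. undefined))"
    by (subst nn_integral_distr) (auto intro!: measurable_restrict measurable_component_singleton simp: measurable_cong_sets[OF IT.sets_C refl])
  also have "\<dots> = (\<integral>\<^sup>+\<omega>. f \<omega> \<partial>IT.C 0 n (\<lambda>_. undefined))"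
    by (intro nn_integral_cong) (auto simp: IT.space_C space_PiM)
  finally show ?thesis .
qed

lemma prob_space_nbp_law: "prob_space (nbp_law M x)"
proof -
  interpret IT: Ionescu_Tulcea "generation_kernel M x" "\<lambda>_. list_space individual_space"
    by (rule Ionescu_Tulcea_nbp)
  interpret C: prob_space "IT.C 0 0 (\<lambda>_. undefined)" by (rule IT.prob_space_C) simp
  have "emeasure (nbp_law M x) (space (nbp_law M x)) = (\<integral>\<^sup>+\<omega>. (\<lambda>_. 1) (restrict \<omega> {0..<0}) \<partial>nbp_law M x)"
    by simp
  also have "\<dots> = 1"
    using C.emeasure_space_1 by (subst nn_integral_nbp_law_prefix[of "\<lambda>_. 1" 0]) auto
  finally show ?thesis by (rule prob_spaceI)
qed

text \<open>Think of \<open>V j s xs\<close> as the mean of the final value when j generations are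
  still to come, s has been accumulated and xs are the next births. The hypothesis
  \<open>step\<close> is the one-step Markov property, so that the mean of \<open>V (N - n)\<close>
  at generation n is the same for all n. A functional is computed by guessing its V.\<close>

lemma nn_integral_accum:
  fixes U :: "ennreal \<Rightarrow> individual list \<Rightarrow> ennreal"
  assumes U: "(\<lambda>(s, ys). U s ys) \<in> borel_measurable (borel \<Otimes>\<^sub>M list_space individual_space)"
    and V: "\<And>j. (\<lambda>(s, xs). V j s xs) \<in> borel_measurable (borel \<Otimes>\<^sub>M list_space newborn_space)"
    and step: "\<And>j s xs. V (Suc j) s xs = (\<integral>\<^sup>+ys. V j (U s ys) (concat (map children ys)) \<partial>live M xs)"
  shows "(\<integral>\<^sup>+\<omega>. V 0 (accum U s N \<omega>) (parents x N \<omega>) \<partial>nbp_law M x) = V N s [(0, x)]"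
proof -
  let ?N = "list_space individual_space"
  let ?Pi = "\<lambda>n. PiM {0..<n} (\<lambda>_. ?N)"
  interpret IT: Ionescu_Tulcea "generation_kernel M x" "\<lambda>_. list_space individual_space"
    by (rule Ionescu_Tulcea_nbp)
  have acc [measurable]: "accum U s n \<in> borel_measurable (?Pi n)" for n
    by (rule measurable_accum[OF U]) auto
  have VA [measurable]: "(\<lambda>\<omega>. V j (accum U s n \<omega>) (parents x n \<omega>)) \<in> borel_measurable (?Pi n)" for j n
  proof -
    have "(\<lambda>\<omega>. (\<lambda>(s, xs). V j s xs) (accum U s n \<omega>, parents x n \<omega>)) \<in> borel_measurable (?Pi n)"
      by (rule measurable_compose[OF _ V]) measurable
    then show ?thesis by simp
  qed
  have shift: "(\<integral>\<^sup>+\<omega>. V (Suc j) (accum U s n \<omega>) (parents x n \<omega>) \<partial>IT.C 0 n (\<lambda>_. undefined))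
     = (\<integral>\<^sup>+\<omega>. V j (accum U s (Suc n) \<omega>) (parents x (Suc n) \<omega>) \<partial>IT.C 0 (Suc n) (\<lambda>_. undefined))" for n j
  proof -
    have "(\<integral>\<^sup>+\<omega>. V j (accum U s (Suc n) \<omega>) (parents x (Suc n) \<omega>) \<partial>IT.C 0 (Suc n) (\<lambda>_. undefined))
      = (\<integral>\<^sup>+\<omega>. \<integral>\<^sup>+\<omega>'. V j (accum U s (Suc n) \<omega>') (parents x (Suc n) \<omega>') \<partial>IT.eP n \<omega> \<partial>IT.C 0 n (\<lambda>_. undefined))"
      unfolding IT.C.simps add_0
      by (rule nn_integral_bind[where B="?Pi (Suc n)"])
        (auto simp del: accum.simps simp: measurable_cong_sets[OF IT.sets_C refl])
    also have "\<dots> = (\<integral>\<^sup>+\<omega>. V (Suc j) (accum U s n \<omega>) (parents x n \<omega>) \<partial>IT.C 0 n (\<lambda>_. undefined))"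
    proof (intro nn_integral_cong)
      fix \<omega> assume "\<omega> \<in> space (IT.C 0 n (\<lambda>_. undefined))"
      then have \<omega>: "\<omega> \<in> space (?Pi n)" by (simp add: IT.space_C)
      have "(\<integral>\<^sup>+\<omega>'. V j (accum U s (Suc n) \<omega>') (parents x (Suc n) \<omega>') \<partial>IT.eP n \<omega>)
         = (\<integral>\<^sup>+y. V j (accum U s (Suc n) (fun_upd \<omega> n y)) (parents x (Suc n) (fun_upd \<omega> n y)) \<partial>live M (parents x n \<omega>))"
        by (subst IT.nn_integral_eP[OF \<omega>]) (auto simp del: accum.simps simp: generation_kernel_eq)
      also have "\<dots> = V (Suc j) (accum U s n \<omega>) (parents x n \<omega>)"
      proof -
        have "accum U s n (fun_upd \<omega> n y) = accum U s n \<omega>" for y by (rule accum_cong) auto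
        then show ?thesis unfolding step by (simp add: parents_def)
      qed
      finally show "(\<integral>\<^sup>+\<omega>'. V j (accum U s (Suc n) \<omega>') (parents x (Suc n) \<omega>') \<partial>IT.eP n \<omega>)
        = V (Suc j) (accum U s n \<omega>) (parents x n \<omega>)" .
    qed
    finally show ?thesis by simp
  qed
  have "(\<integral>\<^sup>+\<omega>. V (N - n) (accum U s n \<omega>) (parents x n \<omega>) \<partial>IT.C 0 n (\<lambda>_. undefined)) = V N s [(0, x)]" if "n \<le> N" for n
    using that
  proof (induction n)
    case 0
    have "(\<lambda>\<omega>. V N (accum U s 0 \<omega>) (parents x 0 \<omega>)) \<in> borel_measurable (?Pi 0)" by (rule VA)
    then show ?case
      unfolding IT.C.simps by (subst nn_integral_return) (auto simp: space_PiM parents_def)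
  next
    case (Suc n)
    then show ?case using shift[of n "N - Suc n"] by (simp add: Suc_diff_Suc del: accum.simps IT.C.simps)
  qed
  from this[of N]
  have "(\<integral>\<^sup>+\<omega>. V 0 (accum U s N \<omega>) (parents x N \<omega>) \<partial>IT.C 0 N (\<lambda>_. undefined)) = V N s [(0, x)]" by simp
  moreover have "(\<integral>\<^sup>+\<omega>. V 0 (accum U s N \<omega>) (parents x N \<omega>) \<partial>IT.C 0 N (\<lambda>_. undefined))
    = (\<integral>\<^sup>+\<omega>. V 0 (accum U s N (restrict \<omega> {0..<N})) (parents x N (restrict \<omega> {0..<N})) \<partial>nbp_law M x)"
    by (subst nn_integral_nbp_law_prefix[OF VA]) simp
  moreover have "accum U s N (restrict \<omega> {0..<N}) = accum U s N \<omega>" for \<omega>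
    by (rule accum_cong) simp
  moreover have "parents x N (restrict \<omega> {0..<N}) = parents x N \<omega>" for \<omega>
    by (simp add: parents_def split: nat.split)
  ultimately show ?thesis by simp
qed

end

section \<open>Moments of the total weight\<close>

lemma SUP_square_ennreal:
  fixes a :: "nat \<Rightarrow> ennreal"
  assumes "incseq a"
  shows "(SUP n. a n)\<^sup>2 = (SUP n. (a n)\<^sup>2)"
proof (rule antisym)
  have "(SUP n. a n)\<^sup>2 = (SUP i. a i * (SUP j. a j))"
    unfolding power2_eq_square by (rule SUP_mult_right_ennreal)
  also have "\<dots> = (SUP i. SUP j. a i * a j)"
    by (simp only: SUP_mult_left_ennreal)
  also have "\<dots> \<le> (SUP n. (a n)\<^sup>2)"
  proof (intro SUP_least)
    fix i j
    have "a i * a j \<le> (a (max i j))\<^sup>2"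
      unfolding power2_eq_square by (intro mult_mono incseqD[OF assms]) auto
    then show "a i * a j \<le> (SUP n. (a n)\<^sup>2)" by (rule order_trans) (rule SUP_upper, simp)
  qed
  finally show "(SUP n. a n)\<^sup>2 \<le> (SUP n. (a n)\<^sup>2)" .
  show "(SUP n. (a n)\<^sup>2) \<le> (SUP n. a n)\<^sup>2"
    by (intro SUP_least power_mono SUP_upper) auto
qed
text \<open>Bookkeeping for one more individual in a generation: w is its weight, c and R' are the
  first and second moment of what its children contribute; W, C and R belong to the others. Since
  there is no subtraction in [0, \<infinity>], the two sides are arranged as sums.\<close>

lemma square_expand:
  fixes s w W c C R R' :: ennreal
  shows "(s + (w + W))\<^sup>2 + 2 * (s + (w + W)) * (c + C) + (R' + R + 2 * c * C)
    = ((s + W)\<^sup>2 + 2 * (s + W) * C + R) + 2 * s * (w + c) + (w\<^sup>2 + 2 * w * c + R') + 2 * (w + c) * (W + C)"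
  by (simp add: power2_eq_square algebra_simps mult_2 mult_2_right)

lemma square_collect:
  fixes s w W c C R' Q K A :: ennreal
  shows "s\<^sup>2 + 2 * s * A + (Q + K) + 2 * s * (w + c) + (w\<^sup>2 + 2 * w * c + R') + 2 * (w + c) * (W + C)
    = s\<^sup>2 + 2 * s * ((w + c) + A) + (((w\<^sup>2 + 2 * w * c + R') + Q) + (2 * (w + c) * (W + C) + K))"
  by (simp only: distrib_left add.assoc add.commute add.left_commute)

lemma sum_list_mono':
  fixes f g :: "'a \<Rightarrow> ennreal"
  shows "(\<And>x. x \<in> set xs \<Longrightarrow> f x \<le> g x) \<Longrightarrow> sum_list (map f xs) \<le> sum_list (map g xs)"
  by (induction xs) (auto intro: add_mono)

lemma prod_list_mono':
  fixes f g :: "'a \<Rightarrow> ennreal"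
  shows "(\<And>x. x \<in> set xs \<Longrightarrow> f x \<le> g x) \<Longrightarrow> prod_list (map f xs) \<le> prod_list (map g xs)"
  by (induction xs) (auto intro: mult_mono)

lemma cross_sum_map_mono:
  fixes f g :: "'a \<Rightarrow> ennreal"
  shows "(\<And>x. x \<in> set xs \<Longrightarrow> f x \<le> g x) \<Longrightarrow> cross_sum (map f xs) \<le> cross_sum (map g xs)"
  by (induction xs) (auto intro!: add_mono mult_mono sum_list_mono')

context nbp
begin

lemma life_sub [measurable]: "life M \<in> measurable borel (subprob_algebra life_space)"
  using life_prob by (rule measurable_prob_algebraD)

lemma measurable_life_integral:
  assumes "(\<lambda>(p, i). f p i) \<in> borel_measurable (P \<Otimes>\<^sub>M individual_space)"
    and y: "y \<in> measurable P newborn_space"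
  shows "(\<lambda>p. \<integral>\<^sup>+l. f p (y p, l) \<partial>life M (snd (y p))) \<in> borel_measurable P"
proof (rule nn_integral_measurable_subprob_algebra2[where N=life_space])
  have "(\<lambda>z. (fst z, (y (fst z), snd z))) \<in> measurable (P \<Otimes>\<^sub>M life_space) (P \<Otimes>\<^sub>M individual_space)"
    using y by measurable
  from measurable_compose[OF this assms(1)]
  show "(\<lambda>(p, l). f p (y p, l)) \<in> borel_measurable (P \<Otimes>\<^sub>M life_space)"
    by (simp add: split_beta')
  show "(\<lambda>p. life M (snd (y p))) \<in> measurable P (subprob_algebra life_space)"
    using y by measurable
qed

text \<open>Mean of the total weight in the first n generations of the tree of y, including y
  itself, by conditioning on the life of y. The newborn carries its time of birth because weights
  depend on absolute time.\<close>

primrec mom1 :: "nat \<Rightarrow> (individual \<Rightarrow> ennreal) \<Rightarrow> newborn \<Rightarrow> ennreal" where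
  "mom1 0 w y = 0"
| "mom1 (Suc n) w y = (\<integral>\<^sup>+l. w (y, l) + sum_list (map (mom1 n w) (children (y, l))) \<partial>life M (snd y))"

text \<open>Second moment of the same total. Given the life of y, the subtrees of its children are
  independent; a squared sum over them has \<open>mom2\<close> on the diagonal and products of
  \<open>mom1\<close> off the diagonal.\<close>

primrec mom2 :: "nat \<Rightarrow> (individual \<Rightarrow> ennreal) \<Rightarrow> newborn \<Rightarrow> ennreal" where
  "mom2 0 w y = 0"
| "mom2 (Suc n) w y = (\<integral>\<^sup>+l. (w (y, l))\<^sup>2 + 2 * w (y, l) * sum_list (map (mom1 n w) (children (y, l)))
     + (sum_list (map (mom2 n w) (children (y, l))) + cross_sum (map (mom1 n w) (children (y, l)))) \<partial>life M (snd y))"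

text \<open>Mean of the product of the weights over the same individuals. With weight z for the
  living and 1 for all others, this is a generating function at z of the number of living
  particles.\<close>

primrec pgf :: "nat \<Rightarrow> (individual \<Rightarrow> ennreal) \<Rightarrow> newborn \<Rightarrow> ennreal" where
  "pgf 0 w y = 1"
| "pgf (Suc n) w y = (\<integral>\<^sup>+l. w (y, l) * prod_list (map (pgf n w) (children (y, l))) \<partial>life M (snd y))"

text \<open>The parameter serves weights that depend on a time over which one integrates
  later.\<close>

lemma mom1_meas_param:
  assumes w: "(\<lambda>(p, i). w p i) \<in> borel_measurable (P \<Otimes>\<^sub>M individual_space)"
  shows "(\<lambda>(p, y). mom1 n (w p) y) \<in> borel_measurable (P \<Otimes>\<^sub>M newborn_space)"
proof (induction n)
  case (Suc n)
  have 1: "(\<lambda>z. w (fst (fst z)) (snd z)) \<in> borel_measurable ((P \<Otimes>\<^sub>M newborn_space) \<Otimes>\<^sub>M individual_space)"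
  proof -
    have "(\<lambda>z. (fst (fst z), snd z)) \<in> measurable ((P \<Otimes>\<^sub>M newborn_space) \<Otimes>\<^sub>M individual_space) (P \<Otimes>\<^sub>M individual_space)"
      by measurable
    from measurable_compose[OF this w] show ?thesis by simp
  qed
  have 2: "(\<lambda>z. sum_list (map (mom1 n (w (fst (fst z)))) (children (snd z))))
    \<in> borel_measurable ((P \<Otimes>\<^sub>M newborn_space) \<Otimes>\<^sub>M individual_space)"
  proof (rule measurable_sum_list_space[where N=newborn_space])
    have "(\<lambda>z. (fst (fst (fst z)), snd z)) \<in> measurable (((P \<Otimes>\<^sub>M newborn_space) \<Otimes>\<^sub>M individual_space) \<Otimes>\<^sub>M newborn_space) (P \<Otimes>\<^sub>M newborn_space)"
      by measurable
    from measurable_compose[OF this Suc]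
    show "(\<lambda>(p, x). mom1 n (w (fst (fst p))) x) \<in> borel_measurable (((P \<Otimes>\<^sub>M newborn_space) \<Otimes>\<^sub>M individual_space) \<Otimes>\<^sub>M newborn_space)"
      by (simp add: split_beta')
  qed measurable
  have "(\<lambda>p. \<integral>\<^sup>+l. (\<lambda>p i. w (fst p) i + sum_list (map (mom1 n (w (fst p))) (children i))) p (snd p, l) \<partial>life M (snd (snd p)))
    \<in> borel_measurable (P \<Otimes>\<^sub>M newborn_space)"
    by (rule measurable_life_integral) (use 1 2 in \<open>simp_all add: split_beta'\<close>)
  then show ?case by (simp add: split_beta')
qed simp

lemma mom1_meas [measurable (raw)]:
  assumes w: "w \<in> borel_measurable individual_space"
  shows "mom1 n w \<in> borel_measurable newborn_space"
proof -
  have "(\<lambda>(p, i). w i) \<in> borel_measurable (count_space (UNIV::unit set) \<Otimes>\<^sub>M individual_space)"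
    using w by measurable
  from measurable_compose[OF _ mom1_meas_param[OF this], of "\<lambda>y. ((), y)" newborn_space]
  show ?thesis by simp
qed

lemma measurable_life_integral':
  assumes "f \<in> borel_measurable individual_space"
  shows "(\<lambda>y. \<integral>\<^sup>+l. f (y, l) \<partial>life M (snd y)) \<in> borel_measurable newborn_space"
  by (rule measurable_life_integral[where f="\<lambda>_. f"]) (use assms in measurable)

lemma mom2_meas [measurable (raw)]:
  assumes w [measurable]: "w \<in> borel_measurable individual_space"
  shows "mom2 n w \<in> borel_measurable newborn_space"
proof (induction n)
  case (Suc n)
  note [measurable] = Suc
  have "(\<lambda>y. \<integral>\<^sup>+l. (\<lambda>i. (w i)\<^sup>2 + 2 * w i * sum_list (map (mom1 n w) (children i))
     + (sum_list (map (mom2 n w) (children i)) + cross_sum (map (mom1 n w) (children i)))) (y, l) \<partial>life M (snd y))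
     \<in> borel_measurable newborn_space"
    by (rule measurable_life_integral') measurable
  then show ?case by (simp add: fun_eq_iff[symmetric])
qed simp

lemma pgf_meas [measurable (raw)]:
  assumes w [measurable]: "w \<in> borel_measurable individual_space"
  shows "pgf n w \<in> borel_measurable newborn_space"
proof (induction n)
  case (Suc n)
  note [measurable] = Suc
  have "(\<lambda>y. \<integral>\<^sup>+l. (\<lambda>i. w i * prod_list (map (pgf n w) (children i))) (y, l) \<partial>life M (snd y))
     \<in> borel_measurable newborn_space"
    by (rule measurable_life_integral') measurable
  then show ?case by (simp add: fun_eq_iff[symmetric])
qed simp

lemma sum_list_mom_0 [simp]: "sum_list (map (mom1 0 w) xs) = 0" "sum_list (map (mom2 0 w) xs) = 0"
  "cross_sum (map (mom1 0 w) xs) = 0" "prod_list (map (pgf 0 w) xs) = 1"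
  by (induction xs; simp)+

lemma sum_list_concat_map:
  "sum_list (map f (concat (map h ys))) = sum_list (map (\<lambda>i. sum_list (map f (h i))) ys)"
  "prod_list (map (f' :: _ \<Rightarrow> ennreal) (concat (map h ys))) = prod_list (map (\<lambda>i. prod_list (map f' (h i))) ys)"
  by (induction ys; simp)+

lemma nn_integral_partial_sum:
  assumes w [measurable]: "w \<in> borel_measurable individual_space"
  shows "(\<integral>\<^sup>+\<omega>. (\<Sum>i<n. sum_list (map w (\<omega> i))) \<partial>nbp_law M x) = mom1 n w (0, x)"
proof -
  let ?U = "\<lambda>s ys. s + sum_list (map w ys)"
  have acc: "accum ?U 0 n \<omega> = (\<Sum>i<n. sum_list (map w (\<omega> i)))" for \<omega>
    by (induction n) auto
  have "(\<integral>\<^sup>+\<omega>. (\<lambda>j s xs. s + sum_list (map (mom1 j w) xs)) 0 (accum ?U 0 n \<omega>) (parents x n \<omega>) \<partial>nbp_law M x)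
    = (\<lambda>j s xs. s + sum_list (map (mom1 j w) xs)) n 0 [(0, x)]"
  proof (rule nn_integral_accum)
    fix j s xs
    have "(\<integral>\<^sup>+ys. s + sum_list (map w ys) + sum_list (map (mom1 j w) (concat (map children ys))) \<partial>live M xs)
       = (\<integral>\<^sup>+ys. s + sum_list (map (\<lambda>i. w i + sum_list (map (mom1 j w) (children i))) ys) \<partial>live M xs)"
      by (intro nn_integral_cong) (simp add: sum_list_concat_map sum_list_addf add.assoc)
    also have "\<dots> = s + (\<integral>\<^sup>+ys. sum_list (map (\<lambda>i. w i + sum_list (map (mom1 j w) (children i))) ys) \<partial>live M xs)"
      by (subst nn_integral_add) (simp_all add: nn_integral_live_const)
    also have "\<dots> = s + sum_list (map (mom1 (Suc j) w) xs)"
      unfolding mom1.simps(2)[abs_def] by (subst nn_integral_live_sum) simp_all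
    finally show "s + sum_list (map (mom1 (Suc j) w) xs)
      = (\<integral>\<^sup>+ys. s + sum_list (map w ys) + sum_list (map (mom1 j w) (concat (map children ys))) \<partial>live M xs)" ..
  qed measurable
  then show ?thesis by (simp add: acc)
qed

lemma nn_integral_partial_square:
  assumes w [measurable]: "w \<in> borel_measurable individual_space"
  shows "(\<integral>\<^sup>+\<omega>. (\<Sum>i<n. sum_list (map w (\<omega> i)))\<^sup>2 \<partial>nbp_law M x) = mom2 n w (0, x)"
proof -
  let ?U = "\<lambda>s ys. s + sum_list (map w ys)"
  have acc: "accum ?U 0 n \<omega> = (\<Sum>i<n. sum_list (map w (\<omega> i)))" for \<omega>
    by (induction n) auto
  \<comment> \<open>The mean of (s + Z)^2, where Z is the total weight of the j generations that
    start with the births xs.\<close>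
  define V where "V j s xs = s\<^sup>2 + 2 * s * sum_list (map (mom1 j w) xs) + (sum_list (map (mom2 j w) xs) + cross_sum (map (mom1 j w) xs))"
    for j s xs
  have "(\<integral>\<^sup>+\<omega>. V 0 (accum ?U 0 n \<omega>) (parents x n \<omega>) \<partial>nbp_law M x) = V n 0 [(0, x)]"
  proof (rule nn_integral_accum)
    fix j s xs
    let ?a = "\<lambda>i. w i + sum_list (map (mom1 j w) (children i))"
    let ?q = "\<lambda>i. (w i)\<^sup>2 + 2 * w i * sum_list (map (mom1 j w) (children i))
     + (sum_list (map (mom2 j w) (children i)) + cross_sum (map (mom1 j w) (children i)))"
    \<comment> \<open>Before averaging over one generation, the value is rewritten as a sum over its
      members plus a cross sum over them; both are integrated by \<open>live\<close> in closed
      form.\<close>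
    have alg: "(s + sum_list (map w ys))\<^sup>2 + 2 * (s + sum_list (map w ys)) * sum_list (map (mom1 j w) (concat (map children ys)))
        + (sum_list (map (mom2 j w) (concat (map children ys))) + cross_sum (map (mom1 j w) (concat (map children ys))))
      = s\<^sup>2 + 2 * s * sum_list (map ?a ys) + (sum_list (map ?q ys) + cross_sum (map ?a ys))" for ys
    proof (induction ys)
      case (Cons i ys)
      define W where "W = sum_list (map w ys)"
      define C where "C = sum_list (map (mom1 j w) (concat (map children ys)))"
      define c where "c = sum_list (map (mom1 j w) (children i))"
      define R where "R = sum_list (map (mom2 j w) (concat (map children ys))) + cross_sum (map (mom1 j w) (concat (map children ys)))"
      define R' where "R' = sum_list (map (mom2 j w) (children i)) + cross_sum (map (mom1 j w) (children i))"
      have A: "sum_list (map ?a ys) = W + C"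
        by (simp add: W_def C_def sum_list_addf sum_list_concat_map)
      have "(s + sum_list (map w (i # ys)))\<^sup>2 + 2 * (s + sum_list (map w (i # ys))) * sum_list (map (mom1 j w) (concat (map children (i # ys))))
        + (sum_list (map (mom2 j w) (concat (map children (i # ys)))) + cross_sum (map (mom1 j w) (concat (map children (i # ys)))))
        = (s + (w i + W))\<^sup>2 + 2 * (s + (w i + W)) * (c + C) + (R' + R + 2 * c * C)"
        by (simp add: W_def C_def c_def R_def R'_def cross_sum_append ac_simps)
      also have "\<dots> = ((s + W)\<^sup>2 + 2 * (s + W) * C + R) + 2 * s * (w i + c) + ((w i)\<^sup>2 + 2 * w i * c + R')
           + 2 * (w i + c) * (W + C)"
        by (rule square_expand)
      also have "(s + W)\<^sup>2 + 2 * (s + W) * C + R = s\<^sup>2 + 2 * s * sum_list (map ?a ys) + (sum_list (map ?q ys) + cross_sum (map ?a ys))"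
        using Cons by (simp add: W_def C_def R_def)
      also have "\<dots> + 2 * s * (w i + c) + ((w i)\<^sup>2 + 2 * w i * c + R') + 2 * (w i + c) * (W + C)
         = s\<^sup>2 + 2 * s * sum_list (map ?a (i # ys)) + (sum_list (map ?q (i # ys)) + cross_sum (map ?a (i # ys)))"
      proof -
        have "sum_list (map ?q (i # ys)) = ((w i)\<^sup>2 + 2 * w i * c + R') + sum_list (map ?q ys)"
          by (simp add: c_def R'_def)
        moreover have "cross_sum (map ?a (i # ys)) = 2 * (w i + c) * (W + C) + cross_sum (map ?a ys)"
          by (simp add: c_def A)
        moreover have "sum_list (map ?a (i # ys)) = (w i + c) + sum_list (map ?a ys)"
          by (simp add: c_def)
        ultimately show ?thesis by (simp only: square_collect)
      qed
      finally show ?case .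
    qed simp
    define a where "a = ?a"
    define q where "q = ?q"
    have [measurable]: "a \<in> borel_measurable individual_space"
      unfolding a_def by (intro borel_measurable_add w measurable_sum_list_space'[OF _ measurable_children] mom1_meas)
    have [measurable]: "q \<in> borel_measurable individual_space"
    proof -
      have [measurable]: "(\<lambda>i. sum_list (map (mom1 j w) (children i))) \<in> borel_measurable individual_space"
        "(\<lambda>i. sum_list (map (mom2 j w) (children i))) \<in> borel_measurable individual_space"
        "(\<lambda>i. cross_sum (map (mom1 j w) (children i))) \<in> borel_measurable individual_space"
        by (intro measurable_sum_list_space'[OF _ measurable_children] measurable_cross_sum_list_space'[OF _ measurable_children]
          mom1_meas mom2_meas w)+
      show ?thesis unfolding q_def by measurable
    qed
    have "(\<integral>\<^sup>+ys. V j (s + sum_list (map w ys)) (concat (map children ys)) \<partial>live M xs)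
      = (\<integral>\<^sup>+ys. (s\<^sup>2 + 2 * s * sum_list (map a ys)) + (sum_list (map q ys) + cross_sum (map a ys)) \<partial>live M xs)"
      unfolding V_def alg a_def q_def ..
    also have "\<dots> = (\<integral>\<^sup>+ys. s\<^sup>2 + 2 * s * sum_list (map a ys) \<partial>live M xs) +
        (\<integral>\<^sup>+ys. sum_list (map q ys) + cross_sum (map a ys) \<partial>live M xs)"
      by (rule nn_integral_add) measurable
    also have "(\<integral>\<^sup>+ys. sum_list (map q ys) + cross_sum (map a ys) \<partial>live M xs)
      = (\<integral>\<^sup>+ys. sum_list (map q ys) \<partial>live M xs) + (\<integral>\<^sup>+ys. cross_sum (map a ys) \<partial>live M xs)"
      by (rule nn_integral_add) measurable
    also have "(\<integral>\<^sup>+ys. s\<^sup>2 + 2 * s * sum_list (map a ys) \<partial>live M xs)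
      = (\<integral>\<^sup>+ys. s\<^sup>2 \<partial>live M xs) + (\<integral>\<^sup>+ys. 2 * s * sum_list (map a ys) \<partial>live M xs)"
      by (rule nn_integral_add) measurable
    also have "(\<integral>\<^sup>+ys. 2 * s * sum_list (map a ys) \<partial>live M xs) = 2 * s * (\<integral>\<^sup>+ys. sum_list (map a ys) \<partial>live M xs)"
      by (rule nn_integral_cmult) measurable
    also have "(\<integral>\<^sup>+ys. s\<^sup>2 \<partial>live M xs) = s\<^sup>2" by (rule nn_integral_live_const)
    also have "(\<integral>\<^sup>+ys. sum_list (map a ys) \<partial>live M xs) = sum_list (map (mom1 (Suc j) w) xs)"
      by (subst nn_integral_live_sum) (simp_all add: a_def mom1.simps(2)[abs_def])
    also have "(\<integral>\<^sup>+ys. sum_list (map q ys) \<partial>live M xs) = sum_list (map (mom2 (Suc j) w) xs)"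
      by (subst nn_integral_live_sum) (simp_all add: q_def mom2.simps(2)[abs_def])
    also have "(\<integral>\<^sup>+ys. cross_sum (map a ys) \<partial>live M xs) = cross_sum (map (mom1 (Suc j) w) xs)"
      by (subst nn_integral_live_cross) (simp_all add: a_def mom1.simps(2)[abs_def])
    also have "s\<^sup>2 + 2 * s * sum_list (map (mom1 (Suc j) w) xs)
        + (sum_list (map (mom2 (Suc j) w) xs) + cross_sum (map (mom1 (Suc j) w) xs)) = V (Suc j) s xs"
      by (simp only: V_def)
    finally show "V (Suc j) s xs = (\<integral>\<^sup>+ys. V j (s + sum_list (map w ys)) (concat (map children ys)) \<partial>live M xs)" ..
  qed (unfold V_def, measurable)
  then show ?thesis by (simp add: acc V_def)
qed

lemma nn_integral_partial_prod:
  assumes w [measurable]: "w \<in> borel_measurable individual_space"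
  shows "(\<integral>\<^sup>+\<omega>. (\<Prod>i<n. prod_list (map w (\<omega> i))) \<partial>nbp_law M x) = pgf n w (0, x)"
proof -
  let ?U = "\<lambda>s ys. s * prod_list (map w ys)"
  have acc: "accum ?U 1 n \<omega> = (\<Prod>i<n. prod_list (map w (\<omega> i)))" for \<omega>
    by (induction n) auto
  have "(\<integral>\<^sup>+\<omega>. (\<lambda>j s xs. s * prod_list (map (pgf j w) xs)) 0 (accum ?U 1 n \<omega>) (parents x n \<omega>) \<partial>nbp_law M x)
    = (\<lambda>j s xs. s * prod_list (map (pgf j w) xs)) n 1 [(0, x)]"
  proof (rule nn_integral_accum)
    fix j s xs
    have p: "prod_list (map f ys) * prod_list (map g ys) = prod_list (map (\<lambda>i. f i * g i) ys)" for f g :: "individual \<Rightarrow> ennreal" and ys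
      by (induction ys) (simp_all add: ac_simps)
    have "(\<integral>\<^sup>+ys. s * prod_list (map w ys) * prod_list (map (pgf j w) (concat (map children ys))) \<partial>live M xs)
       = (\<integral>\<^sup>+ys. s * prod_list (map (\<lambda>i. w i * prod_list (map (pgf j w) (children i))) ys) \<partial>live M xs)"
      by (intro nn_integral_cong) (simp add: sum_list_concat_map p mult.assoc)
    also have "\<dots> = s * (\<integral>\<^sup>+ys. prod_list (map (\<lambda>i. w i * prod_list (map (pgf j w) (children i))) ys) \<partial>live M xs)"
      by (intro nn_integral_cmult) measurable
    also have "\<dots> = s * prod_list (map (pgf (Suc j) w) xs)"
      unfolding pgf.simps(2)[abs_def] by (subst nn_integral_live_prod) simp_all
    finally show "s * prod_list (map (pgf (Suc j) w) xs)
      = (\<integral>\<^sup>+ys. s * prod_list (map w ys) * prod_list (map (pgf j w) (concat (map children ys))) \<partial>live M xs)" ..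
  qed measurable
  then show ?thesis by (simp add: acc)
qed

definition total :: "(individual \<Rightarrow> ennreal) \<Rightarrow> genealogy \<Rightarrow> ennreal" where
  "total w \<omega> = (\<Sum>n. sum_list (map w (\<omega> n)))"

lemma total_SUP: "total w \<omega> = (SUP n. \<Sum>i<n. sum_list (map w (\<omega> i)))"
  unfolding total_def by (rule suminf_eq_SUP)

lemma generation_meas [measurable]: "(\<lambda>\<omega>. \<omega> n) \<in> measurable (nbp_law M x) (list_space individual_space)"
  unfolding measurable_cong_sets[OF sets_nbp_law refl] by (rule measurable_component_singleton) simp

lemma total_meas [measurable]:
  assumes "w \<in> borel_measurable individual_space"
  shows "total w \<in> borel_measurable (nbp_law M x)"
proof -
  have [measurable]: "(\<lambda>\<omega>. sum_list (map w (\<omega> n))) \<in> borel_measurable (nbp_law M x)" for n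
    by (rule measurable_sum_list_space'[OF assms generation_meas])
  show ?thesis unfolding total_def[abs_def] by measurable
qed

lemma incseq_partial: "incseq (\<lambda>n. \<Sum>i<n. sum_list (map w (\<omega> i)) :: ennreal)"
  by (rule incseq_SucI) simp

lemma nn_integral_total:
  assumes [measurable]: "w \<in> borel_measurable individual_space"
  shows "(\<integral>\<^sup>+\<omega>. total w \<omega> \<partial>nbp_law M x) = (SUP n. mom1 n w (0, x))"
  unfolding total_SUP nn_integral_partial_sum[OF assms, symmetric]
  by (rule nn_integral_monotone_convergence_SUP) (auto simp: incseq_def le_fun_def intro!: sum_mono2)

lemma nn_integral_total_square:
  assumes [measurable]: "w \<in> borel_measurable individual_space"
  shows "(\<integral>\<^sup>+\<omega>. (total w \<omega>)\<^sup>2 \<partial>nbp_law M x) = (SUP n. mom2 n w (0, x))"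
  unfolding total_SUP SUP_square_ennreal[OF incseq_partial] nn_integral_partial_square[OF assms, symmetric]
  by (rule nn_integral_monotone_convergence_SUP) (auto simp: incseq_def le_fun_def intro!: sum_mono2 power_mono)

lemma mom1_le_SUP: "mom1 n w y \<le> (SUP n. mom1 n w y)"
  by (rule SUP_upper) simp

lemma mom1_add:
  assumes [measurable]: "w \<in> borel_measurable individual_space" "w' \<in> borel_measurable individual_space"
  shows "mom1 n (\<lambda>i. w i + w' i) y = mom1 n w y + mom1 n w' y"
proof (induction n arbitrary: y)
  case (Suc n)
  have [measurable]: "(\<lambda>l. w (y, l)) \<in> borel_measurable (life M (snd y))"
    "(\<lambda>l. w' (y, l)) \<in> borel_measurable (life M (snd y))"
    "(\<lambda>l. sum_list (map (mom1 n w) (children (y, l)))) \<in> borel_measurable (life M (snd y))"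
    "(\<lambda>l. sum_list (map (mom1 n w') (children (y, l)))) \<in> borel_measurable (life M (snd y))"
    unfolding measurable_cong_sets[OF sets_life refl] by (rule measurable_life_section, measurable)+
  have "mom1 (Suc n) (\<lambda>i. w i + w' i) y = (\<integral>\<^sup>+l. (w (y, l) + sum_list (map (mom1 n w) (children (y, l))))
     + (w' (y, l) + sum_list (map (mom1 n w') (children (y, l)))) \<partial>life M (snd y))"
    unfolding mom1.simps Suc[abs_def] by (intro nn_integral_cong) (simp add: sum_list_addf ac_simps)
  then show ?case by (simp add: nn_integral_add)
qed simp

end

section \<open>Particles alive at a fixed time, and their pairs\<close>

lemma nn_integral_sum_list:
  assumes "\<And>x. x \<in> set xs \<Longrightarrow> f x \<in> borel_measurable N"
  shows "(\<integral>\<^sup>+s. sum_list (map (\<lambda>x. f x s) xs) \<partial>N) = sum_list (map (\<lambda>x. \<integral>\<^sup>+s. f x s \<partial>N) xs)"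
  using assms
proof (induction xs)
  case (Cons x xs)
  have [measurable]: "(\<lambda>s. sum_list (map (\<lambda>x. f x s) xs)) \<in> borel_measurable N"
    using Cons.prems by (induction xs) (auto intro!: borel_measurable_add)
  have [measurable]: "f x \<in> borel_measurable N" using Cons.prems by simp
  show ?case using Cons by (simp add: nn_integral_add)
qed simp

lemma cross_sum_zero: "(\<And>x. x \<in> set xs \<Longrightarrow> f x = 0) \<Longrightarrow> cross_sum (map f xs) = (0::'a::comm_semiring_1)"
  by (induction xs) auto

lemma sum_list_zero: "(\<And>x. x \<in> set xs \<Longrightarrow> f x = 0) \<Longrightarrow> sum_list (map f xs) = (0::'a::comm_monoid_add)"
  by (induction xs) auto

text \<open>Summed over the tree, this is the pairing of f with X at time t, for an f that vanishes
  outside the phase space. The life interval is half open: at the end of a life the children count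
  and the parent does not.\<close>

definition alive_wt :: "real \<Rightarrow> (config \<Rightarrow> ennreal) \<Rightarrow> individual \<Rightarrow> ennreal" where
  "alive_wt t f i = (if fst (fst i) \<le> t \<and> t < fst (fst i) + fst (snd i)
     then f (flow (snd (fst i)) (t - fst (fst i))) else 0)"

lemma alive_wt_meas_param [measurable]:
  assumes [measurable]: "(\<lambda>(s, y). f s y) \<in> borel_measurable (borel \<Otimes>\<^sub>M borel)"
  shows "(\<lambda>(s, i). alive_wt s (f s) i) \<in> borel_measurable (borel \<Otimes>\<^sub>M individual_space)"
  unfolding alive_wt_def[abs_def] split_beta'
proof (rule measurable_If)
  have "(\<lambda>x. (fst x, flow (snd (fst (snd x))) (fst x - fst (fst (snd x)))))
    \<in> measurable (borel \<Otimes>\<^sub>M individual_space) (borel \<Otimes>\<^sub>M borel)" by measurable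
  from measurable_compose[OF this assms]
  show "(\<lambda>x. f (fst x) (flow (snd (fst (snd x))) (fst x - fst (fst (snd x)))))
    \<in> borel_measurable (borel \<Otimes>\<^sub>M individual_space)" by simp
qed measurable

lemma alive_wt_meas [measurable (raw)]:
  assumes [measurable]: "f \<in> borel_measurable borel"
  shows "alive_wt t f \<in> borel_measurable individual_space"
  using measurable_compose[OF _ alive_wt_meas_param[of "\<lambda>_. f"], of "\<lambda>i. (t, i)" individual_space] by simp

lemma alive_wt_square: "(alive_wt t f i)\<^sup>2 = alive_wt t (\<lambda>y. (f y)\<^sup>2) i"
  by (simp add: alive_wt_def)

lemma set_children: "y \<in> set (children ((b, x), (\<tau>, ws))) \<Longrightarrow> fst y = b + \<tau> \<and> (\<exists>w\<in>set ws. snd y = (fst (flow x \<tau>), w))"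
  by (auto simp: children_eq)

context nbp
begin

lemma sets_scatter_law [measurable_cong, simp]: "sets (scatter_law y) = sets borel"
  and sets_offspring_law [measurable_cong, simp]: "sets (offspring_law y) = sets (list_space borel)"
  and prob_space_scatter_law: "prob_space (scatter_law y)"
  and prob_space_offspring_law: "prob_space (offspring_law y)"
  using measurable_space[OF scatter_law_kernel, of y] measurable_space[OF offspring_law_kernel, of y]
  by (auto simp: space_prob_algebra)

lemma AE_scatter_law: "y \<in> phase M \<Longrightarrow> AE w in scatter_law y. w \<in> vel_V M"
proof -
  assume y: "y \<in> phase M"
  have "(\<lambda>w. (\<lambda>(x, w). dens_s x w) (y, w)) \<in> borel_measurable borel" by measurable
  then have "(\<lambda>w. ennreal (dens_s y w)) \<in> borel_measurable lborel" by simp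
  then have "AE w in density lborel (\<lambda>w. ennreal (dens_s y w)). w \<in> vel_V M"
    by (subst AE_density) (auto simp: dens_s_def)
  then show "AE w in scatter_law y. w \<in> vel_V M" using y by (simp only: scatter_law_def if_True)
qed

text \<open>Collects properties of almost every life, so that inductions over generations may argue
  path by path: time does not run backwards and children start in the phase space. The alternative
  in the last clause is for exits, which happen outside of D but leave no children.\<close>

definition good_life :: "config \<Rightarrow> real \<times> r3 list \<Rightarrow> bool" where
  "good_life x l \<longleftrightarrow> 0 \<le> fst l \<and> length (snd l) \<le> nmax \<and> set (snd l) \<subseteq> vel_V M \<and>
     (snd l = [] \<or> flow x (fst l) \<in> phase M)"

lemma good_life_pred [measurable]: "Measurable.pred life_space (good_life x)"
proof -
  have "{ws. set ws \<subseteq> vel_V M} = (\<Union>n. listset (replicate n (vel_V M)))"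
    by (auto simp: listset_replicate)
  also have "\<dots> \<in> sets (list_space borel)"
    by (intro sets.countable_UN) (auto intro!: listset_in_sets_list_space)
  finally have [measurable]: "Measurable.pred (list_space borel) (\<lambda>ws. set ws \<subseteq> vel_V M)"
    by (simp add: pred_def)
  have [measurable]: "Measurable.pred (list_space (borel :: r3 measure)) (\<lambda>ws. ws = [])"
    using sets_list_space_Nil[of "borel :: r3 measure"] by (simp add: pred_def)
  have "(\<lambda>l. flow x (fst l)) \<in> borel_measurable life_space" by measurable
  then show ?thesis unfolding good_life_def[abs_def] by measurable
qed

text \<open>The indicator of the bad lives is integrated with \<open>nn_integral_life\<close>. An
  exit is good because its list is empty; the other two terms vanish by the almost sure properties
  of the scattering and fission laws.\<close>

lemma AE_good_life: "AE l in life M x. good_life x l"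
proof (cases "x \<in> phase M")
  case True
  let ?G = "indicator {l. \<not> good_life x l} :: _ \<Rightarrow> ennreal"
  have "(\<integral>\<^sup>+l. ?G l \<partial>life M x) = ennreal (exp (- cum x (exit_at x))) * ?G (exit_at x, []) +
     (\<integral>\<^sup>+u. indicator {0..} u * ennreal (exp (- cum x u)) *
        (ennreal (rate_s (flow x u)) * (\<integral>\<^sup>+w. ?G (u, [w]) \<partial>scatter_law (flow x u)) +
         ennreal (rate_f (flow x u)) * (\<integral>\<^sup>+ws. ?G (u, ws) \<partial>offspring_law (flow x u))) \<partial>lborel)"
    by (rule nn_integral_life[OF True]) measurable
  also have "(\<integral>\<^sup>+u. indicator {0..} u * ennreal (exp (- cum x u)) *
        (ennreal (rate_s (flow x u)) * (\<integral>\<^sup>+w. ?G (u, [w]) \<partial>scatter_law (flow x u)) +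
         ennreal (rate_f (flow x u)) * (\<integral>\<^sup>+ws. ?G (u, ws) \<partial>offspring_law (flow x u))) \<partial>lborel)
      = (\<integral>\<^sup>+u. 0 \<partial>(lborel :: real measure))"
  proof -
    have *: "indicator {0..} u * ennreal (exp (- cum x u)) *
        (ennreal (rate_s (flow x u)) * (\<integral>\<^sup>+w. ?G (u, [w]) \<partial>scatter_law (flow x u)) +
         ennreal (rate_f (flow x u)) * (\<integral>\<^sup>+ws. ?G (u, ws) \<partial>offspring_law (flow x u))) = 0" for u
    proof (cases "0 \<le> u \<and> flow x u \<in> phase M")
      case u: True
      have "(\<integral>\<^sup>+w. ?G (u, [w]) \<partial>scatter_law (flow x u)) = (\<integral>\<^sup>+w. 0 \<partial>scatter_law (flow x u))"
        using AE_scatter_law[of "flow x u"] u nmax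
        by (intro nn_integral_cong_AE) (auto simp: good_life_def)
      moreover have "(\<integral>\<^sup>+ws. ?G (u, ws) \<partial>offspring_law (flow x u)) = (\<integral>\<^sup>+ws. 0 \<partial>offspring_law (flow x u))"
        using AE_offspring_law[of "flow x u"] u
        by (intro nn_integral_cong_AE) (auto simp: good_life_def)
      ultimately show ?thesis by simp
    qed (auto simp: rate_s_def rate_f_def)
    show ?thesis unfolding * ..
  qed
  finally have "(\<integral>\<^sup>+l. ?G l \<partial>life M x) = 0"
    using exit_pos[OF True] by (simp add: good_life_def)
  then show ?thesis
    by (subst (asm) nn_integral_0_iff_AE) (auto simp: measurable_cong_sets[OF sets_life refl] split: split_indicator_asm elim!: AE_mp)
next
  case False
  then have "life M x = return life_space (0, [])" by (simp add: life_eq)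
  moreover have "AE l in return life_space (0, []). good_life x l"
    by (subst AE_return) (auto simp: space_pair_measure good_life_def[of x "(0, [])"])
  ultimately show ?thesis by (simp only:)
qed

lemma children_after:
  assumes "good_life x (\<tau>, ws)" "y \<in> set (children ((b, x), (\<tau>, ws)))"
  shows "b \<le> fst y" "snd y \<in> phase M" "fst y = b + \<tau>"
  using assms by (auto simp: good_life_def phase_iff flow_def dest!: set_children)

lemma nn_integral_life_mono_good:
  "(\<And>l. good_life x l \<Longrightarrow> f l \<le> g l) \<Longrightarrow> (\<integral>\<^sup>+l. f l \<partial>life M x) \<le> (\<integral>\<^sup>+l. g l \<partial>life M x)"
  using AE_good_life[of x] by (intro nn_integral_mono_AE) auto

lemma nn_integral_life_cong_good:
  "(\<And>l. good_life x l \<Longrightarrow> f l = g l) \<Longrightarrow> (\<integral>\<^sup>+l. f l \<partial>life M x) = (\<integral>\<^sup>+l. g l \<partial>life M x)"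
  using AE_good_life[of x] by (intro nn_integral_cong_AE) auto

text \<open>Along good lives a child is not born before its parent, so nobody in a tree that starts
  after t is alive at t.\<close>

lemma mom1_alive_future: "t < b \<Longrightarrow> mom1 n (alive_wt t f) (b, x) = 0"
proof (induction n arbitrary: b x)
  case (Suc n)
  have "mom1 (Suc n) (alive_wt t f) (b, x) = (\<integral>\<^sup>+l. 0 \<partial>life M x)"
    unfolding mom1.simps snd_conv
  proof (rule nn_integral_life_cong_good)
    fix l assume l: "good_life x l"
    obtain \<tau> ws where lt: "l = (\<tau>, ws)" by (cases l)
    have "mom1 n (alive_wt t f) y = 0" if "y \<in> set (children ((b, x), l))" for y
      using children_after(1)[of x \<tau> ws y b] that l Suc by (cases y) (auto simp: lt)
    then show "alive_wt t f ((b, x), l) + sum_list (map (mom1 n (alive_wt t f)) (children ((b, x), l))) = 0"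
      using Suc.prems by (simp add: sum_list_zero alive_wt_def)
  qed
  then show ?case by simp
qed simp

text \<open>The law of a life does not depend on the time of birth, so only the time left until t
  matters.\<close>

lemma mom1_shift: "mom1 n (alive_wt t f) (b + u, x) = mom1 n (alive_wt (t - u) f) (b, x)"
proof (induction n arbitrary: b x)
  case (Suc n)
  have "alive_wt t f ((b + u, x), l) = alive_wt (t - u) f ((b, x), l)" for l
    by (auto simp: alive_wt_def algebra_simps)
  moreover have "map (mom1 n (alive_wt t f)) (children ((b + u, x), l)) = map (mom1 n (alive_wt (t - u) f)) (children ((b, x), l))" for l
  proof -
    have "mom1 n (alive_wt t f) (b + u + fst l, z) = mom1 n (alive_wt (t - u) f) (b + fst l, z)" for z
      using Suc[of "b + fst l" z] by (simp add: ac_simps)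
    then show ?thesis by (simp add: children_eq comp_def)
  qed
  ultimately show ?case by simp
qed simp

definition mean :: "(config \<Rightarrow> ennreal) \<Rightarrow> real \<Rightarrow> config \<Rightarrow> ennreal" where
  "mean f t x = (SUP n. mom1 n (alive_wt t f) (0, x))"

lemma mean_eq: "(SUP n. mom1 n (alive_wt t f) y) = mean f (t - fst y) (snd y)"
  using mom1_shift[of _ t f 0 "fst y" "snd y"] by (simp add: mean_def)

lemma mean_total:
  "f \<in> borel_measurable borel \<Longrightarrow> mean f t x = (\<integral>\<^sup>+\<omega>. total (alive_wt t f) \<omega> \<partial>nbp_law M x)"
  by (subst nn_integral_total) (auto simp: mean_def intro: alive_wt_meas)

lemma mean_meas_param [measurable (raw)]:
  assumes f: "(\<lambda>(s, y). f s y) \<in> borel_measurable (borel \<Otimes>\<^sub>M borel)"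
  shows "(\<lambda>(s, x). mean (f s) s x) \<in> borel_measurable (borel \<Otimes>\<^sub>M borel)"
proof -
  have [measurable]: "(\<lambda>(s, x). mom1 n (alive_wt s (f s)) (0, x)) \<in> borel_measurable (borel \<Otimes>\<^sub>M borel)" for n
  proof -
    have "(\<lambda>z. (fst z, (0, snd z))) \<in> measurable (borel \<Otimes>\<^sub>M borel) (borel \<Otimes>\<^sub>M newborn_space)"
      unfolding newborn_space_def by measurable
    from measurable_compose[OF this mom1_meas_param[OF alive_wt_meas_param[OF f]]]
    show ?thesis by (simp add: split_beta')
  qed
  show ?thesis unfolding mean_def by measurable
qed

lemma mean_meas:
  assumes "f \<in> borel_measurable borel"
  shows "(\<lambda>(s, x). mean f s x) \<in> borel_measurable (borel \<Otimes>\<^sub>M borel)"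
  by (rule mean_meas_param[of "\<lambda>_. f"]) (use assms in measurable)

text \<open>Charged to a particle whose life ends by time t: for each ordered pair of different
  children, the product of their mean contributions at time t. With \<open>mean f\<close> for m,
  this is the part of the second moment for which the particle is the most recent common
  ancestor.\<close>

definition branch_wt :: "(real \<Rightarrow> config \<Rightarrow> ennreal) \<Rightarrow> real \<Rightarrow> individual \<Rightarrow> ennreal" where
  "branch_wt m t i = (if fst (fst i) + fst (snd i) \<le> t
     then cross_sum (map (\<lambda>y. m (t - fst y) (snd y)) (children i)) else 0)"

lemma branch_wt_meas [measurable (raw)]:
  assumes m: "(\<lambda>(s, x). m s x) \<in> borel_measurable (borel \<Otimes>\<^sub>M borel)"
  shows "branch_wt m t \<in> borel_measurable individual_space"
proof -
  have "(\<lambda>y. (t - fst y, snd y)) \<in> measurable newborn_space (borel \<Otimes>\<^sub>M borel)" by measurable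
  from measurable_compose[OF this m]
  have [measurable]: "(\<lambda>y. m (t - fst y) (snd y)) \<in> borel_measurable newborn_space" by simp
  show ?thesis unfolding branch_wt_def[abs_def] by measurable
qed

text \<open>A particle alive at t has no children by time t. Hence two particles alive at t either
  coincide, which gives the square of f, or descend from different children of a common ancestor,
  which gives \<open>branch_wt\<close>. The inequality comes from replacing means over finitely many
  generations by means over the full tree.\<close>

lemma mom2_le:
  assumes [measurable]: "f \<in> borel_measurable borel"
  shows "mom2 n (alive_wt t f) y \<le> mom1 n (\<lambda>i. alive_wt t (\<lambda>y. (f y)\<^sup>2) i + branch_wt (mean f) t i) y"
proof (induction n arbitrary: y)
  case (Suc n)
  obtain b x where y: "y = (b, x)" by (cases y)
  show ?case unfolding mom2.simps mom1.simps
  proof (rule nn_integral_life_mono_good)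
    fix l assume l: "good_life (snd y) l"
    obtain \<tau> ws where lt: "l = (\<tau>, ws)" by (cases l)
    let ?w = "alive_wt t f" and ?ch = "children (y, l)"
    have fut: "mom1 n ?w c = 0" if "t < b + \<tau>" "c \<in> set ?ch" for c
      using children_after(3)[of x \<tau> ws c b] that l by (cases c) (auto simp: lt y mom1_alive_future)
    have 1: "2 * ?w (y, l) * sum_list (map (mom1 n ?w) ?ch) = 0"
      using fut by (cases "t < b + \<tau>") (auto simp: sum_list_zero alive_wt_def y lt)
    have 2: "cross_sum (map (mom1 n ?w) ?ch) \<le> branch_wt (mean f) t (y, l)"
    proof (cases "t < b + \<tau>")
      case True
      then show ?thesis using cross_sum_zero[of ?ch "mom1 n ?w"] fut by simp
    next
      case False
      have "cross_sum (map (mom1 n ?w) ?ch) \<le> cross_sum (map (\<lambda>y. mean f (t - fst y) (snd y)) ?ch)"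
        by (intro cross_sum_map_mono) (simp add: mean_eq[symmetric] mom1_le_SUP)
      then show ?thesis using False by (simp add: branch_wt_def y lt)
    qed
    have "(?w (y, l))\<^sup>2 + 2 * ?w (y, l) * sum_list (map (mom1 n ?w) ?ch)
       + (sum_list (map (mom2 n ?w) ?ch) + cross_sum (map (mom1 n ?w) ?ch))
      \<le> alive_wt t (\<lambda>y. (f y)\<^sup>2) (y, l) + 0 + (sum_list (map (mom1 n (\<lambda>i. alive_wt t (\<lambda>y. (f y)\<^sup>2) i + branch_wt (mean f) t i)) ?ch)
         + branch_wt (mean f) t (y, l))"
      using Suc 2 unfolding 1 alive_wt_square by (intro add_mono sum_list_mono') auto
    then show "(?w (y, l))\<^sup>2 + 2 * ?w (y, l) * sum_list (map (mom1 n ?w) ?ch)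
       + (sum_list (map (mom2 n ?w) ?ch) + cross_sum (map (mom1 n ?w) ?ch))
      \<le> alive_wt t (\<lambda>y. (f y)\<^sup>2) (y, l) + branch_wt (mean f) t (y, l)
        + sum_list (map (mom1 n (\<lambda>i. alive_wt t (\<lambda>y. (f y)\<^sup>2) i + branch_wt (mean f) t i)) ?ch)"
      by (simp add: ac_simps)
  qed
qed simp

lemma cum_eq_F: "cum x = bounded_rate.F (\<lambda>s. rate_s (flow x s) + rate_f (flow x s))"
proof
  fix t
  interpret A: bounded_rate "\<lambda>s. rate_s (flow x s)" cb by (rule bounded_rate_flow)
  interpret B: bounded_rate "\<lambda>s. rate_f (flow x s)" cb by (rule bounded_rate_flow)
  interpret C: bounded_rate "\<lambda>s. rate_s (flow x s) + rate_f (flow x s)" "2 * cb" by (rule bounded_rate_flow)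
  show "cum x t = C.F t"
    unfolding cum_def C.F_def cum_eq
    by (rule set_integral_add(2)[symmetric]) (auto intro: A.h_integrable[of _ 0 t] B.h_integrable[of _ 0 t])
qed

text \<open>At time u the particle would still be in D, so only the two clocks can have ended its
  life, and neither has rung with probability \<open>exp (- cum x u)\<close>.\<close>

lemma survival:
  assumes x: "x \<in> phase M" and u: "0 \<le> u" "flow x u \<in> phase M"
  shows "emeasure (life M x) {l \<in> space (life M x). u < fst l} = ennreal (exp (- cum x u))"
proof -
  interpret L: prob_space "life M x" by (rule prob_space_life)
  interpret C: bounded_rate "\<lambda>s. rate_s (flow x s) + rate_f (flow x s)" "2 * cb" by (rule bounded_rate_flow)
  have ue: "u < exit_at x" using less_exit_iff[OF x u(1)] u(2) by simp
  have [measurable]: "{l \<in> space (life M x). u < fst l} \<in> sets (life M x)" "{l \<in> space (life M x). fst l \<le> u} \<in> sets (life M x)"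
    by measurable
  let ?G = "\<lambda>l::real \<times> r3 list. indicator {..u} (fst l) :: ennreal"
  have "emeasure (life M x) {l \<in> space (life M x). fst l \<le> u} = (\<integral>\<^sup>+l. ?G l \<partial>life M x)"
  proof -
    have "(\<integral>\<^sup>+l. ?G l \<partial>life M x) = (\<integral>\<^sup>+l. indicator {l \<in> space (life M x). fst l \<le> u} l \<partial>life M x)"
      by (intro nn_integral_cong) (auto split: split_indicator)
    then show ?thesis by simp
  qed
  also have "\<dots> = ennreal (exp (- cum x (exit_at x))) * ?G (exit_at x, []) +
     (\<integral>\<^sup>+u. indicator {0..} u * ennreal (exp (- cum x u)) *
        (ennreal (rate_s (flow x u)) * (\<integral>\<^sup>+w. ?G (u, [w]) \<partial>scatter_law (flow x u)) +
         ennreal (rate_f (flow x u)) * (\<integral>\<^sup>+ws. ?G (u, ws) \<partial>offspring_law (flow x u))) \<partial>lborel)"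
    by (rule nn_integral_life[OF x]) measurable
  also have "\<dots> = (\<integral>\<^sup>+v. ennreal ((rate_s (flow x v) + rate_f (flow x v)) * exp (- C.F v)) * indicator {0..u} v \<partial>lborel)"
  proof -
    have "ennreal (rate_s (flow x v)) + ennreal (rate_f (flow x v)) = ennreal (rate_s (flow x v) + rate_f (flow x v))" for v
      using rate_bounds[of "flow x v"] by simp
    moreover have "ennreal (exp (- C.F v)) * ennreal (rate_s (flow x v) + rate_f (flow x v))
      = ennreal ((rate_s (flow x v) + rate_f (flow x v)) * exp (- C.F v))" for v
      using rate_bounds[of "flow x v"] by (simp add: ennreal_mult mult.commute)
    ultimately show ?thesis
      using ue by (auto intro!: nn_integral_cong simp: cum_eq_F prob_space.emeasure_space_1[OF prob_space_scatter_law]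
         prob_space.emeasure_space_1[OF prob_space_offspring_law] split: split_indicator)
  qed
  also have "\<dots> = ennreal (1 - exp (- C.F u))" by (rule C.nn_integral_h_exp[OF u(1)])
  finally have "L.prob {l \<in> space (life M x). fst l \<le> u} = 1 - exp (- C.F u)"
    using C.F_nonneg[of u] by (simp add: L.emeasure_eq_measure)
  moreover have "L.prob {l \<in> space (life M x). u < fst l} = 1 - L.prob {l \<in> space (life M x). fst l \<le> u}"
    by (subst L.prob_compl[symmetric], measurable) (auto intro!: arg_cong[where f=L.prob])
  ultimately show ?thesis by (simp add: L.emeasure_eq_measure cum_eq_F)
qed

text \<open>The operator \<open>eta_f\<close> with values in [0, \<infinity>] and with the extended
  rate, applicable to means before they are known to be finite.\<close>

definition eta_mean :: "(config \<Rightarrow> ennreal) \<Rightarrow> config \<Rightarrow> ennreal" where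
  "eta_mean m y = ennreal (rate_f y) * (\<integral>\<^sup>+ws. cross_sum (map (\<lambda>w. m (fst y, w)) ws) \<partial>offspring_law y)"

lemma eta_mean_outside: "y \<notin> phase M \<Longrightarrow> eta_mean m y = 0"
  by (simp add: eta_mean_def rate_f_def)

lemma eta_mean_meas_param:
  fixes m :: "real \<Rightarrow> config \<Rightarrow> ennreal"
  assumes m: "(\<lambda>(s, x). m s x) \<in> borel_measurable (borel \<Otimes>\<^sub>M borel)"
  shows "(\<lambda>(s, y). eta_mean (m s) y) \<in> borel_measurable (borel \<Otimes>\<^sub>M borel)"
proof -
  have o: "offspring_law \<in> measurable borel (subprob_algebra (list_space borel))"
    by (rule measurable_prob_algebraD) measurable
  have "(\<lambda>z. (fst (fst (fst z)), (fst (snd (fst (fst z))), snd z)))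
     \<in> measurable ((((borel :: real measure) \<Otimes>\<^sub>M (borel :: config measure)) \<Otimes>\<^sub>M list_space (borel :: r3 measure)) \<Otimes>\<^sub>M (borel :: r3 measure))
         ((borel :: real measure) \<Otimes>\<^sub>M (borel :: config measure))"
  proof -
    have "(\<lambda>z. (fst (snd (fst (fst z))), snd z)) \<in> borel_measurable
      ((((borel :: real measure) \<Otimes>\<^sub>M (borel :: config measure)) \<Otimes>\<^sub>M list_space (borel :: r3 measure)) \<Otimes>\<^sub>M (borel :: r3 measure))"
      by (rule borel_measurable_Pair) measurable
    then show ?thesis by (intro measurable_Pair) measurable
  qed
  from measurable_compose[OF this m]
  have 1: "(\<lambda>z. cross_sum (map (\<lambda>w. m (fst (fst z)) (fst (snd (fst z)), w)) (snd z)))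
     \<in> borel_measurable (((borel :: real measure) \<Otimes>\<^sub>M (borel :: config measure)) \<Otimes>\<^sub>M list_space borel)"
    by (intro measurable_cross_sum_list_space[where N=borel]) (simp_all add: split_beta')
  have "(\<lambda>z. \<integral>\<^sup>+ws. cross_sum (map (\<lambda>w. m (fst z) (fst (snd z), w)) ws) \<partial>offspring_law (snd z))
     \<in> borel_measurable ((borel :: real measure) \<Otimes>\<^sub>M borel)"
    by (rule nn_integral_measurable_subprob_algebra2[where N="list_space borel"])
       (use 1 measurable_compose[OF measurable_snd o] in \<open>auto simp: split_beta'\<close>)
  then show ?thesis unfolding eta_mean_def split_beta' by measurable
qed

text \<open>Density in s of what replaces \<open>branch_wt\<close> in the mean: while the particle
  is alive at s \<le> t, fission occurs at the rate inside \<open>eta_mean\<close>, and the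
  offspring have the time t - s left.\<close>

definition compensator :: "(real \<Rightarrow> config \<Rightarrow> ennreal) \<Rightarrow> real \<Rightarrow> real \<Rightarrow> individual \<Rightarrow> ennreal" where
  "compensator m t s i = indicator {..t} s * alive_wt s (eta_mean (m (t - s))) i"

lemma compensator_meas:
  assumes m: "(\<lambda>(s, x). m s x) \<in> borel_measurable (borel \<Otimes>\<^sub>M borel)"
  shows "(\<lambda>(s, i). compensator m t s i) \<in> borel_measurable (borel \<Otimes>\<^sub>M individual_space)"
proof -
  have "(\<lambda>z. (t - fst z, snd z)) \<in> measurable (borel \<Otimes>\<^sub>M borel) (borel \<Otimes>\<^sub>M borel)" by measurable
  from measurable_compose[OF this eta_mean_meas_param[OF m]]
  have "(\<lambda>(s, y). eta_mean (m (t - s)) y) \<in> borel_measurable (borel \<Otimes>\<^sub>M borel)"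
    by (simp add: split_beta')
  from alive_wt_meas_param[OF this] show ?thesis
    unfolding compensator_def split_beta' by measurable
qed

text \<open>The compensation formula: a scattering contributes nothing to \<open>branch_wt\<close>, and fission occurs at
  rate \<open>rate_f\<close> as long as the life lasts.\<close>

lemma nn_integral_life_compensator:
  assumes m: "(\<lambda>(s, x). m s x) \<in> borel_measurable (borel \<Otimes>\<^sub>M borel)" and x: "x \<in> phase M"
  shows "(\<integral>\<^sup>+l. branch_wt m t ((b, x), l) \<partial>life M x)
    = (\<integral>\<^sup>+l. (\<integral>\<^sup>+s. compensator m t s ((b, x), l) \<partial>lborel) \<partial>life M x)"
proof -
  let ?E = "\<lambda>u. indicator {0..} u * (indicator {..t} (b + u) * eta_mean (m (t - (b + u))) (flow x u))"
  interpret L: prob_space "life M x" by (rule prob_space_life)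
  interpret LL: pair_sigma_finite "life M x" lborel ..
  have br: "(\<lambda>l. branch_wt m t ((b, x), l)) \<in> borel_measurable life_space"
    by (rule measurable_life_section) (rule branch_wt_meas[OF m])
  have "(\<integral>\<^sup>+l. branch_wt m t ((b, x), l) \<partial>life M x) = ennreal (exp (- cum x (exit_at x))) * branch_wt m t ((b, x), (exit_at x, [])) +
     (\<integral>\<^sup>+u. indicator {0..} u * ennreal (exp (- cum x u)) *
        (ennreal (rate_s (flow x u)) * (\<integral>\<^sup>+w. branch_wt m t ((b, x), (u, [w])) \<partial>scatter_law (flow x u)) +
         ennreal (rate_f (flow x u)) * (\<integral>\<^sup>+ws. branch_wt m t ((b, x), (u, ws)) \<partial>offspring_law (flow x u))) \<partial>lborel)"
    by (rule nn_integral_life[OF x br])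
  also have "\<dots> = (\<integral>\<^sup>+u. ?E u * ennreal (exp (- cum x u)) \<partial>lborel)"
  proof -
    have 0: "branch_wt m t ((b, x), (u, [])) = 0" "branch_wt m t ((b, x), (u, [w])) = 0" for u w
      by (auto simp: branch_wt_def children_eq)
    have "branch_wt m t ((b, x), (u, ws)) = indicator {..t} (b + u) * cross_sum (map (\<lambda>w. m (t - (b + u)) (fst (flow x u), w)) ws)" for u ws
      by (auto simp: branch_wt_def children_eq comp_def)
    then have "(\<integral>\<^sup>+ws. branch_wt m t ((b, x), (u, ws)) \<partial>offspring_law (flow x u))
      = indicator {..t} (b + u) * (\<integral>\<^sup>+ws. cross_sum (map (\<lambda>w. m (t - (b + u)) (fst (flow x u), w)) ws) \<partial>offspring_law (flow x u))" for u
      by (simp add: indicator_def)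
    then show ?thesis unfolding 0 eta_mean_def by (simp add: ac_simps)
  qed
  \<comment> \<open>\<open>exp (- cum x u)\<close> is read as the probability of living longer than
    u. Exchanging the integrals then turns the integral over fission times into one over the time
    lived.\<close>
  also have "\<dots> = (\<integral>\<^sup>+u. \<integral>\<^sup>+l. ?E u * indicator {l. u < fst l} l \<partial>life M x \<partial>lborel)"
  proof -
    have "?E u * ennreal (exp (- cum x u)) = (\<integral>\<^sup>+l. ?E u * indicator {l. u < fst l} l \<partial>life M x)" for u
    proof -
      have "(\<integral>\<^sup>+l. ?E u * indicator {l. u < fst l} l \<partial>life M x)
        = (\<integral>\<^sup>+l. ?E u * indicator {l \<in> space (life M x). u < fst l} l \<partial>life M x)"
        by (intro nn_integral_cong) (auto split: split_indicator)
      also have "\<dots> = ?E u * emeasure (life M x) {l \<in> space (life M x). u < fst l}"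
        by (rule nn_integral_cmult_indicator) measurable
      finally show ?thesis
        using survival[OF x, of u] eta_mean_outside[of "flow x u"]
        by (cases "0 \<le> u \<and> flow x u \<in> phase M") auto
    qed
    then show ?thesis by (simp only:)
  qed
  also have "\<dots> = (\<integral>\<^sup>+l. \<integral>\<^sup>+u. ?E u * indicator {l. u < fst l} l \<partial>lborel \<partial>life M x)"
  proof (rule LL.Fubini')
    have "(\<lambda>z. (t - (b + snd z), flow x (snd z))) \<in> measurable (life_space \<Otimes>\<^sub>M borel) (borel \<Otimes>\<^sub>M borel)" by measurable
    from measurable_compose[OF this eta_mean_meas_param[OF m]]
    have [measurable]: "(\<lambda>z. eta_mean (m (t - (b + snd z))) (flow x (snd z))) \<in> borel_measurable (life_space \<Otimes>\<^sub>M borel)"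
      by simp
    have "(\<lambda>(l, u). ?E u * indicator {l. u < fst l} l) \<in> borel_measurable (life_space \<Otimes>\<^sub>M borel)"
      unfolding split_beta' indicator_def by measurable
    then show "(\<lambda>(l, u). ?E u * indicator {l. u < fst l} l) \<in> borel_measurable (life M x \<Otimes>\<^sub>M lborel)"
      by (simp cong: measurable_cong_sets add: sets_pair_measure_cong[OF sets_life])
  qed
  also have "\<dots> = (\<integral>\<^sup>+l. (\<integral>\<^sup>+s. compensator m t s ((b, x), l) \<partial>lborel) \<partial>life M x)"
  proof -
    have "(\<integral>\<^sup>+u. ?E u * indicator {l. u < fst l} l \<partial>lborel) = (\<integral>\<^sup>+s. compensator m t s ((b, x), l) \<partial>lborel)" for l
    proof -
    have [measurable]: "(\<lambda>s. compensator m t s ((b, x), l)) \<in> borel_measurable borel"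
    proof -
      have "(\<lambda>s. (s, ((b, x), l))) \<in> measurable borel (borel \<Otimes>\<^sub>M individual_space)" by measurable
      from measurable_compose[OF this compensator_meas[OF m]] show ?thesis by simp
    qed
    have "(\<integral>\<^sup>+s. compensator m t s ((b, x), l) \<partial>lborel) = (\<integral>\<^sup>+u. compensator m t (b + 1 * u) ((b, x), l) \<partial>lborel)"
      by (subst nn_integral_real_affine[where c=1 and t=b]) simp_all
    also have "\<dots> = (\<integral>\<^sup>+u. ?E u * indicator {l. u < fst l} l \<partial>lborel)"
      by (intro nn_integral_cong) (auto simp: compensator_def alive_wt_def split: split_indicator)
    finally show ?thesis by simp
    qed
    then show ?thesis by (simp only:)
  qed
  finally show ?thesis .
qed

text \<open>The mean over the tree adds up means over single lives, so weights may be exchanged life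
  by life. Equality is assumed for births in the phase space only, which suffices because along good
  lives all children are born there.\<close>

lemma mom1_cong_phase:
  assumes [measurable]: "w \<in> borel_measurable individual_space" "w' \<in> borel_measurable individual_space"
    and eq: "\<And>b x. x \<in> phase M \<Longrightarrow> (\<integral>\<^sup>+l. w ((b, x), l) \<partial>life M x) = (\<integral>\<^sup>+l. w' ((b, x), l) \<partial>life M x)"
  shows "snd y \<in> phase M \<Longrightarrow> mom1 n w y = mom1 n w' y"
proof (induction n arbitrary: y)
  case (Suc n)
  obtain b x where y: "y = (b, x)" by (cases y)
  have [measurable]: "(\<lambda>l. w (y, l)) \<in> borel_measurable (life M (snd y))"
    "(\<lambda>l. w' (y, l)) \<in> borel_measurable (life M (snd y))"
    "(\<lambda>l. sum_list (map (mom1 n w) (children (y, l)))) \<in> borel_measurable (life M (snd y))"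
    "(\<lambda>l. sum_list (map (mom1 n w') (children (y, l)))) \<in> borel_measurable (life M (snd y))"
    unfolding measurable_cong_sets[OF sets_life refl] by (rule measurable_life_section, measurable)+
  have "(\<integral>\<^sup>+l. sum_list (map (mom1 n w) (children (y, l))) \<partial>life M (snd y))
     = (\<integral>\<^sup>+l. sum_list (map (mom1 n w') (children (y, l))) \<partial>life M (snd y))"
  proof (rule nn_integral_life_cong_good)
    fix l assume l: "good_life (snd y) l"
    obtain \<tau> ws where lt: "l = (\<tau>, ws)" by (cases l)
    have "mom1 n w c = mom1 n w' c" if "c \<in> set (children (y, l))" for c
      using children_after(2)[of x \<tau> ws c b] that l by (intro Suc.IH) (auto simp: y lt)
    then show "sum_list (map (mom1 n w) (children (y, l))) = sum_list (map (mom1 n w') (children (y, l)))"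
      by (auto intro!: arg_cong[where f=sum_list] map_cong)
  qed
  then show ?case using eq[of x b] Suc.prems by (simp add: nn_integral_add y)
qed simp

text \<open>Tonelli's theorem in each generation: the integral over s passes through the finite sum
  over the children by induction and through the life of y by exchange of integrals.\<close>

lemma mom1_integral:
  assumes w: "(\<lambda>(s, i). w s i) \<in> borel_measurable (borel \<Otimes>\<^sub>M individual_space)"
  shows "mom1 n (\<lambda>i. \<integral>\<^sup>+s. w s i \<partial>lborel) y = (\<integral>\<^sup>+s. mom1 n (w s) y \<partial>(lborel :: real measure))"
proof (induction n arbitrary: y)
  case (Suc n)
  interpret L: prob_space "life M (snd y)" by (rule prob_space_life)
  interpret LL: pair_sigma_finite "life M (snd y)" "lborel :: real measure" ..
  have mw: "(\<lambda>s. w s i) \<in> borel_measurable borel" for i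
  proof -
    have "(\<lambda>s. (s, i)) \<in> measurable borel (borel \<Otimes>\<^sub>M individual_space)" by measurable
    from measurable_compose[OF this w] show ?thesis by simp
  qed
  have mm: "(\<lambda>s. mom1 n (w s) c) \<in> borel_measurable borel" for c
  proof -
    have "(\<lambda>s. (s, c)) \<in> measurable borel (borel \<Otimes>\<^sub>M newborn_space)" by measurable
    from measurable_compose[OF this mom1_meas_param[OF w]] show ?thesis by simp
  qed
  have ms: "(\<lambda>s. sum_list (map (mom1 n (w s)) cs)) \<in> borel_measurable borel" for cs
    using mm by (induction cs) auto
  have "mom1 (Suc n) (\<lambda>i. \<integral>\<^sup>+s. w s i \<partial>lborel) y
    = (\<integral>\<^sup>+l. (\<integral>\<^sup>+s. w s (y, l) + sum_list (map (mom1 n (w s)) (children (y, l))) \<partial>lborel) \<partial>life M (snd y))"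
    unfolding mom1.simps Suc[abs_def]
    by (intro nn_integral_cong) (simp add: nn_integral_add mw ms nn_integral_sum_list[symmetric] mm)
  also have "\<dots> = (\<integral>\<^sup>+s. (\<integral>\<^sup>+l. w s (y, l) + sum_list (map (mom1 n (w s)) (children (y, l))) \<partial>life M (snd y)) \<partial>lborel)"
  proof (rule LL.Fubini'[symmetric])
    have p: "(\<lambda>z. (snd z, (y, fst z))) \<in> measurable (life_space \<Otimes>\<^sub>M borel) (borel \<Otimes>\<^sub>M individual_space)"
      by measurable
    have 1: "(\<lambda>z. w (snd z) (y, fst z)) \<in> borel_measurable (life_space \<Otimes>\<^sub>M borel)"
      using measurable_compose[OF p w] by simp
    have 2: "(\<lambda>z. sum_list (map (mom1 n (w (snd z))) (children (y, fst z)))) \<in> borel_measurable (life_space \<Otimes>\<^sub>M borel)"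
    proof (rule measurable_sum_list_space[where N=newborn_space])
      have "(\<lambda>z. (snd (fst z), snd z)) \<in> measurable ((life_space \<Otimes>\<^sub>M borel) \<Otimes>\<^sub>M newborn_space) (borel \<Otimes>\<^sub>M newborn_space)" by measurable
      from measurable_compose[OF this mom1_meas_param[OF w]]
      show "(\<lambda>(p, x). mom1 n (w (snd p)) x) \<in> borel_measurable ((life_space \<Otimes>\<^sub>M borel) \<Otimes>\<^sub>M newborn_space)"
        by (simp add: split_beta')
      show "(\<lambda>p. children (y, fst p)) \<in> measurable (life_space \<Otimes>\<^sub>M borel) (list_space newborn_space)"
        by (rule measurable_compose[OF _ measurable_children]) measurable
    qed
    show "(\<lambda>(l, s). w s (y, l) + sum_list (map (mom1 n (w s)) (children (y, l)))) \<in> borel_measurable (life M (snd y) \<Otimes>\<^sub>M lborel)"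
      using borel_measurable_add[OF 1 2]
      by (simp cong: measurable_cong_sets add: sets_pair_measure_cong[OF sets_life] split_beta')
  qed
  finally show ?case by simp
qed simp

text \<open>The many-to-two bound. After \<open>branch_wt\<close> has been replaced by its
  compensator, the integral over s leaves the mean over the tree, and what remains at time s is the
  mean of \<open>eta_mean\<close> over the particles alive at s.\<close>

theorem second_moment_le:
  assumes f [measurable]: "f \<in> borel_measurable borel" and x: "x \<in> phase M"
  shows "(\<integral>\<^sup>+\<omega>. (total (alive_wt t f) \<omega>)\<^sup>2 \<partial>nbp_law M x)
    \<le> mean (\<lambda>y. (f y)\<^sup>2) t x + (\<integral>\<^sup>+s. indicator {0..t} s * mean (eta_mean (mean f (t - s))) s x \<partial>lborel)"
proof -
  note m = mean_meas[OF f]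
  note [measurable] = branch_wt_meas[OF m]
  have em: "eta_mean (mean f s) \<in> borel_measurable borel" for s
    using measurable_compose[OF _ eta_mean_meas_param[OF m], of "\<lambda>y. (s, y)" borel] by simp
  have "mom2 n (alive_wt t f) (0, x)
    \<le> mean (\<lambda>y. (f y)\<^sup>2) t x + (\<integral>\<^sup>+s. indicator {0..t} s * mean (eta_mean (mean f (t - s))) s x \<partial>lborel)" for n
  proof -
    let ?comp = "\<lambda>i. \<integral>\<^sup>+s. compensator (mean f) t s i \<partial>lborel"
    have mc: "?comp \<in> borel_measurable individual_space"
    proof -
      have "(\<lambda>z. (snd z, fst z)) \<in> measurable (individual_space \<Otimes>\<^sub>M lborel) (borel \<Otimes>\<^sub>M individual_space)" by measurable
      from measurable_compose[OF this compensator_meas[OF m]]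
      show ?thesis by (intro lborel.borel_measurable_nn_integral) (simp add: split_beta')
    qed
    have "mom2 n (alive_wt t f) (0, x) \<le> mom1 n (\<lambda>i. alive_wt t (\<lambda>y. (f y)\<^sup>2) i + branch_wt (mean f) t i) (0, x)"
      by (rule mom2_le[OF f])
    also have "\<dots> = mom1 n (alive_wt t (\<lambda>y. (f y)\<^sup>2)) (0, x) + mom1 n (branch_wt (mean f) t) (0, x)"
      by (rule mom1_add) measurable
    also have "mom1 n (branch_wt (mean f) t) (0, x) = mom1 n ?comp (0, x)"
      by (rule mom1_cong_phase) (use x mc nn_integral_life_compensator[OF m] in auto)
    also have "\<dots> = (\<integral>\<^sup>+s. mom1 n (compensator (mean f) t s) (0, x) \<partial>lborel)"
      by (rule mom1_integral[OF compensator_meas[OF m]])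
    also have "\<dots> \<le> (\<integral>\<^sup>+s. indicator {0..t} s * mean (eta_mean (mean f (t - s))) s x \<partial>lborel)"
    proof (intro nn_integral_mono)
      fix s
      show "mom1 n (compensator (mean f) t s) (0, x) \<le> indicator {0..t} s * mean (eta_mean (mean f (t - s))) s x"
      proof (cases "s \<le> t")
        case True
        then have "compensator (mean f) t s = alive_wt s (eta_mean (mean f (t - s)))"
          by (auto simp: compensator_def)
        \<comment> \<open>For s < 0 both sides are 0, since the first particle is born at time
          0.\<close>
        then show ?thesis
          using True mom1_alive_future[of s 0 n] by (cases "0 \<le> s") (auto simp: mean_def intro: mom1_le_SUP)
      next
        case False
        have "mom1 n (\<lambda>_. 0) y = 0" for y by (induction n arbitrary: y) (auto simp: sum_list_zero)
        moreover have "compensator (mean f) t s = (\<lambda>_. 0)" using False by (auto simp: compensator_def)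
        ultimately show ?thesis by simp
      qed
    qed
    also have "mom1 n (alive_wt t (\<lambda>y. (f y)\<^sup>2)) (0, x) \<le> mean (\<lambda>y. (f y)\<^sup>2) t x"
      unfolding mean_def by (rule mom1_le_SUP)
    finally show ?thesis by (simp add: add_mono)
  qed
  then show ?thesis
    by (subst nn_integral_total_square) (auto intro: SUP_least alive_wt_meas)
qed

end

section \<open>Exponential moments of the number of particles\<close>

text \<open>By convexity of the power, whose chord over [0, 1] is the right side.\<close>

lemma one_plus_power_le:
  fixes V :: real
  assumes "0 \<le> V" "V \<le> 1"
  shows "(1 + V) ^ n \<le> 1 + (2 ^ n - 1) * V"
proof (induction n)
  case (Suc n)
  have "(1 + V) ^ Suc n \<le> (1 + (2 ^ n - 1) * V) * (1 + V)"
    using Suc assms by (simp add: mult.commute mult_left_mono)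
  also have "\<dots> = 1 + V + (2 ^ n - 1) * V + (2 ^ n - 1) * (V * V)" by (simp add: algebra_simps)
  also have "\<dots> \<le> 1 + V + (2 ^ n - 1) * V + (2 ^ n - 1) * (V * 1)"
    using assms by (intro add_left_mono mult_left_mono) auto
  also have "\<dots> = 1 + (2 ^ Suc n - 1) * V" by (simp add: algebra_simps)
  finally show ?case .
qed simp

lemma nn_integral_exp_shift:
  fixes k s :: real
  assumes "0 \<le> s" "0 \<le> k"
  shows "(\<integral>\<^sup>+u. ennreal (k * exp (k * (s - u))) * indicator {0..s} u \<partial>lborel) = ennreal (exp (k * s) - 1)"
proof -
  have "(\<integral>\<^sup>+u. ennreal (k * exp (k * (s - u))) * indicator {0..s} u \<partial>lborel)
     = ennreal (- exp (k * (s - s)) - (- exp (k * (s - 0))))"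
    by (rule nn_integral_FTC_Icc[where F="\<lambda>u. - exp (k * (s - u))"])
       (use assms in \<open>auto intro!: derivative_eq_intros\<close>)
  then show ?thesis by simp
qed

lemma nat_power_le_exp:
  fixes x :: real
  assumes "0 \<le> x" "0 < m"
  shows "x ^ m \<le> real m ^ m * exp x"
proof -
  have "x / real m \<le> exp (x / real m)"
    using exp_ge_add_one_self[of "x / real m"] by linarith
  then have "(x / real m) ^ m \<le> exp (x / real m) ^ m"
    using assms by (intro power_mono) auto
  also have "\<dots> = exp x"
    using assms by (simp add: exp_of_nat_mult[symmetric])
  finally show ?thesis using assms by (simp add: power_divide field_simps)
qed

context nbp
begin

lemma alive_at_iff: "alive_at M t i \<longleftrightarrow> fst (fst i) \<le> t \<and> t < fst (fst i) + fst (snd i) \<and>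
    flow (snd (fst i)) (t - fst (fst i)) \<in> phase M"
  by (cases i rule: children.cases) (simp add: flow_def)

lemma config_at_eq: "config_at t i = flow (snd (fst i)) (t - fst (fst i))"
  by (cases i rule: children.cases) (simp add: flow_def)

lemma alive_at_pred [measurable]: "Measurable.pred individual_space (alive_at M t)"
  unfolding alive_at_iff[abs_def] by measurable

definition ext :: "(config \<Rightarrow> real) \<Rightarrow> config \<Rightarrow> ennreal" where
  "ext g y = (if y \<in> phase M then ennreal (g y) else 0)"

lemma ext_meas:
  assumes "g \<in> Linf_plus M"
  shows "ext g \<in> borel_measurable borel"
proof -
  have "(\<lambda>x. if x \<in> phase M then g x else 0) \<in> borel_measurable borel"
    using assms by (intro borel_measurable_extend) (simp add: Linf_plus_def)
  then have "(\<lambda>x. ennreal (if x \<in> phase M then g x else 0)) \<in> borel_measurable borel" by measurable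
  also have "(\<lambda>x. ennreal (if x \<in> phase M then g x else 0)) = ext g" by (auto simp: ext_def)
  finally show ?thesis .
qed

lemma alive_wt_ext: "alive_wt t (ext g) i = (if alive_at M t i then ennreal (g (config_at t i)) else 0)"
  by (simp add: alive_wt_def ext_def alive_at_iff config_at_eq)

abbreviation tagged :: "real \<Rightarrow> real \<Rightarrow> individual \<Rightarrow> ennreal" where
  "tagged z t i \<equiv> (if alive_at M t i then ennreal z else 1)"

text \<open>Since fission has at most \<open>nmax\<close> offspring, \<open>1 + \<delta> exp (\<kappa> s)\<close> is a supersolution of the evolution
  equation of the generating function at \<open>1 + \<delta>\<close> as long as \<open>\<delta> exp (\<kappa> s) \<le> 1\<close>.\<close>

lemma pgf_le:
  fixes T t :: real
  defines "\<kappa> \<equiv> 2 * cb * 2 ^ nmax" and "\<delta> \<equiv> exp (- (2 * cb * 2 ^ nmax * T))"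
  defines "V \<equiv> \<lambda>b. if b \<le> t then \<delta> * exp (\<kappa> * (t - b)) else 0"
  assumes "snd y \<in> phase M" "t - fst y \<le> T"
  shows "pgf n (tagged (1 + \<delta>) t) y \<le> ennreal (1 + V (fst y))"
  using assms(4,5)
proof (induction n arbitrary: y)
  case (Suc n)
  have \<kappa>: "0 \<le> \<kappa>" using cb_nonneg by (simp add: \<kappa>_def)
  have \<delta>: "0 < \<delta>" by (simp add: \<delta>_def)
  \<comment> \<open>The choice of \<delta> keeps V below 1 up to the horizon T, the range in which
    \<open>one_plus_power_le\<close> applies. In \<kappa>, the bound 2 * cb of the total rate meets
    the factor 2 ^ nmax of that linearisation.\<close>
  have V01: "0 \<le> V b" "V b \<le> 1" if "t - b \<le> T" for b
  proof -
    have "\<delta> * exp (\<kappa> * (t - b)) = exp (\<kappa> * (t - b - T))"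
      by (simp add: \<delta>_def \<kappa>_def exp_add[symmetric] algebra_simps)
    also have "\<dots> \<le> 1" using \<kappa> that by (simp add: mult_le_0_iff)
    finally show "V b \<le> 1" by (simp add: V_def)
    show "0 \<le> V b" using \<delta> by (simp add: V_def)
  qed
  obtain b x where y: "y = (b, x)" by (cases y)
  have x: "x \<in> phase M" and bT: "t - b \<le> T" using Suc.prems by (auto simp: y)
  let ?Z = "tagged (1 + \<delta>) t"
  have prod: "prod_list (map (pgf n ?Z) (children (y, (\<tau>, ws)))) \<le> ennreal ((1 + V (b + \<tau>)) ^ length ws)"
    if l: "good_life x (\<tau>, ws)" for \<tau> ws
  proof -
    have "0 \<le> \<tau>" using l by (simp add: good_life_def)
    then have bt: "t - (b + \<tau>) \<le> T" using bT by simp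
    have "prod_list (map (pgf n ?Z) (children (y, (\<tau>, ws))))
       \<le> prod_list (map (\<lambda>_. ennreal (1 + V (b + \<tau>))) (children (y, (\<tau>, ws))))"
    proof (rule prod_list_mono')
      fix c assume c: "c \<in> set (children (y, (\<tau>, ws)))"
      note c' = children_after[OF l c[unfolded y]]
      show "pgf n ?Z c \<le> ennreal (1 + V (b + \<tau>))"
        using Suc.IH[of c] c' bt by simp
    qed
    also have "\<dots> = ennreal (1 + V (b + \<tau>)) ^ length ws"
      by (simp add: map_replicate_const children_eq)
    also have "\<dots> = ennreal ((1 + V (b + \<tau>)) ^ length ws)"
      using V01(1)[OF bt] by (intro ennreal_power) simp
    finally show ?thesis .
  qed
  show ?case
  proof (cases "b \<le> t")
    case False
    have "pgf (Suc n) ?Z y \<le> (\<integral>\<^sup>+l. 1 \<partial>life M (snd y))"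
      unfolding pgf.simps
    proof (rule nn_integral_life_mono_good)
      fix l assume l: "good_life (snd y) l"
      obtain \<tau> ws where lt: "l = (\<tau>, ws)" by (cases l)
      have "0 \<le> \<tau>" using l by (simp add: good_life_def lt)
      then show "?Z (y, l) * prod_list (map (pgf n ?Z) (children (y, l))) \<le> 1"
        using prod[of \<tau> ws] l False by (simp add: y lt alive_at_iff V_def)
    qed
    then show ?thesis using False by (simp add: V_def y)
  next
    case True
    define s where "s = t - b"
    have "0 \<le> s" using True by (simp add: s_def)
    \<comment> \<open>Bounds the excess over 1 + \<delta> caused by the children; it vanishes for
      lives that end without children or after t.\<close>
    define G where "G l = (if snd l \<noteq> [] \<and> 0 \<le> fst l \<and> b + fst l \<le> t then ennreal (2 ^ nmax * V (b + fst l)) else 0)"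
      for l :: "real \<times> r3 list"
    have [measurable]: "V \<in> borel_measurable borel" unfolding V_def by measurable
    have [measurable]: "Measurable.pred (list_space (borel :: r3 measure)) (\<lambda>ws. ws = [])"
      using sets_list_space_Nil[of "borel :: r3 measure"] by (simp add: pred_def)
    have [measurable]: "G \<in> borel_measurable life_space" unfolding G_def by measurable
    have "pgf (Suc n) ?Z y \<le> (\<integral>\<^sup>+l. ennreal (1 + \<delta>) + G l \<partial>life M (snd y))"
      unfolding pgf.simps
    proof (rule nn_integral_life_mono_good)
      fix l assume l': "good_life (snd y) l"
      obtain \<tau> ws where lt: "l = (\<tau>, ws)" by (cases l)
      have l: "good_life x (\<tau>, ws)" using l' by (simp add: y lt)
      then have \<tau>: "0 \<le> \<tau>" "length ws \<le> nmax" by (auto simp: good_life_def)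
      have 1: "1 \<le> ennreal (1 + \<delta>)" using \<delta> by simp
      show "?Z (y, l) * prod_list (map (pgf n ?Z) (children (y, l))) \<le> ennreal (1 + \<delta>) + G l"
      proof (cases "t < b + \<tau>")
        case True
        have "prod_list (map (pgf n ?Z) (children (y, l))) \<le> 1"
          using prod[OF l] True by (simp add: V_def lt)
        then have "?Z (y, l) * prod_list (map (pgf n ?Z) (children (y, l))) \<le> ennreal (1 + \<delta>) * 1"
          using 1 by (intro mult_mono) auto
        then show ?thesis by (simp add: add_increasing2)
      next
        case False
        then have Z: "?Z (y, l) = 1" by (simp add: alive_at_iff y lt)
        have Vb: "0 \<le> V (b + \<tau>)" "V (b + \<tau>) \<le> 1" using V01[of "b + \<tau>"] bT \<tau> by auto
        show ?thesis
        proof (cases "ws = []")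
          case True
          then show ?thesis using 1 unfolding Z by (simp add: lt children_eq add_increasing2)
        next
          case ws: False
          have "(1 + V (b + \<tau>)) ^ length ws \<le> (1 + V (b + \<tau>)) ^ nmax"
            using Vb \<tau> by (intro power_increasing) auto
          also have "\<dots> \<le> 1 + (2 ^ nmax - 1) * V (b + \<tau>)" by (rule one_plus_power_le[OF Vb])
          also have "\<dots> \<le> (1 + \<delta>) + 2 ^ nmax * V (b + \<tau>)" using Vb \<delta> by (simp add: algebra_simps)
          finally have "ennreal ((1 + V (b + \<tau>)) ^ length ws) \<le> ennreal ((1 + \<delta>) + 2 ^ nmax * V (b + \<tau>))"
            by (rule ennreal_leI)
          also have "\<dots> = ennreal (1 + \<delta>) + ennreal (2 ^ nmax * V (b + \<tau>))"
            using Vb \<delta> by (intro ennreal_plus) auto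
          also have "ennreal (2 ^ nmax * V (b + \<tau>)) = G l" using ws False \<tau> by (simp add: G_def lt)
          finally show ?thesis using prod[OF l] unfolding Z by (simp add: lt)
        qed
      qed
    qed
    also have "\<dots> = ennreal (1 + \<delta>) + (\<integral>\<^sup>+l. G l \<partial>life M x)"
      by (subst nn_integral_add) (simp_all add: measurable_cong_sets[OF sets_life refl] y)
    also have "(\<integral>\<^sup>+l. G l \<partial>life M x) \<le> ennreal (\<delta> * (exp (\<kappa> * s) - 1))"
    proof -
      have "(\<integral>\<^sup>+l. G l \<partial>life M x) = ennreal (exp (- cum x (exit_at x))) * G (exit_at x, []) +
        (\<integral>\<^sup>+u. indicator {0..} u * ennreal (exp (- cum x u)) *
        (ennreal (rate_s (flow x u)) * (\<integral>\<^sup>+w. G (u, [w]) \<partial>scatter_law (flow x u)) +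
         ennreal (rate_f (flow x u)) * (\<integral>\<^sup>+ws. G (u, ws) \<partial>offspring_law (flow x u))) \<partial>lborel)"
        by (rule nn_integral_life[OF x]) measurable
      also have "\<dots> \<le> 0 + (\<integral>\<^sup>+u. ennreal \<delta> * (ennreal (\<kappa> * exp (\<kappa> * (s - u))) * indicator {0..s} u) \<partial>lborel)"
      proof (intro add_mono nn_integral_mono)
        fix u
        interpret C: bounded_rate "\<lambda>s. rate_s (flow x s) + rate_f (flow x s)" "2 * cb" by (rule bounded_rate_flow)
        let ?g = "indicator {0..s} u * ennreal (2 ^ nmax * (\<delta> * exp (\<kappa> * (s - u))))"
        have G: "G (u, ws) \<le> ?g" for ws
          by (auto simp: G_def V_def s_def algebra_simps split: split_indicator)
        have "(\<integral>\<^sup>+w. G (u, [w]) \<partial>scatter_law (flow x u)) \<le> (\<integral>\<^sup>+w. ?g \<partial>scatter_law (flow x u))"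
          by (intro nn_integral_mono G)
        then have 1: "(\<integral>\<^sup>+w. G (u, [w]) \<partial>scatter_law (flow x u)) \<le> ?g"
          by (simp add: prob_space.emeasure_space_1[OF prob_space_scatter_law])
        have "(\<integral>\<^sup>+w. G (u, w) \<partial>offspring_law (flow x u)) \<le> (\<integral>\<^sup>+w. ?g \<partial>offspring_law (flow x u))"
          by (intro nn_integral_mono G)
        then have 2: "(\<integral>\<^sup>+w. G (u, w) \<partial>offspring_law (flow x u)) \<le> ?g"
          by (simp add: prob_space.emeasure_space_1[OF prob_space_offspring_law])
        have e1: "ennreal (exp (- cum x u)) \<le> 1"
          using C.F_nonneg[of u] by (simp add: cum_eq_F)
        have "indicator {0..} u * ennreal (exp (- cum x u)) *
          (ennreal (rate_s (flow x u)) * (\<integral>\<^sup>+w. G (u, [w]) \<partial>scatter_law (flow x u)) +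
           ennreal (rate_f (flow x u)) * (\<integral>\<^sup>+ws. G (u, ws) \<partial>offspring_law (flow x u)))
          \<le> 1 * 1 * (ennreal cb * ?g + ennreal cb * ?g)"
          using rate_bounds[of "flow x u"] e1 1 2
          by (intro mult_mono add_mono ennreal_leI) (auto simp: indicator_def)
        also have "\<dots> = ennreal \<delta> * (ennreal (\<kappa> * exp (\<kappa> * (s - u))) * indicator {0..s} u)"
          using \<delta> cb_nonneg
          by (auto simp: ennreal_mult[symmetric] ennreal_plus[symmetric] \<kappa>_def algebra_simps simp del: ennreal_plus split: split_indicator)
        finally show "indicator {0..} u * ennreal (exp (- cum x u)) *
          (ennreal (rate_s (flow x u)) * (\<integral>\<^sup>+w. G (u, [w]) \<partial>scatter_law (flow x u)) +
           ennreal (rate_f (flow x u)) * (\<integral>\<^sup>+ws. G (u, ws) \<partial>offspring_law (flow x u)))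
          \<le> ennreal \<delta> * (ennreal (\<kappa> * exp (\<kappa> * (s - u))) * indicator {0..s} u)" .
      qed (simp add: G_def)
      also have "\<dots> = ennreal \<delta> * ennreal (exp (\<kappa> * s) - 1)"
        by (simp add: nn_integral_cmult nn_integral_exp_shift[OF \<open>0 \<le> s\<close> \<kappa>])
      also have "\<dots> = ennreal (\<delta> * (exp (\<kappa> * s) - 1))"
        using \<delta> \<kappa> \<open>0 \<le> s\<close> by (intro ennreal_mult[symmetric]) auto
      finally show ?thesis .
    qed
    also have "ennreal (1 + \<delta>) + ennreal (\<delta> * (exp (\<kappa> * s) - 1)) = ennreal (1 + V b)"
    proof -
      have "0 \<le> exp (\<kappa> * s) - 1" using \<kappa> \<open>0 \<le> s\<close> by simp
      then have "ennreal (1 + \<delta>) + ennreal (\<delta> * (exp (\<kappa> * s) - 1)) = ennreal ((1 + \<delta>) + \<delta> * (exp (\<kappa> * s) - 1))"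
        using \<delta> by (intro ennreal_plus[symmetric]) simp_all
      also have "(1 + \<delta>) + \<delta> * (exp (\<kappa> * s) - 1) = 1 + V b"
        using True by (simp add: V_def s_def right_diff_distrib)
      finally show ?thesis .
    qed
    finally show ?thesis by (simp add: y add_left_mono)
  qed
qed (use cb_nonneg in \<open>auto simp: V_def \<delta>_def\<close>)

section \<open>The point process as a functional of the family tree\<close>

definition n_alive :: "real \<Rightarrow> genealogy \<Rightarrow> nat \<Rightarrow> nat" where
  "n_alive t \<omega> n = length (filter (alive_at M t) (\<omega> n))"

lemma prod_tagged:
  assumes "0 \<le> z"
  shows "(\<Prod>i<n. prod_list (map (tagged z t) (\<omega> i))) = ennreal (z ^ (\<Sum>i<n. n_alive t \<omega> i))"
proof -
  have "prod_list (map (tagged z t) ys) = ennreal (z ^ length (filter (alive_at M t) ys))" for ys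
    using assms by (induction ys) (auto simp: ennreal_mult)
  then show ?thesis
    using assms by (induction n) (auto simp: n_alive_def power_add ennreal_mult mult.commute)
qed

lemma card_alive_generation: "card {i. i < length (\<omega> n) \<and> alive_at M t (\<omega> n ! i)} = n_alive t \<omega> n"
  by (simp add: n_alive_def length_filter_conv_card)

lemma total_ext:
  "sum_list (map (alive_wt t (ext g)) (\<omega> n))
    = (\<Sum>i\<in>{i. i < length (\<omega> n) \<and> alive_at M t (\<omega> n ! i)}. ennreal (g (config_at t (\<omega> n ! i))))"
proof -
  have "sum_list (map (alive_wt t (ext g)) (\<omega> n))
    = (\<Sum>i<length (\<omega> n). if alive_at M t (\<omega> n ! i) then ennreal (g (config_at t (\<omega> n ! i))) else 0)"
    by (simp add: sum_list_sum_nth atLeast0LessThan alive_wt_ext)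
  also have "\<dots> = (\<Sum>i\<in>{i. i < length (\<omega> n) \<and> alive_at M t (\<omega> n ! i)}. ennreal (g (config_at t (\<omega> n ! i))))"
    by (subst sum.inter_filter[symmetric]) (auto intro!: sum.cong)
  finally show ?thesis .
qed

lemma total_ext_one: "total (alive_wt t (ext (\<lambda>_. 1))) \<omega> = (\<Sum>n. ennreal (real (n_alive t \<omega> n)))"
  unfolding total_def total_ext by (simp add: card_alive_generation ennreal_of_nat_eq_real_of_nat)

text \<open>The total is a series of integers over the generations. If it converges, all but
  finitely many terms are 0, and each generation is a finite list.\<close>

lemma finite_aliveI:
  assumes "total (alive_wt t (ext (\<lambda>_. 1))) \<omega> < \<infinity>"
  shows "finite (alive M t \<omega>)"
proof -
  have "summable (\<lambda>n. real (n_alive t \<omega> n))"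
    using assms unfolding total_ext_one by (intro summable_suminf_not_top) auto
  then have "(\<lambda>n. real (n_alive t \<omega> n)) \<longlonglongrightarrow> 0" by (rule summable_LIMSEQ_zero)
  then have "\<forall>\<^sub>F n in sequentially. real (n_alive t \<omega> n) < 1" by (rule order_tendstoD) simp
  then obtain n0 where n0: "\<And>n. n \<ge> n0 \<Longrightarrow> n_alive t \<omega> n = 0"
    by (auto simp: eventually_sequentially)
  have "alive M t \<omega> \<subseteq> Sigma {..<n0} (\<lambda>n. {i. i < length (\<omega> n) \<and> alive_at M t (\<omega> n ! i)})"
  proof
    fix p assume p: "p \<in> alive M t \<omega>"
    then have "card {i. i < length (\<omega> (fst p)) \<and> alive_at M t (\<omega> (fst p) ! i)} > 0"
      by (subst card_gt_0_iff) (auto simp: alive_def)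
    then have "n_alive t \<omega> (fst p) \<noteq> 0" by (simp add: card_alive_generation)
    then have "fst p < n0" using n0[of "fst p"] by (rule_tac ccontr) simp
    then show "p \<in> Sigma {..<n0} (\<lambda>n. {i. i < length (\<omega> n) \<and> alive_at M t (\<omega> n ! i)})"
      using p by (auto simp: alive_def)
  qed
  then show ?thesis by (rule finite_subset) auto
qed

lemma X_pairing_finite:
  assumes fin: "finite (alive M t \<omega>)"
  shows "X_pairing M g t \<omega> = (\<Sum>(n, i)\<in>alive M t \<omega>. g (config_at t (\<omega> n ! i)))"
  unfolding X_pairing_def X_def
  by (simp add: sum_unfold_sum_mset image_mset.compositionality comp_def split_beta')

lemma X_pairing_infinite: "infinite (alive M t \<omega>) \<Longrightarrow> X_pairing M g t \<omega> = 0"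
  by (simp add: X_pairing_def X_def)

lemma X_pairing_nonneg:
  assumes "\<And>y. y \<in> phase M \<Longrightarrow> 0 \<le> g y"
  shows "0 \<le> X_pairing M g t \<omega>"
  by (cases "finite (alive M t \<omega>)")
     (auto simp: X_pairing_finite X_pairing_infinite alive_def alive_at_iff config_at_eq intro!: sum_nonneg assms)

lemma total_finite_alive:
  assumes fin: "finite (alive M t \<omega>)" and g: "\<And>y. y \<in> phase M \<Longrightarrow> 0 \<le> g y"
  shows "total (alive_wt t (ext g)) \<omega> = ennreal (X_pairing M g t \<omega>)"
proof -
  let ?A = "\<lambda>n. {i. i < length (\<omega> n) \<and> alive_at M t (\<omega> n ! i)}"
  have "finite (fst ` alive M t \<omega>)" using fin by simp
  then obtain n0 where n0: "\<And>p. p \<in> alive M t \<omega> \<Longrightarrow> fst p < n0"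
    using finite_nat_set_iff_bounded[of "fst ` alive M t \<omega>"] by auto
  have A: "alive M t \<omega> = Sigma {..<n0} ?A"
    using n0 unfolding alive_def by fastforce
  have z: "?A n = {}" if "n0 \<le> n" for n
    using n0[of "(n, _)"] that by (force simp: alive_def)
  have "total (alive_wt t (ext g)) \<omega> = (\<Sum>n<n0. sum_list (map (alive_wt t (ext g)) (\<omega> n)))"
    unfolding total_def total_ext by (rule suminf_finite) (use z in auto)
  also have "\<dots> = (\<Sum>n<n0. \<Sum>i\<in>?A n. ennreal (g (config_at t (\<omega> n ! i))))"
    unfolding total_ext ..
  also have "\<dots> = (\<Sum>(n, i)\<in>alive M t \<omega>. ennreal (g (config_at t (\<omega> n ! i))))"
    unfolding A by (subst sum.Sigma) auto
  also have "\<dots> = ennreal (\<Sum>(n, i)\<in>alive M t \<omega>. g (config_at t (\<omega> n ! i)))"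
    unfolding split_beta'
    by (rule sum_ennreal) (auto simp: alive_def alive_at_iff config_at_eq intro!: g)
  finally show ?thesis unfolding X_pairing_finite[OF fin] .
qed

text \<open>Expresses the finiteness on which the definition of \<open>X\<close> depends by a total
  over the tree, which is known to be measurable.\<close>

lemma finite_alive_iff: "finite (alive M t \<omega>) \<longleftrightarrow> total (alive_wt t (ext (\<lambda>_. 1))) \<omega> < \<infinity>"
  using finite_aliveI total_finite_alive[of t \<omega> "\<lambda>_. 1"] by auto

lemma Linf_const [simp]: "0 \<le> c \<Longrightarrow> (\<lambda>_. c) \<in> Linf_plus M"
  by (auto simp: Linf_plus_def)

lemma Linf_nonneg: "g \<in> Linf_plus M \<Longrightarrow> y \<in> phase M \<Longrightarrow> 0 \<le> g y"
  by (auto simp: Linf_plus_def)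

lemma finite_alive_pred [measurable]: "Measurable.pred (nbp_law M x) (\<lambda>\<omega>. finite (alive M t \<omega>))"
proof -
  have [measurable]: "total (alive_wt t (ext (\<lambda>_. 1))) \<in> borel_measurable (nbp_law M x)"
    by (intro total_meas alive_wt_meas ext_meas Linf_const) simp
  show ?thesis unfolding finite_alive_iff by measurable
qed

lemma X_pairing_meas:
  assumes g: "g \<in> Linf_plus M"
  shows "X_pairing M g t \<in> borel_measurable (nbp_law M x)"
proof -
  have [measurable]: "total (alive_wt t (ext g)) \<in> borel_measurable (nbp_law M x)"
    by (intro total_meas alive_wt_meas ext_meas g)
  have "(\<lambda>\<omega>. if finite (alive M t \<omega>) then enn2real (total (alive_wt t (ext g)) \<omega>) else 0) \<in> borel_measurable (nbp_law M x)"
    by measurable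
  also have "(\<lambda>\<omega>. if finite (alive M t \<omega>) then enn2real (total (alive_wt t (ext g)) \<omega>) else 0) = X_pairing M g t"
    using Linf_nonneg[OF g] by (auto simp: fun_eq_iff total_finite_alive X_pairing_infinite X_pairing_nonneg)
  finally show ?thesis .
qed

text \<open>The powers over the first n generations increase with n, and by \<open>pgf_le\<close>
  their means stay below 1 + \<delta> exp (\<kappa> t), which is at most 2 for t \<le> T. The base
  depends on T but not on t, so the bound is uniform on [0, T]. By Bernoulli's inequality the limit
  also dominates a multiple of the number of living particles, which is therefore finite almost
  surely.\<close>

lemma exponential_moment:
  assumes x: "x \<in> phase M" and t: "0 \<le> t" "t \<le> T"
  shows "(AE \<omega> in nbp_law M x. finite (alive M t \<omega>)) \<and>
    (\<integral>\<^sup>+\<omega>. ennreal ((1 + exp (- (2 * cb * 2 ^ nmax * T))) ^ card (alive M t \<omega>)) \<partial>nbp_law M x) \<le> 2"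
proof -
  define \<delta> where "\<delta> = exp (- (2 * cb * 2 ^ nmax * T))"
  have \<delta>: "0 < \<delta>" by (simp add: \<delta>_def)
  define N where "N \<omega> n = (\<Sum>i<n. n_alive t \<omega> i)" for \<omega> n
  define S where "S \<omega> = (SUP n. ennreal ((1 + \<delta>) ^ N \<omega> n))" for \<omega>
  have tag [measurable]: "tagged (1 + \<delta>) t \<in> borel_measurable individual_space" by measurable
  have PN: "(\<Prod>i<n. prod_list (map (tagged (1 + \<delta>) t) (\<omega> i))) = ennreal ((1 + \<delta>) ^ N \<omega> n)" for \<omega> n
    using \<delta> by (subst prod_tagged) (auto simp: N_def)
  have mP: "(\<lambda>\<omega>. ennreal ((1 + \<delta>) ^ N \<omega> n)) \<in> borel_measurable (nbp_law M x)" for n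
  proof -
    have "(\<lambda>\<omega>. prod_list (map (tagged (1 + \<delta>) t) (\<omega> i))) \<in> borel_measurable (nbp_law M x)" for i
      by (rule measurable_prod_list_space'[OF tag generation_meas])
    then have "(\<lambda>\<omega>. \<Prod>i<n. prod_list (map (tagged (1 + \<delta>) t) (\<omega> i))) \<in> borel_measurable (nbp_law M x)"
      by (induction n) (auto intro!: borel_measurable_times)
    then show ?thesis by (simp only: PN)
  qed
  have inc: "incseq (\<lambda>n. ennreal ((1 + \<delta>) ^ N \<omega> n))" for \<omega>
    using \<delta> by (intro incseq_SucI ennreal_leI power_increasing) (auto simp: N_def)
  have "2 * cb * 2 ^ nmax * (t - T) \<le> 0"
    using cb_nonneg t by (intro mult_nonneg_nonpos) auto
  then have V1: "\<delta> * exp (2 * cb * 2 ^ nmax * t) \<le> 1"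
    by (simp add: \<delta>_def exp_add[symmetric] algebra_simps)
  have "(\<integral>\<^sup>+\<omega>. S \<omega> \<partial>nbp_law M x) = (SUP n. pgf n (tagged (1 + \<delta>) t) (0, x))"
    unfolding S_def nn_integral_partial_prod[OF tag, symmetric] PN
    by (rule nn_integral_monotone_convergence_SUP) (use mP incseqD[OF inc] in \<open>auto simp: incseq_def le_fun_def\<close>)
  also have "\<dots> \<le> 2"
  proof (rule SUP_least)
    fix n
    have "pgf n (tagged (1 + \<delta>) t) (0, x) \<le> ennreal (1 + \<delta> * exp (2 * cb * 2 ^ nmax * t))"
      using pgf_le[of "(0, x)" t T n] x t unfolding \<delta>_def by simp
    also have "\<dots> \<le> ennreal 2" using V1 by (intro ennreal_leI) simp
    finally show "pgf n (tagged (1 + \<delta>) t) (0, x) \<le> 2" by simp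
  qed
  finally have S2: "(\<integral>\<^sup>+\<omega>. S \<omega> \<partial>nbp_law M x) \<le> 2" .
  have mS: "S \<in> borel_measurable (nbp_law M x)" unfolding S_def[abs_def] using mP by measurable
  have tS: "ennreal \<delta> * total (alive_wt t (ext (\<lambda>_. 1))) \<omega> \<le> S \<omega>" for \<omega>
  proof -
    have "ennreal \<delta> * total (alive_wt t (ext (\<lambda>_. 1))) \<omega> = (SUP n. ennreal \<delta> * (\<Sum>i<n. ennreal (real (n_alive t \<omega> i))))"
      unfolding total_ext_one suminf_eq_SUP by (rule SUP_mult_left_ennreal)
    also have "\<dots> \<le> S \<omega>" unfolding S_def
    proof (rule SUP_mono, rule bexI)
      fix n
      have "real (N \<omega> n) * \<delta> \<le> (1 + \<delta>) ^ N \<omega> n"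
        using Bernoulli_inequality[of \<delta> "N \<omega> n"] \<delta> by simp
      then show "ennreal \<delta> * (\<Sum>i<n. ennreal (real (n_alive t \<omega> i))) \<le> ennreal ((1 + \<delta>) ^ N \<omega> n)"
        using \<delta> by (simp add: sum_ennreal ennreal_mult[symmetric] N_def mult.commute sum_nonneg ennreal_leI)
    qed simp
    finally show ?thesis .
  qed
  have "AE \<omega> in nbp_law M x. S \<omega> \<noteq> \<infinity>"
    using mS S2 by (intro nn_integral_PInf_AE) (auto simp: top_unique)
  then have fin: "AE \<omega> in nbp_law M x. finite (alive M t \<omega>)"
  proof eventually_elim
    case (elim \<omega>)
    then have "ennreal \<delta> * total (alive_wt t (ext (\<lambda>_. 1))) \<omega> < \<infinity>"
      using tS[of \<omega>] by (simp add: less_top[symmetric] top_unique) (metis top_unique)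
    then show ?case using \<delta> unfolding finite_alive_iff by (auto simp: ennreal_mult_less_top)
  qed
  have "(\<integral>\<^sup>+\<omega>. ennreal ((1 + \<delta>) ^ card (alive M t \<omega>)) \<partial>nbp_law M x) \<le> (\<integral>\<^sup>+\<omega>. S \<omega> \<partial>nbp_law M x)"
  proof (rule nn_integral_mono_AE, use fin in eventually_elim)
    case (elim \<omega>)
    let ?A = "\<lambda>n. {i. i < length (\<omega> n) \<and> alive_at M t (\<omega> n ! i)}"
    have "finite (fst ` alive M t \<omega>)" using elim by simp
    then obtain n0 where n0: "\<And>p. p \<in> alive M t \<omega> \<Longrightarrow> fst p < n0"
      using finite_nat_set_iff_bounded[of "fst ` alive M t \<omega>"] by auto
    have A: "alive M t \<omega> = Sigma {..<n0} ?A"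
      using n0 unfolding alive_def by fastforce
    have "card (alive M t \<omega>) = N \<omega> n0"
      unfolding A by (subst card_SigmaI) (auto simp: card_alive_generation N_def)
    then show ?case unfolding S_def by (auto intro: SUP_upper)
  qed
  with S2 fin show ?thesis by (auto simp: \<delta>_def)
qed

lemma AE_finite_alive: "x \<in> phase M \<Longrightarrow> 0 \<le> t \<Longrightarrow> AE \<omega> in nbp_law M x. finite (alive M t \<omega>)"
  using exponential_moment[of x t t] by simp

lemma X_pairing_le:
  assumes g: "g \<in> Linf_plus M" and H: "\<And>y. y \<in> phase M \<Longrightarrow> g y \<le> H"
  shows "X_pairing M g t \<omega> \<le> H * real (card (alive M t \<omega>))"
proof (cases "finite (alive M t \<omega>)")
  case True
  have "X_pairing M g t \<omega> \<le> real (card (alive M t \<omega>)) * H"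
    unfolding X_pairing_finite[OF True]
    by (rule sum_bounded_above) (auto simp: alive_def alive_at_iff config_at_eq intro!: H)
  then show ?thesis by (simp add: mult.commute)
qed (simp add: X_pairing_infinite)

lemma moments_bounded:
  assumes g: "g \<in> Linf_plus M" and "0 < m"
  shows "\<exists>B\<ge>0. \<forall>t x. 0 \<le> t \<longrightarrow> t \<le> T \<longrightarrow> x \<in> phase M \<longrightarrow>
     (\<integral>\<^sup>+\<omega>. ennreal (X_pairing M g t \<omega> ^ m) \<partial>nbp_law M x) \<le> ennreal B"
proof -
  define z where "z = 1 + exp (- (2 * cb * 2 ^ nmax * T))"
  have z: "1 < z" by (simp add: z_def)
  obtain H where H: "\<And>y. y \<in> phase M \<Longrightarrow> g y \<le> H" using g by (auto simp: Linf_plus_def)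
  define H' where "H' = max H 0"
  have H': "\<And>y. y \<in> phase M \<Longrightarrow> g y \<le> H'" "0 \<le> H'" using H by (auto simp: H'_def intro: max.coboundedI1)
  \<comment> \<open>Comes from x^m \<le> m^m exp x at x = n ln z, where n is the number of living
    particles: powers of n are dominated by z^n.\<close>
  define K where "K = (H' / ln z) ^ m * real m ^ m"
  have K: "0 \<le> K" using H' z by (simp add: K_def)
  have le: "X_pairing M g t \<omega> ^ m \<le> K * z ^ card (alive M t \<omega>)" for t \<omega>
  proof -
    define n where "n = card (alive M t \<omega>)"
    have lnz: "0 < ln z" using z by simp
    have "X_pairing M g t \<omega> ^ m \<le> (H' * real n) ^ m"
      unfolding n_def using X_pairing_le[OF g H'(1)] X_pairing_nonneg[of g] Linf_nonneg[OF g] by (intro power_mono) auto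
    also have "\<dots> = (H' / ln z) ^ m * (real n * ln z) ^ m"
      using lnz by (simp add: power_mult_distrib power_divide)
    also have "\<dots> \<le> (H' / ln z) ^ m * (real m ^ m * exp (real n * ln z))"
      using lnz H' \<open>0 < m\<close> by (intro mult_left_mono nat_power_le_exp) auto
    also have "exp (real n * ln z) = z ^ n" using z by (simp add: exp_of_nat_mult)
    finally show ?thesis by (simp add: K_def n_def mult.assoc)
  qed
  show ?thesis
  proof (intro exI[of _ "2 * K"] conjI allI impI)
    fix t x assume "0 \<le> t" "t \<le> T" "x \<in> phase M"
    from exponential_moment[OF this(3,1,2)]
    have z2: "(\<integral>\<^sup>+\<omega>. ennreal (z ^ card (alive M t \<omega>)) \<partial>nbp_law M x) \<le> 2" by (simp add: z_def)
    have [measurable]: "Measurable.pred (nbp_law M x) (\<lambda>\<omega>. finite (alive M t \<omega>))" by measurable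
    \<comment> \<open>The number of living particles is replaced by the pairing of the constant 1
      with X, whose measurability is known.\<close>
    have X1: "AE \<omega> in nbp_law M x. real (card (alive M t \<omega>)) = X_pairing M (\<lambda>_. 1) t \<omega>"
      using AE_finite_alive[OF \<open>x \<in> phase M\<close> \<open>0 \<le> t\<close>] by eventually_elim (simp add: X_pairing_finite)
    have zm: "(\<lambda>\<omega>. ennreal (z powr X_pairing M (\<lambda>_. 1) t \<omega>)) \<in> borel_measurable (nbp_law M x)"
      using X_pairing_meas[OF Linf_const, of 1 t x] by measurable
    have "(\<integral>\<^sup>+\<omega>. ennreal (X_pairing M g t \<omega> ^ m) \<partial>nbp_law M x) \<le> (\<integral>\<^sup>+\<omega>. ennreal K * ennreal (z powr X_pairing M (\<lambda>_. 1) t \<omega>) \<partial>nbp_law M x)"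
    proof (rule nn_integral_mono_AE, use X1 in eventually_elim)
      case (elim \<omega>)
      have "X_pairing M g t \<omega> ^ m \<le> K * z powr X_pairing M (\<lambda>_. 1) t \<omega>"
        using le[of t \<omega>] z unfolding elim[symmetric] by (simp add: powr_realpow)
      then show ?case using K by (simp add: ennreal_mult[symmetric] ennreal_leI)
    qed
    also have "\<dots> = ennreal K * (\<integral>\<^sup>+\<omega>. ennreal (z powr X_pairing M (\<lambda>_. 1) t \<omega>) \<partial>nbp_law M x)"
      by (rule nn_integral_cmult[OF zm])
    also have "(\<integral>\<^sup>+\<omega>. ennreal (z powr X_pairing M (\<lambda>_. 1) t \<omega>) \<partial>nbp_law M x) = (\<integral>\<^sup>+\<omega>. ennreal (z ^ card (alive M t \<omega>)) \<partial>nbp_law M x)"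
    proof (rule nn_integral_cong_AE, use X1 in eventually_elim)
      case (elim \<omega>)
      show ?case using z unfolding elim[symmetric] by (simp add: powr_realpow)
    qed
    also have "ennreal K * (\<integral>\<^sup>+\<omega>. ennreal (z ^ card (alive M t \<omega>)) \<partial>nbp_law M x) \<le> ennreal K * 2" using z2 by (intro mult_left_mono) auto
    finally have "(\<integral>\<^sup>+\<omega>. ennreal (X_pairing M g t \<omega> ^ m) \<partial>nbp_law M x) \<le> ennreal K * 2" .
    then show "(\<integral>\<^sup>+\<omega>. ennreal (X_pairing M g t \<omega> ^ m) \<partial>nbp_law M x) \<le> ennreal (2 * K)"
      using K by (simp add: ennreal_mult mult.commute)
  qed (use K in simp)
qed

section \<open>The semigroup\<close>

lemma Linf_bound:
  assumes "g \<in> Linf_plus M"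
  obtains H where "0 \<le> H" "\<And>y. y \<in> phase M \<Longrightarrow> g y \<le> H"
proof -
  obtain H where "\<And>y. y \<in> phase M \<Longrightarrow> g y \<le> H" using assms by (auto simp: Linf_plus_def)
  then have "\<And>y. y \<in> phase M \<Longrightarrow> g y \<le> max H 0" by (auto intro: max.coboundedI1)
  then show ?thesis using that[of "max H 0"] by simp
qed

text \<open>\<open>psi\<close> is a Bochner integral and would be 0 if the integral diverged. The
  bounded first moment identifies it with the mean over the tree in [0, \<infinity>], for which the
  recursions were proved.\<close>

lemma psi_props:
  assumes g: "g \<in> Linf_plus M" and x: "x \<in> phase M" and t: "0 \<le> t"
  shows "integrable (nbp_law M x) (X_pairing M g t)" "mean (ext g) t x = ennreal (psi M t g x)" "0 \<le> psi M t g x"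
    "(\<integral>\<^sup>+\<omega>. ennreal (X_pairing M g t \<omega>) \<partial>nbp_law M x) = ennreal (psi M t g x)"
proof -
  have nn: "0 \<le> X_pairing M g t \<omega>" for \<omega> using Linf_nonneg[OF g] by (rule X_pairing_nonneg)
  note [measurable] = X_pairing_meas[OF g]
  obtain B where "(\<integral>\<^sup>+\<omega>. ennreal (X_pairing M g t \<omega> ^ 1) \<partial>nbp_law M x) \<le> ennreal B"
    using moments_bounded[OF g zero_less_one, of t] x t by blast
  then have "(\<integral>\<^sup>+\<omega>. ennreal (X_pairing M g t \<omega>) \<partial>nbp_law M x) \<le> ennreal B" by simp
  also have "\<dots> < \<infinity>" by simp
  finally have "(\<integral>\<^sup>+\<omega>. ennreal (X_pairing M g t \<omega>) \<partial>nbp_law M x) < \<infinity>" .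
  then show int: "integrable (nbp_law M x) (X_pairing M g t)"
    by (intro integrableI_nonneg) (auto simp: nn)
  show "0 \<le> psi M t g x" unfolding psi_def by (intro Bochner_Integration.integral_nonneg nn)
  show *: "(\<integral>\<^sup>+\<omega>. ennreal (X_pairing M g t \<omega>) \<partial>nbp_law M x) = ennreal (psi M t g x)"
    unfolding psi_def by (rule nn_integral_eq_integral[OF int]) (simp add: nn)
  have "mean (ext g) t x = (\<integral>\<^sup>+\<omega>. total (alive_wt t (ext g)) \<omega> \<partial>nbp_law M x)"
    by (rule mean_total[OF ext_meas[OF g]])
  also have "\<dots> = (\<integral>\<^sup>+\<omega>. ennreal (X_pairing M g t \<omega>) \<partial>nbp_law M x)"
    using AE_finite_alive[OF x t]
    by (intro nn_integral_cong_AE, eventually_elim) (simp add: total_finite_alive Linf_nonneg[OF g])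
  finally show "mean (ext g) t x = ennreal (psi M t g x)" using * by simp
qed

lemma psi_bounded:
  assumes g: "g \<in> Linf_plus M"
  shows "\<exists>B\<ge>0. \<forall>t x. 0 \<le> t \<longrightarrow> t \<le> T \<longrightarrow> x \<in> phase M \<longrightarrow> psi M t g x \<le> B"
proof -
  obtain B where B: "0 \<le> B" "\<And>t x. 0 \<le> t \<Longrightarrow> t \<le> T \<Longrightarrow> x \<in> phase M \<Longrightarrow>
     (\<integral>\<^sup>+\<omega>. ennreal (X_pairing M g t \<omega> ^ 1) \<partial>nbp_law M x) \<le> ennreal B"
    using moments_bounded[OF g, of 1 T] by auto
  have "psi M t g x \<le> B" if "0 \<le> t" "t \<le> T" "x \<in> phase M" for t x
    using B(2)[OF that] psi_props(4)[OF g that(3,1)] B(1) by simp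
  then show ?thesis using B(1) by blast
qed

lemma psi_mono:
  assumes g: "g \<in> Linf_plus M" and h: "h \<in> Linf_plus M" and x: "x \<in> phase M" and t: "0 \<le> t"
    and le: "\<And>y. y \<in> phase M \<Longrightarrow> g y \<le> h y"
  shows "psi M t g x \<le> psi M t h x"
  unfolding psi_def
proof (rule integral_mono[OF psi_props(1)[OF g x t] psi_props(1)[OF h x t]])
  fix \<omega>
  show "X_pairing M g t \<omega> \<le> X_pairing M h t \<omega>"
    by (cases "finite (alive M t \<omega>)")
       (auto simp: X_pairing_finite X_pairing_infinite alive_def alive_at_iff config_at_eq intro!: sum_mono le)
qed

lemma psi_scale: "psi M t (\<lambda>y. c * g y) x = c * psi M t g x"
proof -
  have "X_pairing M (\<lambda>y. c * g y) t \<omega> = c * X_pairing M g t \<omega>" for \<omega>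
    by (simp add: X_pairing_def sum_mset_distrib_left)
  then show ?thesis by (simp add: psi_def)
qed

lemma Linf_plusI:
  assumes "f \<in> borel_measurable borel" "\<And>y. y \<in> phase M \<Longrightarrow> f y = ennreal (h y)"
    "\<And>y. y \<in> phase M \<Longrightarrow> 0 \<le> h y" "\<And>y. y \<in> phase M \<Longrightarrow> h y \<le> c"
  shows "h \<in> Linf_plus M"
proof -
  have "(\<lambda>y. enn2real (f y)) \<in> borel_measurable (restrict_space borel (phase M))"
    using assms(1) by (intro measurable_restrict_space1) measurable
  then have "h \<in> borel_measurable (restrict_space borel (phase M))"
    by (rule measurable_cong[THEN iffD1, rotated]) (use assms in \<open>auto simp: space_restrict_space\<close>)
  then show ?thesis using assms(3,4) unfolding Linf_plus_def by blast
qed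

lemma mean_ext_meas:
  assumes g: "g \<in> Linf_plus M"
  shows "(\<lambda>(s, x). mean (ext g) s x) \<in> borel_measurable (borel \<Otimes>\<^sub>M borel)"
  by (rule mean_meas[OF ext_meas[OF g]])

lemma psi_Linf:
  assumes g: "g \<in> Linf_plus M" and t: "0 \<le> t"
  shows "psi M t g \<in> Linf_plus M"
proof -
  obtain B where "\<And>x. x \<in> phase M \<Longrightarrow> psi M t g x \<le> B"
    using psi_bounded[OF g, of t] t by blast
  moreover have "mean (ext g) t \<in> borel_measurable borel"
    using measurable_compose[OF _ mean_ext_meas[OF g], of "\<lambda>x. (t, x)" borel] by simp
  ultimately show ?thesis
    using psi_props[OF g _ t] by (intro Linf_plusI[of "mean (ext g) t" _ B]) auto
qed

text \<open>The integral in \<open>C2\<close> requires measurability in time. At times s \<ge> 0,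
  \<open>psi\<close> coincides with a mean that is jointly measurable in time and space; the
  indicator restricts the claim to these times.\<close>

lemma psi_time_meas:
  assumes g: "g \<in> Linf_plus M" and x: "x \<in> phase M"
  shows "(\<lambda>s. indicator {0..} s * psi M s g x) \<in> borel_measurable borel"
proof -
  have [measurable]: "(\<lambda>s. mean (ext g) s x) \<in> borel_measurable borel"
    using measurable_compose[OF _ mean_ext_meas[OF g], of "\<lambda>s. (s, x)" borel] by simp
  have "(\<lambda>s. indicator {0..} s * enn2real (mean (ext g) s x)) \<in> borel_measurable borel" by measurable
  also have "(\<lambda>s. indicator {0..} s * enn2real (mean (ext g) s x)) = (\<lambda>s. indicator {0..} s * psi M s g x)"
    using psi_props(2,3)[OF g x] by (auto simp: fun_eq_iff split: split_indicator)
  finally show ?thesis .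
qed

lemma square_Linf:
  assumes g: "g \<in> Linf_plus M"
  shows "(\<lambda>y. (g y)\<^sup>2) \<in> Linf_plus M"
proof -
  obtain H where H: "0 \<le> H" "\<And>y. y \<in> phase M \<Longrightarrow> g y \<le> H" using Linf_bound[OF g] by blast
  have "(g y)\<^sup>2 \<le> H\<^sup>2" if "y \<in> phase M" for y
    using H(2)[OF that] Linf_nonneg[OF g that] by (intro power_mono)
  moreover have "(\<lambda>y. (g y)\<^sup>2) \<in> borel_measurable (restrict_space borel (phase M))"
    using g by (auto simp: Linf_plus_def)
  ultimately show ?thesis unfolding Linf_plus_def using zero_le_power2 by blast
qed

lemma scale_Linf:
  assumes g: "g \<in> Linf_plus M" and c: "0 \<le> c"
  shows "(\<lambda>y. c * g y) \<in> Linf_plus M"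
proof -
  obtain H where H: "0 \<le> H" "\<And>y. y \<in> phase M \<Longrightarrow> g y \<le> H" using Linf_bound[OF g] by blast
  have "c * g y \<le> c * H" if "y \<in> phase M" for y
    using H(2)[OF that] c by (intro mult_left_mono)
  moreover have "0 \<le> c * g y" if "y \<in> phase M" for y
    using Linf_nonneg[OF g that] c by simp
  moreover have "(\<lambda>y. c * g y) \<in> borel_measurable (restrict_space borel (phase M))"
    using g by (auto simp: Linf_plus_def)
  ultimately show ?thesis unfolding Linf_plus_def by blast
qed

section \<open>The branching operator on bounded functions\<close>

lemma eta_props:
  assumes h: "h \<in> Linf_plus M" and y: "y \<in> phase M"
  shows "eta_mean (ext h) y = ennreal (eta_f M h y)" "0 \<le> eta_f M h y"
    "(\<And>z. z \<in> phase M \<Longrightarrow> h z \<le> H) \<Longrightarrow> eta_f M h y \<le> cb * (real nmax * H)\<^sup>2"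
proof -
  obtain r v where yr: "y = (r, v)" by (cases y)
  have rv: "r \<in> dom_D M" "v \<in> vel_V M" using y by (auto simp: yr phase_def)
  obtain H0 where H0: "0 \<le> H0" "\<And>y. y \<in> phase M \<Longrightarrow> h y \<le> H0" using Linf_bound[OF h] by blast
  let ?F = "fission_law M r v"
  interpret F: prob_space ?F using prob_space_fission_law[OF y] by (simp add: yr)
  define q where "q ws = cross_sum (map (\<lambda>w. h (r, w)) ws)" for ws
  define Q where "Q ws = cross_sum (map (\<lambda>w. ext h (r, w)) ws)" for ws
  have S: "space ?F = lists (vel_V M)"
    using sets_eq_imp_space_eq[OF sets_fission_law[OF y]] by (simp add: space_restrict_space yr)
  have mr: "(\<lambda>w. ext h (r, w)) \<in> borel_measurable borel"
    by (rule measurable_compose[OF _ ext_meas[OF h]]) (intro borel_measurable_Pair; simp)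
  have Q_meas: "Q \<in> borel_measurable (list_space borel)"
    unfolding Q_def[abs_def] by (rule measurable_cross_sum_list_space'[OF mr]) simp
  have Qq: "Q ws = ennreal (q ws)" "0 \<le> q ws" if "ws \<in> space ?F" for ws
  proof -
    have ws: "(r, w) \<in> phase M" if "w \<in> set ws" for w
      using that \<open>ws \<in> space ?F\<close> rv by (auto simp: S phase_def)
    have "Q ws = cross_sum (map ennreal (map (\<lambda>w. h (r, w)) ws))"
      unfolding Q_def using ws by (auto simp: ext_def comp_def intro!: arg_cong[where f=cross_sum])
    then show "Q ws = ennreal (q ws)" "0 \<le> q ws"
      using cross_sum_ennreal[of "map (\<lambda>w. h (r, w)) ws"] ws Linf_nonneg[OF h] by (auto simp: q_def)
  qed
  have QF: "Q \<in> borel_measurable ?F"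
    using measurable_compose[OF measurable_fission_law_ident[OF y] Q_meas] by (simp add: yr)
  have qF: "q \<in> borel_measurable ?F"
  proof -
    have "(\<lambda>ws. enn2real (Q ws)) \<in> borel_measurable ?F" using QF by measurable
    then show ?thesis by (rule measurable_cong[THEN iffD1, rotated]) (simp add: Qq)
  qed
  \<comment> \<open>A cross sum of nonnegative numbers is at most the square of their sum, which has
    at most nmax terms. This bound also provides integrability.\<close>
  have bound: "AE ws in ?F. q ws \<le> (real nmax * K)\<^sup>2" if K: "\<And>z. z \<in> phase M \<Longrightarrow> h z \<le> K" for K
    using nmax_bound[OF rv] AE_space
  proof eventually_elim
    case (elim ws)
    have ws: "(r, w) \<in> phase M" if "w \<in> set ws" for w
      using that elim rv by (auto simp: S phase_def)
    have K0: "0 \<le> K" using K[OF y] Linf_nonneg[OF h y] by simp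
    have 0: "0 \<le> sum_list (map (\<lambda>w. h (r, w)) ws)"
      using ws Linf_nonneg[OF h] by (auto intro!: sum_list_nonneg)
    have "sum_list (map (\<lambda>w. (h (r, w))\<^sup>2) ws) \<ge> 0" by (intro sum_list_nonneg) auto
    then have "q ws \<le> (sum_list (map (\<lambda>w. h (r, w)) ws))\<^sup>2"
      unfolding q_def square_sum_list by (simp add: comp_def)
    also have "\<dots> \<le> (sum_list (map (\<lambda>w. K) ws))\<^sup>2"
      using ws K 0 by (intro power_mono sum_list_mono) auto
    also have "\<dots> \<le> (real nmax * K)\<^sup>2"
      using elim K0 by (intro power_mono) (auto simp: sum_list_triv intro!: mult_right_mono)
    finally show ?case .
  qed
  have int: "integrable ?F q"
  proof (rule F.integrable_const_bound[where B="(real nmax * H0)\<^sup>2"])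
    show "AE ws in ?F. norm (q ws) \<le> (real nmax * H0)\<^sup>2"
    proof -
      have "AE ws in ?F. q ws \<le> (real nmax * H0)\<^sup>2" using H0(2) by (rule bound)
      then show ?thesis using AE_space by eventually_elim (simp add: Qq(2))
    qed
  qed (rule qF)
  have eta: "eta_f M h y = sigma_f M r v * (LINT ws|?F. q ws)"
    unfolding eta_f_def yr prod.case q_def using sum_cross_eq_cross_sum[of "\<lambda>w. h (r, w)"] by simp
  have sf: "0 \<le> sigma_f M r v" "sigma_f M r v \<le> cb" using bounded_data[OF rv] by auto
  have L0: "0 \<le> (LINT ws|?F. q ws)" by (intro integral_nonneg_AE) (auto simp: Qq(2))
  show "0 \<le> eta_f M h y" unfolding eta using sf L0 by simp
  have "eta_mean (ext h) y = ennreal (sigma_f M r v) * (\<integral>\<^sup>+ws. Q ws \<partial>distr ?F (list_space borel) (\<lambda>ws. ws))"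
    using y by (simp add: eta_mean_def rate_f_def offspring_law_def yr Q_def)
  also have "(\<integral>\<^sup>+ws. Q ws \<partial>distr ?F (list_space borel) (\<lambda>ws. ws)) = (\<integral>\<^sup>+ws. Q ws \<partial>?F)"
    using measurable_fission_law_ident[OF y] Q_meas by (subst nn_integral_distr) (auto simp: yr)
  also have "\<dots> = (\<integral>\<^sup>+ws. ennreal (q ws) \<partial>?F)" by (intro nn_integral_cong) (simp add: Qq)
  also have "\<dots> = ennreal (LINT ws|?F. q ws)"
    by (rule nn_integral_eq_integral[OF int]) (auto simp: Qq(2))
  also have "ennreal (sigma_f M r v) * \<dots> = ennreal (eta_f M h y)"
    unfolding eta using sf L0 by (simp add: ennreal_mult)
  finally show "eta_mean (ext h) y = ennreal (eta_f M h y)" .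
  show "eta_f M h y \<le> cb * (real nmax * H)\<^sup>2" if H: "\<And>z. z \<in> phase M \<Longrightarrow> h z \<le> H"
  proof -
    have "(LINT ws|?F. q ws) \<le> (LINT ws|?F. (real nmax * H)\<^sup>2)"
      using H by (intro integral_mono_AE int bound) simp_all
    then have "(LINT ws|?F. q ws) \<le> (real nmax * H)\<^sup>2" by (simp add: F.prob_space)
    then show ?thesis unfolding eta using sf L0 by (intro mult_mono) auto
  qed
qed

text \<open>Almost all offspring velocities lie in V, so only the values on the phase space
  enter.\<close>

lemma eta_mean_cong:
  assumes y: "y \<in> phase M" and eq: "\<And>z. z \<in> phase M \<Longrightarrow> m z = m' z"
  shows "eta_mean m y = eta_mean m' y"
proof -
  have "(\<integral>\<^sup>+ws. cross_sum (map (\<lambda>w. m (fst y, w)) ws) \<partial>offspring_law y)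
     = (\<integral>\<^sup>+ws. cross_sum (map (\<lambda>w. m' (fst y, w)) ws) \<partial>offspring_law y)"
  proof (rule nn_integral_cong_AE, use AE_offspring_law[OF y] in eventually_elim)
    case (elim ws)
    then have "map (\<lambda>w. m (fst y, w)) ws = map (\<lambda>w. m' (fst y, w)) ws"
      using y by (auto intro!: eq simp: phase_iff)
    then show ?case by (simp only:)
  qed
  then show ?thesis by (simp add: eta_mean_def)
qed

lemma eta_mean_psi:
  assumes g: "g \<in> Linf_plus M" and s: "0 \<le> s"
  shows "eta_mean (mean (ext g) s) = ext (eta_f M (psi M s g))"
proof
  fix y
  show "eta_mean (mean (ext g) s) y = ext (eta_f M (psi M s g)) y"
  proof (cases "y \<in> phase M")
    case True
    have "eta_mean (mean (ext g) s) y = eta_mean (ext (psi M s g)) y"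
      by (rule eta_mean_cong[OF True]) (simp add: psi_props(2)[OF g _ s] ext_def)
    then show ?thesis using True eta_props(1)[OF psi_Linf[OF g s] True] by (simp add: ext_def)
  qed (simp add: eta_mean_outside ext_def)
qed

lemma eta_Linf:
  assumes h: "h \<in> Linf_plus M"
  shows "eta_f M h \<in> Linf_plus M"
proof -
  obtain H where H: "0 \<le> H" "\<And>y. y \<in> phase M \<Longrightarrow> h y \<le> H" using Linf_bound[OF h] by blast
  have "(\<lambda>(s::real, x). ext h x) \<in> borel_measurable (borel \<Otimes>\<^sub>M borel)" using ext_meas[OF h] by measurable
  from measurable_compose[OF _ eta_mean_meas_param[OF this], of "\<lambda>y. (0, y)" borel]
  have "eta_mean (ext h) \<in> borel_measurable borel" by simp
  moreover have "eta_f M h y \<le> cb * (real nmax * H)\<^sup>2" if "y \<in> phase M" for y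
    using eta_props(3)[OF h that] H(2) by blast
  ultimately show ?thesis using eta_props(1,2)[OF h] by (intro Linf_plusI[of "eta_mean (ext h)"])
qed

text \<open>The comparison is made in [0, \<infinity>], where monotonicity of the integral asks for
  no integrability.\<close>

lemma eta_mono:
  assumes g: "g \<in> Linf_plus M" and h: "h \<in> Linf_plus M" and y: "y \<in> phase M"
    and le: "\<And>z. z \<in> phase M \<Longrightarrow> g z \<le> h z"
  shows "eta_f M g y \<le> eta_f M h y"
proof -
  have "eta_mean (ext g) y \<le> eta_mean (ext h) y"
    unfolding eta_mean_def
    by (intro mult_left_mono nn_integral_mono cross_sum_map_mono) (auto simp: ext_def intro!: ennreal_leI le)
  then show ?thesis using eta_props(1,2)[OF g y] eta_props(1,2)[OF h y] by simp
qed

lemma cross_sum_scale: "cross_sum (map (\<lambda>w. c * f w) ws) = (c::real)\<^sup>2 * cross_sum (map f ws)"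
  by (induction ws) (simp_all add: sum_list_const_mult power2_eq_square algebra_simps)

lemma eta_scale: "eta_f M (\<lambda>y. c * f y) y = c\<^sup>2 * eta_f M f y"
  by (cases y) (simp add: eta_f_def sum_cross_eq_cross_sum[of "\<lambda>w. c * f (_, w)"] sum_cross_eq_cross_sum[of "\<lambda>w. f (_, w)"] cross_sum_scale)

text \<open>With bounded g all means are finite, so the many-to-two bound may be read in terms of
  \<open>psi\<close> and \<open>eta_f\<close>.\<close>

theorem second_moment:
  assumes g: "g \<in> Linf_plus M" and x: "x \<in> phase M" and t: "0 \<le> t"
  shows "(\<integral>\<^sup>+\<omega>. ennreal ((X_pairing M g t \<omega>)\<^sup>2) \<partial>nbp_law M x)
    \<le> ennreal (psi M t (\<lambda>y. (g y)\<^sup>2) x)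
      + (\<integral>\<^sup>+s. indicator {0..t} s * ennreal (psi M s (eta_f M (psi M (t - s) g)) x) \<partial>lborel)"
proof -
  have "(\<integral>\<^sup>+\<omega>. ennreal ((X_pairing M g t \<omega>)\<^sup>2) \<partial>nbp_law M x) = (\<integral>\<^sup>+\<omega>. (total (alive_wt t (ext g)) \<omega>)\<^sup>2 \<partial>nbp_law M x)"
    using AE_finite_alive[OF x t]
  proof (intro nn_integral_cong_AE, eventually_elim)
    case (elim \<omega>)
    then show ?case
      using X_pairing_nonneg[of g t \<omega>] Linf_nonneg[OF g] by (simp add: total_finite_alive ennreal_power)
  qed
  also have "\<dots> \<le> mean (\<lambda>y. (ext g y)\<^sup>2) t x
     + (\<integral>\<^sup>+s. indicator {0..t} s * mean (eta_mean (mean (ext g) (t - s))) s x \<partial>lborel)"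
    by (rule second_moment_le[OF ext_meas[OF g] x])
  also have "(\<lambda>y. (ext g y)\<^sup>2) = ext (\<lambda>y. (g y)\<^sup>2)"
    using Linf_nonneg[OF g] by (auto simp: ext_def fun_eq_iff ennreal_power)
  also have "mean (ext (\<lambda>y. (g y)\<^sup>2)) t x = ennreal (psi M t (\<lambda>y. (g y)\<^sup>2) x)"
    by (rule psi_props(2)[OF square_Linf[OF g] x t])
  also have "(\<integral>\<^sup>+s. indicator {0..t} s * mean (eta_mean (mean (ext g) (t - s))) s x \<partial>lborel)
     = (\<integral>\<^sup>+s. indicator {0..t} s * ennreal (psi M s (eta_f M (psi M (t - s) g)) x) \<partial>lborel)"
  proof (intro nn_integral_cong)
    fix s
    show "indicator {0..t} s * mean (eta_mean (mean (ext g) (t - s))) s x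
      = indicator {0..t} s * ennreal (psi M s (eta_f M (psi M (t - s) g)) x)"
      using eta_mean_psi[OF g, of "t - s"] psi_props(2)[OF eta_Linf[OF psi_Linf[OF g]] x, of "t - s" s]
      by (auto split: split_indicator)
  qed
  finally show ?thesis .
qed

section \<open>The pairing over the phase space\<close>

lemma pairing_commute: "pairing M f g = pairing M g f"
  by (simp add: pairing_def mult.commute)

lemma pairing_props:
  assumes f: "f \<in> Linf_plus M" and g: "g \<in> Linf_plus M"
  shows "(\<integral>\<^sup>+y. ext f y * ext g y \<partial>lborel) = ennreal (pairing M f g)" "0 \<le> pairing M f g"
    "set_integrable lborel (phase M) (\<lambda>y. f y * g y)"
proof -
  obtain F where F: "0 \<le> F" "\<And>y. y \<in> phase M \<Longrightarrow> f y \<le> F" using Linf_bound[OF f] by blast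
  obtain G where G: "0 \<le> G" "\<And>y. y \<in> phase M \<Longrightarrow> g y \<le> G" using Linf_bound[OF g] by blast
  note nn = Linf_nonneg[OF f] Linf_nonneg[OF g]
  have m: "(\<lambda>y. f y * g y) \<in> borel_measurable (restrict_space borel (phase M))"
    using f g by (intro borel_measurable_times) (auto simp: Linf_plus_def)
  have m': "(\<lambda>y. indicator (phase M) y *\<^sub>R (f y * g y)) \<in> borel_measurable borel"
    using m by (subst (asm) borel_measurable_restrict_space_iff) auto
  show int: "set_integrable lborel (phase M) (\<lambda>y. f y * g y)"
    unfolding set_integrable_def
  proof (rule Bochner_Integration.integrable_bound)
    show "integrable lborel (\<lambda>y. indicator (phase M) y *\<^sub>R (F * G))"
      using emeasure_phase by (intro integrable_scaleR_left) (simp add: integrable_indicator_iff)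
    show "AE y in lborel. norm (indicator (phase M) y *\<^sub>R (f y * g y)) \<le> norm (indicator (phase M) y *\<^sub>R (F * G))"
      using F G nn by (intro AE_I2) (auto simp: indicator_def abs_mult intro!: mult_mono)
  qed (use m' in simp)
  show "0 \<le> pairing M f g"
    unfolding pairing_def set_lebesgue_integral_def using nn
    by (intro Bochner_Integration.integral_nonneg) (auto simp: indicator_def)
  have "(\<integral>\<^sup>+y. ext f y * ext g y \<partial>lborel) = (\<integral>\<^sup>+y. ennreal (indicator (phase M) y *\<^sub>R (f y * g y)) \<partial>lborel)"
    using nn by (intro nn_integral_cong) (auto simp: ext_def ennreal_mult split: split_indicator)
  also have "\<dots> = ennreal (pairing M f g)"
    unfolding pairing_def set_lebesgue_integral_def
    using int nn by (intro nn_integral_eq_integral) (auto simp: set_integrable_def indicator_def)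
  finally show "(\<integral>\<^sup>+y. ext f y * ext g y \<partial>lborel) = ennreal (pairing M f g)" .
qed

lemma pairing_mono:
  assumes f: "f \<in> Linf_plus M" and g: "g \<in> Linf_plus M" and h: "h \<in> Linf_plus M"
    and le: "\<And>y. y \<in> phase M \<Longrightarrow> g y \<le> h y"
  shows "pairing M f g \<le> pairing M f h"
  unfolding pairing_def
  using pairing_props(3)[OF f g] pairing_props(3)[OF f h] Linf_nonneg[OF f] le
  by (intro set_integral_mono) (auto intro!: mult_left_mono)

lemma pairing_scale: "pairing M f (\<lambda>y. c * g y) = c * pairing M f g"
  unfolding pairing_def set_lebesgue_integral_def
proof -
  have "(\<lambda>x. indicat_real (phase M) x *\<^sub>R (f x * (c * g x))) = (\<lambda>x. c * (indicat_real (phase M) x *\<^sub>R (f x * g x)))"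
    by (simp add: fun_eq_iff)
  then show "(LBINT x. indicat_real (phase M) x *\<^sub>R (f x * (c * g x))) = c * (LBINT x. indicat_real (phase M) x *\<^sub>R (f x * g x))"
    by (simp only: integral_mult_right_zero)
qed

lemma pairing_eta_meas:
  assumes f: "f \<in> Linf_plus M" and g: "g \<in> Linf_plus M"
  shows "(\<lambda>s. indicator {0..} s * pairing M f (eta_f M (psi M s g))) \<in> borel_measurable borel"
proof -
  note [measurable] = eta_mean_meas_param[OF mean_ext_meas[OF g]] ext_meas[OF f]
  have "(\<lambda>s. \<integral>\<^sup>+y. ext f y * eta_mean (mean (ext g) s) y \<partial>lborel) \<in> borel_measurable borel"
    by (rule lborel.borel_measurable_nn_integral) (simp add: split_beta')
  then have "(\<lambda>s. indicator {0..} s * enn2real (\<integral>\<^sup>+y. ext f y * eta_mean (mean (ext g) s) y \<partial>lborel)) \<in> borel_measurable borel"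
    by measurable
  also have "(\<lambda>s. indicator {0..} s * enn2real (\<integral>\<^sup>+y. ext f y * eta_mean (mean (ext g) s) y \<partial>lborel))
     = (\<lambda>s. indicator {0..} s * pairing M f (eta_f M (psi M s g)))"
  proof
    fix s :: real
    show "indicator {0..} s * enn2real (\<integral>\<^sup>+y. ext f y * eta_mean (mean (ext g) s) y \<partial>lborel)
       = indicator {0..} s * pairing M f (eta_f M (psi M s g))"
      using eta_mean_psi[OF g, of s] pairing_props(1,2)[OF f eta_Linf[OF psi_Linf[OF g, of s]]]
      by (auto split: split_indicator)
  qed
  finally show ?thesis .
qed

end

section \<open>Powers of sample means\<close>

text \<open>The tangent at 1 lies above a concave power. Here it comes from the convexity of exp
  between 0 and ln x, the weighted inequality of the arithmetic and the geometric mean.\<close>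

lemma powr_le_affine:
  fixes x p :: real
  assumes "0 \<le> x" "0 < p" "p \<le> 1"
  shows "x powr p \<le> 1 + p * (x - 1)"
proof (cases "x = 0")
  case False
  then have "0 < x" using assms by simp
  have "exp ((1 - p) *\<^sub>R 0 + p *\<^sub>R ln x) \<le> (1 - p) * exp 0 + p * exp (ln x)"
    using assms by (intro convex_onD[OF exp_convex]) auto
  then show ?thesis using \<open>0 < x\<close> by (simp add: powr_def algebra_simps)
qed (use assms in simp)

text \<open>For p \<le> 1 the power lies between 1 and x, whence the first bound. A factor p cannot
  be gained near 0, where the slope is unbounded if p < 1; from 1 / 2 on, the slope is at most 2
  p.\<close>

lemma abs_powr_minus_one_le:
  fixes x p :: real
  assumes x: "0 \<le> x" and p: "0 < p" "p \<le> 1"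
  shows "\<bar>x powr p - 1\<bar> \<le> \<bar>x - 1\<bar>" "1 / 2 \<le> x \<Longrightarrow> \<bar>x powr p - 1\<bar> \<le> 2 * p * \<bar>x - 1\<bar>"
proof -
  have up: "x powr p - 1 \<le> p * (x - 1)" using powr_le_affine[OF assms] by simp
  have pos: "1 \<le> x powr p" if "1 \<le> x" using that p by (simp add: ge_one_powr_ge_zero)
  show "\<bar>x powr p - 1\<bar> \<le> \<bar>x - 1\<bar>"
  proof (cases "1 \<le> x")
    case True
    have "p * (x - 1) \<le> 1 * (x - 1)" using p True by (intro mult_right_mono) auto
    then show ?thesis using up pos[OF True] True by simp
  next
    case False
    have "x \<le> x powr p"
    proof (cases "x = 0")
      case False
      then show ?thesis using x p \<open>\<not> 1 \<le> x\<close> powr_mono'[of p 1 x] by simp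
    qed simp
    moreover have "x powr p \<le> 1" using False x p by (intro powr_le1) auto
    ultimately show ?thesis using False by simp
  qed
  show "\<bar>x powr p - 1\<bar> \<le> 2 * p * \<bar>x - 1\<bar>" if h: "1 / 2 \<le> x"
  proof (cases "1 \<le> x")
    case True
    have "p * (x - 1) \<le> 2 * p * (x - 1)" using p True by (intro mult_right_mono) auto
    then show ?thesis using up pos[OF True] True by simp
  next
    case False
    have "x powr p \<le> 1" using False x p by (intro powr_le1) auto
    have "1 + p * ln x \<le> x powr p" using h exp_ge_add_one_self[of "p * ln x"] by (simp add: powr_def)
    then have "1 - x powr p \<le> p * - ln x" by simp
    also have "- ln x = ln (1 / x)" using h by (simp add: ln_div)
    also have "p * ln (1 / x) \<le> p * (1 / x - 1)" using h p by (intro mult_left_mono ln_le_minus_one) auto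
    also have "1 / x - 1 = (1 - x) / x" using h by (simp add: field_simps)
    also have "p * ((1 - x) / x) \<le> p * (2 * (1 - x))"
    proof -
      have "(1 - x) * 1 \<le> (1 - x) * (2 * x)" using h False by (intro mult_left_mono) auto
      then have "(1 - x) / x \<le> 2 * (1 - x)" using h by (simp add: divide_le_eq) (simp add: algebra_simps)
      then show ?thesis using p by (intro mult_left_mono) auto
    qed
    finally show ?thesis using \<open>x powr p \<le> 1\<close> False by (simp add: algebra_simps)
  qed
qed

lemma square_sum_le: "(a + b)\<^sup>2 \<le> 2 * a\<^sup>2 + 2 * (b::real)\<^sup>2"
  using sum_squares_ge_zero[of "a - b" 0] by (simp add: power2_eq_square algebra_simps)

text \<open>S is any bound of the second moment, because the second moment of the process is only
  estimated from above. The square integrability of Y follows from it.\<close>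

locale sample_mean = prob_space N for N :: "'a measure" +
  fixes Y :: "'a \<Rightarrow> real" and k :: nat and m S :: real
  assumes Y_meas [measurable]: "Y \<in> borel_measurable N"
    and Y_nonneg: "\<And>\<omega>. 0 \<le> Y \<omega>"
    and k_pos: "1 \<le> k"
    and S: "(\<integral>\<^sup>+\<omega>. ennreal ((Y \<omega>)\<^sup>2) \<partial>N) \<le> ennreal S"
    and m: "m = expectation Y" and S_nonneg: "0 \<le> S"
begin

definition Prod :: "(nat \<Rightarrow> 'a) measure" where
  "Prod = (\<Pi>\<^sub>M i\<in>{1..k}. N)"

definition Psi :: "(nat \<Rightarrow> 'a) \<Rightarrow> real" where
  "Psi \<omega> = (\<Sum>i=1..k. Y (\<omega> i)) / real k"

sublocale PS: product_prob_space "\<lambda>_::nat. N" "{1..k}" ..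

sublocale FP: prob_space Prod
  unfolding Prod_def by (rule PS.P.prob_space_axioms)

lemma component_meas [measurable]: "i \<in> {1..k} \<Longrightarrow> (\<lambda>\<omega>. \<omega> i) \<in> measurable Prod N"
  unfolding Prod_def by (rule measurable_component_singleton)

lemma Psi_meas [measurable]: "Psi \<in> borel_measurable Prod"
  unfolding Psi_def[abs_def] by measurable

lemma Psi_nonneg: "0 \<le> Psi \<omega>"
  unfolding Psi_def by (intro divide_nonneg_nonneg sum_nonneg Y_nonneg) simp

lemma nn_integral_component:
  assumes "i \<in> {1..k}" and [measurable]: "f \<in> borel_measurable N"
  shows "(\<integral>\<^sup>+\<omega>. f (\<omega> i) \<partial>Prod) = (\<integral>\<^sup>+\<omega>. f \<omega> \<partial>N)"
proof -
  have "(\<integral>\<^sup>+\<omega>. f \<omega> \<partial>N) = (\<integral>\<^sup>+\<omega>. f \<omega> \<partial>distr (\<Pi>\<^sub>M i\<in>{1..k}. N) N (\<lambda>\<omega>. \<omega> i))"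
    using assms(1) prob_space_axioms by (subst distr_PiM_component) auto
  also have "\<dots> = (\<integral>\<^sup>+\<omega>. f (\<omega> i) \<partial>Prod)"
    using assms(1) unfolding Prod_def by (subst nn_integral_distr) (auto intro: measurable_component_singleton)
  finally show ?thesis by simp
qed

lemma integrable_Y2: "integrable N (\<lambda>\<omega>. (Y \<omega>)\<^sup>2)"
  using S by (intro integrableI_nonneg) (auto intro: order_le_less_trans)

lemma integrable_Y: "integrable N Y"
proof (rule Bochner_Integration.integrable_bound)
  show "integrable N (\<lambda>\<omega>. 1 + (Y \<omega>)\<^sup>2)" using integrable_Y2 by simp
  have "\<bar>y\<bar> \<le> \<bar>1 + y\<^sup>2\<bar>" for y :: real
    using sum_squares_ge_zero[of "\<bar>y\<bar> - 1 / 2" 0] by (simp add: power2_eq_square algebra_simps abs_mult_self_eq)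
  then show "AE \<omega> in N. norm (Y \<omega>) \<le> norm (1 + (Y \<omega>)\<^sup>2)" by simp
qed simp

lemma expectation_Y2_le: "expectation (\<lambda>\<omega>. (Y \<omega>)\<^sup>2) \<le> S"
  using S nn_integral_eq_integral[OF integrable_Y2] S_nonneg by simp

lemma m2_le_S: "m\<^sup>2 \<le> S"
proof -
  have "0 \<le> expectation (\<lambda>\<omega>. (Y \<omega>)\<^sup>2) - (expectation Y)\<^sup>2"
    using variance_positive[of Y] variance_eq[OF integrable_Y integrable_Y2] by simp
  then show ?thesis using expectation_Y2_le m by simp
qed

text \<open>Off the diagonal, products of independent centred variables have mean 0, so k equal
  terms remain out of k^2. Each is a variance, at most the second moment.\<close>

lemma variance_le: "(\<integral>\<^sup>+\<omega>. ennreal ((Psi \<omega> - m)\<^sup>2) \<partial>Prod) \<le> ennreal (S / real k)"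
proof -
  define Z where "Z \<omega> = Y \<omega> - m" for \<omega>
  have iZ: "integrable N Z" unfolding Z_def[abs_def] using integrable_Y by simp
  have EZ: "expectation Z = 0" unfolding Z_def[abs_def] using integrable_Y by (simp add: m prob_space)
  have iZ2: "integrable N (\<lambda>\<omega>. (Z \<omega>)\<^sup>2)"
    using integrable_Y integrable_Y2 by (simp add: Z_def power2_diff)
  have EZ2: "expectation (\<lambda>\<omega>. (Z \<omega>)\<^sup>2) \<le> S"
  proof -
    have "expectation (\<lambda>\<omega>. (Z \<omega>)\<^sup>2) = expectation (\<lambda>\<omega>. (Y \<omega>)\<^sup>2) - m\<^sup>2"
      using variance_eq[OF integrable_Y integrable_Y2] by (simp add: Z_def m)
    then show ?thesis using expectation_Y2_le by (simp add: add_increasing2) (smt (verit) zero_le_power2)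
  qed
  have cross: "integrable Prod (\<lambda>\<omega>. Z (\<omega> i) * Z (\<omega> j)) \<and>
     (\<integral>\<omega>. Z (\<omega> i) * Z (\<omega> j) \<partial>Prod) = (if i = j then expectation (\<lambda>\<omega>. (Z \<omega>)\<^sup>2) else 0)"
    if ij: "i \<in> {1..k}" "j \<in> {1..k}" for i j
  proof (cases "i = j")
    case True
    \<comment> \<open>The integral over the product space factorises for products over all
      coordinates; so 1 is taken as the factor at the coordinates not involved.\<close>
    define f where "f l \<omega> = (if l = i then (Z \<omega>)\<^sup>2 else 1)" for l \<omega>
    have fi: "integrable N (f l)" for l unfolding f_def using iZ2 by (cases "l = i") auto
    have p: "(\<Prod>l\<in>{1..k}. f l (\<omega> l)) = Z (\<omega> i) * Z (\<omega> j)" for \<omega>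
      using ij(1) True unfolding f_def by (subst prod.remove[of _ i]) (auto simp: power2_eq_square)
    have "(\<Prod>l\<in>{1..k}. integral\<^sup>L N (f l)) = expectation (\<lambda>\<omega>. (Z \<omega>)\<^sup>2)"
      using ij(1) unfolding f_def by (subst prod.remove[of _ i]) (auto simp: prob_space)
    then show ?thesis
      using PS.product_integrable_prod[of "{1..k}" f] PS.product_integral_prod[of "{1..k}" f] fi True
      unfolding p Prod_def by simp
  next
    case False
    define f where "f l \<omega> = (if l = i then Z \<omega> else if l = j then Z \<omega> else 1)" for l \<omega>
    have fi: "integrable N (f l)" for l unfolding f_def using iZ by (cases "l = i"; cases "l = j") auto
    have p: "(\<Prod>l\<in>{1..k}. f l (\<omega> l)) = Z (\<omega> i) * Z (\<omega> j)" for \<omega>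
    proof -
      have "(\<Prod>l\<in>{1..k}. f l (\<omega> l)) = f i (\<omega> i) * (f j (\<omega> j) * (\<Prod>l\<in>{1..k} - {i} - {j}. f l (\<omega> l)))"
        using ij False by (subst prod.remove[of _ i], simp, simp, subst prod.remove[of _ j]) auto
      also have "(\<Prod>l\<in>{1..k} - {i} - {j}. f l (\<omega> l)) = 1" by (intro prod.neutral) (auto simp: f_def)
      finally show ?thesis by (simp add: f_def)
    qed
    have "f i = Z" by (simp add: f_def fun_eq_iff)
    then have "integral\<^sup>L N (f i) = 0" using EZ by simp
    then have "(\<Prod>l\<in>{1..k}. integral\<^sup>L N (f l)) = 0"
      using ij(1) by (intro prod_zero) auto
    then show ?thesis
      using PS.product_integrable_prod[of "{1..k}" f] PS.product_integral_prod[of "{1..k}" f] fi False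
      unfolding p Prod_def by simp
  qed
  have kk: "0 < real k" using k_pos by simp
  have sq: "(Psi \<omega> - m)\<^sup>2 = (\<Sum>i=1..k. \<Sum>j=1..k. Z (\<omega> i) * Z (\<omega> j)) / (real k)\<^sup>2" for \<omega>
  proof -
    have "Psi \<omega> - m = (\<Sum>i=1..k. Z (\<omega> i)) / real k"
      using kk by (simp add: Psi_def Z_def sum_subtractf diff_divide_distrib)
    then show ?thesis by (simp add: power_divide power2_eq_square sum_product)
  qed
  have int: "integrable Prod (\<lambda>\<omega>. (Psi \<omega> - m)\<^sup>2)"
    unfolding sq using cross by (intro integrable_divide Bochner_Integration.integrable_sum) auto
  have "(\<integral>\<omega>. (Psi \<omega> - m)\<^sup>2 \<partial>Prod) = (\<Sum>i=1..k. \<Sum>j=1..k. \<integral>\<omega>. Z (\<omega> i) * Z (\<omega> j) \<partial>Prod) / (real k)\<^sup>2"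
  proof -
    have "(\<integral>\<omega>. (\<Sum>i=1..k. \<Sum>j=1..k. Z (\<omega> i) * Z (\<omega> j)) \<partial>Prod)
       = (\<Sum>i=1..k. \<integral>\<omega>. (\<Sum>j=1..k. Z (\<omega> i) * Z (\<omega> j)) \<partial>Prod)"
      by (rule Bochner_Integration.integral_sum, rule Bochner_Integration.integrable_sum) (use cross in blast)
    also have "\<dots> = (\<Sum>i=1..k. \<Sum>j=1..k. \<integral>\<omega>. Z (\<omega> i) * Z (\<omega> j) \<partial>Prod)"
      by (rule sum.cong[OF refl], rule Bochner_Integration.integral_sum) (use cross in blast)
    finally show ?thesis unfolding sq integral_divide_zero by (simp only:)
  qed
  also have "\<dots> = (\<Sum>i=1..k. \<Sum>j=1..k. if i = j then expectation (\<lambda>\<omega>. (Z \<omega>)\<^sup>2) else 0) / (real k)\<^sup>2"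
    using cross by (intro arg_cong2[where f="(/)"] sum.cong refl) auto
  also have "\<dots> = expectation (\<lambda>\<omega>. (Z \<omega>)\<^sup>2) / real k"
    using kk by (simp add: power2_eq_square)
  also have "\<dots> \<le> S / real k" using EZ2 by (intro divide_right_mono) auto
  finally show ?thesis
    using nn_integral_eq_integral[OF int] by (simp add: ennreal_leI)
qed

text \<open>With x = Psi / m, the distance of \<open>x powr p\<close> from 1 is at most that of x,
  for every x \<ge> 0. No factor p is gained, since values of x near 0 are not excluded.\<close>

lemma mse_basic:
  assumes m_pos: "0 < m" and p: "0 < p" "p \<le> 1" and c: "0 \<le> c"
  shows "(\<integral>\<^sup>+\<omega>. ennreal ((Psi \<omega> powr p - c)\<^sup>2) \<partial>Prod)
    \<le> ennreal (2 * (m powr p)\<^sup>2 * (S / m\<^sup>2) / real k + 2 * (m powr p - c)\<^sup>2)"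
proof -
  have "(Psi \<omega> powr p - c)\<^sup>2 \<le> (2 * (m powr p)\<^sup>2 / m\<^sup>2) * (Psi \<omega> - m)\<^sup>2 + 2 * (m powr p - c)\<^sup>2" for \<omega>
  proof -
    define x where "x = Psi \<omega> / m"
    have x: "0 \<le> x" "Psi \<omega> = m * x" using Psi_nonneg[of \<omega>] m_pos by (auto simp: x_def)
    have "(x powr p - 1)\<^sup>2 \<le> (x - 1)\<^sup>2"
      using abs_powr_minus_one_le(1)[OF x(1) p] by (simp add: abs_le_square_iff)
    then have *: "(m powr p)\<^sup>2 * (x powr p - 1)\<^sup>2 \<le> (m powr p)\<^sup>2 * (x - 1)\<^sup>2" by (intro mult_left_mono) auto
    have "(Psi \<omega> powr p - c)\<^sup>2 = (m powr p * (x powr p - 1) + (m powr p - c))\<^sup>2"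
      using x m_pos by (simp add: powr_mult algebra_simps)
    also have "\<dots> \<le> 2 * (m powr p * (x powr p - 1))\<^sup>2 + 2 * (m powr p - c)\<^sup>2"
      by (rule square_sum_le)
    also have "\<dots> \<le> 2 * ((m powr p)\<^sup>2 * (x - 1)\<^sup>2) + 2 * (m powr p - c)\<^sup>2"
      using * by (simp add: power_mult_distrib)
    also have "(x - 1)\<^sup>2 = (Psi \<omega> - m)\<^sup>2 / m\<^sup>2"
      using m_pos by (simp add: x_def power_divide[symmetric] diff_divide_distrib)
    finally show ?thesis by simp
  qed
  then have "(\<integral>\<^sup>+\<omega>. ennreal ((Psi \<omega> powr p - c)\<^sup>2) \<partial>Prod)
    \<le> (\<integral>\<^sup>+\<omega>. ennreal (2 * (m powr p)\<^sup>2 / m\<^sup>2) * ennreal ((Psi \<omega> - m)\<^sup>2) + ennreal (2 * (m powr p - c)\<^sup>2) \<partial>Prod)"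
    by (intro nn_integral_mono) (simp add: ennreal_mult[symmetric] ennreal_plus[symmetric] ennreal_leI del: ennreal_plus)
  also have "\<dots> = ennreal (2 * (m powr p)\<^sup>2 / m\<^sup>2) * (\<integral>\<^sup>+\<omega>. ennreal ((Psi \<omega> - m)\<^sup>2) \<partial>Prod) + ennreal (2 * (m powr p - c)\<^sup>2)"
    by (subst nn_integral_add, simp, simp, subst nn_integral_cmult, simp) (simp add: FP.emeasure_space_1)
  also have "\<dots> \<le> ennreal (2 * (m powr p)\<^sup>2 / m\<^sup>2) * ennreal (S / real k) + ennreal (2 * (m powr p - c)\<^sup>2)"
    using variance_le by (intro add_mono mult_left_mono) auto
  also have "\<dots> = ennreal (2 * (m powr p)\<^sup>2 / m\<^sup>2 * (S / real k) + 2 * (m powr p - c)\<^sup>2)"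
    using S_nonneg by (simp add: ennreal_mult[symmetric] ennreal_plus[symmetric] del: ennreal_plus)
  finally show ?thesis by (simp add: mult.assoc)
qed

text \<open>Chernoff's bound. As \<open>e\<^sup>-\<^sup>y \<le> 1 - y + y\<^sup>2 / 2\<close> for \<open>y \<ge> 0\<close>, the lower tail of a nonnegative variable only
  involves its second moment.\<close>

lemma lower_tail:
  assumes m_pos: "0 < m"
  defines "B \<equiv> S / m\<^sup>2"
  shows "emeasure Prod {\<omega> \<in> space Prod. Psi \<omega> < m / 2} \<le> ennreal (exp (- real k / (8 * B)))"
proof -
  have B1: "1 \<le> B" using m2_le_S m_pos by (simp add: B_def)
  \<comment> \<open>With y = \<theta> m, Chernoff's exponent per copy is at most - y / 2 + B y^2 /
    2. It is smallest at y = 1 / (2 B), where it equals - 1 / (8 B).\<close>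
  define \<theta> where "\<theta> = 1 / (2 * B * m)"
  have \<theta>: "0 < \<theta>" using B1 m_pos by (simp add: \<theta>_def)
  have kk: "0 < real k" using k_pos by simp
  have L: "(\<integral>\<^sup>+\<omega>. ennreal (exp (\<theta> * (m / 2 - Y \<omega>))) \<partial>N) \<le> ennreal (exp (- 1 / (8 * B)))"
  proof -
    have e: "exp (- y) \<le> 1 - y + y\<^sup>2 / 2" if "0 \<le> y" for y :: real
    proof -
      define f where "f z = 1 - z + z\<^sup>2 / 2 - exp (- z)" for z :: real
      have "f 0 \<le> f y"
      proof (rule DERIV_nonneg_imp_nondecreasing[OF that], intro exI conjI)
        fix z :: real assume "0 \<le> z"
        show "(f has_real_derivative (- 1 + z + exp (- z))) (at z)"
          unfolding f_def by (auto intro!: derivative_eq_intros)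
        show "0 \<le> - 1 + z + exp (- z)" using exp_ge_add_one_self[of "- z"] by simp
      qed
      then show ?thesis by (simp add: f_def)
    qed
    have e': "exp (- (\<theta> * Y \<omega>)) \<le> 1 - \<theta> * Y \<omega> + (\<theta>\<^sup>2 / 2) * (Y \<omega>)\<^sup>2" for \<omega>
      using e[of "\<theta> * Y \<omega>"] \<theta> Y_nonneg[of \<omega>] by (simp add: power_mult_distrib)
    have 1: "exp (\<theta> * (m / 2 - Y \<omega>)) \<le> exp (\<theta> * m / 2) * (1 - \<theta> * Y \<omega> + (\<theta>\<^sup>2 / 2) * (Y \<omega>)\<^sup>2)" for \<omega>
    proof -
      have "exp (\<theta> * (m / 2 - Y \<omega>)) = exp (\<theta> * m / 2) * exp (- (\<theta> * Y \<omega>))"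
        by (simp add: exp_add[symmetric] right_diff_distrib)
      then show ?thesis using e'[of \<omega>]
        by (simp only:) (rule mult_left_mono, auto)
    qed
    have i: "integrable N (\<lambda>\<omega>. exp (\<theta> * m / 2) * (1 - \<theta> * Y \<omega> + (\<theta>\<^sup>2 / 2) * (Y \<omega>)\<^sup>2))"
      using integrable_Y integrable_Y2 by simp
    have "(\<integral>\<^sup>+\<omega>. ennreal (exp (\<theta> * (m / 2 - Y \<omega>))) \<partial>N)
      \<le> (\<integral>\<^sup>+\<omega>. ennreal (exp (\<theta> * m / 2) * (1 - \<theta> * Y \<omega> + (\<theta>\<^sup>2 / 2) * (Y \<omega>)\<^sup>2)) \<partial>N)"
      by (intro nn_integral_mono ennreal_leI 1)
    also have "\<dots> = ennreal (expectation (\<lambda>\<omega>. exp (\<theta> * m / 2) * (1 - \<theta> * Y \<omega> + (\<theta>\<^sup>2 / 2) * (Y \<omega>)\<^sup>2)))"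
      using order_trans[OF _ 1] by (intro nn_integral_eq_integral i) auto
    also have "expectation (\<lambda>\<omega>. exp (\<theta> * m / 2) * (1 - \<theta> * Y \<omega> + (\<theta>\<^sup>2 / 2) * (Y \<omega>)\<^sup>2))
      = exp (\<theta> * m / 2) * (1 - \<theta> * m + (\<theta>\<^sup>2 / 2) * expectation (\<lambda>\<omega>. (Y \<omega>)\<^sup>2))"
      using integrable_Y integrable_Y2 by (simp add: m prob_space)
    also have "\<dots> \<le> exp (\<theta> * m / 2) * (1 - \<theta> * m + (\<theta>\<^sup>2 / 2) * S)"
      using expectation_Y2_le by (intro mult_left_mono add_left_mono) auto
    also have "1 - \<theta> * m + (\<theta>\<^sup>2 / 2) * S = 1 - 3 / (8 * B)"
    proof -
      have "\<theta> * m = 1 / (2 * B)" using m_pos B1 by (simp add: \<theta>_def)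
      moreover have "\<theta>\<^sup>2 * S = 1 / (4 * B)"
      proof -
        have "S = B * m\<^sup>2" using m_pos by (simp add: B_def)
        then show ?thesis using m_pos B1 by (simp add: \<theta>_def power2_eq_square field_simps)
      qed
      ultimately show ?thesis using B1 by (simp add: field_simps)
    qed
    also have "exp (\<theta> * m / 2) * (1 - 3 / (8 * B)) \<le> exp (1 / (4 * B)) * exp (- 3 / (8 * B))"
      using exp_ge_add_one_self[of "- 3 / (8 * B)"] m_pos B1 by (intro mult_mono) (auto simp: \<theta>_def)
    also have "\<dots> = exp (- 1 / (8 * B))" using B1 by (simp add: exp_add[symmetric] field_simps)
    finally show ?thesis by (simp add: ennreal_leI)
  qed
  have "emeasure Prod {\<omega> \<in> space Prod. Psi \<omega> < m / 2}
    = (\<integral>\<^sup>+\<omega>. indicator {\<omega> \<in> space Prod. Psi \<omega> < m / 2} \<omega> \<partial>Prod)"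
    by (subst nn_integral_indicator) simp_all
  also have "\<dots> \<le> (\<integral>\<^sup>+\<omega>. (\<Prod>i\<in>{1..k}. ennreal (exp (\<theta> * (m / 2 - Y (\<omega> i))))) \<partial>Prod)"
  proof (intro nn_integral_mono)
    fix \<omega>
    have "(\<Prod>i\<in>{1..k}. ennreal (exp (\<theta> * (m / 2 - Y (\<omega> i))))) = ennreal (exp (\<Sum>i=1..k. \<theta> * (m / 2 - Y (\<omega> i))))"
      by (simp add: prod_ennreal exp_sum)
    also have "(\<Sum>i=1..k. \<theta> * (m / 2 - Y (\<omega> i))) = \<theta> * (real k * (m / 2 - Psi \<omega>))"
      using kk by (simp add: sum_distrib_left[symmetric] sum_subtractf Psi_def right_diff_distrib)
    finally have *: "(\<Prod>i\<in>{1..k}. ennreal (exp (\<theta> * (m / 2 - Y (\<omega> i))))) = ennreal (exp (\<theta> * (real k * (m / 2 - Psi \<omega>))))" .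
    show "indicator {\<omega> \<in> space Prod. Psi \<omega> < m / 2} \<omega> \<le> (\<Prod>i\<in>{1..k}. ennreal (exp (\<theta> * (m / 2 - Y (\<omega> i)))))"
      unfolding * using \<theta> kk by (auto split: split_indicator)
  qed
  also have "\<dots> = (\<Prod>i\<in>{1..k}. (\<integral>\<^sup>+\<omega>. ennreal (exp (\<theta> * (m / 2 - Y \<omega>))) \<partial>N))"
    unfolding Prod_def by (rule PS.product_nn_integral_prod) auto
  also have "\<dots> = (\<integral>\<^sup>+\<omega>. ennreal (exp (\<theta> * (m / 2 - Y \<omega>))) \<partial>N) ^ k"
    by (simp only: prod_constant card_atLeastAtMost) simp
  also have "\<dots> \<le> ennreal (exp (- 1 / (8 * B))) ^ k" by (intro power_mono L) auto
  also have "\<dots> = ennreal (exp (- 1 / (8 * B)) ^ k)" by (simp add: ennreal_power)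
  also have "exp (- 1 / (8 * B)) ^ k = exp (- real k / (8 * B))" by (simp add: exp_of_nat_mult[symmetric])
  finally show ?thesis .
qed

text \<open>Above m / 2 the second bound for the power gains p^2, and below m / 2 the power deviates
  from 1 by at most 1, on an event covered by \<open>lower_tail\<close>. Apart from the factor m^(2
  p) and the bias, the result depends on S and m through the ratio B only.\<close>

lemma mse_refined:
  assumes m_pos: "0 < m" and p: "0 < p" "p \<le> 1" and c: "0 \<le> c"
  defines "B \<equiv> S / m\<^sup>2"
  shows "(\<integral>\<^sup>+\<omega>. ennreal ((Psi \<omega> powr p - c)\<^sup>2) \<partial>Prod)
    \<le> ennreal (2 * (m powr p)\<^sup>2 * (4 * p\<^sup>2 * B / real k + exp (- real k / (8 * B))) + 2 * (m powr p - c)\<^sup>2)"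
proof -
  define A where "A = {\<omega> \<in> space Prod. Psi \<omega> < m / 2}"
  have [measurable]: "A \<in> sets Prod" by (simp add: A_def)
  have pw: "(Psi \<omega> powr p - c)\<^sup>2 \<le> (8 * p\<^sup>2 * (m powr p)\<^sup>2 / m\<^sup>2) * (Psi \<omega> - m)\<^sup>2
      + 2 * (m powr p)\<^sup>2 * indicator A \<omega> + 2 * (m powr p - c)\<^sup>2" if "\<omega> \<in> space Prod" for \<omega>
  proof -
    define x where "x = Psi \<omega> / m"
    have x: "0 \<le> x" "Psi \<omega> = m * x" using Psi_nonneg[of \<omega>] m_pos by (auto simp: x_def)
    have "(x powr p - 1)\<^sup>2 \<le> 4 * p\<^sup>2 * (x - 1)\<^sup>2 + indicator A \<omega>"
    proof (cases "1 / 2 \<le> x")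
      case True
      have "\<bar>x powr p - 1\<bar> \<le> \<bar>2 * p * (x - 1)\<bar>"
        using abs_powr_minus_one_le(2)[OF x(1) p True] p by (simp add: abs_mult)
      then have "(x powr p - 1)\<^sup>2 \<le> (2 * p * (x - 1))\<^sup>2" by (simp only: abs_le_square_iff)
      then show ?thesis by (simp add: power_mult_distrib add_increasing2)
    next
      case False
      then have "\<omega> \<in> A" using m_pos that by (simp add: A_def x_def field_simps)
      have "x powr p \<le> 1" using False x p by (intro powr_le1) auto
      then have "(x powr p - 1)\<^sup>2 \<le> 1" by (simp add: abs_square_le_1)
      then show ?thesis using \<open>\<omega> \<in> A\<close> by (simp add: add_increasing)
    qed
    then have *: "(m powr p)\<^sup>2 * (x powr p - 1)\<^sup>2 \<le> (m powr p)\<^sup>2 * (4 * p\<^sup>2 * (x - 1)\<^sup>2 + indicator A \<omega>)"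
      by (intro mult_left_mono) auto
    have "(Psi \<omega> powr p - c)\<^sup>2 = (m powr p * (x powr p - 1) + (m powr p - c))\<^sup>2"
      using x m_pos by (simp add: powr_mult algebra_simps)
    also have "\<dots> \<le> 2 * (m powr p * (x powr p - 1))\<^sup>2 + 2 * (m powr p - c)\<^sup>2"
      by (rule square_sum_le)
    also have "\<dots> \<le> 2 * ((m powr p)\<^sup>2 * (4 * p\<^sup>2 * (x - 1)\<^sup>2 + indicator A \<omega>)) + 2 * (m powr p - c)\<^sup>2"
      using * by (simp add: power_mult_distrib)
    also have "(x - 1)\<^sup>2 = (Psi \<omega> - m)\<^sup>2 / m\<^sup>2"
      using m_pos by (simp add: x_def power_divide[symmetric] diff_divide_distrib)
    finally show ?thesis by (simp add: distrib_left mult.assoc mult.left_commute)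
  qed
  have "(\<integral>\<^sup>+\<omega>. ennreal ((Psi \<omega> powr p - c)\<^sup>2) \<partial>Prod)
    \<le> (\<integral>\<^sup>+\<omega>. ennreal (8 * p\<^sup>2 * (m powr p)\<^sup>2 / m\<^sup>2) * ennreal ((Psi \<omega> - m)\<^sup>2)
       + ennreal (2 * (m powr p)\<^sup>2) * indicator A \<omega> + ennreal (2 * (m powr p - c)\<^sup>2) \<partial>Prod)"
  proof (intro nn_integral_mono)
    fix \<omega> assume \<omega>: "\<omega> \<in> space Prod"
    have eq: "ennreal (8 * p\<^sup>2 * (m powr p)\<^sup>2 / m\<^sup>2) * ennreal ((Psi \<omega> - m)\<^sup>2)
       + ennreal (2 * (m powr p)\<^sup>2) * indicator A \<omega> + ennreal (2 * (m powr p - c)\<^sup>2)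
      = ennreal ((8 * p\<^sup>2 * (m powr p)\<^sup>2 / m\<^sup>2) * (Psi \<omega> - m)\<^sup>2
      + 2 * (m powr p)\<^sup>2 * indicator A \<omega> + 2 * (m powr p - c)\<^sup>2)"
      by (simp add: ennreal_mult[symmetric] ennreal_plus[symmetric] del: ennreal_plus split: split_indicator)
    show "ennreal ((Psi \<omega> powr p - c)\<^sup>2) \<le> ennreal (8 * p\<^sup>2 * (m powr p)\<^sup>2 / m\<^sup>2) * ennreal ((Psi \<omega> - m)\<^sup>2)
       + ennreal (2 * (m powr p)\<^sup>2) * indicator A \<omega> + ennreal (2 * (m powr p - c)\<^sup>2)"
      unfolding eq by (rule ennreal_leI[OF pw[OF \<omega>]])
  qed
  also have "\<dots> = ennreal (8 * p\<^sup>2 * (m powr p)\<^sup>2 / m\<^sup>2) * (\<integral>\<^sup>+\<omega>. ennreal ((Psi \<omega> - m)\<^sup>2) \<partial>Prod)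
       + ennreal (2 * (m powr p)\<^sup>2) * emeasure Prod A + ennreal (2 * (m powr p - c)\<^sup>2)"
    by (subst nn_integral_add, simp, simp, subst nn_integral_add, simp, simp, subst nn_integral_cmult, simp)
       (simp add: FP.emeasure_space_1 nn_integral_cmult)
  also have "\<dots> \<le> ennreal (8 * p\<^sup>2 * (m powr p)\<^sup>2 / m\<^sup>2) * ennreal (S / real k)
       + ennreal (2 * (m powr p)\<^sup>2) * ennreal (exp (- real k / (8 * B))) + ennreal (2 * (m powr p - c)\<^sup>2)"
    using variance_le lower_tail[OF m_pos] by (intro add_mono mult_left_mono) (auto simp: A_def B_def)
  also have "\<dots> = ennreal (8 * p\<^sup>2 * (m powr p)\<^sup>2 / m\<^sup>2 * (S / real k) + 2 * (m powr p)\<^sup>2 * exp (- real k / (8 * B)) + 2 * (m powr p - c)\<^sup>2)"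
    using S_nonneg by (simp add: ennreal_mult[symmetric] ennreal_plus[symmetric] del: ennreal_plus)
  also have "8 * p\<^sup>2 * (m powr p)\<^sup>2 / m\<^sup>2 * (S / real k) + 2 * (m powr p)\<^sup>2 * exp (- real k / (8 * B)) + 2 * (m powr p - c)\<^sup>2
    = 2 * (m powr p)\<^sup>2 * (4 * p\<^sup>2 * B / real k + exp (- real k / (8 * B))) + 2 * (m powr p - c)\<^sup>2"
    by (simp add: B_def distrib_left mult.assoc mult.left_commute)
  finally show ?thesis .
qed

text \<open>Meant for p > 1, where the power is no longer controlled by the variance. The n-th power
  of the sample mean is at most the mean of the n-th powers, by convexity, so the bound does not
  depend on k. The condition p \<le> n / 2 lets 1 + x^n dominate the squared power, and even n makes
  the n-th power convex on the whole line.\<close>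

lemma mse_crude:
  assumes p: "0 < p" "p \<le> real n / 2" "even n" "0 < n" and c: "0 \<le> c"
    and D: "(\<integral>\<^sup>+\<omega>. ennreal (Y \<omega> ^ n) \<partial>N) \<le> ennreal D" "0 \<le> D"
  shows "(\<integral>\<^sup>+\<omega>. ennreal ((Psi \<omega> powr p - c)\<^sup>2) \<partial>Prod) \<le> ennreal (2 + 2 * D + 2 * c\<^sup>2)"
proof -
  have kk: "0 < real k" using k_pos by simp
  have "(Psi \<omega> powr p - c)\<^sup>2 \<le> 2 * ((\<Sum>i=1..k. Y (\<omega> i) ^ n) / real k) + (2 + 2 * c\<^sup>2)" for \<omega>
  proof -
    have "(\<Sum>i\<in>{1..k}. (1 / real k) *\<^sub>R Y (\<omega> i)) ^ n \<le> (\<Sum>i\<in>{1..k}. 1 / real k * Y (\<omega> i) ^ n)"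
      using kk k_pos convex_power_even[OF p(3)] by (intro convex_on_sum[where f="\<lambda>x. x ^ n" and C=UNIV]) auto
    then have 1: "Psi \<omega> ^ n \<le> (\<Sum>i=1..k. Y (\<omega> i) ^ n) / real k"
      by (simp add: Psi_def sum_divide_distrib)
    have 2: "(Psi \<omega> powr p)\<^sup>2 \<le> 1 + Psi \<omega> ^ n"
    proof (cases "1 \<le> Psi \<omega>")
      case True
      have "(Psi \<omega> powr p)\<^sup>2 = Psi \<omega> powr (2 * p)" using True by (simp add: powr_powr powr_realpow[symmetric] mult.commute)
      also have "\<dots> \<le> Psi \<omega> powr real n" using True p by (intro powr_mono) auto
      finally show ?thesis using True by (simp add: powr_realpow)
    next
      case False
      then have "Psi \<omega> powr p \<le> 1" using Psi_nonneg[of \<omega>] p by (intro powr_le1) auto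
      then have "(Psi \<omega> powr p)\<^sup>2 \<le> 1" by (simp add: abs_square_le_1)
      then show ?thesis using Psi_nonneg[of \<omega>] by (simp add: add_increasing2)
    qed
    have "(Psi \<omega> powr p - c)\<^sup>2 \<le> 2 * (Psi \<omega> powr p)\<^sup>2 + 2 * c\<^sup>2"
      using square_sum_le[of "Psi \<omega> powr p" "- c"] by simp
    then show ?thesis using 1 2 by simp
  qed
  then have "(\<integral>\<^sup>+\<omega>. ennreal ((Psi \<omega> powr p - c)\<^sup>2) \<partial>Prod)
    \<le> (\<integral>\<^sup>+\<omega>. (\<Sum>i=1..k. ennreal (2 / real k) * ennreal (Y (\<omega> i) ^ n)) + ennreal (2 + 2 * c\<^sup>2) \<partial>Prod)"
  proof (intro nn_integral_mono)
    fix \<omega>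
    assume *: "\<And>\<omega>. (Psi \<omega> powr p - c)\<^sup>2 \<le> 2 * ((\<Sum>i=1..k. Y (\<omega> i) ^ n) / real k) + (2 + 2 * c\<^sup>2)"
    have s0: "0 \<le> (\<Sum>i=1..k. 2 / real k * Y (\<omega> i) ^ n)" using Y_nonneg by (intro sum_nonneg mult_nonneg_nonneg) auto
    have "(\<Sum>i=1..k. ennreal (2 / real k) * ennreal (Y (\<omega> i) ^ n)) = (\<Sum>i=1..k. ennreal (2 / real k * Y (\<omega> i) ^ n))"
      using Y_nonneg by (intro sum.cong refl ennreal_mult[symmetric]) auto
    also have "\<dots> = ennreal (\<Sum>i=1..k. 2 / real k * Y (\<omega> i) ^ n)"
      using Y_nonneg by (intro sum_ennreal mult_nonneg_nonneg) auto
    also have "\<dots> + ennreal (2 + 2 * c\<^sup>2) = ennreal ((\<Sum>i=1..k. 2 / real k * Y (\<omega> i) ^ n) + (2 + 2 * c\<^sup>2))"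
      using s0 by (intro ennreal_plus[symmetric]) auto
    also have "(\<Sum>i=1..k. 2 / real k * Y (\<omega> i) ^ n) = 2 * ((\<Sum>i=1..k. Y (\<omega> i) ^ n) / real k)"
      by (simp add: sum_distrib_left sum_divide_distrib)
    finally show "ennreal ((Psi \<omega> powr p - c)\<^sup>2) \<le> (\<Sum>i=1..k. ennreal (2 / real k) * ennreal (Y (\<omega> i) ^ n)) + ennreal (2 + 2 * c\<^sup>2)"
      using *[of \<omega>] by (simp add: ennreal_leI)
  qed
  also have "\<dots> = (\<Sum>i=1..k. ennreal (2 / real k) * (\<integral>\<^sup>+\<omega>. ennreal (Y (\<omega> i) ^ n) \<partial>Prod)) + ennreal (2 + 2 * c\<^sup>2)"
    by (subst nn_integral_add, measurable, subst nn_integral_sum, measurable)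
       (simp add: FP.emeasure_space_1 nn_integral_cmult)
  also have "\<dots> \<le> (\<Sum>i=1..k. ennreal (2 / real k) * ennreal D) + ennreal (2 + 2 * c\<^sup>2)"
    using D by (intro add_mono sum_mono mult_left_mono) (auto simp: nn_integral_component[of _ "\<lambda>\<omega>. ennreal (Y \<omega> ^ n)"])
  also have "(\<Sum>i=1..k. ennreal (2 / real k) * ennreal D) = ennreal (2 * D)"
    using D kk by (simp add: ennreal_mult[symmetric] ennreal_of_nat_eq_real_of_nat)
  also have "ennreal (2 * D) + ennreal (2 + 2 * c\<^sup>2) = ennreal (2 + 2 * D + 2 * c\<^sup>2)"
    using D by (subst ennreal_plus[symmetric]) (auto simp: algebra_simps)
  finally show ?thesis .
qed

end

section \<open>Growth of the second moment\<close>

lemma nn_integral_Icc_exp: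
  fixes l t :: real
  assumes "l \<noteq> 0" "0 \<le> t"
  shows "(\<integral>\<^sup>+s. indicator {0..t} s * ennreal (exp (l * s)) \<partial>lborel) = ennreal ((exp (l * t) - 1) / l)"
proof -
  have "(\<integral>\<^sup>+s. ennreal (exp (l * s)) * indicator {0..t} s \<partial>lborel) = ennreal (exp (l * t) / l - exp (l * 0) / l)"
    by (rule nn_integral_FTC_Icc[where F="\<lambda>s. exp (l * s) / l"])
       (use assms in \<open>auto intro!: derivative_eq_intros\<close>)
  then show ?thesis by (simp add: mult.commute diff_divide_distrib)
qed

lemma nn_integral_Ici_exp:
  fixes l :: real
  assumes "l < 0"
  shows "(\<integral>\<^sup>+s. indicator {0..} s * ennreal (exp (l * s)) \<partial>lborel) = ennreal (1 / - l)"
proof -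
  have "((\<lambda>s. exp (l * s) / l) \<longlongrightarrow> 0) at_top"
    using assms by (real_asymp)
  then have "(\<integral>\<^sup>+s. ennreal (exp (l * s)) * indicator {0..} s \<partial>lborel) = ennreal (0 - exp (l * 0) / l)"
    by (intro nn_integral_FTC_atLeast[where F="\<lambda>s. exp (l * s) / l"])
       (use assms in \<open>auto intro!: derivative_eq_intros\<close>)
  then show ?thesis by (simp add: mult.commute)
qed

lemma ennreal_add_mult:
  "0 \<le> a \<Longrightarrow> 0 \<le> b \<Longrightarrow> 0 \<le> r \<Longrightarrow> ennreal a + ennreal b * ennreal r = ennreal (a + b * r)"
  by (simp add: ennreal_mult ennreal_plus)

lemma nn_integral_reflect:
  fixes f :: "real \<Rightarrow> ennreal"
  assumes [measurable]: "f \<in> borel_measurable borel"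
  shows "(\<integral>\<^sup>+s. indicator {0..t} s * f (t - s) \<partial>lborel) = (\<integral>\<^sup>+u. indicator {0..t} u * f u \<partial>lborel)"
proof -
  have "(\<integral>\<^sup>+u. indicator {0..t} u * f u \<partial>lborel) = (\<integral>\<^sup>+s. indicator {0..t} (t + (-1) * s) * f (t + (-1) * s) \<partial>lborel)"
    by (subst nn_integral_real_affine[where c="-1" and t=t]) simp_all
  also have "\<dots> = (\<integral>\<^sup>+s. indicator {0..t} s * f (t - s) \<partial>lborel)"
    by (intro nn_integral_cong) (auto split: split_indicator)
  finally show ?thesis by simp
qed

text \<open>The estimates are made in [0, \<infinity>], but \<open>C2\<close> and \<open>C3\<close>
  contain Bochner integrals. Domination by a decaying exponential makes the two notions
  agree.\<close>

lemma integral_exp_bounded: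
  fixes f :: "real \<Rightarrow> real"
  assumes l: "l < 0" and f: "(\<lambda>s. indicator {0..} s * f s) \<in> borel_measurable borel"
    and b: "\<And>s. 0 \<le> s \<Longrightarrow> 0 \<le> f s" "\<And>s. 0 \<le> s \<Longrightarrow> f s \<le> C * exp (l * s)"
  shows "(\<integral>\<^sup>+s. indicator {0..} s * ennreal (f s) \<partial>lborel) = ennreal (LBINT s:{0..}. f s)" "0 \<le> (LBINT s:{0..}. f s)"
proof -
  have eq: "indicator {0..} s * ennreal (f s) = ennreal (indicator {0..} s * f s)" for s
    by (auto split: split_indicator)
  have C: "0 \<le> C" using b(1)[of 0] b(2)[of 0] by simp
  have "(\<integral>\<^sup>+s. indicator {0..} s * ennreal (f s) \<partial>lborel) \<le> (\<integral>\<^sup>+s. ennreal C * (indicator {0..} s * ennreal (exp (l * s))) \<partial>lborel)"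
    using C b by (intro nn_integral_mono) (auto simp: ennreal_mult[symmetric] ennreal_leI split: split_indicator)
  also have "\<dots> = ennreal C * ennreal (1 / - l)"
    by (simp only: nn_integral_Ici_exp[OF l, symmetric]) (rule nn_integral_cmult, simp)
  also have "\<dots> < \<infinity>" by (simp add: ennreal_mult_less_top)
  finally have fin: "(\<integral>\<^sup>+s. ennreal (indicator {0..} s * f s) \<partial>lborel) < \<infinity>" unfolding eq .
  have int: "integrable lborel (\<lambda>s. indicator {0..} s * f s)"
    using f fin b(1) by (intro integrableI_nonneg) (auto split: split_indicator)
  show "(\<integral>\<^sup>+s. indicator {0..} s * ennreal (f s) \<partial>lborel) = ennreal (LBINT s:{0..}. f s)"
    unfolding eq set_lebesgue_integral_def
    using nn_integral_eq_integral[OF int] b(1) by (simp add: indicator_def)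
  show "0 \<le> (LBINT s:{0..}. f s)"
    unfolding set_lebesgue_integral_def using b(1)
    by (intro Bochner_Integration.integral_nonneg) (auto simp: indicator_def)
qed

section \<open>Growth of the semigroup and of its branching terms\<close>

locale nbp_triple = nbp M cb nmax for M cb nmax +
  fixes lam :: real and phi phit :: "config \<Rightarrow> real"
  assumes triple: "leading_triple M lam phi phit"
begin

lemma phi_Linf: "phi \<in> Linf_plus M" and phit_Linf: "phit \<in> Linf_plus M"
  and phi_pos: "y \<in> phase M \<Longrightarrow> 0 < phi y"
  and psi_phi: "0 \<le> t \<Longrightarrow> y \<in> phase M \<Longrightarrow> psi M t phi y = exp (lam * t) * phi y"
  using triple by (auto simp: leading_triple_def)

text \<open>The known asymptotics on the unit ball, made homogeneous in h: the error is linear in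
  any bound H, so h may vary with time. Lowering the rate \<epsilon> only weakens the claim; the cap
  e0 allows the subcritical case to demand a small rate.\<close>

lemma asymptotics:
  assumes e0: "0 < e0"
  obtains \<epsilon> c T :: real where "0 < \<epsilon>" "\<epsilon> \<le> e0" "0 \<le> c" "0 \<le> T"
    "\<And>t h H x. T \<le> t \<Longrightarrow> h \<in> Linf_plus M \<Longrightarrow> 0 < H \<Longrightarrow> (\<And>y. y \<in> phase M \<Longrightarrow> h y \<le> H) \<Longrightarrow> x \<in> phase M \<Longrightarrow>
      \<bar>psi M t h x - exp (lam * t) * phi x * pairing M phit h\<bar> \<le> exp (lam * t) * phi x * (c * H * exp (- \<epsilon> * t))"
proof -
  have "\<exists>\<epsilon>>0. \<exists>c T. \<forall>t\<ge>T. \<forall>g\<in>Linf_plus M. (\<forall>x\<in>phase M. g x \<le> 1) \<longrightarrow>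
        (\<forall>x\<in>phase M. \<bar>exp (- lam * t) * psi M t g x / phi x - pairing M phit g\<bar> \<le> c * exp (- \<epsilon> * t))"
    using triple unfolding leading_triple_def by (elim conjE) assumption
  then obtain \<epsilon>1 c1 T1 :: real where e1: "0 < \<epsilon>1" and A': "\<forall>t\<ge>T1. \<forall>g\<in>Linf_plus M. (\<forall>x\<in>phase M. g x \<le> 1) \<longrightarrow>
        (\<forall>x\<in>phase M. \<bar>exp (- lam * t) * psi M t g x / phi x - pairing M phit g\<bar> \<le> c1 * exp (- \<epsilon>1 * t))"
    by (elim exE conjE) (rule that)
  have A: "\<bar>exp (- lam * t) * psi M t g x / phi x - pairing M phit g\<bar> \<le> c1 * exp (- \<epsilon>1 * t)"
    if "T1 \<le> t" "g \<in> Linf_plus M" "\<And>y. y \<in> phase M \<Longrightarrow> g y \<le> 1" "x \<in> phase M" for t g x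
    by (rule A'[rule_format]) (use that in auto)
  define \<epsilon> where "\<epsilon> = min \<epsilon>1 e0"
  show ?thesis
  proof (rule that[of \<epsilon> "\<bar>c1\<bar>" "max T1 0"])
    show "0 < \<epsilon>" "\<epsilon> \<le> e0" using e1 e0 by (auto simp: \<epsilon>_def)
    fix t h H x
    assume t: "max T1 0 \<le> t" and h: "h \<in> Linf_plus M" and H: "0 < H" "\<And>y. y \<in> phase M \<Longrightarrow> h y \<le> H" and x: "x \<in> phase M"
    have "\<bar>exp (- lam * t) * psi M t (\<lambda>y. 1 / H * h y) x / phi x - pairing M phit (\<lambda>y. 1 / H * h y)\<bar> \<le> c1 * exp (- \<epsilon>1 * t)"
    proof (rule A)
      show "1 / H * h y \<le> 1" if "y \<in> phase M" for y using H(1) H(2)[OF that] by (simp add: divide_le_eq)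
      show "(\<lambda>y. 1 / H * h y) \<in> Linf_plus M" using H(1) by (intro scale_Linf h) simp
    qed (use t x in auto)
    then have 1: "\<bar>1 / H * (exp (- lam * t) * psi M t h x / phi x - pairing M phit h)\<bar> \<le> c1 * exp (- \<epsilon>1 * t)"
    proof -
      have "exp (- lam * t) * (1 / H * psi M t h x) / phi x - 1 / H * pairing M phit h
        = 1 / H * (exp (- lam * t) * psi M t h x / phi x - pairing M phit h)"
        by (simp add: right_diff_distrib)
      then show ?thesis
        using \<open>\<bar>exp (- lam * t) * psi M t (\<lambda>y. 1 / H * h y) x / phi x - pairing M phit (\<lambda>y. 1 / H * h y)\<bar> \<le> c1 * exp (- \<epsilon>1 * t)\<close>
        unfolding psi_scale pairing_scale by (simp only:)
    qed
    also have "\<dots> \<le> \<bar>c1\<bar> * exp (- \<epsilon> * t)"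
      using t mult_right_mono[of \<epsilon> \<epsilon>1 t] by (intro mult_mono) (auto simp: \<epsilon>_def)
    finally have "\<bar>exp (- lam * t) * psi M t h x / phi x - pairing M phit h\<bar> / H \<le> \<bar>c1\<bar> * exp (- \<epsilon> * t)"
      using H(1) by (simp only: abs_mult abs_divide abs_one abs_of_pos times_divide_eq_left mult_1)
    then have "\<bar>exp (- lam * t) * psi M t h x / phi x - pairing M phit h\<bar> \<le> (\<bar>c1\<bar> * exp (- \<epsilon> * t)) * H"
      using H(1) by (simp only: pos_divide_le_eq)
    also have "(\<bar>c1\<bar> * exp (- \<epsilon> * t)) * H = \<bar>c1\<bar> * H * exp (- \<epsilon> * t)" by (simp only: mult.assoc mult.commute)
    finally have "\<bar>exp (- lam * t) * psi M t h x / phi x - pairing M phit h\<bar> \<le> \<bar>c1\<bar> * H * exp (- \<epsilon> * t)" .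
    then have "exp (lam * t) * phi x * \<bar>exp (- lam * t) * psi M t h x / phi x - pairing M phit h\<bar>
      \<le> exp (lam * t) * phi x * (\<bar>c1\<bar> * H * exp (- \<epsilon> * t))"
      using phi_pos[OF x] by (intro mult_left_mono) auto
    also have "exp (lam * t) * phi x * \<bar>exp (- lam * t) * psi M t h x / phi x - pairing M phit h\<bar>
      = \<bar>exp (lam * t) * phi x * (exp (- lam * t) * psi M t h x / phi x - pairing M phit h)\<bar>"
      using phi_pos[OF x] by (simp add: abs_mult)
    also have "exp (lam * t) * phi x * (exp (- lam * t) * psi M t h x / phi x - pairing M phit h)
      = psi M t h x - exp (lam * t) * phi x * pairing M phit h"
    proof -
      have gen: "e * p * (e' * s / p - q) = s - e * p * q" if "e * e' = 1" "p \<noteq> 0" for e e' p s q :: real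
      proof -
        have "e * p * (e' * s / p) = (e * e') * s" using that(2) by simp
        then show ?thesis using that(1) by (simp add: right_diff_distrib)
      qed
      have "exp (lam * t) * exp (- lam * t) = 1" by (simp add: exp_add[symmetric])
      then show ?thesis using phi_pos[OF x] by (intro gen) auto
    qed
    finally show "\<bar>psi M t h x - exp (lam * t) * phi x * pairing M phit h\<bar> \<le> exp (lam * t) * phi x * (\<bar>c1\<bar> * H * exp (- \<epsilon> * t))" .
  qed simp_all
qed

lemma psi_growth:
  assumes g: "g \<in> Linf_plus M"
  obtains A :: real where "0 \<le> A" "\<And>(t::real) x. 0 \<le> t \<Longrightarrow> x \<in> phase M \<Longrightarrow> psi M t g x \<le> A * exp (lam * t)"
proof -
  obtain \<epsilon> c T :: real where e: "0 < \<epsilon>" "\<epsilon> \<le> 1" and c: "0 \<le> c" and T: "0 \<le> T" and as: "\<And>t h H x. T \<le> t \<Longrightarrow> h \<in> Linf_plus M \<Longrightarrow> 0 < H \<Longrightarrow> (\<And>y. y \<in> phase M \<Longrightarrow> h y \<le> H) \<Longrightarrow> x \<in> phase M \<Longrightarrow>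
      \<bar>psi M t h x - exp (lam * t) * phi x * pairing M phit h\<bar> \<le> exp (lam * t) * phi x * (c * H * exp (- \<epsilon> * t))"
    by (fact asymptotics[OF zero_less_one])
  obtain H0 where H0: "0 \<le> H0" "\<And>y. y \<in> phase M \<Longrightarrow> g y \<le> H0" using Linf_bound[OF g] by blast
  define H where "H = H0 + 1"
  have H: "0 < H" "\<And>y. y \<in> phase M \<Longrightarrow> g y \<le> H" using H0 by (auto simp: H_def intro: order_trans[OF H0(2)])
  obtain P :: real where P: "0 \<le> P" "\<And>y. y \<in> phase M \<Longrightarrow> phi y \<le> P" using Linf_bound[OF phi_Linf] by blast
  obtain B :: real where B: "0 \<le> B" "\<And>(t::real) x. 0 \<le> t \<Longrightarrow> t \<le> T \<Longrightarrow> x \<in> phase M \<Longrightarrow> psi M t g x \<le> B"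
    using psi_bounded[OF g, of T] by blast
  define Q where "Q = pairing M phit g"
  have Q: "0 \<le> Q" unfolding Q_def by (rule pairing_props(2)[OF phit_Linf g])
  \<comment> \<open>The first summand serves times from T on. Before T, \<open>psi\<close> is
    bounded by B, and \<open>exp (\<bar>lam\<bar> * T)\<close> makes up for values of
    \<open>exp (lam * t)\<close> below 1.\<close>
  define A where "A = P * (Q + c * H) + B * exp (\<bar>lam\<bar> * T)"
  show ?thesis
  proof (rule that[of A])
    show "0 \<le> A" using P Q c H B by (simp add: A_def)
    fix t :: real and x assume t: "0 \<le> t" and x: "x \<in> phase M"
    show "psi M t g x \<le> A * exp (lam * t)"
    proof (cases "T \<le> t")
      case True
      have "psi M t g x \<le> exp (lam * t) * (phi x * (Q + c * H * exp (- \<epsilon> * t)))"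
        using as[OF True g H x] by (simp add: Q_def algebra_simps abs_le_iff)
      also have "\<dots> \<le> exp (lam * t) * (P * (Q + c * H * 1))"
        using P phi_pos[OF x] x Q c H e t by (intro mult_left_mono mult_mono add_left_mono) (auto intro!: add_nonneg_nonneg mult_nonneg_nonneg)
      also have "\<dots> \<le> exp (lam * t) * A" using B by (intro mult_left_mono) (auto simp: A_def)
      finally show ?thesis by (simp add: mult.commute)
    next
      case False
      have "\<bar>lam\<bar> * t \<le> \<bar>lam\<bar> * T" using False by (intro mult_left_mono) auto
      then have "0 \<le> \<bar>lam\<bar> * T + lam * t" using t abs_ge_minus_self[of lam] mult_right_mono[of "- lam" "\<bar>lam\<bar>" t] by simp
      then have "1 \<le> exp (\<bar>lam\<bar> * T) * exp (lam * t)" by (simp add: exp_add[symmetric])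
      then have "B * 1 \<le> B * (exp (\<bar>lam\<bar> * T) * exp (lam * t))" using B(1) by (rule mult_left_mono)
      also have "\<dots> \<le> A * exp (lam * t)" using P Q c H by (simp add: A_def distrib_right)
      finally show ?thesis using B(2)[OF t _ x] False by simp
    qed
  qed
qed

text \<open>By monotonicity and homogeneity it suffices to treat the constant function 1.\<close>

lemma psi_growth_uniform:
  obtains A :: real where "0 < A" "\<And>(t::real) x h (H::real). 0 \<le> t \<Longrightarrow> x \<in> phase M \<Longrightarrow> h \<in> Linf_plus M \<Longrightarrow> 0 \<le> H \<Longrightarrow>
     (\<And>y. y \<in> phase M \<Longrightarrow> h y \<le> H) \<Longrightarrow> psi M t h x \<le> A * H * exp (lam * t)"
proof -
  have one: "(\<lambda>_. 1) \<in> Linf_plus M" by simp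
  obtain A :: real where A: "0 \<le> A" "\<And>(t::real) x. 0 \<le> t \<Longrightarrow> x \<in> phase M \<Longrightarrow> psi M t (\<lambda>_. 1) x \<le> A * exp (lam * t)"
    by (fact psi_growth[OF one])
  show ?thesis
  proof (rule that[of "A + 1"])
    fix t :: real and x h and H :: real
    assume t: "0 \<le> t" and x: "x \<in> phase M" and h: "h \<in> Linf_plus M" and H: "0 \<le> H" "\<And>y. y \<in> phase M \<Longrightarrow> h y \<le> H"
    have "psi M t h x \<le> psi M t (\<lambda>y. H * 1) x"
      using H by (intro psi_mono h t x scale_Linf one) auto
    also have "\<dots> = H * psi M t (\<lambda>_. 1) x" by (rule psi_scale)
    also have "\<dots> \<le> H * ((A + 1) * exp (lam * t))"
      using A(2)[OF t x] H by (intro mult_left_mono) (auto simp: distrib_right intro: order_trans)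
    finally show "psi M t h x \<le> (A + 1) * H * exp (lam * t)" by (simp add: mult.commute mult.left_commute)
  qed (use A in simp)
qed

text \<open>\<open>eta_f\<close> is quadratic, so it turns the order \<open>exp (lam * u)\<close>
  into \<open>exp (2 * lam * u)\<close>, and the outer semigroup adds \<open>exp (lam * s)\<close>.
  K is kept strictly positive, so that it yields a bound H for \<open>asymptotics\<close>.\<close>

lemma branching_term_bound:
  assumes g: "g \<in> Linf_plus M"
  obtains K A :: real where "0 < K" "0 < A" "\<And>(u::real) y. 0 \<le> u \<Longrightarrow> y \<in> phase M \<Longrightarrow> eta_f M (psi M u g) y \<le> K * exp (2 * lam * u)"
    "\<And>(s::real) (u::real) x. 0 \<le> s \<Longrightarrow> 0 \<le> u \<Longrightarrow> x \<in> phase M \<Longrightarrow>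
       psi M s (eta_f M (psi M u g)) x \<le> A * K * exp (lam * s + 2 * lam * u)"
proof -
  obtain A :: real where A: "0 < A" "\<And>(t::real) x h (H::real). 0 \<le> t \<Longrightarrow> x \<in> phase M \<Longrightarrow> h \<in> Linf_plus M \<Longrightarrow> 0 \<le> H \<Longrightarrow>
     (\<And>y. y \<in> phase M \<Longrightarrow> h y \<le> H) \<Longrightarrow> psi M t h x \<le> A * H * exp (lam * t)"
    by (fact psi_growth_uniform)
  obtain B :: real where B: "0 \<le> B" "\<And>(t::real) x. 0 \<le> t \<Longrightarrow> x \<in> phase M \<Longrightarrow> psi M t g x \<le> B * exp (lam * t)"
    by (fact psi_growth[OF g])
  define K where "K = cb * (real nmax * B)\<^sup>2 + 1"
  have K: "0 < K" using cb_nonneg by (simp add: K_def add_nonneg_pos)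
  have 1: "eta_f M (psi M u g) y \<le> K * exp (2 * lam * u)" if u: "0 \<le> u" and y: "y \<in> phase M" for u y
  proof -
    have "eta_f M (psi M u g) y \<le> cb * (real nmax * (B * exp (lam * u)))\<^sup>2"
      using B(2)[OF u] by (intro eta_props(3)[OF psi_Linf[OF g u] y]) auto
    also have "\<dots> = (cb * (real nmax * B)\<^sup>2) * exp (2 * lam * u)"
      by (simp add: power_mult_distrib exp_double[symmetric] mult.assoc)
    also have "\<dots> \<le> K * exp (2 * lam * u)" by (intro mult_right_mono) (auto simp: K_def)
    finally show ?thesis .
  qed
  show ?thesis
  proof (rule that[OF K A(1) 1])
    fix s u :: real and x assume s: "0 \<le> s" and u: "0 \<le> u" and x: "x \<in> phase M"
    have "psi M s (eta_f M (psi M u g)) x \<le> A * (K * exp (2 * lam * u)) * exp (lam * s)"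
      using K 1[OF u] by (intro A(2)[OF s x eta_Linf[OF psi_Linf[OF g u]]]) auto
    then show "psi M s (eta_f M (psi M u g)) x \<le> A * K * exp (lam * s + 2 * lam * u)"
      by (simp add: exp_add mult.commute mult.left_commute)
  qed auto
qed

text \<open>The order of magnitude of \<open>\<langle>g, X\<^sub>t\<rangle>\<^sup>2\<close> in the mean, relative to \<open>e\<^sup>2\<^sup>\<lambda>\<^sup>t\<close>.\<close>

definition growth :: "real \<Rightarrow> real" where
  "growth t = (if lam = 0 then t else if 0 < lam then 1 else exp (- lam * t))"

text \<open>Fission at time s contributes at most a multiple of
  \<open>exp (lam * s + 2 * lam * (t - s))\<close>, which is \<open>exp (2 * lam * t)\<close> times
  \<open>exp (- lam * s)\<close>. The integral of the last factor over [0, t] decides: early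
  fissions prevail if lam > 0, all times count alike if lam = 0, late ones prevail if lam < 0. From
  t = 1 on, the term with the square of g is of no larger order.\<close>

lemma second_moment_growth:
  assumes g: "g \<in> Linf_plus M" and x: "x \<in> phase M"
  obtains S :: real where "0 \<le> S" "\<And>t. 1 \<le> t \<Longrightarrow>
    (\<integral>\<^sup>+\<omega>. ennreal ((X_pairing M g t \<omega>)\<^sup>2) \<partial>nbp_law M x) \<le> ennreal (S * growth t * exp (2 * lam * t))"
proof -
  obtain A :: real where A: "0 \<le> A" "\<And>(t::real) x. 0 \<le> t \<Longrightarrow> x \<in> phase M \<Longrightarrow> psi M t (\<lambda>y. (g y)\<^sup>2) x \<le> A * exp (lam * t)"
    by (fact psi_growth[OF square_Linf[OF g]])
  obtain K B :: real where K: "0 < K" "0 < B"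
    and K1: "\<And>(u::real) y. 0 \<le> u \<Longrightarrow> y \<in> phase M \<Longrightarrow> eta_f M (psi M u g) y \<le> K * exp (2 * lam * u)"
    and KB: "\<And>(s::real) (u::real) x. 0 \<le> s \<Longrightarrow> 0 \<le> u \<Longrightarrow> x \<in> phase M \<Longrightarrow>
       psi M s (eta_f M (psi M u g)) x \<le> B * K * exp (lam * s + 2 * lam * u)"
    by (fact branching_term_bound[OF g])
  define C where "C = B * K"
  have C: "0 \<le> C" using K by (simp add: C_def)
  have main: "(\<integral>\<^sup>+\<omega>. ennreal ((X_pairing M g t \<omega>)\<^sup>2) \<partial>nbp_law M x)
     \<le> ennreal (A * exp (lam * t)) + ennreal (C * exp (2 * lam * t)) * (\<integral>\<^sup>+s. indicator {0..t} s * ennreal (exp (- lam * s)) \<partial>lborel)"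
    if t: "0 \<le> t" for t
  proof -
    have "(\<integral>\<^sup>+s. indicator {0..t} s * ennreal (psi M s (eta_f M (psi M (t - s) g)) x) \<partial>lborel)
      \<le> (\<integral>\<^sup>+s. ennreal (C * exp (2 * lam * t)) * (indicator {0..t} s * ennreal (exp (- lam * s))) \<partial>lborel)"
    proof (rule nn_integral_mono)
      fix s
      show "indicator {0..t} s * ennreal (psi M s (eta_f M (psi M (t - s) g)) x)
        \<le> ennreal (C * exp (2 * lam * t)) * (indicator {0..t} s * ennreal (exp (- lam * s)))"
      proof (cases "s \<in> {0..t}")
        case True
        have "psi M s (eta_f M (psi M (t - s) g)) x \<le> C * exp (lam * s + 2 * lam * (t - s))"
          using KB[of s "t - s" x] True x by (simp add: C_def)
        also have "lam * s + 2 * lam * (t - s) = 2 * lam * t + - lam * s" by (simp add: algebra_simps)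
        also have "C * exp (2 * lam * t + - lam * s) = C * exp (2 * lam * t) * exp (- lam * s)"
          by (simp only: exp_add mult.assoc)
        finally have "ennreal (psi M s (eta_f M (psi M (t - s) g)) x) \<le> ennreal (C * exp (2 * lam * t) * exp (- lam * s))"
          by (rule ennreal_leI)
        then show ?thesis using True C by (simp add: ennreal_mult)
      qed simp
    qed
    also have "\<dots> = ennreal (C * exp (2 * lam * t)) * (\<integral>\<^sup>+s. indicator {0..t} s * ennreal (exp (- lam * s)) \<partial>lborel)"
      by (rule nn_integral_cmult) simp
    finally show ?thesis
      using second_moment[OF g x t] A(2)[OF t x]
      by (elim order_trans) (intro add_mono ennreal_leI)
  qed
  define S where "S = A + (if lam = 0 then C else C / \<bar>lam\<bar>)"
  show ?thesis
  proof (rule that[of S])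
    show "0 \<le> S" using A C by (simp add: S_def)
    fix t :: real assume t: "1 \<le> t"
    consider "lam = 0" | "0 < lam" | "lam < 0" by linarith
    then show "(\<integral>\<^sup>+\<omega>. ennreal ((X_pairing M g t \<omega>)\<^sup>2) \<partial>nbp_law M x) \<le> ennreal (S * growth t * exp (2 * lam * t))"
    proof cases
      case 1
      have "A * 1 \<le> A * t" using A(1) t by (intro mult_left_mono)
      then have "A + C * t \<le> S * t" using 1 by (simp add: S_def distrib_right)
      then have "ennreal A + ennreal C * ennreal t \<le> ennreal (S * t)"
        using A(1) C t by (simp add: ennreal_mult[symmetric] ennreal_plus[symmetric] ennreal_leI del: ennreal_plus)
      moreover have "growth t = t" using 1 unfolding growth_def by simp
      ultimately show ?thesis using main[of t] t 1 by simp
    next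
      case 2
      have "exp (lam * t) \<le> exp (2 * lam * t)" using 2 t by simp
      then have a: "A * exp (lam * t) \<le> A * exp (2 * lam * t)" using A(1) by (rule mult_left_mono)
      have "(exp (- lam * t) - 1) / - lam \<le> 1 / lam" using 2 by (simp add: field_simps)
      then have b: "C * exp (2 * lam * t) * ((exp (- lam * t) - 1) / - lam) \<le> C * exp (2 * lam * t) * (1 / lam)"
        using C by (intro mult_left_mono) auto
      have nn: "0 \<le> (exp (- lam * t) - 1) / - lam" using 2 t by (simp add: divide_le_0_iff)
      have "A * exp (lam * t) + C * exp (2 * lam * t) * ((exp (- lam * t) - 1) / - lam) \<le> S * growth t * exp (2 * lam * t)"
        using a b 2 by (simp add: S_def growth_def distrib_right)
      then have "ennreal (A * exp (lam * t)) + ennreal (C * exp (2 * lam * t)) * ennreal ((exp (- lam * t) - 1) / - lam) \<le> ennreal (S * growth t * exp (2 * lam * t))"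
        using A(1) C nn by (subst ennreal_add_mult) (auto intro!: ennreal_leI)
      then show ?thesis using main[of t] t 2 nn_integral_Icc_exp[of "- lam" t] by simp
    next
      case 3
      have nn: "0 \<le> (exp (- lam * t) - 1) / - lam" using 3 t by (simp add: divide_le_0_iff mult_le_0_iff)
      have "C * exp (2 * lam * t) * ((exp (- lam * t) - 1) / - lam) \<le> C * exp (2 * lam * t) * (exp (- lam * t) / - lam)"
        using C 3 by (intro mult_left_mono divide_right_mono) auto
      also have "\<dots> = C / - lam * exp (lam * t)" by (simp add: exp_add[symmetric])
      finally have "A * exp (lam * t) + C * exp (2 * lam * t) * ((exp (- lam * t) - 1) / - lam)
         \<le> A * exp (lam * t) + C / - lam * exp (lam * t)"
        by (rule add_left_mono)
      also have "\<dots> = S * exp (lam * t)" using 3 by (simp add: S_def left_diff_distrib)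
      also have "S * exp (lam * t) = S * growth t * exp (2 * lam * t)"
        using 3 by (simp add: growth_def exp_add[symmetric] mult.assoc)
      finally have "ennreal (A * exp (lam * t)) + ennreal (C * exp (2 * lam * t)) * ennreal ((exp (- lam * t) - 1) / - lam) \<le> ennreal (S * growth t * exp (2 * lam * t))"
        using A(1) C nn by (subst ennreal_add_mult) (auto intro!: ennreal_leI)
      then show ?thesis using main[of t] t 3 nn_integral_Icc_exp[of "- lam" t] by simp
    qed
  qed
qed

text \<open>If s and t - s are both large, the inner semigroup is close to \<open>phi\<close> times
  the pairing of g, and the outer one replaces \<open>eta_f M phi\<close> by its pairing with
  \<open>phit\<close>. The integrand is then close to the constant \<open>C1\<close>. The two ends
  of [0, t] contribute a bounded amount, negligible against t.\<close>

lemma second_moment_critical: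
  assumes g: "g \<in> Linf_plus M" and x: "x \<in> phase M" and lam: "lam = 0" and \<delta>: "0 < \<delta>"
  shows "0 \<le> C1 M phi phit g x" "\<forall>\<^sub>F t in at_top.
    (\<integral>\<^sup>+\<omega>. ennreal ((X_pairing M g t \<omega>)\<^sup>2) \<partial>nbp_law M x) \<le> ennreal (t * (C1 M phi phit g x + \<delta>))"
proof -
  define Q where "Q = pairing M phit g"
  define R where "R = pairing M phit (eta_f M phi)"
  have Q: "0 \<le> Q" unfolding Q_def by (rule pairing_props(2)[OF phit_Linf g])
  have R: "0 \<le> R" unfolding R_def by (rule pairing_props(2)[OF phit_Linf eta_Linf[OF phi_Linf]])
  have C1: "C1 M phi phit g x = R * Q\<^sup>2 * phi x"
    by (simp add: C1_def R_def Q_def pairing_commute[of _ phit])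
  then show C1_nonneg: "0 \<le> C1 M phi phit g x" using R phi_pos[OF x] by simp
  obtain \<epsilon> c T :: real where e: "0 < \<epsilon>" "\<epsilon> \<le> 1" and c: "0 \<le> c" and T: "0 \<le> T" and as: "\<And>t h H x. T \<le> t \<Longrightarrow> h \<in> Linf_plus M \<Longrightarrow> 0 < H \<Longrightarrow> (\<And>y. y \<in> phase M \<Longrightarrow> h y \<le> H) \<Longrightarrow> x \<in> phase M \<Longrightarrow>
      \<bar>psi M t h x - exp (lam * t) * phi x * pairing M phit h\<bar> \<le> exp (lam * t) * phi x * (c * H * exp (- \<epsilon> * t))"
    by (fact asymptotics[OF zero_less_one])
  have up: "\<exists>T'\<ge>0. \<forall>t\<ge>T'. \<forall>y\<in>phase M. psi M t h y \<le> phi y * (pairing M phit h + d)"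
    if h: "h \<in> Linf_plus M" and d: "0 < d" for h d
  proof -
    obtain H0 where H0: "0 \<le> H0" "\<And>y. y \<in> phase M \<Longrightarrow> h y \<le> H0" using Linf_bound[OF h] by blast
    have H: "0 < H0 + 1" "\<And>y. y \<in> phase M \<Longrightarrow> h y \<le> H0 + 1" using H0 by (auto intro: order_trans[OF H0(2)])
    have "((\<lambda>t. c * (H0 + 1) * exp (- \<epsilon> * t)) \<longlongrightarrow> 0) at_top" using e by real_asymp
    then have "\<forall>\<^sub>F t in at_top. c * (H0 + 1) * exp (- \<epsilon> * t) < d" using d by (rule order_tendstoD)
    then obtain T2 where T2: "\<And>t. T2 \<le> t \<Longrightarrow> c * (H0 + 1) * exp (- \<epsilon> * t) < d" by (auto simp: eventually_at_top_linorder)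
    show ?thesis
    proof (intro exI[of _ "max T T2"] conjI allI impI ballI)
      fix t y assume t: "max T T2 \<le> t" and y: "y \<in> phase M"
      have "psi M t h y \<le> phi y * pairing M phit h + phi y * (c * (H0 + 1) * exp (- \<epsilon> * t))"
        using as[of t h "H0 + 1" y] t h H y lam by (simp add: abs_le_iff)
      also have "\<dots> \<le> phi y * pairing M phit h + phi y * d"
        using T2[of t] t phi_pos[OF y] by (intro add_left_mono mult_left_mono) auto
      finally show "psi M t h y \<le> phi y * (pairing M phit h + d)" by (simp add: distrib_left)
    qed (use T in simp)
  qed
  \<comment> \<open>A slack d is fixed such that the product of the perturbed limits stays within
    \<delta> / 2 of \<open>C1\<close>. The other half of \<delta> absorbs the terms that stay
    bounded in t.\<close>
  have "((\<lambda>d. (Q + d)\<^sup>2 * (phi x * (R + d))) \<longlongrightarrow> (Q + 0)\<^sup>2 * (phi x * (R + 0))) (at_right 0)"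
    by (intro tendsto_intros)
  then have "\<forall>\<^sub>F d in at_right 0. (Q + d)\<^sup>2 * (phi x * (R + d)) < C1 M phi phit g x + \<delta> / 2"
    by (rule order_tendstoD(2)) (use \<delta> in \<open>simp add: C1 mult.commute mult.left_commute\<close>)
  moreover have "\<forall>\<^sub>F d in at_right (0::real). 0 < d" by (rule eventually_at_right_less)
  ultimately have "\<forall>\<^sub>F d in at_right (0::real). 0 < d \<and> (Q + d)\<^sup>2 * (phi x * (R + d)) < C1 M phi phit g x + \<delta> / 2"
    by eventually_elim simp
  then obtain d :: real where d: "0 < d" "(Q + d)\<^sup>2 * (phi x * (R + d)) < C1 M phi phit g x + \<delta> / 2"
    using eventually_happens'[OF trivial_limit_at_right_real] by blast
  define D where "D = (Q + d)\<^sup>2 * (phi x * (R + d))"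
  have D0: "0 \<le> D" using Q R d phi_pos[OF x] by (simp add: D_def)
  obtain T1 where T1: "0 \<le> T1" "\<And>t y. T1 \<le> t \<Longrightarrow> y \<in> phase M \<Longrightarrow> psi M t g y \<le> phi y * (Q + d)"
    using up[OF g d(1)] unfolding Q_def by blast
  obtain T2 where T2: "0 \<le> T2" "\<And>t y. T2 \<le> t \<Longrightarrow> y \<in> phase M \<Longrightarrow> psi M t (eta_f M phi) y \<le> phi y * (R + d)"
    using up[OF eta_Linf[OF phi_Linf] d(1)] unfolding R_def by blast
  define T' where "T' = max T1 T2"
  obtain K B :: real where K: "0 < K" "0 < B"
    and K1: "\<And>(u::real) y. 0 \<le> u \<Longrightarrow> y \<in> phase M \<Longrightarrow> eta_f M (psi M u g) y \<le> K * exp (2 * lam * u)"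
    and KB: "\<And>(s::real) (u::real) x. 0 \<le> s \<Longrightarrow> 0 \<le> u \<Longrightarrow> x \<in> phase M \<Longrightarrow>
       psi M s (eta_f M (psi M u g)) x \<le> B * K * exp (lam * s + 2 * lam * u)"
    by (fact branching_term_bound[OF g])
  define C where "C = B * K"
  have C: "0 \<le> C" using K by (simp add: C_def)
  obtain A :: real where A: "0 \<le> A" "\<And>(t::real) x. 0 \<le> t \<Longrightarrow> x \<in> phase M \<Longrightarrow> psi M t (\<lambda>y. (g y)\<^sup>2) x \<le> A * exp (lam * t)"
    by (fact psi_growth[OF square_Linf[OF g]])
  \<comment> \<open>In the two windows of length T', where s or t - s is too small for the
    asymptotics, the crude bound C is used; in between, the two asymptotic bounds combine to
    D.\<close>
  have J: "psi M s (eta_f M (psi M (t - s) g)) x \<le> D + C * indicator {0..T'} s + C * indicator {t - T'..t} s"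
    if s: "0 \<le> s" "s \<le> t" for s t
  proof (cases "s \<le> T' \<or> t - s \<le> T'")
    case True
    have "psi M s (eta_f M (psi M (t - s) g)) x \<le> C" using KB[of s "t - s" x] s x lam by (simp add: C_def)
    then show ?thesis using True s D0 C by (auto simp: indicator_def)
  next
    case False
    then have u: "T1 \<le> t - s" "T2 \<le> s" by (auto simp: T'_def)
    have "psi M s (eta_f M (psi M (t - s) g)) x \<le> psi M s (\<lambda>y. (Q + d)\<^sup>2 * eta_f M phi y) x"
    proof (rule psi_mono)
      fix y assume y: "y \<in> phase M"
      have "eta_f M (psi M (t - s) g) y \<le> eta_f M (\<lambda>y. (Q + d) * phi y) y"
        using Q d T1(2)[OF u(1)] s by (intro eta_mono psi_Linf g scale_Linf phi_Linf y) (auto simp: mult.commute)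
      then show "eta_f M (psi M (t - s) g) y \<le> (Q + d)\<^sup>2 * eta_f M phi y" by (simp only: eta_scale)
    qed (use s x in \<open>auto intro!: eta_Linf psi_Linf g scale_Linf phi_Linf\<close>)
    also have "\<dots> = (Q + d)\<^sup>2 * psi M s (eta_f M phi) x" by (rule psi_scale)
    also have "\<dots> \<le> D" unfolding D_def by (intro mult_left_mono T2(2)[OF u(2) x]) simp
    finally show ?thesis using C by (auto simp: indicator_def)
  qed
  have main: "(\<integral>\<^sup>+\<omega>. ennreal ((X_pairing M g t \<omega>)\<^sup>2) \<partial>nbp_law M x) \<le> ennreal (A + D * t + 2 * C * T')" if t: "0 \<le> t" for t
  proof -
    have "(\<integral>\<^sup>+s. indicator {0..t} s * ennreal (psi M s (eta_f M (psi M (t - s) g)) x) \<partial>lborel)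
      \<le> (\<integral>\<^sup>+s. ennreal D * indicator {0..t} s + ennreal C * indicator {0..T'} s + ennreal C * indicator {t - T'..t} s \<partial>lborel)"
    proof (rule nn_integral_mono)
      fix s
      show "indicator {0..t} s * ennreal (psi M s (eta_f M (psi M (t - s) g)) x)
        \<le> ennreal D * indicator {0..t} s + ennreal C * indicator {0..T'} s + ennreal C * indicator {t - T'..t} s"
      proof (cases "s \<in> {0..t}")
        case True
        then have "ennreal (psi M s (eta_f M (psi M (t - s) g)) x) \<le> ennreal (D + C * indicator {0..T'} s + C * indicator {t - T'..t} s)"
          by (intro ennreal_leI J) auto
        also have "\<dots> = ennreal D + ennreal C * indicator {0..T'} s + ennreal C * indicator {t - T'..t} s"
          using D0 C by (auto simp: indicator_def)
        finally show ?thesis using True by simp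
      qed simp
    qed
    also have "\<dots> = ennreal D * ennreal t + ennreal C * ennreal T' + ennreal C * ennreal T'"
      using t T1 T2 by (subst nn_integral_add, simp, simp, subst nn_integral_add, simp, simp)
        (simp add: nn_integral_cmult T'_def)
    also have "\<dots> = ennreal (D * t + 2 * C * T')"
      using D0 C t T1 T2 by (simp add: ennreal_mult[symmetric] ennreal_plus[symmetric] T'_def del: ennreal_plus)
    finally have "ennreal (psi M t (\<lambda>y. (g y)\<^sup>2) x) + (\<integral>\<^sup>+s. indicator {0..t} s * ennreal (psi M s (eta_f M (psi M (t - s) g)) x) \<partial>lborel)
      \<le> ennreal A + ennreal (D * t + 2 * C * T')"
      using A(2)[OF t x] lam by (intro add_mono ennreal_leI) simp_all
    also have "\<dots> = ennreal (A + D * t + 2 * C * T')"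
      using A(1) D0 C t T1 T2 by (subst ennreal_plus[symmetric]) (auto simp: T'_def add.assoc)
    finally show ?thesis by (rule order_trans[OF second_moment[OF g x t]])
  qed
  have "\<forall>\<^sub>F t in at_top. 2 * (A + 2 * C * T') / \<delta> \<le> t" by (rule eventually_ge_at_top)
  with eventually_ge_at_top[of 0]
  show "\<forall>\<^sub>F t in at_top. (\<integral>\<^sup>+\<omega>. ennreal ((X_pairing M g t \<omega>)\<^sup>2) \<partial>nbp_law M x) \<le> ennreal (t * (C1 M phi phit g x + \<delta>))"
  proof eventually_elim
    case (elim t)
    have "A + 2 * C * T' \<le> t * (\<delta> / 2)" using elim \<delta> by (simp add: field_simps)
    moreover have "D * t \<le> (C1 M phi phit g x + \<delta> / 2) * t" using d(2) elim by (intro mult_right_mono) (auto simp: D_def)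
    ultimately have "A + D * t + 2 * C * T' \<le> t * (C1 M phi phit g x + \<delta>)" by (simp add: algebra_simps)
    then show ?case using main[of t] elim by (meson ennreal_leI order_trans)
  qed
qed

text \<open>Let u = t - s be the time left after a fission. The branching term at u is of order
  \<open>exp (2 * lam * u)\<close>, so fissions long before t hardly count, while for bounded u the
  outer semigroup has reached its asymptotic form. Relative to \<open>exp (lam * t)\<close> the
  integrand tends to that of \<open>C3\<close>, with an error that is integrable in u and vanishes
  as t grows.\<close>

lemma second_moment_subcritical:
  assumes g: "g \<in> Linf_plus M" and x: "x \<in> phase M" and lam: "lam < 0" and \<delta>: "0 < \<delta>"
  shows "0 \<le> C3 M lam phi phit g x" "\<forall>\<^sub>F t in at_top.
    (\<integral>\<^sup>+\<omega>. ennreal ((X_pairing M g t \<omega>)\<^sup>2) \<partial>nbp_law M x) \<le> ennreal (exp (lam * t) * (C3 M lam phi phit g x + \<delta>))"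
proof -
  have pos: "0 < - lam / 2" using lam by simp
  obtain \<epsilon> c T :: real where e: "0 < \<epsilon>" "\<epsilon> \<le> - lam / 2" and c: "0 \<le> c" and T: "0 \<le> T" and as: "\<And>t h H x. T \<le> t \<Longrightarrow> h \<in> Linf_plus M \<Longrightarrow> 0 < H \<Longrightarrow> (\<And>y. y \<in> phase M \<Longrightarrow> h y \<le> H) \<Longrightarrow> x \<in> phase M \<Longrightarrow>
      \<bar>psi M t h x - exp (lam * t) * phi x * pairing M phit h\<bar> \<le> exp (lam * t) * phi x * (c * H * exp (- \<epsilon> * t))"
    by (fact asymptotics[OF pos])
  obtain K B :: real where K: "0 < K" "0 < B"
    and K1: "\<And>(u::real) y. 0 \<le> u \<Longrightarrow> y \<in> phase M \<Longrightarrow> eta_f M (psi M u g) y \<le> K * exp (2 * lam * u)"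
    and KB: "\<And>(s::real) (u::real) x. 0 \<le> s \<Longrightarrow> 0 \<le> u \<Longrightarrow> x \<in> phase M \<Longrightarrow>
       psi M s (eta_f M (psi M u g)) x \<le> B * K * exp (lam * s + 2 * lam * u)"
    by (fact branching_term_bound[OF g])
  obtain H0 where H0: "0 \<le> H0" "\<And>y. y \<in> phase M \<Longrightarrow> (g y)\<^sup>2 \<le> H0" using Linf_bound[OF square_Linf[OF g]] by blast
  define H where "H = H0 + 1"
  have H: "0 < H" "\<And>y. y \<in> phase M \<Longrightarrow> (g y)\<^sup>2 \<le> H" using H0 by (auto simp: H_def intro: order_trans[OF H0(2)])
  have px: "0 < phi x" by (rule phi_pos[OF x])
  define Pu where "Pu u = pairing M phit (eta_f M (psi M u g))" for u
  define W where "W = pairing M phit (\<lambda>_. 1)"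
  define f where "f u = exp (- lam * u) * Pu u" for u
  have Pu: "0 \<le> Pu u" "Pu u \<le> K * W * exp (2 * lam * u)" if u: "0 \<le> u" for u
  proof -
    have eL: "eta_f M (psi M u g) \<in> Linf_plus M" by (intro eta_Linf psi_Linf g u)
    show "0 \<le> Pu u" unfolding Pu_def by (rule pairing_props(2)[OF phit_Linf eL])
    have "Pu u \<le> pairing M phit (\<lambda>y. K * exp (2 * lam * u) * 1)"
      unfolding Pu_def using K K1[OF u] by (intro pairing_mono phit_Linf eL scale_Linf) auto
    also have "\<dots> = K * exp (2 * lam * u) * W" unfolding W_def by (rule pairing_scale)
    finally show "Pu u \<le> K * W * exp (2 * lam * u)" by (simp add: mult.commute mult.left_commute)
  qed
  have f0: "0 \<le> f u" if "0 \<le> u" for u using Pu(1)[OF that] by (simp add: f_def)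
  have f1: "f u \<le> K * W * exp (lam * u)" if "0 \<le> u" for u
  proof -
    have "f u \<le> exp (- lam * u) * (K * W * exp (2 * lam * u))"
      unfolding f_def using Pu(2)[OF that] by (intro mult_left_mono) auto
    also have "\<dots> = K * W * (exp (- lam * u) * exp (2 * lam * u))" by simp
    also have "exp (- lam * u) * exp (2 * lam * u) = exp (lam * u)" by (simp add: exp_add[symmetric])
    finally show ?thesis .
  qed
  have f_meas: "(\<lambda>u. indicator {0..} u * f u) \<in> borel_measurable borel"
  proof -
    have "(\<lambda>u. exp (- lam * u) * (indicator {0..} u * pairing M phit (eta_f M (psi M u g)))) \<in> borel_measurable borel"
      using pairing_eta_meas[OF phit_Linf g] by measurable
    then show ?thesis by (simp add: f_def Pu_def mult.left_commute)
  qed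
  define I where "I = (LBINT u:{0..}. f u)"
  have I: "(\<integral>\<^sup>+u. indicator {0..} u * ennreal (f u) \<partial>lborel) = ennreal I" "0 \<le> I"
    using integral_exp_bounded[OF lam f_meas f0 f1] by (simp_all add: I_def)
  define Q where "Q = pairing M phit (\<lambda>y. (g y)\<^sup>2)"
  have Q: "0 \<le> Q" unfolding Q_def by (rule pairing_props(2)[OF phit_Linf square_Linf[OF g]])
  have C3: "C3 M lam phi phit g x = phi x * (Q + I)"
    by (simp add: C3_def Q_def I_def f_def Pu_def pairing_commute[of _ phit])
  then show "0 \<le> C3 M lam phi phit g x" using px Q I by simp
  \<comment> \<open>The error factor, common to two regimes. As long as t - u \<ge> T, it is the
    error of \<open>asymptotics\<close>, where \<epsilon> \<le> - lam / 2 leaves the decay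
    \<open>exp (lam / 2 * u)\<close>. For u beyond t - T, half of the decay
    \<open>exp (lam * u)\<close> is at most \<open>exp (lam * (t - T) / 2)\<close>.\<close>
  define r where "r t = phi x * (c * K * exp (- \<epsilon> * t)) + B * K * exp (lam * (t - T) / 2)" for t
  have r0: "0 \<le> r t" for t using px c K by (simp add: r_def)
  have J: "psi M (t - u) (eta_f M (psi M u g)) x \<le> exp (lam * t) * (phi x * f u + r t * exp (lam / 2 * u))"
    if u: "0 \<le> u" "u \<le> t" for u t
  proof (cases "T \<le> t - u")
    case True
    have "psi M (t - u) (eta_f M (psi M u g)) x
      \<le> exp (lam * (t - u)) * phi x * Pu u + exp (lam * (t - u)) * phi x * (c * (K * exp (2 * lam * u)) * exp (- \<epsilon> * (t - u)))"
      using as[OF True eta_Linf[OF psi_Linf[OF g u(1)]] _ _ x, of "K * exp (2 * lam * u)"] K K1[OF u(1)]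
      by (simp add: Pu_def abs_le_iff)
    also have "exp (lam * (t - u)) * phi x * Pu u = exp (lam * t) * (phi x * f u)"
      by (simp add: f_def right_diff_distrib exp_diff exp_minus divide_inverse)
    also have "exp (lam * (t - u)) * phi x * (c * (K * exp (2 * lam * u)) * exp (- \<epsilon> * (t - u)))
      = exp (lam * t) * (phi x * (c * K * exp (- \<epsilon> * t)) * exp ((lam + \<epsilon>) * u))"
    proof -
      have "exp (lam * (t - u)) * exp (2 * lam * u) * exp (- \<epsilon> * (t - u)) = exp (lam * t) * exp (- \<epsilon> * t) * exp ((lam + \<epsilon>) * u)"
        unfolding exp_add[symmetric] by (rule arg_cong[where f=exp]) (simp add: algebra_simps)
      then show ?thesis by (simp only: mult.assoc mult.commute mult.left_commute)
    qed
    also have "exp (lam * t) * (phi x * (c * K * exp (- \<epsilon> * t)) * exp ((lam + \<epsilon>) * u)) \<le> exp (lam * t) * (r t * exp (lam / 2 * u))"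
    proof (intro mult_left_mono mult_mono)
      have "(lam + \<epsilon>) * u \<le> lam / 2 * u" using e u by (intro mult_right_mono) auto
      then show "exp ((lam + \<epsilon>) * u) \<le> exp (lam / 2 * u)" by simp
    qed (use r0 K px c in \<open>auto simp: r_def\<close>)
    finally show ?thesis by (simp add: distrib_left)
  next
    case False
    have "psi M (t - u) (eta_f M (psi M u g)) x \<le> B * K * exp (lam * (t - u) + 2 * lam * u)"
      using KB[of "t - u" u x] u x by simp
    also have "lam * (t - u) + 2 * lam * u = lam * t + (lam / 2 * u + lam / 2 * u)" by (simp add: algebra_simps)
    also have "B * K * exp (lam * t + (lam / 2 * u + lam / 2 * u)) = exp (lam * t) * (B * K * exp (lam / 2 * u) * exp (lam / 2 * u))"
      by (simp only: exp_add mult.assoc mult.left_commute)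
    also have "\<dots> \<le> exp (lam * t) * (r t * exp (lam / 2 * u))"
    proof (intro mult_left_mono mult_right_mono)
      have "lam / 2 * u \<le> lam * (t - T) / 2" using False lam mult_left_mono_neg[of "t - T" u "lam / 2"] by simp
      then have "B * K * exp (lam / 2 * u) \<le> B * K * exp (lam * (t - T) / 2)" using K by (intro mult_left_mono) auto
      then show "B * K * exp (lam / 2 * u) \<le> r t" using px c K by (simp add: r_def add_increasing)
    qed auto
    also have "\<dots> \<le> exp (lam * t) * (phi x * f u + r t * exp (lam / 2 * u))"
      using px f0[OF u(1)] by (intro mult_left_mono) auto
    finally show ?thesis .
  qed
  have main: "(\<integral>\<^sup>+\<omega>. ennreal ((X_pairing M g t \<omega>)\<^sup>2) \<partial>nbp_law M x)
     \<le> ennreal (exp (lam * t) * (phi x * (Q + c * H * exp (- \<epsilon> * t)) + (phi x * I + r t * (2 / - lam))))" if t: "T \<le> t" for t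
  proof -
    have t0: "0 \<le> t" using T t by simp
    define j where "j u = ennreal (exp (lam * t) * phi x) * ennreal (indicator {0..} u * f u)
       + ennreal (exp (lam * t) * r t) * ennreal (exp (lam / 2 * u))" for u
    have j_meas [measurable]: "j \<in> borel_measurable borel" unfolding j_def[abs_def]
      using measurable_compose[OF f_meas measurable_ennreal]
      by (intro borel_measurable_add borel_measurable_times_ennreal) simp_all
    have "(\<integral>\<^sup>+s. indicator {0..t} s * ennreal (psi M s (eta_f M (psi M (t - s) g)) x) \<partial>lborel)
      \<le> (\<integral>\<^sup>+s. indicator {0..t} s * j (t - s) \<partial>lborel)"
    proof (rule nn_integral_mono)
      fix s
      show "indicator {0..t} s * ennreal (psi M s (eta_f M (psi M (t - s) g)) x) \<le> indicator {0..t} s * j (t - s)"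
      proof (cases "s \<in> {0..t}")
        case True
        have "ennreal (psi M s (eta_f M (psi M (t - s) g)) x)
          \<le> ennreal (exp (lam * t) * (phi x * f (t - s) + r t * exp (lam / 2 * (t - s))))"
          using J[of "t - s" t] True by (intro ennreal_leI) simp
        also have "\<dots> = ennreal ((exp (lam * t) * phi x) * f (t - s) + (exp (lam * t) * r t) * exp (lam / 2 * (t - s)))"
          by (simp add: distrib_left mult.assoc)
        also have "\<dots> = j (t - s)"
          using True f0[of "t - s"] px r0[of t] by (simp add: j_def ennreal_mult ennreal_plus)
        finally show ?thesis using True by simp
      qed simp
    qed
    also have "\<dots> = (\<integral>\<^sup>+u. indicator {0..t} u * j u \<partial>lborel)" by (rule nn_integral_reflect[OF j_meas])
    also have "\<dots> \<le> (\<integral>\<^sup>+u. ennreal (exp (lam * t) * phi x) * (indicator {0..} u * ennreal (f u))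
        + ennreal (exp (lam * t) * r t) * (indicator {0..} u * ennreal (exp (lam / 2 * u))) \<partial>lborel)"
      by (intro nn_integral_mono) (auto simp: j_def split: split_indicator)
    also have "\<dots> = (\<integral>\<^sup>+u. ennreal (exp (lam * t) * phi x) * (indicator {0..} u * ennreal (f u)) \<partial>lborel)
        + (\<integral>\<^sup>+u. ennreal (exp (lam * t) * r t) * (indicator {0..} u * ennreal (exp (lam / 2 * u))) \<partial>lborel)"
    proof (rule nn_integral_add)
      have "(\<lambda>u. ennreal (exp (lam * t) * phi x) * ennreal (indicator {0..} u * f u)) \<in> borel_measurable borel"
        using measurable_compose[OF f_meas measurable_ennreal] by (intro borel_measurable_times_ennreal) simp_all
      also have "(\<lambda>u. ennreal (exp (lam * t) * phi x) * ennreal (indicator {0..} u * f u))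
        = (\<lambda>u. ennreal (exp (lam * t) * phi x) * (indicator {0..} u * ennreal (f u)))"
        by (auto simp: fun_eq_iff split: split_indicator)
      finally show "(\<lambda>u. ennreal (exp (lam * t) * phi x) * (indicator {0..} u * ennreal (f u))) \<in> borel_measurable lborel"
        by simp
    qed simp
    also have "(\<integral>\<^sup>+u. ennreal (exp (lam * t) * phi x) * (indicator {0..} u * ennreal (f u)) \<partial>lborel)
      = ennreal (exp (lam * t) * phi x) * ennreal I"
    proof -
      have eq: "indicator {0..} u * ennreal (f u) = ennreal (indicator {0..} u * f u)" for u
        by (auto split: split_indicator)
      show ?thesis unfolding I(1)[symmetric] eq using measurable_compose[OF f_meas measurable_ennreal] by (intro nn_integral_cmult) simp
    qed
    also have "(\<integral>\<^sup>+u. ennreal (exp (lam * t) * r t) * (indicator {0..} u * ennreal (exp (lam / 2 * u))) \<partial>lborel)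
      = ennreal (exp (lam * t) * r t) * ennreal (2 / - lam)"
      using nn_integral_Ici_exp[of "lam / 2"] lam by (simp add: nn_integral_cmult)
    also have "ennreal (exp (lam * t) * phi x) * ennreal I + ennreal (exp (lam * t) * r t) * ennreal (2 / - lam)
      = ennreal (exp (lam * t) * (phi x * I + r t * (2 / - lam)))"
    proof -
      have "0 \<le> 2 / - lam" using lam by simp
      then show ?thesis
        using px I(2) r0[of t] by (simp only: ennreal_mult[symmetric] ennreal_plus[symmetric] mult_nonneg_nonneg exp_ge_zero less_imp_le distrib_left mult.assoc)
    qed
    finally have 1: "(\<integral>\<^sup>+s. indicator {0..t} s * ennreal (psi M s (eta_f M (psi M (t - s) g)) x) \<partial>lborel)
       \<le> ennreal (exp (lam * t) * (phi x * I + r t * (2 / - lam)))" .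
    have "psi M t (\<lambda>y. (g y)\<^sup>2) x \<le> exp (lam * t) * (phi x * (Q + c * H * exp (- \<epsilon> * t)))"
      using as[OF t square_Linf[OF g] H x] by (simp add: Q_def algebra_simps abs_le_iff)
    then have "(\<integral>\<^sup>+\<omega>. ennreal ((X_pairing M g t \<omega>)\<^sup>2) \<partial>nbp_law M x)
      \<le> ennreal (exp (lam * t) * (phi x * (Q + c * H * exp (- \<epsilon> * t)))) + ennreal (exp (lam * t) * (phi x * I + r t * (2 / - lam)))"
      using second_moment[OF g x t0] 1 by (elim order_trans) (intro add_mono ennreal_leI)
    also have "\<dots> = ennreal (exp (lam * t) * (phi x * (Q + c * H * exp (- \<epsilon> * t))) + exp (lam * t) * (phi x * I + r t * (2 / - lam)))"
    proof (rule ennreal_plus[symmetric])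
      have "0 \<le> r t * (2 / - lam)" using r0[of t] lam by (intro mult_nonneg_nonneg) auto
      then show "0 \<le> exp (lam * t) * (phi x * I + r t * (2 / - lam))" using px I(2) by (intro mult_nonneg_nonneg[OF exp_ge_zero] add_nonneg_nonneg) auto
      show "0 \<le> exp (lam * t) * (phi x * (Q + c * H * exp (- \<epsilon> * t)))" using px Q c H by (intro mult_nonneg_nonneg add_nonneg_nonneg) auto
    qed
    finally show ?thesis by (simp only: distrib_left)
  qed
  have "((\<lambda>t. c * H * exp (- \<epsilon> * t)) \<longlongrightarrow> 0) at_top" using e by real_asymp
  moreover have "((\<lambda>t. c * K * exp (- \<epsilon> * t)) \<longlongrightarrow> 0) at_top" using e by real_asymp
  moreover have "((\<lambda>t. B * K * exp (lam * (t - T) / 2)) \<longlongrightarrow> 0) at_top" using lam by real_asymp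
  ultimately have "((\<lambda>t. phi x * (Q + c * H * exp (- \<epsilon> * t)) + (phi x * I + (phi x * (c * K * exp (- \<epsilon> * t)) + B * K * exp (lam * (t - T) / 2)) * (2 / - lam)))
      \<longlongrightarrow> phi x * (Q + 0) + (phi x * I + (phi x * 0 + 0) * (2 / - lam))) at_top"
    by (intro tendsto_intros)
  then have "\<forall>\<^sub>F t in at_top. phi x * (Q + c * H * exp (- \<epsilon> * t)) + (phi x * I + r t * (2 / - lam)) < C3 M lam phi phit g x + \<delta>"
    unfolding r_def by (rule order_tendstoD(2)) (use \<delta> in \<open>simp add: C3 distrib_left\<close>)
  with eventually_ge_at_top[of T]
  show "\<forall>\<^sub>F t in at_top. (\<integral>\<^sup>+\<omega>. ennreal ((X_pairing M g t \<omega>)\<^sup>2) \<partial>nbp_law M x) \<le> ennreal (exp (lam * t) * (C3 M lam phi phit g x + \<delta>))"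
  proof eventually_elim
    case (elim t)
    have "exp (lam * t) * (phi x * (Q + c * H * exp (- \<epsilon> * t)) + (phi x * I + r t * (2 / - lam))) \<le> exp (lam * t) * (C3 M lam phi phit g x + \<delta>)"
      using elim(2) by (intro mult_left_mono) auto
    then show ?case using main[OF elim(1)] by (meson ennreal_leI order_trans)
  qed
qed

lemma sample_mean_nbp:
  assumes g: "g \<in> Linf_plus M" and x: "x \<in> phase M" and k: "1 \<le> k"
    and S: "(\<integral>\<^sup>+\<omega>. ennreal ((X_pairing M g t \<omega>)\<^sup>2) \<partial>nbp_law M x) \<le> ennreal S" "0 \<le> S"
  shows "sample_mean (nbp_law M x) (X_pairing M g t) k (psi M t g x) S"
  unfolding sample_mean_def sample_mean_axioms_def
  using prob_space_nbp_law X_pairing_meas[OF g] X_pairing_nonneg[of g] Linf_nonneg[OF g] k S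
  by (auto simp: psi_def)

text \<open>The martingale \<open>e\<^sup>-\<^sup>\<lambda>\<^sup>t \<langle>\<phi>, X\<^sub>t\<rangle>\<close> has mean \<open>\<phi>\<close>, so its second moment, whose limit is the integral
  in \<open>C\<^sub>[\<^sub>2\<^sub>]\<close>, is at least \<open>\<phi>\<^sup>2\<close>.\<close>

lemma C2_nonneg:
  assumes x: "x \<in> phase M" and lam: "0 < lam"
  shows "0 \<le> C2 M lam phi phit g x"
proof -
  define f where "f s = exp (- 2 * lam * s) * psi M s (eta_f M phi) x" for s
  note eL = eta_Linf[OF phi_Linf]
  obtain A :: real where A: "0 \<le> A" "\<And>(t::real) x. 0 \<le> t \<Longrightarrow> x \<in> phase M \<Longrightarrow> psi M t (eta_f M phi) x \<le> A * exp (lam * t)"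
    by (fact psi_growth[OF eL])
  obtain B :: real where B: "0 \<le> B" "\<And>(t::real) x. 0 \<le> t \<Longrightarrow> x \<in> phase M \<Longrightarrow> psi M t (\<lambda>y. (phi y)\<^sup>2) x \<le> B * exp (lam * t)"
    by (fact psi_growth[OF square_Linf[OF phi_Linf]])
  have f0: "0 \<le> f s" if "0 \<le> s" for s
    using psi_props(3)[OF eL x that] by (simp add: f_def)
  have f1: "f s \<le> A * exp (- lam * s)" if "0 \<le> s" for s
  proof -
    have "f s \<le> exp (- 2 * lam * s) * (A * exp (lam * s))"
      unfolding f_def using A(2)[OF that x] by (intro mult_left_mono) auto
    also have "\<dots> = A * (exp (- 2 * lam * s) * exp (lam * s))" by simp
    also have "exp (- 2 * lam * s) * exp (lam * s) = exp (- lam * s)" by (simp add: exp_add[symmetric])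
    finally show ?thesis .
  qed
  have f_meas: "(\<lambda>s. indicator {0..} s * f s) \<in> borel_measurable borel"
  proof -
    have "(\<lambda>s. exp (- 2 * lam * s) * (indicator {0..} s * psi M s (eta_f M phi) x)) \<in> borel_measurable borel"
      using psi_time_meas[OF eL x] by measurable
    then show ?thesis by (simp add: f_def mult.left_commute)
  qed
  define I where "I = (LBINT s:{0..}. f s)"
  have "- lam < 0" using lam by simp
  have I: "(\<integral>\<^sup>+u. indicator {0..} u * ennreal (f u) \<partial>lborel) = ennreal I" "0 \<le> I"
    using integral_exp_bounded[OF \<open>- lam < 0\<close> f_meas f0 f1] by (simp_all add: I_def)
  have main: "(phi x)\<^sup>2 \<le> B * exp (- lam * t) + I" if t: "0 \<le> t" for t
  proof -
    have "(\<integral>\<^sup>+s. indicator {0..t} s * ennreal (psi M s (eta_f M (psi M (t - s) phi)) x) \<partial>lborel)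
      \<le> (\<integral>\<^sup>+s. ennreal (exp (2 * lam * t)) * (indicator {0..} s * ennreal (f s)) \<partial>lborel)"
    proof (rule nn_integral_mono)
      fix s
      show "indicator {0..t} s * ennreal (psi M s (eta_f M (psi M (t - s) phi)) x)
        \<le> ennreal (exp (2 * lam * t)) * (indicator {0..} s * ennreal (f s))"
      proof (cases "s \<in> {0..t}")
        case True
        define a where "a = exp (lam * (t - s))"
        have "psi M s (eta_f M (psi M (t - s) phi)) x \<le> psi M s (\<lambda>y. a\<^sup>2 * eta_f M phi y) x"
        proof (rule psi_mono)
          fix y assume y: "y \<in> phase M"
          have "eta_f M (psi M (t - s) phi) y \<le> eta_f M (\<lambda>y. a * phi y) y"
            using psi_phi[of "t - s"] True by (intro eta_mono psi_Linf phi_Linf scale_Linf y) (auto simp: a_def)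
          then show "eta_f M (psi M (t - s) phi) y \<le> a\<^sup>2 * eta_f M phi y" by (simp only: eta_scale)
        qed (use True x in \<open>auto intro!: eta_Linf psi_Linf phi_Linf scale_Linf\<close>)
        also have "\<dots> = a\<^sup>2 * psi M s (eta_f M phi) x" by (rule psi_scale)
        also have "a\<^sup>2 = exp (2 * lam * t) * exp (- 2 * lam * s)"
          by (simp add: a_def exp_double[symmetric] exp_add[symmetric] algebra_simps)
        finally have "psi M s (eta_f M (psi M (t - s) phi)) x \<le> exp (2 * lam * t) * f s" by (simp add: f_def)
        then have "ennreal (psi M s (eta_f M (psi M (t - s) phi)) x) \<le> ennreal (exp (2 * lam * t)) * ennreal (f s)"
          using f0[of s] True by (simp add: ennreal_mult[symmetric] ennreal_leI)
        then show ?thesis using True by simp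
      qed simp
    qed
    also have "\<dots> = ennreal (exp (2 * lam * t)) * ennreal I"
    proof -
      have eq: "indicator {0..} u * ennreal (f u) = ennreal (indicator {0..} u * f u)" for u
        by (auto split: split_indicator)
      show ?thesis unfolding I(1)[symmetric] eq using measurable_compose[OF f_meas measurable_ennreal] by (intro nn_integral_cmult) simp
    qed
    finally have "(\<integral>\<^sup>+\<omega>. ennreal ((X_pairing M phi t \<omega>)\<^sup>2) \<partial>nbp_law M x)
      \<le> ennreal (B * exp (lam * t)) + ennreal (exp (2 * lam * t)) * ennreal I"
      using second_moment[OF phi_Linf x t] B(2)[OF t x] by (elim order_trans) (intro add_mono ennreal_leI)
    also have "\<dots> = ennreal (B * exp (lam * t) + exp (2 * lam * t) * I)"
      using B(1) I(2) by (intro ennreal_add_mult) auto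
    finally have S: "(\<integral>\<^sup>+\<omega>. ennreal ((X_pairing M phi t \<omega>)\<^sup>2) \<partial>nbp_law M x) \<le> ennreal (B * exp (lam * t) + exp (2 * lam * t) * I)" .
    have "0 \<le> B * exp (lam * t) + exp (2 * lam * t) * I" using B(1) I(2) by simp
    \<comment> \<open>The square of the mean is at most the second moment, taken from the sample
      mean of a single copy.\<close>
    from sample_mean.m2_le_S[OF sample_mean_nbp[OF phi_Linf x order_refl S this]]
    have "(exp (lam * t) * phi x)\<^sup>2 \<le> B * exp (lam * t) + exp (2 * lam * t) * I"
      using psi_phi[OF t x] by simp
    then have "exp (- 2 * lam * t) * (exp (lam * t) * phi x)\<^sup>2 \<le> exp (- 2 * lam * t) * (B * exp (lam * t) + exp (2 * lam * t) * I)"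
      by (intro mult_left_mono) auto
    also have "exp (- 2 * lam * t) * (exp (lam * t) * phi x)\<^sup>2 = (exp (- 2 * lam * t) * exp (2 * lam * t)) * (phi x)\<^sup>2"
      by (simp add: power_mult_distrib exp_double[symmetric] mult.assoc)
    also have "exp (- 2 * lam * t) * (B * exp (lam * t) + exp (2 * lam * t) * I)
      = B * (exp (- 2 * lam * t) * exp (lam * t)) + (exp (- 2 * lam * t) * exp (2 * lam * t)) * I"
      by (simp add: distrib_left)
    finally show ?thesis by (simp add: exp_add[symmetric])
  qed
  have "((\<lambda>t. B * exp (- lam * t)) \<longlongrightarrow> 0) at_top" using lam by real_asymp
  then have "((\<lambda>t. B * exp (- lam * t) + I) \<longlongrightarrow> 0 + I) at_top" by (intro tendsto_intros)
  moreover have "\<forall>\<^sub>F t in at_top. (phi x)\<^sup>2 \<le> B * exp (- lam * t) + I"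
    using eventually_ge_at_top[of 0] by eventually_elim (rule main)
  ultimately have "(phi x)\<^sup>2 \<le> 0 + I" by (intro tendsto_lowerbound) auto
  then show ?thesis by (simp add: C2_def I_def f_def)
qed

end

section \<open>The mean square error\<close>

locale nbp_estimator = nbp_triple M cb nmax lam phi phit for M cb nmax lam phi phit +
  fixes g :: "config \<Rightarrow> real" and x :: config
  assumes g_Linf: "g \<in> Linf_plus M" and x_phase: "x \<in> phase M" and g_pos: "0 < pairing M g phit"
begin

definition m :: "real \<Rightarrow> real" where "m t = psi M t g x"
definition w :: "real \<Rightarrow> real" where "w t = m t * exp (- lam * t)"
definition rt :: "real \<Rightarrow> real" where "rt t = m t powr (1 / t)"
definition c :: real where "c = C0 M phi phit g x"
definition E2 :: "real \<Rightarrow> ennreal" where "E2 t = (\<integral>\<^sup>+\<omega>. ennreal ((X_pairing M g t \<omega>)\<^sup>2) \<partial>nbp_law M x)"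

lemma c_pos: "0 < c"
  unfolding c_def C0_def pairing_commute[of phit g] using g_pos phi_pos[OF x_phase] by (rule mult_pos_pos)

section \<open>The deterministic error: the root of the mean\<close>

lemma w_tendsto: "(w \<longlongrightarrow> c) at_top"
proof -
  obtain \<epsilon> d T :: real where e: "0 < \<epsilon>" "\<epsilon> \<le> 1" and d: "0 \<le> d" and T: "0 \<le> T" and as: "\<And>t h H x. T \<le> t \<Longrightarrow> h \<in> Linf_plus M \<Longrightarrow> 0 < H \<Longrightarrow> (\<And>y. y \<in> phase M \<Longrightarrow> h y \<le> H) \<Longrightarrow> x \<in> phase M \<Longrightarrow>
      \<bar>psi M t h x - exp (lam * t) * phi x * pairing M phit h\<bar> \<le> exp (lam * t) * phi x * (d * H * exp (- \<epsilon> * t))"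
    by (fact asymptotics[OF zero_less_one])
  obtain H0 where H0: "0 \<le> H0" "\<And>y. y \<in> phase M \<Longrightarrow> g y \<le> H0" using Linf_bound[OF g_Linf] by blast
  have H: "0 < H0 + 1" "\<And>y. y \<in> phase M \<Longrightarrow> g y \<le> H0 + 1" using H0 by (auto intro: order_trans[OF H0(2)])
  have "((\<lambda>t. w t - c) \<longlongrightarrow> 0) at_top"
  proof (rule Lim_null_comparison)
    show "\<forall>\<^sub>F t in at_top. norm (w t - c) \<le> phi x * (d * (H0 + 1) * exp (- \<epsilon> * t))"
      using eventually_ge_at_top[of T]
    proof eventually_elim
      case (elim t)
      have gen: "\<bar>s * e - q * p\<bar> \<le> p * r" if eE: "e * E = 1" and e: "0 < e" and le: "\<bar>s - E * p * q\<bar> \<le> E * p * r"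
        for e E s p q r :: real
      proof -
        have "s * e - q * p = s * e - (e * E) * (q * p)" by (simp only: eE mult_1)
        also have "\<dots> = e * (s - E * p * q)" by algebra
        finally have "\<bar>s * e - q * p\<bar> = e * \<bar>s - E * p * q\<bar>" using e by (simp only: abs_mult abs_of_pos)
        also have "\<dots> \<le> e * (E * p * r)" using e le by (intro mult_left_mono) auto
        also have "\<dots> = (e * E) * (p * r)" by algebra
        finally show ?thesis by (simp only: eE mult_1)
      qed
      have "exp (- lam * t) * exp (lam * t) = 1" by (simp add: exp_add[symmetric])
      then show ?case
        unfolding w_def m_def c_def C0_def real_norm_def
        by (rule gen) (simp, rule as[OF elim g_Linf H x_phase])
    qed
    show "((\<lambda>t. phi x * (d * (H0 + 1) * exp (- \<epsilon> * t))) \<longlongrightarrow> 0) at_top"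
      using e by (intro tendsto_mult_right_zero) real_asymp
  qed
  then show ?thesis by (rule LIM_zero_cancel)
qed

lemma m_eq: "m t = w t * exp (lam * t)"
  by (simp add: w_def mult.assoc exp_add[symmetric])

text \<open>The root of the mean is \<open>exp (lam + ln (w t) / t)\<close>, and ln (w t) tends to
  ln c; so the first order expansion of exp at 0 gives the limit.\<close>

lemma root_scaled: "((\<lambda>t. t * (rt t - exp lam)) \<longlongrightarrow> ln c * exp lam) at_top"
proof -
  \<comment> \<open>The difference quotient of exp at 0 in Caratheodory's form, a product with a
    continuous factor. No division by ln (w t) occurs, which may be 0.\<close>
  obtain h :: "real \<Rightarrow> real" where h: "\<And>z. exp z - exp 0 = h z * (z - 0)" "isCont h 0" "h 0 = exp 0"
    using DERIV_exp[of "0::real"] unfolding CARAT_DERIV by blast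
  have ln_w: "((\<lambda>t. ln (w t)) \<longlongrightarrow> ln c) at_top" using w_tendsto c_pos by (intro tendsto_ln) auto
  have "((\<lambda>t. ln (w t) / t) \<longlongrightarrow> 0) at_top"
    using tendsto_divide_0[OF ln_w filterlim_at_top_imp_at_infinity[OF filterlim_ident]] .
  then have "((\<lambda>t. h (ln (w t) / t)) \<longlongrightarrow> h 0) at_top"
    using h(2) by (rule isCont_tendsto_compose[rotated])
  then have "((\<lambda>t. exp lam * (h (ln (w t) / t) * ln (w t))) \<longlongrightarrow> exp lam * (1 * ln c)) at_top"
    unfolding h(3) exp_zero by (intro tendsto_intros ln_w)
  moreover have "\<forall>\<^sub>F t in at_top. exp lam * (h (ln (w t) / t) * ln (w t)) = t * (rt t - exp lam)"
    using order_tendstoD(1)[OF w_tendsto c_pos] eventually_gt_at_top[of 0]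
  proof eventually_elim
    case (elim t)
    have "rt t = exp (ln (m t) * (1 / t))"
      using elim by (simp add: rt_def powr_def m_eq mult.commute)
    also have "ln (m t) * (1 / t) = lam + ln (w t) / t"
      using elim by (simp add: m_eq ln_mult add_divide_distrib)
    finally have "rt t - exp lam = exp lam * (exp (ln (w t) / t) - 1)"
      by (simp add: exp_add right_diff_distrib)
    also have "\<dots> = exp lam * (h (ln (w t) / t) * (ln (w t) / t))" using h(1)[of "ln (w t) / t"] by simp
    finally show ?case using elim by simp
  qed
  ultimately have "((\<lambda>t. t * (rt t - exp lam)) \<longlongrightarrow> exp lam * (1 * ln c)) at_top"
    by (rule Lim_transform_eventually)
  then show ?thesis by (simp add: mult.commute)
qed

lemma root_tendsto: "(rt \<longlongrightarrow> exp lam) at_top"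
proof -
  have "((\<lambda>t. t * (rt t - exp lam) / t) \<longlongrightarrow> 0) at_top"
    using tendsto_divide_0[OF root_scaled filterlim_at_top_imp_at_infinity[OF filterlim_ident]] .
  moreover have "\<forall>\<^sub>F t in at_top. t * (rt t - exp lam) / t = rt t - exp lam"
    using eventually_gt_at_top[of 0] by eventually_elim simp
  ultimately have "((\<lambda>t. rt t - exp lam) \<longlongrightarrow> 0) at_top" by (simp add: tendsto_cong)
  then show ?thesis by (rule LIM_zero_cancel)
qed

lemma bias:
  assumes "0 < \<eta>"
  shows "\<forall>\<^sub>F t in at_top. 2 * (rt t - exp lam)\<^sup>2 \<le> (2 * (ln c * exp lam)\<^sup>2 + \<eta>) / t\<^sup>2"
proof -
  have "((\<lambda>t. 2 * (t * (rt t - exp lam))\<^sup>2) \<longlongrightarrow> 2 * (ln c * exp lam)\<^sup>2) at_top"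
    by (intro tendsto_intros root_scaled)
  then have "\<forall>\<^sub>F t in at_top. 2 * (t * (rt t - exp lam))\<^sup>2 < 2 * (ln c * exp lam)\<^sup>2 + \<eta>"
    by (rule order_tendstoD(2)) (use assms in simp)
  with eventually_gt_at_top[of 0] show ?thesis
  proof eventually_elim
    case (elim t)
    have "2 * (rt t - exp lam)\<^sup>2 * t\<^sup>2 \<le> 2 * (ln c * exp lam)\<^sup>2 + \<eta>"
      using elim(2) by (simp add: power_mult_distrib mult.commute mult.left_commute)
    then show ?case using elim(1) by (simp add: pos_le_divide_eq)
  qed
qed

section \<open>The random error of the estimator\<close>

lemma growth_nonneg: "0 \<le> t \<Longrightarrow> 0 \<le> growth t"
  by (simp add: growth_def)

lemma sample_mean:
  assumes "1 \<le> k" "E2 t \<le> ennreal S" "0 \<le> S"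
  shows "sample_mean (nbp_law M x) (X_pairing M g t) k (m t) S"
  unfolding m_def using assms unfolding E2_def by (intro sample_mean_nbp g_Linf x_phase)

lemma mse_sample_mean:
  assumes "sample_mean (nbp_law M x) (X_pairing M g t) k (m t) S"
  shows "mse M lam g x k t = (\<integral>\<^sup>+\<omega>. ennreal ((sample_mean.Psi (X_pairing M g t) k \<omega> powr (1 / t) - exp lam)\<^sup>2)
    \<partial>sample_mean.Prod (nbp_law M x) k)"
  unfolding mse_def Psi_br_def sample_mean.Psi_def[OF assms] sample_mean.Prod_def[OF assms] ..

lemma mse_le:
  assumes t: "1 \<le> t" and k: "1 \<le> k" and m: "0 < m t" and S: "E2 t \<le> ennreal S" "0 \<le> S"
  shows "mse M lam g x k t \<le> ennreal (2 * (rt t)\<^sup>2 * (S / (m t)\<^sup>2) / real k + 2 * (rt t - exp lam)\<^sup>2)"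
proof -
  note sm = sample_mean[OF k S]
  show ?thesis unfolding mse_sample_mean[OF sm] rt_def
    using t by (intro sample_mean.mse_basic[OF sm m]) auto
qed

lemma mse_le_refined:
  assumes t: "1 \<le> t" and k: "1 \<le> k" and m: "0 < m t" and S: "E2 t \<le> ennreal (B * (m t)\<^sup>2)" "0 \<le> B"
  shows "mse M lam g x k t \<le> ennreal (2 * (rt t)\<^sup>2 * (4 * (1 / t)\<^sup>2 * B / real k + exp (- real k / (8 * B))) + 2 * (rt t - exp lam)\<^sup>2)"
proof -
  have "0 \<le> B * (m t)\<^sup>2" using S(2) by simp
  note sm = sample_mean[OF k S(1) this]
  have "B * (m t)\<^sup>2 / (m t)\<^sup>2 = B" using m by simp
  then show ?thesis unfolding mse_sample_mean[OF sm] rt_def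
    using sample_mean.mse_refined[OF sm m, of "1 / t" "exp lam"] t by simp
qed

text \<open>If lam \<le> 0, the factor m^(2 / t) tends to \<open>(exp lam)^2\<close>, which is at
  most 1 and may be dropped, so the constant 2 of the elementary bound is the one claimed. The
  exponentials in the second moment and in m^2 cancel, and w tends to c.\<close>

lemma mse_eventually_nonsupercritical:
  assumes lam: "lam \<le> 0" and \<sigma>: "0 \<le> \<sigma>" and \<eta>: "0 < \<eta>"
    and E2: "\<And>\<delta>. 0 < \<delta> \<Longrightarrow> \<forall>\<^sub>F t in at_top. E2 t \<le> ennreal (growth t * exp (2 * lam * t) * (\<sigma> + \<delta>))"
  shows "\<forall>\<^sub>F t in at_top. \<forall>k\<ge>1. mse M lam g x k t
    \<le> ennreal ((2 * \<sigma> / c\<^sup>2 + \<eta>) * growth t / real k + (2 * (ln c * exp lam)\<^sup>2 + \<eta>) / t\<^sup>2)"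
proof -
  \<comment> \<open>Then 2 \<delta> / c^2 is \<eta> / 2, and the other half of \<eta> is left for
    the convergence in t.\<close>
  define \<delta> where "\<delta> = \<eta> * c\<^sup>2 / 4"
  have \<delta>: "0 < \<delta>" using \<eta> c_pos by (simp add: \<delta>_def)
  have c2: "0 < c\<^sup>2" using c_pos by simp
  have "((\<lambda>t. 2 * (rt t)\<^sup>2 * ((\<sigma> + \<delta>) / (w t)\<^sup>2)) \<longlongrightarrow> 2 * (exp lam)\<^sup>2 * ((\<sigma> + \<delta>) / c\<^sup>2)) at_top"
    using c_pos by (intro tendsto_intros root_tendsto w_tendsto) simp
  moreover have "2 * (exp lam)\<^sup>2 * ((\<sigma> + \<delta>) / c\<^sup>2) < 2 * \<sigma> / c\<^sup>2 + \<eta>"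
  proof -
    have "2 * (exp lam)\<^sup>2 * ((\<sigma> + \<delta>) / c\<^sup>2) \<le> 2 * 1 * ((\<sigma> + \<delta>) / c\<^sup>2)"
      using lam \<sigma> \<delta> by (intro mult_right_mono mult_left_mono) (auto simp: power_le_one)
    also have "\<dots> = 2 * \<sigma> / c\<^sup>2 + \<eta> / 2" using c_pos by (simp add: \<delta>_def add_divide_distrib distrib_left)
    also have "\<dots> < 2 * \<sigma> / c\<^sup>2 + \<eta>" using \<eta> by simp
    finally show ?thesis .
  qed
  ultimately have "\<forall>\<^sub>F t in at_top. 2 * (rt t)\<^sup>2 * ((\<sigma> + \<delta>) / (w t)\<^sup>2) < 2 * \<sigma> / c\<^sup>2 + \<eta>"
    by (rule order_tendstoD(2))
  with E2[OF \<delta>] bias[OF \<eta>] order_tendstoD(1)[OF w_tendsto c_pos] eventually_ge_at_top[of 1]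
  show ?thesis
  proof eventually_elim
    case (elim t)
    show ?case
    proof (intro allI impI)
      fix k :: nat assume k: "1 \<le> k"
      define S where "S = growth t * exp (2 * lam * t) * (\<sigma> + \<delta>)"
      have G: "0 \<le> growth t" using elim(4) by (simp add: growth_nonneg)
      have S: "0 \<le> S" using G \<sigma> \<delta> by (simp add: S_def)
      have m: "0 < m t" using elim(3) by (simp add: m_eq)
      have "S / (m t)\<^sup>2 = growth t * ((\<sigma> + \<delta>) / (w t)\<^sup>2)"
        by (simp add: S_def m_eq power_mult_distrib exp_double[symmetric] mult.assoc)
      then have "2 * (rt t)\<^sup>2 * (S / (m t)\<^sup>2) = 2 * (rt t)\<^sup>2 * ((\<sigma> + \<delta>) / (w t)\<^sup>2) * growth t"
        by (simp only: mult.assoc mult.commute[of "growth t"])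
      also have "\<dots> \<le> (2 * \<sigma> / c\<^sup>2 + \<eta>) * growth t" using elim(5) G by (intro mult_right_mono) auto
      finally have "2 * (rt t)\<^sup>2 * (S / (m t)\<^sup>2) / real k + 2 * (rt t - exp lam)\<^sup>2
        \<le> (2 * \<sigma> / c\<^sup>2 + \<eta>) * growth t / real k + (2 * (ln c * exp lam)\<^sup>2 + \<eta>) / t\<^sup>2"
        using elim(2) by (intro add_mono divide_right_mono) auto
      then have "ennreal (2 * (rt t)\<^sup>2 * (S / (m t)\<^sup>2) / real k + 2 * (rt t - exp lam)\<^sup>2)
        \<le> ennreal ((2 * \<sigma> / c\<^sup>2 + \<eta>) * growth t / real k + (2 * (ln c * exp lam)\<^sup>2 + \<eta>) / t\<^sup>2)"
        by (rule ennreal_leI)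
      then show "mse M lam g x k t
        \<le> ennreal ((2 * \<sigma> / c\<^sup>2 + \<eta>) * growth t / real k + (2 * (ln c * exp lam)\<^sup>2 + \<eta>) / t\<^sup>2)"
        by (rule order_trans[OF mse_le[OF elim(4) k m elim(1)[folded S_def] S]])
    qed
  qed
qed

text \<open>The second moment has the order of m^2, so the ratio B in the refined bound is a
  constant. The part with 4 / t^2 falls below any multiple of 1 / k for large t, the exponential
  part for large k; hence an arbitrary \<eta> suffices as coefficient of 1 / k.\<close>

lemma mse_eventually_supercritical:
  assumes lam: "0 < lam" and \<eta>: "0 < \<eta>"
  shows "\<exists>K. \<forall>\<^sub>F t in at_top. \<forall>k\<ge>K. mse M lam g x k t
    \<le> ennreal (\<eta> / real k + (2 * (ln c * exp lam)\<^sup>2 + \<eta>) / t\<^sup>2)"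
proof -
  obtain S :: real where S: "0 \<le> S" "\<And>t. 1 \<le> t \<Longrightarrow>
    (\<integral>\<^sup>+\<omega>. ennreal ((X_pairing M g t \<omega>)\<^sup>2) \<partial>nbp_law M x) \<le> ennreal (S * growth t * exp (2 * lam * t))"
    by (fact second_moment_growth[OF g_Linf x_phase])
  \<comment> \<open>The factor 4 / c^2 comes from w > c / 2 for large t; the summand 1 keeps B
    positive if S = 0.\<close>
  define B where "B = 4 * S / c\<^sup>2 + 1"
  define P where "P = exp lam + 1"
  have B: "0 < B" using S(1) c_pos by (simp add: B_def add_nonneg_pos)
  have P: "0 < P" by (simp add: P_def add_pos_pos)
  have "((\<lambda>k. 2 * P\<^sup>2 * (real k * exp (- real k / (8 * B)))) \<longlongrightarrow> 0) at_top" using B P by real_asymp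
  then have "\<forall>\<^sub>F k in at_top. 2 * P\<^sup>2 * (real k * exp (- real k / (8 * B))) < \<eta> / 2"
    by (rule order_tendstoD(2)) (use \<eta> in simp)
  then obtain K0 where K0: "\<And>k. K0 \<le> k \<Longrightarrow> 2 * P\<^sup>2 * (real k * exp (- real k / (8 * B))) < \<eta> / 2"
    unfolding eventually_at_top_linorder by blast
  have "((\<lambda>t::real. 2 * P\<^sup>2 * (4 * (1 / t)\<^sup>2 * B)) \<longlongrightarrow> 0) at_top" using B P by real_asymp
  then have ev_t: "\<forall>\<^sub>F t in at_top. 2 * P\<^sup>2 * (4 * (1 / t)\<^sup>2 * B) < \<eta> / 2"
    by (rule order_tendstoD(2)) (use \<eta> in simp)
  have ev_r: "\<forall>\<^sub>F t in at_top. rt t < P" by (rule order_tendstoD(2)[OF root_tendsto]) (simp add: P_def)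
  have ev_w: "\<forall>\<^sub>F t in at_top. c / 2 < w t" by (rule order_tendstoD(1)[OF w_tendsto]) (use c_pos in simp)
  have "\<forall>\<^sub>F t in at_top. \<forall>k\<ge>max K0 1. mse M lam g x k t
    \<le> ennreal (\<eta> / real k + (2 * (ln c * exp lam)\<^sup>2 + \<eta>) / t\<^sup>2)"
    using ev_t ev_r ev_w bias[OF \<eta>] eventually_ge_at_top[of 1]
  proof eventually_elim
    case (elim t)
    show ?case
    proof (intro allI impI)
      fix k :: nat assume k: "max K0 1 \<le> k"
      have kk: "0 < real k" using k by simp
      have m: "0 < m t" using elim(3) c_pos by (simp add: m_eq)
      have "(c / 2)\<^sup>2 \<le> (w t)\<^sup>2" using elim(3) c_pos by (intro power_mono) auto
      then have "B * (c / 2)\<^sup>2 \<le> B * (w t)\<^sup>2" using B by (intro mult_left_mono) auto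
      moreover have "S \<le> B * (c / 2)\<^sup>2" using c_pos by (simp add: B_def power_divide distrib_right)
      ultimately have "S * exp (2 * lam * t) \<le> B * (w t)\<^sup>2 * exp (2 * lam * t)" by (intro mult_right_mono) auto
      also have "\<dots> = B * (m t)\<^sup>2" by (simp add: m_eq power_mult_distrib exp_double[symmetric] mult.assoc)
      finally have "E2 t \<le> ennreal (B * (m t)\<^sup>2)"
        using S(2)[OF elim(5)] lam unfolding E2_def by (auto simp: growth_def intro: order_trans ennreal_leI)
      moreover have "0 \<le> B" "1 \<le> k" using B k by auto
      ultimately have "mse M lam g x k t \<le> ennreal (2 * (rt t)\<^sup>2 * (4 * (1 / t)\<^sup>2 * B / real k + exp (- real k / (8 * B))) + 2 * (rt t - exp lam)\<^sup>2)"
        by (intro mse_le_refined elim(5) m)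
      also have "\<dots> \<le> ennreal (\<eta> / real k + (2 * (ln c * exp lam)\<^sup>2 + \<eta>) / t\<^sup>2)"
      proof (intro ennreal_leI add_mono elim(4))
        have "0 \<le> rt t" by (simp add: rt_def)
        then have "2 * (rt t)\<^sup>2 * (4 * (1 / t)\<^sup>2 * B / real k + exp (- real k / (8 * B)))
          \<le> 2 * P\<^sup>2 * (4 * (1 / t)\<^sup>2 * B / real k + exp (- real k / (8 * B)))"
          using elim(2) B by (intro mult_right_mono mult_left_mono power_mono) auto
        also have "\<dots> = (2 * P\<^sup>2 * (4 * (1 / t)\<^sup>2 * B) + 2 * P\<^sup>2 * (real k * exp (- real k / (8 * B)))) / real k"
          using kk by (simp add: add_divide_distrib distrib_left)
        also have "\<dots> \<le> \<eta> / real k" using elim(1) K0[of k] k by (intro divide_right_mono) auto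
        finally show "2 * (rt t)\<^sup>2 * (4 * (1 / t)\<^sup>2 * B / real k + exp (- real k / (8 * B))) \<le> \<eta> / real k" .
      qed
      finally show "mse M lam g x k t \<le> ennreal (\<eta> / real k + (2 * (ln c * exp lam)\<^sup>2 + \<eta>) / t\<^sup>2)" .
    qed
  qed
  then show ?thesis by blast
qed

text \<open>From some T on, the asymptotic estimates apply with a single constant. On [t0, T] the
  exponent 1 / t is at most 1 / t0, so one moment of fixed order bounds the error for all k at
  once.\<close>

lemma mse_bound:
  assumes t0: "0 < t0"
  obtains \<kappa> \<kappa>0 :: real where "0 \<le> \<kappa>" "0 \<le> \<kappa>0"
    "\<And>t k. t0 \<le> t \<Longrightarrow> 1 \<le> k \<Longrightarrow> mse M lam g x k t \<le> ennreal (\<kappa> * growth t / real k + \<kappa>0 / t\<^sup>2)"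
proof -
  obtain S :: real where S: "0 \<le> S" "\<And>t. 1 \<le> t \<Longrightarrow>
    (\<integral>\<^sup>+\<omega>. ennreal ((X_pairing M g t \<omega>)\<^sup>2) \<partial>nbp_law M x) \<le> ennreal (S * growth t * exp (2 * lam * t))"
    by (fact second_moment_growth[OF g_Linf x_phase])
  define P where "P = exp lam + 1"
  define b where "b = 2 * (ln c * exp lam)\<^sup>2 + 1"
  have b: "0 \<le> b" by (simp add: b_def)
  have ev_r: "\<forall>\<^sub>F t in at_top. rt t < P" by (rule order_tendstoD(2)[OF root_tendsto]) (simp add: P_def)
  have ev_w: "\<forall>\<^sub>F t in at_top. c / 2 < w t" by (rule order_tendstoD(1)[OF w_tendsto]) (use c_pos in simp)
  have "\<forall>\<^sub>F t in at_top. rt t < P \<and> c / 2 < w t \<and> 2 * (rt t - exp lam)\<^sup>2 \<le> b / t\<^sup>2 \<and> 1 \<le> t"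
    using ev_r ev_w bias[OF zero_less_one] eventually_ge_at_top[of 1] unfolding b_def by eventually_elim auto
  then obtain T where T: "\<And>t. T \<le> t \<Longrightarrow> rt t < P \<and> c / 2 < w t \<and> 2 * (rt t - exp lam)\<^sup>2 \<le> b / t\<^sup>2 \<and> 1 \<le> t"
    unfolding eventually_at_top_linorder by blast
  have T1: "1 \<le> T" using T[of T] by simp
  define \<kappa> where "\<kappa> = 2 * P\<^sup>2 * (4 * S / c\<^sup>2)"
  have \<kappa>: "0 \<le> \<kappa>" using S(1) by (simp add: \<kappa>_def)
  \<comment> \<open>An even integer, at least 2 / t0, as required for the exponent 1 / t in
    \<open>mse_crude\<close>.\<close>
  define n where "n = 2 * (nat \<lceil>1 / t0\<rceil> + 1)"
  have n: "even n" "0 < n" by (auto simp: n_def)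
  have n2: "1 / t0 \<le> real n / 2" unfolding n_def by (simp add: of_nat_nat) linarith
  obtain D where D: "0 \<le> D" "\<And>t x. 0 \<le> t \<Longrightarrow> t \<le> T \<Longrightarrow> x \<in> phase M \<Longrightarrow>
     (\<integral>\<^sup>+\<omega>. ennreal (X_pairing M g t \<omega> ^ n) \<partial>nbp_law M x) \<le> ennreal D"
    using moments_bounded[OF g_Linf n(2), of T] by blast
  \<comment> \<open>A second moment bound before T, where \<open>second_moment_growth\<close> may
    not apply. It only serves to enter the locale of sample means; the crude error bound does not
    contain it.\<close>
  obtain D2 where D2: "0 \<le> D2" "\<And>t x. 0 \<le> t \<Longrightarrow> t \<le> T \<Longrightarrow> x \<in> phase M \<Longrightarrow>
     (\<integral>\<^sup>+\<omega>. ennreal (X_pairing M g t \<omega> ^ 2) \<partial>nbp_law M x) \<le> ennreal D2"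
    using moments_bounded[OF g_Linf zero_less_numeral, of T] by blast
  define R where "R = 2 + 2 * D + 2 * (exp lam)\<^sup>2"
  have R: "0 \<le> R" using D by (simp add: R_def)
  show ?thesis
  \<comment> \<open>Before T, the constant R is hidden in the second term, since R \<le> R * T^2 /
    t^2 there.\<close>
  proof (rule that[of \<kappa> "b + R * T\<^sup>2"])
    fix t :: real and k :: nat assume t: "t0 \<le> t" and k: "1 \<le> k"
    have t_pos: "0 < t" using t t0 by simp
    have G: "0 \<le> growth t" using t_pos by (simp add: growth_nonneg)
    show "mse M lam g x k t \<le> ennreal (\<kappa> * growth t / real k + (b + R * T\<^sup>2) / t\<^sup>2)"
    proof (cases "T \<le> t")
      case True
      note Tt = T[OF True]
      have m: "0 < m t" using Tt c_pos by (simp add: m_eq)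
      have E: "E2 t \<le> ennreal (S * growth t * exp (2 * lam * t))" unfolding E2_def using S(2) Tt by blast
      have "0 \<le> S * growth t * exp (2 * lam * t)" using S(1) G by simp
      then have "mse M lam g x k t \<le> ennreal (2 * (rt t)\<^sup>2 * (S * growth t * exp (2 * lam * t) / (m t)\<^sup>2) / real k + 2 * (rt t - exp lam)\<^sup>2)"
        using Tt by (intro mse_le k m E) auto
      also have "\<dots> \<le> ennreal (\<kappa> * growth t / real k + (b + R * T\<^sup>2) / t\<^sup>2)"
      proof (intro ennreal_leI add_mono divide_right_mono)
        have "(c / 2)\<^sup>2 \<le> (w t)\<^sup>2" using Tt c_pos by (intro power_mono) auto
        then have "S * growth t / (w t)\<^sup>2 \<le> S * growth t / (c / 2)\<^sup>2"
          using S(1) G c_pos by (intro divide_left_mono mult_pos_pos) (auto simp: zero_less_power)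
        moreover have "S * growth t * exp (2 * lam * t) / (m t)\<^sup>2 = S * growth t / (w t)\<^sup>2"
          by (simp add: m_eq power_mult_distrib exp_double[symmetric] mult.assoc)
        moreover have "(rt t)\<^sup>2 \<le> P\<^sup>2" using Tt by (intro power_mono) (auto simp: rt_def)
        ultimately have "2 * (rt t)\<^sup>2 * (S * growth t * exp (2 * lam * t) / (m t)\<^sup>2) \<le> 2 * P\<^sup>2 * (S * growth t / (c / 2)\<^sup>2)"
          using S(1) G by (intro mult_mono) auto
        also have "\<dots> = \<kappa> * growth t" by (simp add: \<kappa>_def power_divide)
        finally show "2 * (rt t)\<^sup>2 * (S * growth t * exp (2 * lam * t) / (m t)\<^sup>2) \<le> \<kappa> * growth t" .
        have "b / t\<^sup>2 \<le> (b + R * T\<^sup>2) / t\<^sup>2" using R by (intro divide_right_mono) auto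
        then show "2 * (rt t - exp lam)\<^sup>2 \<le> (b + R * T\<^sup>2) / t\<^sup>2" using Tt by linarith
      qed simp
      finally show ?thesis .
    next
      case False
      then have tT: "0 \<le> t" "t \<le> T" using t_pos by auto
      have "E2 t \<le> ennreal D2" unfolding E2_def by (rule D2(2)[OF tT x_phase])
      note sm = sample_mean[OF k this D2(1)]
      have "1 / t \<le> 1 / t0" using t t0 by (simp add: frac_le)
      then have pn: "1 / t \<le> real n / 2" using n2 by linarith
      have "mse M lam g x k t \<le> ennreal R"
        unfolding mse_sample_mean[OF sm] R_def
        by (rule sample_mean.mse_crude[OF sm _ pn n exp_ge_zero D(2)[OF tT x_phase] D(1)]) (use t_pos in simp)
      also have "\<dots> \<le> ennreal (\<kappa> * growth t / real k + (b + R * T\<^sup>2) / t\<^sup>2)"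
      proof (rule ennreal_leI)
        have "t\<^sup>2 \<le> T\<^sup>2" using tT by (intro power_mono)
        then have "R * t\<^sup>2 \<le> b + R * T\<^sup>2" using R b by (intro add_increasing mult_left_mono)
        then have "R \<le> (b + R * T\<^sup>2) / t\<^sup>2" using t_pos by (simp add: pos_le_divide_eq)
        moreover have "0 \<le> \<kappa> * growth t / real k" using \<kappa> G by simp
        ultimately show "R \<le> \<kappa> * growth t / real k + (b + R * T\<^sup>2) / t\<^sup>2" by linarith
      qed
      finally show ?thesis .
    qed
  qed (use \<kappa> b R in auto)
qed

lemma mse_vanishing:
  obtains k :: "real \<Rightarrow> nat" where "mono k" "\<And>t. 1 \<le> k t" "filterlim k at_top at_top"
    "((\<lambda>t. mse M lam g x (k t) t) \<longlongrightarrow> 0) at_top"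
proof -
  obtain \<kappa> \<kappa>0 :: real where \<kappa>: "0 \<le> \<kappa>" "0 \<le> \<kappa>0"
    "\<And>t k. 1 \<le> t \<Longrightarrow> 1 \<le> k \<Longrightarrow> mse M lam g x k t \<le> ennreal (\<kappa> * growth t / real k + \<kappa>0 / t\<^sup>2)"
    by (fact mse_bound[OF zero_less_one])
  \<comment> \<open>The factor t^2 exceeds what is needed to dominate \<open>growth t\<close> by one
    power of t, so that \<open>growth t / f t\<close> is at most 1 / t for t \<ge> 1. The maximum
    with 1 makes f monotone and at least 1 on the whole line.\<close>
  define f where "f t = (max t 1)\<^sup>2 * exp (\<bar>lam\<bar> * max t 1)" for t :: real
  define k where "k t = nat \<lceil>f t\<rceil>" for t
  have f_mono: "f s \<le> f t" if "s \<le> t" for s t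
    unfolding f_def using that by (intro mult_mono power_mono) (auto intro!: mult_left_mono)
  have f_ge: "max t 1 \<le> f t" for t
  proof -
    have "max t 1 * 1 \<le> max t 1 * max t 1" by (intro mult_left_mono) auto
    then have "max t 1 * 1 * 1 \<le> (max t 1 * max t 1) * exp (\<bar>lam\<bar> * max t 1)"
      by (intro mult_mono) auto
    then show ?thesis by (simp add: f_def power2_eq_square)
  qed
  have fk: "f t \<le> real (k t)" for t unfolding k_def by (rule real_nat_ceiling_ge)
  have k1: "1 \<le> k t" for t using f_ge[of t] fk[of t] by linarith
  show ?thesis
  proof (rule that[of k])
    show "mono k" unfolding k_def by (intro monoI nat_mono ceiling_mono f_mono)
    show "filterlim k at_top at_top"
    proof -
      have "filterlim (\<lambda>t. real (k t)) at_top at_top"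
        by (rule filterlim_at_top_mono[OF filterlim_ident])
           (use f_ge fk in \<open>auto intro!: always_eventually intro: order_trans[OF _ fk] order_trans[OF _ f_ge]\<close>)
      then show ?thesis by (simp add: filterlim_sequentially_iff_filterlim_real)
    qed
    have "((\<lambda>t. \<kappa> * (1 / t) + \<kappa>0 / t\<^sup>2) \<longlongrightarrow> 0) at_top" by real_asymp
    then have lim: "((\<lambda>t. ennreal (\<kappa> * (1 / t) + \<kappa>0 / t\<^sup>2)) \<longlongrightarrow> 0) at_top"
      using tendsto_ennrealI by fastforce
    have le: "\<forall>\<^sub>F t in at_top. mse M lam g x (k t) t \<le> ennreal (\<kappa> * (1 / t) + \<kappa>0 / t\<^sup>2)"
      using eventually_ge_at_top[of 1]
    proof eventually_elim
      case (elim t)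
      have "growth t \<le> t * exp (\<bar>lam\<bar> * t)"
      proof -
        have "1 * 1 \<le> t * exp (\<bar>lam\<bar> * t)" using elim by (intro mult_mono) auto
        moreover have "1 * exp (\<bar>lam\<bar> * t) \<le> t * exp (\<bar>lam\<bar> * t)" using elim by (intro mult_right_mono) auto
        ultimately show ?thesis by (auto simp: growth_def)
      qed
      then have "growth t * t \<le> t * exp (\<bar>lam\<bar> * t) * t" using elim by (intro mult_right_mono) auto
      also have "\<dots> = f t" using elim by (simp add: f_def power2_eq_square max_def)
      also have "\<dots> \<le> real (k t)" by (rule fk)
      finally have "growth t / real (k t) \<le> 1 / t"
        using elim k1[of t] by (simp add: divide_le_eq pos_le_divide_eq)
      then have "\<kappa> * (growth t / real (k t)) \<le> \<kappa> * (1 / t)" using \<kappa>(1) by (rule mult_left_mono)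
      then have "ennreal (\<kappa> * growth t / real (k t) + \<kappa>0 / t\<^sup>2) \<le> ennreal (\<kappa> * (1 / t) + \<kappa>0 / t\<^sup>2)"
        by (intro ennreal_leI) simp
      then show ?case by (rule order_trans[OF \<kappa>(3)[OF elim k1]])
    qed
    show "((\<lambda>t. mse M lam g x (k t) t) \<longlongrightarrow> 0) at_top"
      by (rule tendsto_sandwich[OF _ le tendsto_const lim]) simp
  qed (rule k1)
qed

lemma mse_eventually:
  assumes \<eta>: "0 < \<eta>"
  defines "\<kappa>0 \<equiv> 2 * (ln c * exp lam)\<^sup>2 + \<eta>"
  shows "\<exists>T K. 0 < T \<and> 1 \<le> K \<and> (\<forall>t\<ge>T. \<forall>k\<ge>K.
    (lam = 0 \<longrightarrow> mse M lam g x k t \<le> ennreal ((2 * C1 M phi phit g x / c\<^sup>2 + \<eta>) * t / real k + \<kappa>0 / t\<^sup>2)) \<and>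
    (lam > 0 \<longrightarrow> mse M lam g x k t \<le> ennreal ((2 * C2 M lam phi phit g x / c\<^sup>2 + \<eta>) / real k + \<kappa>0 / t\<^sup>2)) \<and>
    (lam < 0 \<longrightarrow> mse M lam g x k t \<le> ennreal ((2 * C3 M lam phi phit g x / c\<^sup>2 + \<eta>) * exp (- lam * t) / real k + \<kappa>0 / t\<^sup>2)))"
    (is "\<exists>T K. _ \<and> _ \<and> (\<forall>t\<ge>T. \<forall>k\<ge>K. ?P t k)")
proof -
  have "\<exists>K. \<forall>\<^sub>F t in at_top. \<forall>k\<ge>K. ?P t k"
  proof (cases lam "0::real" rule: linorder_cases)
    case less
    have "\<forall>\<^sub>F t in at_top. \<forall>k\<ge>1. mse M lam g x k t \<le> ennreal ((2 * C3 M lam phi phit g x / c\<^sup>2 + \<eta>) * growth t / real k + \<kappa>0 / t\<^sup>2)"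
      unfolding \<kappa>0_def
    proof (rule mse_eventually_nonsupercritical[OF _ second_moment_subcritical(1)[OF g_Linf x_phase less zero_less_one] \<eta>])
      fix \<delta> :: real assume \<delta>: "0 < \<delta>"
      have "growth t * exp (2 * lam * t) = exp (lam * t)" for t
        using less by (simp add: growth_def exp_add[symmetric])
      then show "\<forall>\<^sub>F t in at_top. E2 t \<le> ennreal (growth t * exp (2 * lam * t) * (C3 M lam phi phit g x + \<delta>))"
        unfolding E2_def using second_moment_subcritical(2)[OF g_Linf x_phase less \<delta>] by simp
    qed (use less in simp)
    then have "\<forall>\<^sub>F t in at_top. \<forall>k\<ge>1. ?P t k"
      by eventually_elim (use less in \<open>simp add: growth_def\<close>)
    then show ?thesis by blast
  next
    case equal
    have "\<forall>\<^sub>F t in at_top. \<forall>k\<ge>1. mse M lam g x k t \<le> ennreal ((2 * C1 M phi phit g x / c\<^sup>2 + \<eta>) * growth t / real k + \<kappa>0 / t\<^sup>2)"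
      unfolding \<kappa>0_def
    proof (rule mse_eventually_nonsupercritical[OF _ second_moment_critical(1)[OF g_Linf x_phase equal zero_less_one] \<eta>])
      fix \<delta> :: real assume \<delta>: "0 < \<delta>"
      have "growth t * exp (2 * lam * t) = t" for t
        using equal unfolding growth_def by simp
      then show "\<forall>\<^sub>F t in at_top. E2 t \<le> ennreal (growth t * exp (2 * lam * t) * (C1 M phi phit g x + \<delta>))"
        unfolding E2_def using second_moment_critical(2)[OF g_Linf x_phase equal \<delta>] by simp
    qed (use equal in simp)
    moreover have "growth = (\<lambda>t. t)" using equal unfolding growth_def by (simp add: fun_eq_iff)
    ultimately have "\<forall>\<^sub>F t in at_top. \<forall>k\<ge>1. mse M lam g x k t \<le> ennreal ((2 * C1 M phi phit g x / c\<^sup>2 + \<eta>) * t / real k + \<kappa>0 / t\<^sup>2)"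
      by (simp only:)
    then have "\<forall>\<^sub>F t in at_top. \<forall>k\<ge>1. ?P t k"
      by eventually_elim (use equal in auto)
    then show ?thesis by blast
  next
    case greater
    then obtain K where "\<forall>\<^sub>F t in at_top. \<forall>k\<ge>K. mse M lam g x k t \<le> ennreal (\<eta> / real k + \<kappa>0 / t\<^sup>2)"
      using mse_eventually_supercritical[OF greater \<eta>] unfolding \<kappa>0_def by blast
    then have "\<forall>\<^sub>F t in at_top. \<forall>k\<ge>K. ?P t k"
    proof eventually_elim
      case (elim t)
      show ?case
      proof (intro allI impI)
        fix k assume k: "K \<le> k"
        \<comment> \<open>The error is bounded with coefficient \<eta> alone; by
          \<open>C2_nonneg\<close> the claimed coefficient is at least as large.\<close>
        have "\<eta> / real k + \<kappa>0 / t\<^sup>2 \<le> (2 * C2 M lam phi phit g x / c\<^sup>2 + \<eta>) / real k + \<kappa>0 / t\<^sup>2"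
          using C2_nonneg[OF x_phase greater] by (intro add_right_mono divide_right_mono) auto
        then have "mse M lam g x k t \<le> ennreal ((2 * C2 M lam phi phit g x / c\<^sup>2 + \<eta>) / real k + \<kappa>0 / t\<^sup>2)"
          using elim k by (meson ennreal_leI order_trans)
        then show "?P t k" using greater by auto
      qed
    qed
    then show ?thesis by blast
  qed
  then obtain K where "\<forall>\<^sub>F t in at_top. \<forall>k\<ge>K. ?P t k" by blast
  then obtain T where T: "\<And>t. T \<le> t \<Longrightarrow> \<forall>k\<ge>K. ?P t k" unfolding eventually_at_top_linorder by blast
  show ?thesis
  proof (intro exI[of _ "max T 1"] exI[of _ "max K 1"] conjI[of "0 < max T 1"] conjI[of "1 \<le> max K 1"] allI[where P="\<lambda>t. max T 1 \<le> t \<longrightarrow> _ t"] impI)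
    fix t assume "max T 1 \<le> t"
    then have "\<forall>k\<ge>K. ?P t k" by (intro T) simp
    then show "\<forall>k\<ge>max K 1. ?P t k" by simp
  qed auto
qed

end

text \<open>The first family of constants is chosen for times from a given lower bound on. Near t =
  0 this cannot be avoided: for the constant function g = 2 and one copy, no event has occurred by a
  small time t with probability close to 1, and the squared error is then about 4^(1 / t). Since the
  error is taken in [0, \<infinity>], each bound includes integrability.\<close>

theorem theorem5p1:
  fixes M :: nbp_model and lam :: real and phi phit g :: "config \<Rightarrow> real" and r v :: r3
  assumes "nbp_setting M"
    and "leading_triple M lam phi phit"
    and "g \<in> Linf_plus M"
    and "pairing M g phit > 0"
    and "r \<in> dom_D M" and "v \<in> vel_V M"
  shows "(\<forall>t\<^sub>0>0. \<exists>\<kappa>\<^sub>0 \<kappa>\<^sub>1 \<kappa>\<^sub>2 \<kappa>\<^sub>3 :: real. \<forall>t::real. \<forall>k::nat. t \<ge> t\<^sub>0 \<longrightarrow> k \<ge> 1 \<longrightarrow>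
            (lam = 0 \<longrightarrow> mse M lam g (r, v) k t \<le> ennreal (\<kappa>\<^sub>1 * t / real k + \<kappa>\<^sub>0 / t\<^sup>2)) \<and>
            (lam > 0 \<longrightarrow> mse M lam g (r, v) k t \<le> ennreal (\<kappa>\<^sub>2 / real k + \<kappa>\<^sub>0 / t\<^sup>2)) \<and>
            (lam < 0 \<longrightarrow> mse M lam g (r, v) k t
                           \<le> ennreal (\<kappa>\<^sub>3 * exp (- lam * t) / real k + \<kappa>\<^sub>0 / t\<^sup>2)))
       \<and> (C0 M phi phit g (r, v) \<noteq> 1 \<longrightarrow> (\<forall>\<eta>>0.
            let c = C0 M phi phit g (r, v);
                \<kappa>\<^sub>0 = 2 * (ln c * exp lam)\<^sup>2 + \<eta>;
                \<kappa>\<^sub>1 = 2 * C1 M phi phit g (r, v) / c\<^sup>2 + \<eta>;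
                \<kappa>\<^sub>2 = 2 * C2 M lam phi phit g (r, v) / c\<^sup>2 + \<eta>;
                \<kappa>\<^sub>3 = 2 * C3 M lam phi phit g (r, v) / c\<^sup>2 + \<eta>
            in \<exists>(T::real) (K::nat). T > 0 \<and> K \<ge> 1 \<and> (\<forall>t\<ge>T. \<forall>k\<ge>K.
                 (lam = 0 \<longrightarrow> mse M lam g (r, v) k t \<le> ennreal (\<kappa>\<^sub>1 * t / real k + \<kappa>\<^sub>0 / t\<^sup>2)) \<and>
                 (lam > 0 \<longrightarrow> mse M lam g (r, v) k t \<le> ennreal (\<kappa>\<^sub>2 / real k + \<kappa>\<^sub>0 / t\<^sup>2)) \<and>
                 (lam < 0 \<longrightarrow> mse M lam g (r, v) k t
                                \<le> ennreal (\<kappa>\<^sub>3 * exp (- lam * t) / real k + \<kappa>\<^sub>0 / t\<^sup>2)))))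
       \<and> (\<exists>k :: real \<Rightarrow> nat. mono k \<and> (\<forall>t. k t \<ge> 1) \<and> filterlim k at_top at_top \<and>
            ((\<lambda>t. mse M lam g (r, v) (k t) t) \<longlongrightarrow> 0) at_top)"
proof -
  obtain cb where cb: "\<forall>r\<in>dom_D M. \<forall>v\<in>vel_V M.
       sigma_s M r v \<in> {0..cb} \<and> sigma_f M r v \<in> {0..cb} \<and>
       (\<forall>w\<in>vel_V M. pi_s M r v w \<in> {0..cb} \<and> pi_f M r v w \<in> {0..cb})"
    using assms(1) unfolding nbp_setting_def by blast
  obtain nmax :: nat where nmax: "1 < nmax" "\<forall>r\<in>dom_D M. \<forall>v\<in>vel_V M. AE ws in fission_law M r v. length ws \<le> nmax"
    using assms(1) unfolding nbp_setting_def by blast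
  interpret nbp_estimator M cb nmax lam phi phit g "(r, v)"
  proof
    show "(r, v) \<in> phase M" using assms(5,6) by (simp add: phase_def)
  qed (use assms cb nmax in auto)
  show ?thesis
  proof (intro conjI allI impI)
    fix t0 :: real assume t0: "0 < t0"
    obtain \<kappa> \<kappa>0 :: real where \<kappa>: "0 \<le> \<kappa>" "0 \<le> \<kappa>0"
      "\<And>t k. t0 \<le> t \<Longrightarrow> 1 \<le> k \<Longrightarrow> mse M lam g (r, v) k t \<le> ennreal (\<kappa> * growth t / real k + \<kappa>0 / t\<^sup>2)"
      by (fact mse_bound[OF t0])
    show "\<exists>\<kappa>\<^sub>0 \<kappa>\<^sub>1 \<kappa>\<^sub>2 \<kappa>\<^sub>3 :: real. \<forall>t::real. \<forall>k::nat. t0 \<le> t \<longrightarrow> 1 \<le> k \<longrightarrow>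
            (lam = 0 \<longrightarrow> mse M lam g (r, v) k t \<le> ennreal (\<kappa>\<^sub>1 * t / real k + \<kappa>\<^sub>0 / t\<^sup>2)) \<and>
            (lam > 0 \<longrightarrow> mse M lam g (r, v) k t \<le> ennreal (\<kappa>\<^sub>2 / real k + \<kappa>\<^sub>0 / t\<^sup>2)) \<and>
            (lam < 0 \<longrightarrow> mse M lam g (r, v) k t
                           \<le> ennreal (\<kappa>\<^sub>3 * exp (- lam * t) / real k + \<kappa>\<^sub>0 / t\<^sup>2))"
    \<comment> \<open>One \<kappa> serves all three cases, because the sign of lam is fixed and
      selects the form of \<open>growth\<close>.\<close>
    proof (rule exI[of _ \<kappa>0], intro exI[of _ \<kappa>] allI impI)
      fix t :: real and k :: nat assume t: "t0 \<le> t" and k: "1 \<le> k"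
      have growth: "lam = 0 \<Longrightarrow> growth t = t" "0 < lam \<Longrightarrow> growth t = 1" "lam < 0 \<Longrightarrow> growth t = exp (- lam * t)"
        unfolding growth_def by simp_all
      show "(lam = 0 \<longrightarrow> mse M lam g (r, v) k t \<le> ennreal (\<kappa> * t / real k + \<kappa>0 / t\<^sup>2)) \<and>
            (lam > 0 \<longrightarrow> mse M lam g (r, v) k t \<le> ennreal (\<kappa> / real k + \<kappa>0 / t\<^sup>2)) \<and>
            (lam < 0 \<longrightarrow> mse M lam g (r, v) k t \<le> ennreal (\<kappa> * exp (- lam * t) / real k + \<kappa>0 / t\<^sup>2))"
        using \<kappa>(3)[OF t k] growth by (metis mult_1_right)
    qed
  next
    fix \<eta> :: real assume "0 < \<eta>"
    from mse_eventually[OF this] show "let c = C0 M phi phit g (r, v);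
                \<kappa>\<^sub>0 = 2 * (ln c * exp lam)\<^sup>2 + \<eta>;
                \<kappa>\<^sub>1 = 2 * C1 M phi phit g (r, v) / c\<^sup>2 + \<eta>;
                \<kappa>\<^sub>2 = 2 * C2 M lam phi phit g (r, v) / c\<^sup>2 + \<eta>;
                \<kappa>\<^sub>3 = 2 * C3 M lam phi phit g (r, v) / c\<^sup>2 + \<eta>
            in \<exists>(T::real) (K::nat). T > 0 \<and> K \<ge> 1 \<and> (\<forall>t\<ge>T. \<forall>k\<ge>K.
                 (lam = 0 \<longrightarrow> mse M lam g (r, v) k t \<le> ennreal (\<kappa>\<^sub>1 * t / real k + \<kappa>\<^sub>0 / t\<^sup>2)) \<and>
                 (lam > 0 \<longrightarrow> mse M lam g (r, v) k t \<le> ennreal (\<kappa>\<^sub>2 / real k + \<kappa>\<^sub>0 / t\<^sup>2)) \<and>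
                 (lam < 0 \<longrightarrow> mse M lam g (r, v) k t
                                \<le> ennreal (\<kappa>\<^sub>3 * exp (- lam * t) / real k + \<kappa>\<^sub>0 / t\<^sup>2)))"
      unfolding Let_def c_def .
  next
    show "\<exists>k :: real \<Rightarrow> nat. mono k \<and> (\<forall>t. k t \<ge> 1) \<and> filterlim k at_top at_top \<and>
            ((\<lambda>t. mse M lam g (r, v) (k t) t) \<longlongrightarrow> 0) at_top"
      using mse_vanishing by blast
  qed
qed

end
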